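(* Let $d\ge 2$ and $1\le p\le q\le\infty$. Then there is a constant $c>0$, depending only on $d,p,q$, such that for all integers $n\ge 1$ $$\|H_n^d\|_{p,q}\ \ge\ c\, n^{\gamma(p,q)}.$$ Furthermore, if $(\frac1p,\frac1q)\in [S,R]\cup[S',R']$, then $$\sup_{n\ge 1}\, n^{-\gamma(p,q)}\,\|H_n^d\|_{p,q}=\infty .$$
   Context: $\mathbb S^d$ is the unit sphere in $\mathbb R^{d+1}$ with its surface measure $\sigma$, and $\mathcal H_n^d$ is the (finite-dimensional) space of spherical harmonic polynomials of degree $n$ on $\mathbb S^d$, i.e. the eigenspace of the Laplace--Beltrami operator $\Delta_{\mathbb S^d}$ with eigenvalue $-n(n+d-1)$. $H_n^d$ denotes the orthogonal projection of $L^2(\mathbb S^d)$ onto $\mathcal H_n^d$; it is given by integration against a smooth kernel and is thus defined on $L^p(\mathbb S^d)$ for all $1\le p\le\infty$. Set $\|H_n^d\|_{p,q}:=\sup_{\|f\|_{L^p(\mathbb S^d)}\le 1}\|H_n^d f\|_{L^q(\mathbb S^d)}$. Convention: $1/\infty=0$. The exponent is $$\gamma(p,q)=\max\Big\{\tfrac{d-1}2\big(\tfrac1p-\tfrac1q\big),\ d\big(\tfrac1p-\tfrac1q\big)-1,\ \tfrac{d-1}2-\tfrac dq,\ -\tfrac{d+1}2+\tfrac dp\Big\}.$$ In $[0,1]^2$ let $R=\big(\frac{d+1}{2d},0\big)$, $S=\big(\frac{d+1}{2d},\frac{(d-1)^2}{2d(d+1)}\big)$, and for a point $(x,y)\in[0,1]^2$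 let $(x,y)'=(1-y,1-x)$; this defines $R'$ and $S'$. $[A,B]$ denotes the closed line segment joining $A$ and $B$. *)

theory Defs
  imports "HOL-Analysis.Analysis" "HOL-Probability.Essential_Supremum"
begin

text \<open>
  The surface measure of the unit sphere of a Euclidean space of dimension \<open>m\<close>, in polar
  coordinates: the surface measure of a Borel set \<open>A\<close> is \<open>m\<close> times the volume of the
  cone of all \<open>x\<close> with \<open>0 < |x| < 1\<close> and \<open>x / |x| \<in> A\<close>.
\<close>

definition surface_measure :: "'a::euclidean_space measure" where
  "surface_measure =
     scale_measure (of_nat DIM('a))
       (distr (restrict_space lborel (ball 0 1 - {0})) (restrict_space borel (sphere 0 1)) sgn)"

lemma space_surface_measure [simp]: "space surface_measure = sphere 0 1"
  by (simp add: surface_measure_def space_scale_measure space_restrict_space)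

lemma sets_surface_measure [simp, measurable_cong]:
  "sets surface_measure = sets (restrict_space borel (sphere 0 1))"
  by (simp add: surface_measure_def)

lemma emeasure_surface_measure:
  fixes A :: "'a::euclidean_space set"
  assumes "A \<in> sets borel" "A \<subseteq> sphere 0 1"
  shows "emeasure surface_measure A =
           of_nat DIM('a) * emeasure lborel {x \<in> ball 0 1 - {0}. sgn x \<in> A}"
proof -
  let ?B = "ball 0 1 - {0 :: 'a}"
  have B: "?B \<in> sets borel" by auto
  have "continuous_on ?B (sgn :: 'a \<Rightarrow> 'a)"
    unfolding sgn_div_norm by (intro continuous_intros) auto
  then have "sgn \<in> measurable (restrict_space borel ?B) (borel :: 'a measure)"
    by (rule borel_measurable_continuous_on_restrict)
  then have "sgn \<in> measurable (restrict_space lborel ?B) (borel :: 'a measure)"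
    by (simp cong: measurable_cong_sets add: sets_restrict_space)
  then have m: "sgn \<in> measurable (restrict_space lborel ?B) (restrict_space borel (sphere 0 1 :: 'a set))"
    by (intro measurable_restrict_space2) (auto simp: space_restrict_space norm_sgn)
  have A: "A \<in> sets (restrict_space borel (sphere 0 1))"
    using assms by (auto simp: sets_restrict_space_iff)
  have eq: "sgn -` A \<inter> space (restrict_space lborel ?B) = {x \<in> ?B. sgn x \<in> A}"
    by (auto simp: space_restrict_space)
  show ?thesis
    unfolding surface_measure_def emeasure_scale_measure emeasure_distr[OF m A] eq
    using B by (subst emeasure_restrict_space) auto
qed

definition partial_deriv :: "'a::real_normed_vector \<Rightarrow> ('a \<Rightarrow> 'b::real_normed_vector) \<Rightarrow> 'a \<Rightarrow> 'b" where
  "partial_deriv b f x = vector_derivative (\<lambda>t. f (x + t *\<^sub>R b)) (at 0)"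

definition laplacian :: "('a::euclidean_space \<Rightarrow> 'b::real_normed_vector) \<Rightarrow> 'a \<Rightarrow> 'b" where
  "laplacian f x = (\<Sum>b\<in>Basis. partial_deriv b (partial_deriv b f) x)"

definition harmonic_polynomials :: "nat \<Rightarrow> ('a::euclidean_space \<Rightarrow> complex) set" where
  "harmonic_polynomials n =
     {P. polynomial_function P \<and> (\<forall>t x. P (t *\<^sub>R x) = of_real (t ^ n) * P x) \<and>
         (\<forall>x. laplacian P x = 0)}"

text \<open>
  Spherical harmonics are functions on the sphere: they are represented extensionally, so that
  equality of functions is equality on the sphere.
\<close>

definition spherical_harmonics :: "nat \<Rightarrow> ('a::euclidean_space \<Rightarrow> complex) set" where
  "spherical_harmonics n = (\<lambda>P. restrict P (sphere 0 1)) ` harmonic_polynomials n"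

definition Lp_norm :: "'a measure \<Rightarrow> ennreal \<Rightarrow> ('a \<Rightarrow> 'b::real_normed_vector) \<Rightarrow> ennreal" where
  "Lp_norm M p f =
     (if p = \<infinity> then esssup M (\<lambda>x. ennreal (norm (f x)))
      else let I = \<integral>\<^sup>+ x. ennreal (norm (f x) powr enn2real p) \<partial>M
           in if I = \<infinity> then \<infinity> else ennreal (enn2real I powr (1 / enn2real p)))"

definition Lp_space :: "'a measure \<Rightarrow> ennreal \<Rightarrow> ('a \<Rightarrow> 'b::real_normed_vector) set" where
  "Lp_space M p = {f \<in> borel_measurable M. Lp_norm M p f < \<infinity>}"

definition op_norm :: "'a measure \<Rightarrow> ennreal \<Rightarrow> ennreal \<Rightarrow>
    (('a \<Rightarrow> 'b::real_normed_vector) \<Rightarrow> 'a \<Rightarrow> 'b) \<Rightarrow> ennreal" where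
  "op_norm M p q T = (SUP f\<in>{f \<in> Lp_space M p. Lp_norm M p f \<le> 1}. Lp_norm M q (T f))"

text \<open>The orthogonal projection of \<open>L\<^sup>2\<close> onto the spherical harmonics of degree \<open>n\<close>.\<close>

definition L2_projection :: "nat \<Rightarrow> ('a::euclidean_space \<Rightarrow> complex) \<Rightarrow> 'a \<Rightarrow> complex" where
  "L2_projection n f =
     (THE Y. Y \<in> spherical_harmonics n \<and>
        (\<forall>Z\<in>spherical_harmonics n. (\<integral>x. (f x - Y x) * cnj (Z x) \<partial>surface_measure) = 0))"

text \<open>
  Its integral kernel. Continuity determines the kernel uniquely on the product of the sphere
  with itself (it is then smooth), and only the values there matter below.
\<close>

definition projection_kernel :: "nat \<Rightarrow> 'a::euclidean_space \<Rightarrow> 'a \<Rightarrow> complex" where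
  "projection_kernel n =
     (SOME K. continuous_on (sphere 0 1 \<times> sphere 0 1) (\<lambda>(x, y). K x y) \<and>
        (\<forall>f\<in>Lp_space surface_measure 2. \<forall>x\<in>sphere 0 1.
           L2_projection n f x = (\<integral>y. K x y * f y \<partial>surface_measure)))"

text \<open>The extension of the projection to all \<open>L\<^sup>p\<close> with \<open>1 \<le> p \<le> \<infinity>\<close>.\<close>

definition harmonic_projection :: "nat \<Rightarrow> ('a::euclidean_space \<Rightarrow> complex) \<Rightarrow> 'a \<Rightarrow> complex" where
  "harmonic_projection n f x = (\<integral>y. projection_kernel n x y * f y \<partial>surface_measure)"

text \<open>In the following, the convention \<open>1 / \<infinity> = 0\<close> is the one of \<^typ>\<open>ennreal\<close>.\<close>

definition recip :: "ennreal \<Rightarrow> real" where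
  "recip p = enn2real (1 / p)"

definition gamma_exponent :: "nat \<Rightarrow> ennreal \<Rightarrow> ennreal \<Rightarrow> real" where
  "gamma_exponent d p q =
     Max {(real d - 1) / 2 * (recip p - recip q),
          real d * (recip p - recip q) - 1,
          (real d - 1) / 2 - real d * recip q,
          - (real d + 1) / 2 + real d * recip p}"

definition point_R :: "nat \<Rightarrow> real \<times> real" where
  "point_R d = ((real d + 1) / (2 * real d), 0)"

definition point_S :: "nat \<Rightarrow> real \<times> real" where
  "point_S d = ((real d + 1) / (2 * real d), (real d - 1)\<^sup>2 / (2 * real d * (real d + 1)))"

definition dual_point :: "real \<times> real \<Rightarrow> real \<times> real" where
  "dual_point z = (1 - snd z, 1 - fst z)"

end

theory Submission
  imports Defs
begin

text \<open>
  By the Funk--Hecke formula the projection is convolution with the zonal kernel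
  \<open>P (x \<bullet> y) / m\<close>, where \<open>P\<close> is the Legendre (Gegenbauer) polynomial of degree \<open>n\<close> with \<open>P 1 = 1\<close> and
  \<open>m = \<integral> P (y \<bullet> e)\<^sup>2\<close> is of order at most \<open>n\<close> to the power \<open>- (d - 1)\<close>, and a zonal function \<open>\<phi> (y \<bullet> e)\<close> is mapped to
  \<open>(\<integral> \<phi> P / m) P (x \<bullet> e)\<close>. Each of the four terms of the exponent comes from one test function:
  the harmonic \<open>(x\<^sub>1 + \<i> x\<^sub>2)\<^sup>n\<close>; the indicator of a cap of radius \<open>c / n\<close>, on which \<open>P \<ge> 1/2\<close>; the bounded
  zonal function with \<open>\<phi> (cos \<theta>)\<close> proportional to \<open>P (cos \<theta>)\<close> times \<open>sin \<theta>\<close> to the power \<open>d - 1\<close>, evaluated on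
  the cap; and, by duality, the indicator of the cap tested against that function.
  On the two segments one takes \<open>\<phi> (cos \<theta>) = P (cos \<theta>) / (1 + n sin \<theta>)\<close> instead: with \<open>r = 2 d / (d + 1)\<close>
  both \<open>\<integral> \<bar>\<phi>\<bar>\<^sup>r\<close> and \<open>\<integral> \<phi> P\<close> have order \<open>log n\<close> divided by the \<open>d\<close>-th power of \<open>n\<close>, which gains a factor
  \<open>log n\<close> to the power \<open>1 - 1 / r\<close>.

  The size of \<open>P (cos \<theta>)\<close>, pointwise from above and on average from below, is obtained from the differential equation
  of \<open>P\<close> by energy estimates; no asymptotic expansion is needed.
\<close>

section \<open>Polynomial functions and partial derivatives\<close>

text \<open>The surface measure is given by cones, so the sphere comes without charts. All that is
  needed about it follows from a divergence theorem for polynomials F that are homogeneous of degree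
  k in dimension N: the derivative of F in direction v has integral N + k - 1 times that of (y
  \<bullet> v) F. Applied to suitable F it becomes a recursion, and such recursions give the
  Funk--Hecke formula, the one-variable form of zonal integrals and the moments of the highest
  weight harmonics. In the angle, P solves the equation of an oscillator of frequency \<omega> ~ n
  with friction D cot \<theta>, D = d - 1. All constants of the energy estimates depend on D alone;
  this makes the bounds uniform in n. The function P / (1 + n sin \<theta>) imitates the extremal of
  Hoelder's inequality: |P| has the order of (n sin \<theta>) to the power - D / 2, so |\<phi>|
  should have the order of |P| to the power 1 / (r - 1) = (d + 1) / (d - 1), that is (n sin
  \<theta>) to the power - (d + 1) / 2. For r (d + 1) / 2 = d both integrands then have the order of
  1 / sin \<theta>, whence the logarithm. The abscissa of R and S is 1 / r.\<close>

lemma polynomial_function_complex_iff: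
  "polynomial_function f \<longleftrightarrow>
     real_polynomial_function (\<lambda>x. Re (f x)) \<and> real_polynomial_function (\<lambda>x. Im (f x))"
  by (simp add: polynomial_function_iff_Basis_inner Basis_complex_def inner_complex_def)

lemma polynomial_function_of_real:
  "real_polynomial_function f \<Longrightarrow> polynomial_function (\<lambda>x. complex_of_real (f x))"
  by (simp add: polynomial_function_complex_iff real_polynomial_function.intros(2))

lemma polynomial_function_complex_mult:
  fixes f g :: "'a::real_normed_vector \<Rightarrow> complex"
  shows "polynomial_function f \<Longrightarrow> polynomial_function g \<Longrightarrow> polynomial_function (\<lambda>x. f x * g x)"
  by (auto simp: polynomial_function_complex_iff)

lemma polynomial_function_complex_power:
  fixes f :: "'a::real_normed_vector \<Rightarrow> complex"
  shows "polynomial_function f \<Longrightarrow> polynomial_function (\<lambda>x. f x ^ n)"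
  by (induction n) (auto intro: polynomial_function_complex_mult)

lemma real_polynomial_function_inner:
  "real_polynomial_function (\<lambda>x::'a::real_inner. x \<bullet> a)"
  by (simp add: bounded_linear_inner_left real_polynomial_function.intros(1))

lemma real_polynomial_function_inner_self:
  "real_polynomial_function (\<lambda>x::'a::euclidean_space. x \<bullet> x)"
proof -
  have "(\<lambda>x::'a. x \<bullet> x) = (\<lambda>x. \<Sum>b\<in>Basis. (x \<bullet> b) * (x \<bullet> b))"
    by (intro ext euclidean_inner)
  then show ?thesis
    by (simp only:) (intro real_polynomial_function_sum real_polynomial_function.intros(4)
        real_polynomial_function_inner finite_Basis)
qed

lemmas poly_intros = polynomial_function_complex_mult polynomial_function_complex_power
  polynomial_function_add polynomial_function_const polynomial_function_of_real
  polynomial_function_sum real_polynomial_function_inner real_polynomial_function_inner_self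
  real_polynomial_function_power real_polynomial_function.intros(4) real_polynomial_function.intros(2)
  real_polynomial_function.intros(3)

text \<open>A linear functional is the inner product with a fixed vector, and f is its real part
  plus \<i> times its imaginary part. So constants and coordinate functionals generate everything
  under sums and products, and rules for \<open>partial_deriv\<close> need to be checked on these
  four cases only.\<close>

lemma complex_polynomial_function_induct
    [consumes 1, case_names const inner add mult]:
  fixes f :: "'a::euclidean_space \<Rightarrow> complex"
  assumes f: "polynomial_function f"
    and const: "\<And>c. P (\<lambda>x. c)"
    and inner: "\<And>a. P (\<lambda>x. of_real (x \<bullet> a))"
    and add: "\<And>f g. polynomial_function f \<Longrightarrow> polynomial_function g \<Longrightarrow> P f \<Longrightarrow> P g \<Longrightarrow> P (\<lambda>x. f x + g x)"
    and mult: "\<And>f g. polynomial_function f \<Longrightarrow> polynomial_function g \<Longrightarrow> P f \<Longrightarrow> P g \<Longrightarrow> P (\<lambda>x. f x * g x)"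
  shows "P f"
proof -
  have real: "P (\<lambda>x. of_real (g x))" if "real_polynomial_function g" for g :: "'a \<Rightarrow> real"
    using that
  proof (induction g rule: real_polynomial_function.induct)
    case (linear h)
    then interpret bounded_linear h .
    have "h x = x \<bullet> (\<Sum>b\<in>Basis. h b *\<^sub>R b)" for x
    proof -
      have "h x = h (\<Sum>b\<in>Basis. (x \<bullet> b) *\<^sub>R b)" by (simp add: euclidean_representation)
      also have "\<dots> = (\<Sum>b\<in>Basis. (x \<bullet> b) * h b)" by (simp add: sum scaleR)
      finally show ?thesis by (simp add: inner_sum_right mult.commute)
    qed
    then have "(\<lambda>x. complex_of_real (h x)) = (\<lambda>x. of_real (x \<bullet> (\<Sum>b\<in>Basis. h b *\<^sub>R b)))"
      by (intro ext arg_cong[where f=complex_of_real])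
    then show ?case by (simp only: inner)
  next
    case (add f g)
    have "P (\<lambda>x. of_real (f x) + of_real (g x))"
      by (rule assms(4)[where f="\<lambda>x. of_real (f x)" and g="\<lambda>x. of_real (g x)"])
        (fact add.IH polynomial_function_of_real[OF add.hyps(1)] polynomial_function_of_real[OF add.hyps(2)])+
    then show ?case by (simp only: of_real_add)
  next
    case (mult f g)
    have "P (\<lambda>x. of_real (f x) * of_real (g x))"
      by (rule assms(5)[where f="\<lambda>x. of_real (f x)" and g="\<lambda>x. of_real (g x)"])
        (fact mult.IH polynomial_function_of_real[OF mult.hyps(1)] polynomial_function_of_real[OF mult.hyps(2)])+
    then show ?case by (simp only: of_real_mult)
  qed (rule const)
  have ri: "real_polynomial_function (\<lambda>x. Re (f x))" "real_polynomial_function (\<lambda>x. Im (f x))"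
    using f by (auto simp: polynomial_function_complex_iff)
  have "P (\<lambda>x. of_real (Re (f x)) + \<i> * of_real (Im (f x)))"
  proof -
    note p = polynomial_function_of_real[OF ri(1)] polynomial_function_of_real[OF ri(2)]
    have m: "P (\<lambda>x. \<i> * of_real (Im (f x)))"
      by (rule assms(5)[where f="\<lambda>x. \<i>" and g="\<lambda>x. of_real (Im (f x))"])
        (fact polynomial_function_const p(2) const real[OF ri(2)])+
    have pm: "polynomial_function (\<lambda>x. \<i> * of_real (Im (f x)))"
      using p by (intro polynomial_function_complex_mult) simp_all
    show ?thesis
      by (rule assms(4)[where f="\<lambda>x. of_real (Re (f x))" and g="\<lambda>x. \<i> * of_real (Im (f x))"])
        (fact p(1) pm real[OF ri(1)] m)+
  qed
  then show ?thesis by (simp only: complex_eq[symmetric])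
qed

text \<open>\<open>partial_deriv\<close> is a total function and carries information only where the
  derivative exists, which polynomiality ensures. The parameter s is arbitrary because integration
  along lines needs the derivative at every point of the line.\<close>

lemma has_vector_derivative_partial_deriv:
  fixes f :: "'a::euclidean_space \<Rightarrow> 'b::euclidean_space"
  assumes "polynomial_function f"
  shows "((\<lambda>t. f (x + t *\<^sub>R v)) has_vector_derivative partial_deriv v f (x + s *\<^sub>R v)) (at s)"
proof -
  have D: "((\<lambda>t. f (y + t *\<^sub>R v)) has_vector_derivative partial_deriv v f y) (at 0)" for y
  proof -
    have "f differentiable (at (y + 0 *\<^sub>R v))"
      using assms by (simp add: differentiable_at_polynomial_function)
    then have "(\<lambda>t. f (y + t *\<^sub>R v)) differentiable (at (0::real))"
      by (intro differentiable_compose[of f "\<lambda>t. y + t *\<^sub>R v"]) (auto intro!: derivative_intros)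
    then show ?thesis by (simp add: partial_deriv_def vector_derivative_works)
  qed
  have "((\<lambda>t. t - s) has_real_derivative 1) (at s)"
    by (auto intro!: derivative_eq_intros)
  moreover have "((\<lambda>t. f ((x + s *\<^sub>R v) + t *\<^sub>R v)) has_vector_derivative partial_deriv v f (x + s *\<^sub>R v))
      (at (s - s))" using D by simp
  ultimately have "((\<lambda>t. f ((x + s *\<^sub>R v) + t *\<^sub>R v)) \<circ> (\<lambda>t. t - s) has_vector_derivative
      1 *\<^sub>R partial_deriv v f (x + s *\<^sub>R v)) (at s)"
    by (intro vector_diff_chain_at) (simp_all add: has_real_derivative_iff_has_vector_derivative)
  then show ?thesis by (simp add: o_def algebra_simps)
qed

lemma has_vector_derivative_partial_deriv_0:
  fixes f :: "'a::euclidean_space \<Rightarrow> 'b::euclidean_space"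
  assumes "polynomial_function f"
  shows "((\<lambda>t. f (x + t *\<^sub>R v)) has_vector_derivative partial_deriv v f x) (at 0)"
  using has_vector_derivative_partial_deriv[OF assms, of x v 0] by simp

lemma partial_deriv_eqI:
  assumes "\<And>x. ((\<lambda>t. f (x + t *\<^sub>R v)) has_vector_derivative f' x) (at 0)"
  shows "partial_deriv v f = f'"
  using assms by (auto simp: partial_deriv_def vector_derivative_at)

lemma partial_deriv_const: "partial_deriv v (\<lambda>x. c) = (\<lambda>x. 0)"
  by (intro partial_deriv_eqI) auto

lemma partial_deriv_inner:
  "partial_deriv v (\<lambda>x. complex_of_real (x \<bullet> a)) = (\<lambda>x. of_real (v \<bullet> a))"
  by (intro partial_deriv_eqI)
    (auto intro!: derivative_eq_intros simp: inner_add_left scaleR_conv_of_real)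

lemma partial_deriv_add:
  fixes f g :: "'a::euclidean_space \<Rightarrow> 'b::euclidean_space"
  assumes "polynomial_function f" "polynomial_function g"
  shows "partial_deriv v (\<lambda>x. f x + g x) = (\<lambda>x. partial_deriv v f x + partial_deriv v g x)"
  by (intro partial_deriv_eqI has_vector_derivative_add has_vector_derivative_partial_deriv_0 assms)

lemma partial_deriv_sum:
  fixes f :: "'i \<Rightarrow> 'a::euclidean_space \<Rightarrow> 'b::euclidean_space"
  assumes "\<And>i. i \<in> I \<Longrightarrow> polynomial_function (f i)"
  shows "partial_deriv v (\<lambda>x. \<Sum>i\<in>I. f i x) = (\<lambda>x. \<Sum>i\<in>I. partial_deriv v (f i) x)"
  by (intro partial_deriv_eqI has_vector_derivative_sum has_vector_derivative_partial_deriv_0 assms)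

lemma partial_deriv_mult:
  fixes f g :: "'a::euclidean_space \<Rightarrow> complex"
  assumes "polynomial_function f" "polynomial_function g"
  shows "partial_deriv v (\<lambda>x. f x * g x) = (\<lambda>x. f x * partial_deriv v g x + partial_deriv v f x * g x)"
proof (intro partial_deriv_eqI)
  fix x
  show "((\<lambda>t. f (x + t *\<^sub>R v) * g (x + t *\<^sub>R v)) has_vector_derivative
      f x * partial_deriv v g x + partial_deriv v f x * g x) (at 0)"
    using has_vector_derivative_mult[OF has_vector_derivative_partial_deriv_0[OF assms(1), of x v]
        has_vector_derivative_partial_deriv_0[OF assms(2), of x v]] by simp
qed

lemma partial_deriv_cmult:
  fixes g :: "'a::euclidean_space \<Rightarrow> complex"
  assumes "polynomial_function g"
  shows "partial_deriv v (\<lambda>x. c * g x) = (\<lambda>x. c * partial_deriv v g x)"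
  using partial_deriv_mult[OF polynomial_function_const assms, of v c]
  by (simp add: partial_deriv_const)

lemma partial_deriv_power:
  fixes f :: "'a::euclidean_space \<Rightarrow> complex"
  assumes "polynomial_function f"
  shows "partial_deriv v (\<lambda>x. f x ^ n) = (\<lambda>x. of_nat n * f x ^ (n - 1) * partial_deriv v f x)"
proof (induction n)
  case 0
  then show ?case by (simp add: partial_deriv_const)
next
  case (Suc n)
  have "f x * (of_nat n * f x ^ (n - 1) * partial_deriv v f x) = of_nat n * f x ^ n * partial_deriv v f x" for x
    by (cases n) auto
  then show ?case
    by (auto simp: partial_deriv_mult[OF assms polynomial_function_complex_power[OF assms]]
        Suc.IH algebra_simps fun_eq_iff)
qed

lemma polynomial_function_partial_deriv:
  fixes f :: "'a::euclidean_space \<Rightarrow> complex"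
  assumes "polynomial_function f"
  shows "polynomial_function (partial_deriv v f)"
  using assms
proof (induction rule: complex_polynomial_function_induct)
  case (add f g) then show ?case by (auto simp: partial_deriv_add intro!: poly_intros)
next
  case (mult f g) then show ?case by (auto simp: partial_deriv_mult intro!: poly_intros)
qed (auto simp: partial_deriv_const partial_deriv_inner)

lemma partial_deriv_commute:
  fixes f :: "'a::euclidean_space \<Rightarrow> complex"
  assumes "polynomial_function f"
  shows "partial_deriv v (partial_deriv w f) = partial_deriv w (partial_deriv v f)"
  using assms
proof (induction rule: complex_polynomial_function_induct)
  case (add f g)
  then show ?case by (simp add: partial_deriv_add polynomial_function_partial_deriv)
next
  case (mult f g)
  then show ?case
    by (simp add: partial_deriv_mult partial_deriv_add polynomial_function_partial_deriv
        polynomial_function_complex_mult fun_eq_iff)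
qed (auto simp: partial_deriv_const partial_deriv_inner)

lemma partial_deriv_euclidean:
  fixes f :: "'a::euclidean_space \<Rightarrow> complex"
  assumes "polynomial_function f"
  shows "partial_deriv v f x = (\<Sum>b\<in>Basis. of_real (v \<bullet> b) * partial_deriv b f x)"
  using assms
proof (induction rule: complex_polynomial_function_induct)
  case (inner a)
  then show ?case
    using euclidean_inner[of v a]
    by (simp add: partial_deriv_inner inner_commute[of a] flip: of_real_mult of_real_sum)
next
  case (add f g)
  then show ?case by (simp add: partial_deriv_add sum.distrib algebra_simps)
next
  case (mult f g)
  then show ?case by (simp add: partial_deriv_mult sum.distrib algebra_simps sum_distrib_left)
qed (simp add: partial_deriv_const)

section \<open>Homogeneous functions and Euler's identity\<close>

definition homogeneous :: "nat \<Rightarrow> ('a::real_vector \<Rightarrow> complex) \<Rightarrow> bool" where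
  "homogeneous k f \<longleftrightarrow> (\<forall>t x. f (t *\<^sub>R x) = of_real (t ^ k) * f x)"

lemma homogeneousD: "homogeneous k f \<Longrightarrow> f (t *\<^sub>R x) = of_real (t ^ k) * f x"
  by (simp add: homogeneous_def)

lemma homogeneous_add: "homogeneous k f \<Longrightarrow> homogeneous k g \<Longrightarrow> homogeneous k (\<lambda>x. f x + g x)"
  by (simp add: homogeneous_def algebra_simps)

lemma homogeneous_sum: "(\<And>i. i \<in> I \<Longrightarrow> homogeneous k (f i)) \<Longrightarrow> homogeneous k (\<lambda>x. \<Sum>i\<in>I. f i x)"
  by (simp add: homogeneous_def sum_distrib_left)

lemma homogeneous_mult: "homogeneous k f \<Longrightarrow> homogeneous l g \<Longrightarrow> homogeneous (k + l) (\<lambda>x. f x * g x)"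
  by (simp add: homogeneous_def power_add mult_ac)

lemma homogeneous_cmult: "homogeneous k f \<Longrightarrow> homogeneous k (\<lambda>x. c * f x)"
  by (simp add: homogeneous_def)

lemma homogeneous_power: "homogeneous k f \<Longrightarrow> homogeneous (k * n) (\<lambda>x. f x ^ n)"
  by (simp add: homogeneous_def power_mult_distrib power_mult)

lemma homogeneous_inner_power: "homogeneous n (\<lambda>x. of_real ((x \<bullet> a) ^ n))"
  by (simp add: homogeneous_def power_mult_distrib)

text \<open>Euler's identity: along the ray through x the function is (1 + t) ^ k times its value at
  x.\<close>

lemma partial_deriv_self:
  fixes f :: "'a::euclidean_space \<Rightarrow> complex"
  assumes "polynomial_function f" "homogeneous k f"
  shows "partial_deriv x f x = of_nat k * f x"
proof -
  have "((\<lambda>t. f (x + t *\<^sub>R x)) has_vector_derivative of_nat k * f x) (at 0)"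
  proof -
    have "f (x + t *\<^sub>R x) = ((1 + t) ^ k) *\<^sub>R f x" for t
      using homogeneousD[OF assms(2), of "1 + t" x] by (simp add: algebra_simps scaleR_conv_of_real)
    moreover have "((\<lambda>t. ((1 + t) ^ k) *\<^sub>R f x) has_vector_derivative of_nat k * f x) (at (0::real))"
    proof -
      have "((\<lambda>t. (1 + t) ^ k) has_real_derivative of_nat k) (at (0::real))"
        by (auto intro!: derivative_eq_intros)
      from has_vector_derivative_scaleR[OF this has_vector_derivative_const[of "f x"]]
      show ?thesis by (simp add: scaleR_conv_of_real)
    qed
    ultimately show ?thesis by simp
  qed
  then show ?thesis by (simp add: partial_deriv_def vector_derivative_at)
qed

lemma partial_deriv_homogeneous_0:
  fixes f :: "'a::euclidean_space \<Rightarrow> complex"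
  assumes "homogeneous 0 f"
  shows "partial_deriv v f = (\<lambda>x. 0)"
proof -
  have "f = (\<lambda>x. f 0)"
  proof
    fix x show "f x = f 0" using homogeneousD[OF assms, of 0 x] by simp
  qed
  then show ?thesis by (metis partial_deriv_const)
qed

text \<open>Differentiating the homogeneity relation leaves a factor s on the left, which can be
  cancelled for s \<noteq> 0 only. Both sides are continuous in the scaling parameter, so the value
  0 (where 0 ^ 0 = 1 matters if k = 0) is reached as a limit.\<close>

lemma homogeneous_partial_deriv:
  fixes f :: "'a::euclidean_space \<Rightarrow> complex"
  assumes f: "polynomial_function f" "homogeneous (Suc k) f"
  shows "homogeneous k (partial_deriv v f)"
  unfolding homogeneous_def
proof (intro allI)
  fix t x
  let ?g = "partial_deriv v f"
  have *: "?g (s *\<^sub>R x) = of_real (s ^ k) * ?g x" if "s \<noteq> 0" for s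
  proof -
    have "((\<lambda>h. h * s) has_real_derivative s) (at 0)"
      by (auto intro!: derivative_eq_intros)
    then have A: "((\<lambda>h. f (s *\<^sub>R x + h *\<^sub>R (s *\<^sub>R v))) has_vector_derivative s *\<^sub>R ?g (s *\<^sub>R x)) (at 0)"
      using vector_diff_chain_at[of "\<lambda>h. h * s" s 0 "\<lambda>h. f (s *\<^sub>R x + h *\<^sub>R v)" "?g (s *\<^sub>R x)"]
        has_vector_derivative_partial_deriv_0[OF f(1), of "s *\<^sub>R x" v]
      by (simp add: o_def has_real_derivative_iff_has_vector_derivative)
    have B: "((\<lambda>h. of_real (s ^ Suc k) * f (x + h *\<^sub>R v)) has_vector_derivative
        of_real (s ^ Suc k) * ?g x) (at 0)"
      by (intro has_vector_derivative_mult_right has_vector_derivative_partial_deriv_0 f)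
    have "f (s *\<^sub>R x + h *\<^sub>R (s *\<^sub>R v)) = of_real (s ^ Suc k) * f (x + h *\<^sub>R v)" for h
      using homogeneousD[OF f(2), of s "x + h *\<^sub>R v"] by (simp add: algebra_simps)
    then have "(\<lambda>h. f (s *\<^sub>R x + h *\<^sub>R (s *\<^sub>R v))) = (\<lambda>h. of_real (s ^ Suc k) * f (x + h *\<^sub>R v))"
      by (rule ext)
    from vector_derivative_unique_at[OF A B[folded this]]
    have "s *\<^sub>R ?g (s *\<^sub>R x) = of_real (s ^ Suc k) * ?g x" .
    then show ?thesis using that by (simp add: scaleR_conv_of_real)
  qed
  have cont: "isCont ?g y" for y
    using continuous_on_polymonial_function[OF polynomial_function_partial_deriv[OF f(1)], of UNIV]
    by (simp add: continuous_on_eq_continuous_at)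
  have L: "((\<lambda>s. ?g (s *\<^sub>R x)) \<longlongrightarrow> ?g (t *\<^sub>R x)) (at t)"
    by (intro isCont_tendsto_compose[OF cont] tendsto_intros)
  have R: "((\<lambda>s. of_real (s ^ k) * ?g x) \<longlongrightarrow> of_real (t ^ k) * ?g x) (at t)"
    by (intro tendsto_intros)
  have "eventually (\<lambda>s. ?g (s *\<^sub>R x) = of_real (s ^ k) * ?g x) (at t)"
  proof -
    have "eventually (\<lambda>s. s \<in> - {0}) (at t)"
    proof (cases "t = 0")
      case True then show ?thesis by (simp add: eventually_at_filter)
    next
      case False
      then show ?thesis
        by (intro eventually_at_in_open'[where A="- {0}"]) auto
    qed
    then show ?thesis by eventually_elim (use * in auto)
  qed
  from Lim_transform_eventually[OF L this]
  show "?g (t *\<^sub>R x) = of_real (t ^ k) * ?g x"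
    using R by (rule tendsto_unique[OF trivial_limit_at])
qed

lemma laplacian_eq_sum:
  "laplacian f = (\<lambda>x. \<Sum>b\<in>Basis. partial_deriv b (partial_deriv b f) x)"
  by (simp add: laplacian_def fun_eq_iff)

lemma harmonic_polynomials_iff:
  "Y \<in> harmonic_polynomials n \<longleftrightarrow>
     polynomial_function Y \<and> homogeneous n Y \<and> laplacian Y = (\<lambda>x. 0)"
  by (auto simp: harmonic_polynomials_def homogeneous_def fun_eq_iff)

text \<open>Directional derivatives commute with the Laplacian. This lowers the degree in the
  induction behind the Funk--Hecke formula.\<close>

lemma partial_deriv_harmonic:
  assumes "Y \<in> harmonic_polynomials (Suc n)"
  shows "partial_deriv v Y \<in> harmonic_polynomials n"
proof -
  from assms have Y: "polynomial_function Y" "homogeneous (Suc n) Y" "laplacian Y = (\<lambda>x. 0)"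
    by (auto simp: harmonic_polynomials_iff)
  have "laplacian (partial_deriv v Y) = partial_deriv v (laplacian Y)"
    unfolding laplacian_eq_sum
    by (subst partial_deriv_sum)
      (auto simp: polynomial_function_partial_deriv Y partial_deriv_commute[of Y v]
        partial_deriv_commute[of "partial_deriv b Y" v b for b])
  also have "\<dots> = (\<lambda>x. 0)" by (simp add: Y partial_deriv_const)
  finally show ?thesis
    using Y by (simp add: harmonic_polynomials_iff polynomial_function_partial_deriv
        homogeneous_partial_deriv)
qed

section \<open>Integration over the sphere\<close>

lemma ball_borel [measurable]: "ball x r \<in> sets (borel :: 'a::metric_space measure)"
  by simp

lemma scale_measure_eq_density: "scale_measure r M = density M (\<lambda>_. r)"
  by (rule measure_eqI) (simp_all add: emeasure_density_const)

lemma measurable_surface_measure_imp_id: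
  "(\<lambda>x. x) \<in> surface_measure \<rightarrow>\<^sub>M (borel :: 'a::euclidean_space measure)"
  by (simp add: measurable_cong_sets[OF sets_surface_measure refl] measurable_restrict_space1)

lemma borel_measurable_surface_measure:
  "f \<in> borel_measurable borel \<Longrightarrow> f \<in> borel_measurable (surface_measure :: 'a::euclidean_space measure)"
  by (rule measurable_compose[OF measurable_surface_measure_imp_id])

lemma sgn_measurable_sphere:
  "sgn \<in> restrict_space lborel (ball 0 1 - {0 :: 'a::euclidean_space}) \<rightarrow>\<^sub>M restrict_space borel (sphere 0 1)"
proof (rule measurable_restrict_space2)
  show "sgn \<in> space (restrict_space lborel (ball 0 1 - {0 :: 'a})) \<rightarrow> sphere 0 1"
    by (auto simp: space_restrict_space norm_sgn)
  show "sgn \<in> restrict_space lborel (ball 0 1 - {0 :: 'a}) \<rightarrow>\<^sub>M borel"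
    by (rule measurable_restrict_space1) simp
qed

text \<open>The scaling factor acts as a constant density and the image measure is pulled back along
  \<open>sgn\<close>. The origin had to be removed because \<open>sgn\<close> does not send it to
  the sphere; as a null set it can be put back.\<close>

lemma integral_surface_measure:
  fixes f :: "'a::euclidean_space \<Rightarrow> 'b::{banach, second_countable_topology}"
  assumes f: "f \<in> borel_measurable surface_measure"
  shows "(\<integral>x. f x \<partial>surface_measure) =
    real DIM('a) *\<^sub>R (\<integral>y. indicator (ball 0 1) y *\<^sub>R f (sgn y) \<partial>lborel)"
proof -
  let ?M = "restrict_space lborel (ball 0 1 - {0 :: 'a})"
  let ?D = "distr ?M (restrict_space borel (sphere 0 1)) sgn"
  have f': "f \<in> borel_measurable (restrict_space borel (sphere 0 1))"
    using f by (simp add: measurable_cong_sets[OF sets_surface_measure refl])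
  have eq: "surface_measure = density ?D (\<lambda>_. ennreal (real DIM('a)))"
    by (simp add: surface_measure_def scale_measure_eq_density ennreal_of_nat_eq_real_of_nat)
  have "(\<integral>x. f x \<partial>surface_measure) = (\<integral>x. real DIM('a) *\<^sub>R f x \<partial>?D)"
    unfolding eq using f' by (subst integral_density) auto
  also have "\<dots> = real DIM('a) *\<^sub>R (\<integral>x. f x \<partial>?D)"
    by simp
  also have "(\<integral>x. f x \<partial>?D) = (\<integral>y. f (sgn y) \<partial>?M)"
    using sgn_measurable_sphere f' by (rule integral_distr)
  also have "\<dots> = (\<integral>y. indicator (ball 0 1 - {0}) y *\<^sub>R f (sgn y) \<partial>lborel)"
    by (subst integral_restrict_space) auto
  also have "\<dots> = (\<integral>y. indicator (ball 0 1) y *\<^sub>R f (sgn y) \<partial>lborel)"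
  proof (rule integral_cong_AE)
    show m1: "(\<lambda>y. indicator (ball 0 1 - {0}) y *\<^sub>R f (sgn y)) \<in> borel_measurable lborel"
      using measurable_compose[OF sgn_measurable_sphere f']
      by (subst (asm) borel_measurable_restrict_space_iff) auto
    have "(\<lambda>y. indicator (ball 0 1 - {0}) y *\<^sub>R f (sgn y) + indicator {0} y *\<^sub>R f 0) \<in> borel_measurable lborel"
      using m1 by measurable
    also have "(\<lambda>y. indicator (ball 0 1 - {0}) y *\<^sub>R f (sgn y) + indicator {0} y *\<^sub>R f 0) =
        (\<lambda>y. indicator (ball 0 1) y *\<^sub>R f (sgn y))"
      by (auto simp: indicator_def fun_eq_iff)
    finally show "(\<lambda>y. indicator (ball 0 1) y *\<^sub>R f (sgn y)) \<in> borel_measurable lborel" .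
    show "AE y in lborel. indicator (ball 0 1 - {0}) y *\<^sub>R f (sgn y) =
        indicator (ball 0 1) y *\<^sub>R f (sgn y)"
      using AE_lborel_singleton[of "0::'a"] by eventually_elim (auto simp: indicator_def)
  qed
  finally show ?thesis .
qed

lemma emeasure_ball_lborel_finite: "emeasure lborel (ball x r :: 'a::euclidean_space set) < \<infinity>"
  by (rule emeasure_bounded_finite) (rule bounded_ball)

lemma finite_measure_surface_measure: "finite_measure (surface_measure :: 'a::euclidean_space measure)"
proof
  have "emeasure (surface_measure :: 'a measure) (sphere 0 1) =
      of_nat DIM('a) * emeasure lborel {x \<in> ball 0 1 - {0::'a}. sgn x \<in> sphere 0 1}"
    by (rule emeasure_surface_measure) auto
  also have "\<dots> \<le> of_nat DIM('a) * emeasure lborel (ball 0 1 :: 'a set)"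
    by (intro mult_left_mono emeasure_mono) auto
  also have "\<dots> < \<infinity>"
    by (simp add: emeasure_ball_lborel_finite[simplified] ennreal_mult_less_top of_nat_less_top)
  finally show "emeasure (surface_measure :: 'a measure) (space surface_measure) \<noteq> \<infinity>"
    by simp
qed

section \<open>Radial integration without polar coordinates\<close>

lemma integral_lborel_scale:
  fixes g :: "'a::euclidean_space \<Rightarrow> 'b::{banach, second_countable_topology}"
  assumes "s > 0" and g: "g \<in> borel_measurable borel"
  shows "(\<integral>y. g y \<partial>lborel) = s ^ DIM('a) *\<^sub>R (\<integral>y. g (s *\<^sub>R y) \<partial>lborel)"
proof -
  have "(\<integral>y. g y \<partial>lborel) = (\<integral>y. g y \<partial>density (distr lborel borel (\<lambda>x. 0 + s *\<^sub>R x)) (\<lambda>_. ennreal (\<bar>s\<bar>^DIM('a))))"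
    using lborel_affine[of s "0::'a"] assms by simp
  also have "\<dots> = (\<integral>y. s ^ DIM('a) *\<^sub>R g y \<partial>distr lborel borel (\<lambda>x. 0 + s *\<^sub>R x))"
    using assms by (subst integral_density) auto
  also have "\<dots> = s ^ DIM('a) *\<^sub>R (\<integral>y. g (s *\<^sub>R y) \<partial>lborel)"
    using g by (simp add: integral_distr)
  finally show ?thesis .
qed

lemma integrable_ball_lborel:
  fixes g :: "'a::euclidean_space \<Rightarrow> 'b::{banach, second_countable_topology}"
  assumes g: "g \<in> borel_measurable borel" and "\<And>y. norm y < r \<Longrightarrow> norm (g y) \<le> C"
  shows "integrable lborel (\<lambda>y. indicator (ball 0 r) y *\<^sub>R g y)"
proof (rule integrableI_bounded_set[where A="ball 0 r" and B=C])
  show "emeasure lborel (ball 0 r :: 'a set) < \<infinity>"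
    by (rule emeasure_ball_lborel_finite)
  show "AE x\<in>ball 0 r in lborel. norm (indicator (ball 0 r) x *\<^sub>R g x) \<le> C"
    using assms(2) by auto
  show "(\<lambda>y. indicator (ball 0 r) y *\<^sub>R g y) \<in> borel_measurable lborel"
    using g by measurable
qed auto

text \<open>In polar coordinates this is the integral of r ^ (N + k - 1) over (0, 1). Instead, the
  shell between the radii s and 1 is integrated in two ways: by scaling it carries exactly the
  fractions 1 - s ^ (N + k) and 1 - s ^ N of the two integrals over the ball, while on the shell the
  two integrands almost agree. Dividing by 1 - s and letting s tend to 1 gives the identity.\<close>

lemma integral_ball_norm_power:
  fixes f :: "'a::euclidean_space \<Rightarrow> complex"
  assumes f: "f \<in> borel_measurable borel" and C: "\<And>x. x \<in> cball 0 1 \<Longrightarrow> norm (f x) \<le> C"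
  shows "real (DIM('a) + k) *\<^sub>R (\<integral>y. indicator (ball 0 1) y *\<^sub>R (norm y ^ k *\<^sub>R f (sgn y)) \<partial>lborel) =
    real DIM('a) *\<^sub>R (\<integral>y. indicator (ball 0 1) y *\<^sub>R f (sgn y) \<partial>lborel)"
proof -
  let ?N = "DIM('a)"
  define I where "I k = (\<integral>y. indicator (ball 0 1 :: 'a set) y *\<^sub>R (norm y ^ k *\<^sub>R f (sgn y)) \<partial>lborel)" for k
  define V where "V = measure lborel (ball 0 (1::real) :: 'a set)"
  \<comment> \<open>This is (1 - s ^ k) / (1 - s), continued by the value k at s = 1.\<close>
  define G where "G k s = (\<Sum>i<k. s ^ i)" for k and s :: real
  have sgn_ball: "sgn y \<in> cball 0 1" for y :: 'a by (auto simp: norm_sgn)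
  have Cf: "norm (f (sgn y)) \<le> C" for y using C sgn_ball by blast
  have C0: "0 \<le> C" using Cf[of 0] norm_ge_zero order_trans by blast
  note f[measurable]
  have int: "integrable lborel (\<lambda>y. indicator (ball 0 s) y *\<^sub>R (norm y ^ k *\<^sub>R f (sgn y)))" if "0 < s" "s \<le> 1" for k s
  proof (rule integrable_ball_lborel)
    show "norm (norm y ^ k *\<^sub>R f (sgn y)) \<le> 1 * C" if "norm y < s" for y
      unfolding norm_scaleR by (rule mult_mono) (use \<open>s \<le> 1\<close> that Cf in \<open>auto intro: power_le_one\<close>)
  qed measurable
  have scale: "(\<integral>y. indicator (ball 0 s) y *\<^sub>R (norm y ^ k *\<^sub>R f (sgn y)) \<partial>lborel) = s ^ (?N + k) *\<^sub>R I k"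
    if "0 < s" for k s
  proof -
    have "(\<integral>y. indicator (ball 0 s) y *\<^sub>R (norm y ^ k *\<^sub>R f (sgn y)) \<partial>lborel) =
        s ^ ?N *\<^sub>R (\<integral>y. indicator (ball 0 s) (s *\<^sub>R y) *\<^sub>R (norm (s *\<^sub>R y) ^ k *\<^sub>R f (sgn (s *\<^sub>R y))) \<partial>lborel)"
      by (rule integral_lborel_scale[OF that]) measurable
    also have "(\<lambda>y. indicator (ball 0 s) (s *\<^sub>R y) *\<^sub>R (norm (s *\<^sub>R y) ^ k *\<^sub>R f (sgn (s *\<^sub>R y)))) =
        (\<lambda>y. s ^ k *\<^sub>R (indicator (ball 0 1) y *\<^sub>R (norm y ^ k *\<^sub>R f (sgn y))))"
      using that by (auto simp: indicator_def fun_eq_iff sgn_scaleR power_mult_distrib)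
    finally show ?thesis unfolding I_def integral_scaleR_right by (simp add: power_add)
  qed
  have I0: "I 0 = (\<integral>y. indicator (ball 0 1) y *\<^sub>R f (sgn y) \<partial>lborel)" by (simp add: I_def)
  have est: "norm (G (?N + k) s *\<^sub>R I k - G ?N s *\<^sub>R I 0) \<le> C * V * (1 - s) * G k s * G ?N s"
    if s: "0 < s" "s < 1" for s
  proof -
    let ?i = "\<lambda>y::'a. indicator (ball 0 1) y - indicator (ball 0 s) y :: real"
    have ir: "integrable lborel (indicator (ball 0 r) :: 'a \<Rightarrow> real)" for r
      using integrable_ball_lborel[of "\<lambda>_. 1::real" r 1] by simp
    have Vs: "measure lborel (ball 0 s :: 'a set) = s ^ ?N * V"
      using s(1) by (simp add: V_def content_ball)
    have a: "(\<integral>y. ?i y *\<^sub>R (norm y ^ k *\<^sub>R f (sgn y)) \<partial>lborel) = (1 - s ^ (?N + k)) *\<^sub>R I k" for k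
      unfolding scaleR_diff_left scale[OF s(1)]
        Bochner_Integration.integral_diff[OF int[OF zero_less_one order_refl] int[OF s(1) less_imp_le[OF s(2)]]]
      by (simp only: I_def scaleR_one)
    have id: "integrable lborel (\<lambda>y. ?i y *\<^sub>R (norm y ^ k *\<^sub>R f (sgn y)))" for k
      unfolding scaleR_diff_left
      by (intro Bochner_Integration.integrable_diff int zero_less_one order_refl s less_imp_le)
    have "(1 - s ^ (?N + k)) *\<^sub>R I k - (1 - s ^ ?N) *\<^sub>R I 0 =
        (\<integral>y. ?i y *\<^sub>R (norm y ^ k *\<^sub>R f (sgn y)) \<partial>lborel) - (\<integral>y. ?i y *\<^sub>R (norm y ^ 0 *\<^sub>R f (sgn y)) \<partial>lborel)"
      unfolding a by (simp only: add_0_right)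
    also have "\<dots> = (\<integral>y. ?i y *\<^sub>R (norm y ^ k *\<^sub>R f (sgn y)) - ?i y *\<^sub>R (norm y ^ 0 *\<^sub>R f (sgn y)) \<partial>lborel)"
      by (rule Bochner_Integration.integral_diff[symmetric]) (rule id)+
    \<comment> \<open>On the shell the power of the norm differs from 1 by at most 1 - s ^ k, and
      the shell has volume (1 - s ^ N) V. The error is of second order in 1 - s, so it still tends
      to 0 after the division by 1 - s.\<close>
    also have "norm \<dots> \<le> (\<integral>y. ?i y * ((1 - s ^ k) * C) \<partial>lborel)"
    proof (rule order_trans[OF integral_norm_bound integral_mono])
      show "integrable lborel (\<lambda>y. norm (?i y *\<^sub>R (norm y ^ k *\<^sub>R f (sgn y)) - ?i y *\<^sub>R (norm y ^ 0 *\<^sub>R f (sgn y))))"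
        by (intro integrable_norm Bochner_Integration.integrable_diff id)
      show "integrable lborel (\<lambda>y. ?i y * ((1 - s ^ k) * C))"
        using ir by auto
      fix y :: 'a
      show "norm (?i y *\<^sub>R (norm y ^ k *\<^sub>R f (sgn y)) - ?i y *\<^sub>R (norm y ^ 0 *\<^sub>R f (sgn y))) \<le> ?i y * ((1 - s ^ k) * C)"
      proof (cases "s \<le> norm y \<and> norm y < 1")
        case True
        have eq: "?i y *\<^sub>R (norm y ^ k *\<^sub>R f (sgn y)) - ?i y *\<^sub>R (norm y ^ 0 *\<^sub>R f (sgn y)) =
            (norm y ^ k - 1) *\<^sub>R f (sgn y)"
          using True by (simp add: scaleR_diff_left)
        have "s ^ k \<le> norm y ^ k" "norm y ^ k \<le> 1"
          using True s by (auto intro: power_mono power_le_one)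
        then have "\<bar>norm y ^ k - 1\<bar> * norm (f (sgn y)) \<le> (1 - s ^ k) * C"
          by (intro mult_mono Cf) auto
        then show ?thesis unfolding eq using True by simp
      next
        case False
        then have "?i y = 0" using s by (auto simp: indicator_def)
        then show ?thesis by simp
      qed
    qed
    also have "\<dots> = (1 - s ^ ?N) * V * ((1 - s ^ k) * C)"
      using ir by (simp add: Vs V_def algebra_simps)
    finally have *: "norm ((1 - s ^ (?N + k)) *\<^sub>R I k - (1 - s ^ ?N) *\<^sub>R I 0) \<le> (1 - s ^ ?N) * V * ((1 - s ^ k) * C)" .
    have g: "1 - s ^ m = (1 - s) * G m s" for m
      by (simp add: G_def one_diff_power_eq)
    have "(1 - s) * norm (G (?N + k) s *\<^sub>R I k - G ?N s *\<^sub>R I 0) =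
        norm ((1 - s) *\<^sub>R (G (?N + k) s *\<^sub>R I k - G ?N s *\<^sub>R I 0))"
      using s by simp
    also have "\<dots> \<le> (1 - s) * (C * V * (1 - s) * G k s * G ?N s)"
      using * unfolding g by (simp add: scaleR_diff_right mult_ac)
    finally show ?thesis using s by simp
  qed
  have contG: "continuous_on UNIV (G k)" for k unfolding G_def by (intro continuous_intros)
  have Gt: "(G k \<longlongrightarrow> real k) (at_left 1)" for k
  proof -
    have "isCont (G k) 1" using contG by (simp add: continuous_on_eq_continuous_at)
    then have "(G k \<longlongrightarrow> G k 1) (at_left 1)"
      using continuous_at_imp_continuous_within continuous_within by blast
    then show ?thesis by (simp add: G_def)
  qed
  have L: "((\<lambda>s. norm (G (?N + k) s *\<^sub>R I k - G ?N s *\<^sub>R I 0)) \<longlongrightarrow>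
      norm (real (?N + k) *\<^sub>R I k - real ?N *\<^sub>R I 0)) (at_left 1)"
    by (intro tendsto_intros Gt)
  have R: "((\<lambda>s. C * V * (1 - s) * G k s * G ?N s) \<longlongrightarrow> C * V * (1 - 1) * real k * real ?N) (at_left 1)"
    by (intro tendsto_intros Gt)
  have "eventually (\<lambda>s. norm (G (?N + k) s *\<^sub>R I k - G ?N s *\<^sub>R I 0) \<le> C * V * (1 - s) * G k s * G ?N s) (at_left 1)"
    by (rule eventually_mono[OF eventually_at_left_real[OF zero_less_one]]) (use est in auto)
  then have "norm (real (?N + k) *\<^sub>R I k - real ?N *\<^sub>R I 0) \<le> C * V * (1 - 1) * real k * real ?N"
    using tendsto_le[OF trivial_limit_at_left_real R L] by blast
  then show ?thesis by (simp add: I0[symmetric]) (simp add: I_def)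
qed

lemma polynomial_function_borel_measurable:
  fixes f :: "'a::euclidean_space \<Rightarrow> 'b::euclidean_space"
  shows "polynomial_function f \<Longrightarrow> f \<in> borel_measurable borel"
  by (intro borel_measurable_continuous_onI continuous_on_polymonial_function)

lemma polynomial_function_bounded_cball:
  fixes f :: "'a::euclidean_space \<Rightarrow> 'b::euclidean_space"
  assumes "polynomial_function f"
  obtains C where "\<And>x. x \<in> cball 0 r \<Longrightarrow> norm (f x) \<le> C"
  using compact_imp_bounded[OF compact_continuous_image[OF continuous_on_polymonial_function[OF assms] compact_cball]]
  unfolding bounded_iff by blast

text \<open>Turns integrals over the ball into integrals over the sphere: by homogeneity g (y) is
  the j-th power of the norm times g at \<open>sgn y\<close>, so only the total radial power j + i
  enters.\<close>

lemma integral_ball_homogeneous: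
  fixes g :: "'a::euclidean_space \<Rightarrow> complex"
  assumes g: "polynomial_function g" "homogeneous j g"
  shows "(\<integral>y. indicator (ball 0 1) y *\<^sub>R (norm y ^ i *\<^sub>R g y) \<partial>lborel) =
    (\<integral>y. g y \<partial>surface_measure) /\<^sub>R real (DIM('a) + j + i)"
proof -
  obtain C where C: "\<And>x. x \<in> cball 0 1 \<Longrightarrow> norm (g x) \<le> C"
    using polynomial_function_bounded_cball[OF g(1), of 1] by metis
  have m[measurable]: "g \<in> borel_measurable borel" by (rule polynomial_function_borel_measurable[OF g(1)])
  have 1: "norm y ^ (j + i) *\<^sub>R g (sgn y) = norm y ^ i *\<^sub>R g y" if "y \<noteq> 0" for y
    using homogeneousD[OF g(2), of "norm y" "sgn y"] that
    by (simp add: sgn_div_norm power_add scaleR_conv_of_real)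
  have "(\<integral>y. indicator (ball 0 1) y *\<^sub>R (norm y ^ i *\<^sub>R g y) \<partial>lborel) =
      (\<integral>y. indicator (ball 0 1) y *\<^sub>R (norm y ^ (j + i) *\<^sub>R g (sgn y)) \<partial>lborel)"
  proof (rule integral_cong_AE)
    show "AE y in lborel. indicator (ball 0 1) y *\<^sub>R (norm y ^ i *\<^sub>R g y) =
        indicator (ball 0 1) y *\<^sub>R (norm y ^ (j + i) *\<^sub>R g (sgn y))"
      using AE_lborel_singleton[of "0::'a"] by eventually_elim (auto simp: 1)
  qed measurable
  moreover have "real (DIM('a) + (j + i)) *\<^sub>R (\<integral>y. indicator (ball 0 1) y *\<^sub>R (norm y ^ (j + i) *\<^sub>R g (sgn y)) \<partial>lborel) =
      (\<integral>y. g y \<partial>surface_measure)"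
    using integral_ball_norm_power[OF m C, of "j + i"]
      integral_surface_measure[OF borel_measurable_surface_measure[OF m]] by simp
  moreover have "real (DIM('a) + (j + i)) \<noteq> 0"
    using DIM_positive[where 'a='a] by linarith
  ultimately show ?thesis
    by (simp only: add.assoc flip: \<open>_ = (\<integral>y. g y \<partial>surface_measure)\<close>) (simp only: scaleR_scaleR left_inverse[OF \<open>_ \<noteq> 0\<close>] scaleR_one)
qed

section \<open>The divergence theorem on the sphere\<close>

lemma vector_derivative_bound:
  fixes f :: "real \<Rightarrow> 'b::real_normed_vector"
  assumes "\<And>s. (f has_vector_derivative f' s) (at s)" and "\<And>s. norm (f' s) \<le> C"
  shows "norm (f h - f 0) \<le> C * \<bar>h\<bar>"
proof -
  have "norm (f h - f 0) \<le> C * norm (h - 0)"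
  proof (rule differentiable_bound[where S=UNIV and f'="\<lambda>s x. x *\<^sub>R f' s"])
    fix s :: real
    show "(f has_derivative (\<lambda>x. x *\<^sub>R f' s)) (at s within UNIV)"
      using assms(1)[of s] by (simp add: has_vector_derivative_def)
    have "norm (x *\<^sub>R f' s) \<le> C * norm x" for x
      using mult_left_mono[OF assms(2)[of s], of "\<bar>x\<bar>"] by (simp add: mult.commute)
    then show "onorm (\<lambda>x. x *\<^sub>R f' s) \<le> C"
      by (rule onorm_le)
  qed auto
  then show ?thesis by simp
qed

lemma has_vector_derivative_tendsto_quotient:
  fixes f :: "'a::real_normed_vector \<Rightarrow> 'b::real_normed_vector"
  assumes "((\<lambda>t. f (x + t *\<^sub>R v)) has_vector_derivative D) (at (0::real))"
  shows "((\<lambda>t. (f (x + t *\<^sub>R v) - f x) /\<^sub>R t) \<longlongrightarrow> D) (at 0)"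
proof -
  have "((\<lambda>t. norm (f (x + t *\<^sub>R v) - f x - t *\<^sub>R D) / norm t) \<longlongrightarrow> 0) (at 0)"
    using assms by (simp add: has_vector_derivative_def has_derivative_at)
  moreover have "\<forall>\<^sub>F t in at 0. norm (f (x + t *\<^sub>R v) - f x - t *\<^sub>R D) / norm t =
      norm ((f (x + t *\<^sub>R v) - f x) /\<^sub>R t - D)"
  proof (rule eventually_at_filter[THEN iffD2, OF always_eventually], intro allI impI)
    fix t :: real assume t: "t \<noteq> 0"
    have eq: "(f (x + t *\<^sub>R v) - f x) /\<^sub>R t - D = (f (x + t *\<^sub>R v) - f x - t *\<^sub>R D) /\<^sub>R t"
      by (simp only: scaleR_diff_right scaleR_scaleR left_inverse[OF t] scaleR_one)
    show "norm (f (x + t *\<^sub>R v) - f x - t *\<^sub>R D) / norm t =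
      norm ((f (x + t *\<^sub>R v) - f x) /\<^sub>R t - D)"
      unfolding eq norm_scaleR by (simp add: divide_inverse_commute)
  qed
  ultimately have "((\<lambda>t. norm ((f (x + t *\<^sub>R v) - f x) /\<^sub>R t - D)) \<longlongrightarrow> 0) (at 0)"
    by (rule Lim_transform_eventually)
  then show ?thesis
    by (rule LIM_zero_cancel[OF tendsto_norm_zero_cancel])
qed

text \<open>By translation invariance every difference quotient has integral 0. The quotients are
  bounded by C (mean value estimate) and vanish outside the ball of radius 1 + |v| since the shifts
  h are at most 1, so dominated convergence applies.\<close>

lemma integral_directional_derivative_eq_0:
  fixes G G' :: "'a::euclidean_space \<Rightarrow> complex"
  assumes m[measurable]: "G \<in> borel_measurable borel" "G' \<in> borel_measurable borel"
    and deriv: "\<And>y s. ((\<lambda>t. G (y + t *\<^sub>R v)) has_vector_derivative G' (y + s *\<^sub>R v)) (at s)"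
    and bound: "\<And>y. norm (G y) \<le> C" "\<And>y. norm (G' y) \<le> C"
    and supp: "\<And>y. norm y \<ge> 1 \<Longrightarrow> G y = 0"
  shows "(\<integral>y. G' y \<partial>lborel) = 0"
proof -
  define h where "h j = 1 / real (Suc j)" for j
  define D where "D j y = (G (y + h j *\<^sub>R v) - G y) /\<^sub>R h j" for j y
  define R where "R = 1 + norm v"
  have h: "0 < h j" "h j \<le> 1" for j by (auto simp: h_def)
  have iG: "integrable lborel G"
  proof -
    have "integrable lborel (\<lambda>y. indicator (ball 0 1) y *\<^sub>R G y)"
      by (rule integrable_ball_lborel[OF m(1)]) (rule bound)
    also have "(\<lambda>y. indicator (ball 0 1) y *\<^sub>R G y) = G"
      using supp by (force simp: indicator_def fun_eq_iff)
    finally show ?thesis .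
  qed
  have shift: "(\<integral>y. G (y + w) \<partial>lborel) = (\<integral>y. G y \<partial>lborel)" "integrable lborel (\<lambda>y. G (y + w))" for w
  proof -
    have d: "distr lborel borel (\<lambda>y. w + y) = (lborel :: 'a measure)" by (rule lborel_distr_plus)
    have "(\<integral>y. G y \<partial>distr lborel borel (\<lambda>y. w + y)) = (\<integral>y. G (w + y) \<partial>lborel)"
      by (rule integral_distr) simp_all
    then show "(\<integral>y. G (y + w) \<partial>lborel) = (\<integral>y. G y \<partial>lborel)"
      by (simp only: d) (simp add: add.commute)
    have "integrable (distr lborel borel (\<lambda>y. w + y)) G" using iG by (simp add: d)
    then show "integrable lborel (\<lambda>y. G (y + w))"
      by (subst (asm) integrable_distr_eq) (simp_all add: add.commute)
  qed
  have ID: "(\<integral>y. D j y \<partial>lborel) = 0" for j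
    unfolding D_def using shift[of "h j *\<^sub>R v"] iG by simp
  have "(\<lambda>j. \<integral>y. D j y \<partial>lborel) \<longlonglongrightarrow> (\<integral>y. G' y \<partial>lborel)"
  proof (rule integral_dominated_convergence[where w="\<lambda>y. C * indicator (ball 0 R) y"])
    show "integrable lborel (\<lambda>y::'a. C * indicator (ball 0 R) y)"
      using integrable_ball_lborel[of "\<lambda>_::'a. 1::real" R 1] by simp
    show "D j \<in> borel_measurable lborel" for j
      unfolding D_def by measurable
    show "AE y in lborel. (\<lambda>j. D j y) \<longlonglongrightarrow> G' y"
    proof (rule AE_I2)
      fix y
      have "((\<lambda>t. G (y + t *\<^sub>R v)) has_vector_derivative G' y) (at 0)"
        using deriv[of y 0] by simp
      then have "((\<lambda>t. (G (y + t *\<^sub>R v) - G y) /\<^sub>R t) \<longlongrightarrow> G' y) (at 0)"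
        by (rule has_vector_derivative_tendsto_quotient)
      moreover have "filterlim h (at 0) sequentially"
        unfolding filterlim_at h_def using LIMSEQ_inverse_real_of_nat
        by (auto simp: inverse_eq_divide)
      ultimately show "(\<lambda>j. D j y) \<longlonglongrightarrow> G' y"
        unfolding D_def by (rule filterlim_compose)
    qed
    show "AE y in lborel. norm (D j y) \<le> C * indicator (ball 0 R) y" for j
    proof (rule AE_I2)
      fix y
      show "norm (D j y) \<le> C * indicator (ball 0 R) y"
      proof (cases "norm y < R")
        case True
        have "norm (G (y + h j *\<^sub>R v) - G (y + 0 *\<^sub>R v)) \<le> C * \<bar>h j\<bar>"
          by (rule vector_derivative_bound[OF deriv bound(2)])
        then have "norm (G (y + h j *\<^sub>R v) - G y) / h j \<le> C"
          using h[of j] by (simp add: field_simps)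
        then show ?thesis using True h[of j]
          by (simp add: D_def divide_inverse mult.commute)
      next
        case False
        have "norm (h j *\<^sub>R v) \<le> norm v" using h[of j] by (simp add: mult_left_le_one_le)
        then have "1 \<le> norm (y + h j *\<^sub>R v)"
          using False norm_triangle_ineq4[of "y + h j *\<^sub>R v" "h j *\<^sub>R v"] by (simp add: R_def)
        moreover have "1 \<le> norm y" using False norm_ge_zero[of v] unfolding R_def by linarith
        ultimately show ?thesis using False supp by (simp add: D_def)
      qed
    qed
  qed measurable
  then show ?thesis unfolding ID using LIMSEQ_unique tendsto_const by blast
qed

text \<open>The squared positive part is differentiable also at 0. This lets the cut-off of the next
  integration by parts pass through the unit sphere without a boundary term.\<close>

lemma has_real_derivative_max_0_power2:
  "((\<lambda>x. (max 0 x)\<^sup>2) has_real_derivative 2 * max 0 x) (at (x::real))"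
proof -
  consider "x > 0" | "x < 0" | "x = 0" by linarith
  then show ?thesis
  proof cases
    case 1
    have "((\<lambda>x. x\<^sup>2) has_real_derivative 2 * max 0 x) (at x)"
      using 1 by (auto intro!: derivative_eq_intros)
    then show ?thesis
      by (rule has_field_derivative_transform_within_open[where S="{0<..}"]) (use 1 in auto)
  next
    case 2
    have "((\<lambda>x. 0) has_real_derivative 2 * max 0 x) (at x)"
      using 2 by (auto intro!: derivative_eq_intros)
    then show ?thesis
      by (rule has_field_derivative_transform_within_open[where S="{..<0}"]) (use 2 in auto)
  next
    case 3
    have "((\<lambda>h::real. (max 0 h)\<^sup>2 / h) \<longlongrightarrow> 0) (at 0)"
    proof (rule Lim_null_comparison)
      show "((\<lambda>h::real. \<bar>h\<bar>) \<longlongrightarrow> 0) (at 0)"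
        using tendsto_rabs_zero[OF tendsto_ident_at] .
      show "\<forall>\<^sub>F h in at 0. norm ((max 0 h)\<^sup>2 / h) \<le> \<bar>h::real\<bar>"
        by (auto simp: eventually_at_filter max_def power2_eq_square)
    qed
    then show ?thesis using 3 by (simp add: DERIV_def)
  qed
qed

lemma continuous_bounded_cball:
  fixes g :: "'a::euclidean_space \<Rightarrow> 'b::real_normed_vector"
  assumes "continuous_on UNIV g"
  shows "\<exists>C. \<forall>y. y \<in> cball 0 r \<longrightarrow> norm (g y) \<le> C"
proof -
  have "compact (g ` cball 0 r)"
    by (intro compact_continuous_image continuous_on_subset[OF assms]) auto
  from compact_imp_bounded[OF this] show ?thesis
    unfolding bounded_iff by (simp only: ball_simps) blast
qed

text \<open>Integration by parts against the cut-off (1 - |y|^2)^2, extended by 0 outside the ball: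
  its derivative in direction v is -4 (1 - |y|^2) (y \<bullet> v). The square is what makes the
  product continuously differentiable on the whole space.\<close>

lemma integral_partial_deriv_ball:
  fixes F :: "'a::euclidean_space \<Rightarrow> complex"
  assumes F: "polynomial_function F"
  shows "(\<integral>y. indicator (ball 0 1) y *\<^sub>R (((1 - norm y ^ 2)\<^sup>2) *\<^sub>R partial_deriv v F y) \<partial>lborel) =
    4 * (\<integral>y. indicator (ball 0 1) y *\<^sub>R ((1 - norm y ^ 2) *\<^sub>R (of_real (y \<bullet> v) * F y)) \<partial>lborel)"
proof -
  let ?F' = "partial_deriv v F"
  define w where "w y = max 0 (1 - y \<bullet> y)" for y :: 'a
  define G where "G y = ((w y)\<^sup>2) *\<^sub>R F y" for y
  define G' where "G' y = ((w y)\<^sup>2) *\<^sub>R ?F' y - (4 * w y * (y \<bullet> v)) *\<^sub>R F y" for y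
  have F': "polynomial_function ?F'" by (rule polynomial_function_partial_deriv[OF F])
  have cw: "continuous_on UNIV w" unfolding w_def by (intro continuous_intros)
  have cF: "continuous_on UNIV F" "continuous_on UNIV ?F'"
    using F F' by (auto intro: continuous_on_polymonial_function)
  have cG: "continuous_on UNIV G" "continuous_on UNIV G'"
    unfolding G_def G'_def by (intro continuous_intros cw cF)+
  have w0: "w y = 0" if "norm y \<ge> 1" for y
    using that by (simp add: w_def dot_square_norm one_le_power)
  have w1: "w y = 1 - (norm y)\<^sup>2" if "norm y < 1" for y
    using that by (simp add: w_def dot_square_norm power_le_one)
  have bd: "\<exists>C. \<forall>y. norm (g y) \<le> C" if g: "continuous_on UNIV g" "\<And>y. norm y \<ge> 1 \<Longrightarrow> g y = 0" for g :: "'a \<Rightarrow> complex"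
  proof -
    obtain C where C: "\<And>y. y \<in> cball 0 1 \<Longrightarrow> norm (g y) \<le> C"
      using continuous_bounded_cball[OF g(1)] by metis
    have "norm (g y) \<le> max 0 C" for y
      using C[of y] g(2)[of y] by (cases "norm y \<le> 1") auto
    then show ?thesis by blast
  qed
  obtain C1 where C1: "\<And>y. norm (G y) \<le> C1"
    using bd[OF cG(1)] w0 by (auto simp: G_def)
  obtain C2 where C2: "\<And>y. norm (G' y) \<le> C2"
    using bd[OF cG(2)] w0 by (auto simp: G'_def)
  have "(\<integral>y. G' y \<partial>lborel) = 0"
  proof (rule integral_directional_derivative_eq_0[where G=G and v=v and C="max C1 C2"])
    show "G \<in> borel_measurable borel" "G' \<in> borel_measurable borel"
      using cG by (auto intro: borel_measurable_continuous_onI)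
    show "norm (G y) \<le> max C1 C2" "norm (G' y) \<le> max C1 C2" for y
      using C1[of y] C2[of y] by auto
    show "G y = 0" if "1 \<le> norm y" for y using w0[OF that] by (simp add: G_def)
    fix y s
    let ?q = "\<lambda>t. 1 - (y + t *\<^sub>R v) \<bullet> (y + t *\<^sub>R v)"
    have q: "(?q has_real_derivative - 2 * ((y + s *\<^sub>R v) \<bullet> v)) (at s)"
      unfolding inner_add_left inner_add_right inner_scaleR_left inner_scaleR_right
      by (auto intro!: derivative_eq_intros simp: inner_commute algebra_simps)
    have "((\<lambda>t. (w (y + t *\<^sub>R v))\<^sup>2) has_real_derivative (2 * w (y + s *\<^sub>R v)) * (- 2 * ((y + s *\<^sub>R v) \<bullet> v))) (at s)"
      unfolding w_def by (rule DERIV_chain2[OF has_real_derivative_max_0_power2 q])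
    from has_vector_derivative_scaleR[OF this has_vector_derivative_partial_deriv[OF F, of y v s]]
    show "((\<lambda>t. G (y + t *\<^sub>R v)) has_vector_derivative G' (y + s *\<^sub>R v)) (at s)"
      unfolding G_def G'_def by (rule has_vector_derivative_eq_rhs) (simp add: algebra_simps)
  qed
  moreover have eq: "G' y = indicator (ball 0 1) y *\<^sub>R (((1 - norm y ^ 2)\<^sup>2) *\<^sub>R ?F' y) -
      4 * (indicator (ball 0 1) y *\<^sub>R ((1 - norm y ^ 2) *\<^sub>R (of_real (y \<bullet> v) * F y)))" for y
    by (cases "norm y < 1") (simp_all add: G'_def w0 w1 scaleR_conv_of_real)
  have i: "integrable lborel (\<lambda>y. indicator (ball 0 1) y *\<^sub>R g y)" if g: "continuous_on UNIV g" for g :: "'a \<Rightarrow> complex"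
  proof -
    obtain C where C: "\<And>y. y \<in> cball 0 1 \<Longrightarrow> norm (g y) \<le> C"
      using continuous_bounded_cball[OF g] by metis
    then show ?thesis
      using g by (intro integrable_ball_lborel[where C=C]) (auto intro: borel_measurable_continuous_onI)
  qed
  have "(\<integral>y. G' y \<partial>lborel) = (\<integral>y. indicator (ball 0 1) y *\<^sub>R (((1 - norm y ^ 2)\<^sup>2) *\<^sub>R ?F' y) \<partial>lborel) -
      (\<integral>y. 4 * (indicator (ball 0 1) y *\<^sub>R ((1 - norm y ^ 2) *\<^sub>R (of_real (y \<bullet> v) * F y))) \<partial>lborel)"
    unfolding eq
    by (intro Bochner_Integration.integral_diff integrable_mult_right i continuous_intros cF)
  ultimately show ?thesis by (simp only: integral_mult_right_zero) simp
qed

lemma polynomial_function_inner_mult: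
  fixes F :: "'a::euclidean_space \<Rightarrow> complex"
  shows "polynomial_function F \<Longrightarrow> polynomial_function (\<lambda>y. of_real (y \<bullet> v) * F y)"
  by (intro polynomial_function_complex_mult polynomial_function_of_real real_polynomial_function_inner)

lemma homogeneous_inner_mult:
  "homogeneous k F \<Longrightarrow> homogeneous (Suc k) (\<lambda>y. of_real (y \<bullet> v) * F y)"
  by (simp add: homogeneous_def)

text \<open>Both sides of the identity on the ball consist of homogeneous functions times even
  powers of the norm, so each becomes a rational factor times an integral over the sphere; comparing
  the factors leaves N + k - 1.\<close>

theorem surface_integral_partial_deriv:
  fixes F :: "'a::euclidean_space \<Rightarrow> complex"
  assumes F: "polynomial_function F" "homogeneous k F"
  shows "(\<integral>y. partial_deriv v F y \<partial>surface_measure) =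
    of_real (real DIM('a) + real k - 1) * (\<integral>y. of_real (y \<bullet> v) * F y \<partial>surface_measure)"
proof -
  let ?B = "ball 0 1 :: 'a set"
  define J where "J = (\<integral>y. of_real (y \<bullet> v) * F y \<partial>surface_measure)"
  define N where "N = real DIM('a)"
  have N: "N \<ge> 1" by (simp add: N_def Suc_leI)
  have int: "integrable lborel (\<lambda>y. indicator ?B y *\<^sub>R (norm y ^ i *\<^sub>R g y))"
    if g: "polynomial_function g" for g :: "'a \<Rightarrow> complex" and i
  proof -
    obtain C where C: "\<And>x. x \<in> cball 0 1 \<Longrightarrow> norm (g x) \<le> C"
      using polynomial_function_bounded_cball[OF g, of 1] by metis
    show ?thesis
    proof (rule integrable_ball_lborel)
      show "(\<lambda>y. norm y ^ i *\<^sub>R g y) \<in> borel_measurable borel"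
        using polynomial_function_borel_measurable[OF g] by measurable
      show "norm (norm y ^ i *\<^sub>R g y) \<le> 1 * C" if "norm y < 1" for y
        unfolding norm_scaleR by (rule mult_mono) (use that C in \<open>auto intro: power_le_one\<close>)
    qed
  qed
  let ?yF = "\<lambda>y. of_real (y \<bullet> v) * F y"
  have yF: "polynomial_function ?yF" "homogeneous (Suc k) ?yF"
    using F by (auto intro: polynomial_function_inner_mult homogeneous_inner_mult)
  have "(\<integral>y. indicator ?B y *\<^sub>R ((1 - norm y ^ 2) *\<^sub>R ?yF y) \<partial>lborel) =
      (\<integral>y. indicator ?B y *\<^sub>R (norm y ^ 0 *\<^sub>R ?yF y) - indicator ?B y *\<^sub>R (norm y ^ 2 *\<^sub>R ?yF y) \<partial>lborel)"
    by (intro Bochner_Integration.integral_cong refl) (simp only: power_0 scaleR_one scaleR_diff_left scaleR_diff_right)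
  also have "\<dots> = (\<integral>y. indicator ?B y *\<^sub>R (norm y ^ 0 *\<^sub>R ?yF y) \<partial>lborel) - (\<integral>y. indicator ?B y *\<^sub>R (norm y ^ 2 *\<^sub>R ?yF y) \<partial>lborel)"
    by (intro Bochner_Integration.integral_diff int yF)
  also have "\<dots> = (1 / (N + k + 1) - 1 / (N + k + 3)) *\<^sub>R J"
    unfolding integral_ball_homogeneous[OF yF]
    by (simp add: J_def N_def scaleR_diff_left divide_inverse add_ac)
  finally have rhs: "(\<integral>y. indicator ?B y *\<^sub>R ((1 - norm y ^ 2) *\<^sub>R ?yF y) \<partial>lborel) = (1 / (N + k + 1) - 1 / (N + k + 3)) *\<^sub>R J" .
  note rhs = integral_partial_deriv_ball[OF F(1), of v, unfolded rhs]
  show ?thesis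
  proof (cases k)
    \<comment> \<open>A constant F has derivative 0, and what remains is that (y \<bullet> v) F has
      integral 0. The identity on the ball gives this because its right-hand factor is
      positive.\<close>
    case 0
    then have "partial_deriv v F = (\<lambda>_. 0)"
      using F partial_deriv_homogeneous_0 by blast
    moreover from this rhs have "(1 / (N + k + 1) - 1 / (N + k + 3)) *\<^sub>R J = 0" by simp
    moreover have "1 / (N + k + 1) - 1 / (N + k + 3) > 0"
      using N by (simp add: frac_less2)
    ultimately show ?thesis by (simp add: J_def)
  next
    case (Suc j)
    let ?g = "partial_deriv v F"
    define I where "I = (\<integral>y. ?g y \<partial>surface_measure)"
    have g: "polynomial_function ?g" "homogeneous j ?g"
      using F Suc by (auto intro: polynomial_function_partial_deriv homogeneous_partial_deriv)
    have "(\<integral>y. indicator ?B y *\<^sub>R (((1 - norm y ^ 2)\<^sup>2) *\<^sub>R ?g y) \<partial>lborel) =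
      (\<integral>y. indicator ?B y *\<^sub>R (norm y ^ 0 *\<^sub>R ?g y) - 2 *\<^sub>R (indicator ?B y *\<^sub>R (norm y ^ 2 *\<^sub>R ?g y))
         + indicator ?B y *\<^sub>R (norm y ^ 4 *\<^sub>R ?g y) \<partial>lborel)"
    proof (intro Bochner_Integration.integral_cong refl)
      fix y :: 'a
      have eq: "(1 - norm y ^ 2)\<^sup>2 = 1 - 2 * norm y ^ 2 + norm y ^ 4"
        by (simp add: power2_eq_square power4_eq_xxxx algebra_simps)
      show "indicator ?B y *\<^sub>R (((1 - norm y ^ 2)\<^sup>2) *\<^sub>R ?g y) =
         indicator ?B y *\<^sub>R (norm y ^ 0 *\<^sub>R ?g y) - 2 *\<^sub>R (indicator ?B y *\<^sub>R (norm y ^ 2 *\<^sub>R ?g y))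
         + indicator ?B y *\<^sub>R (norm y ^ 4 *\<^sub>R ?g y)"
        unfolding eq by (cases "y \<in> ?B") (simp_all add: scaleR_add_left scaleR_diff_left)
    qed
    also have "\<dots> = (\<integral>y. indicator ?B y *\<^sub>R (norm y ^ 0 *\<^sub>R ?g y) \<partial>lborel) - 2 *\<^sub>R (\<integral>y. indicator ?B y *\<^sub>R (norm y ^ 2 *\<^sub>R ?g y) \<partial>lborel)
         + (\<integral>y. indicator ?B y *\<^sub>R (norm y ^ 4 *\<^sub>R ?g y) \<partial>lborel)"
      using int[OF g(1), of 0] int[OF g(1), of 2] int[OF g(1), of 4]
      by (simp only: Bochner_Integration.integral_add Bochner_Integration.integral_diff integral_scaleR_right
          Bochner_Integration.integrable_diff integrable_scaleR_right)
    also have "\<dots> = (1 / (N + j) - 2 / (N + j + 2) + 1 / (N + j + 4)) *\<^sub>R I"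
      unfolding integral_ball_homogeneous[OF g]
      by (simp add: I_def N_def scaleR_diff_left scaleR_add_left divide_inverse add_ac)
    finally have E: "(1 / (N + j) - 2 / (N + j + 2) + 1 / (N + j + 4)) *\<^sub>R I =
        (4 * (1 / (N + j + 2) - 1 / (N + j + 4))) *\<^sub>R J"
      using rhs Suc by (simp add: add_ac scaleR_conv_of_real)
    \<comment> \<open>Here a = N + k - 1: the derivative has degree j = k - 1, and (y \<bullet> v) F
      has degree k + 1, which accounts for the shifts by 2 and 4.\<close>
    have *: "1 / a - 2 / (a + 2) + 1 / (a + 4) = 8 / (a * (a + 2) * (a + 4))"
      "4 * (1 / (a + 2) - 1 / (a + 4)) = a * (8 / (a * (a + 2) * (a + 4)))" if "a > 0" for a :: real
    proof -
      have nz: "a \<noteq> 0" "a + 2 \<noteq> 0" "a + 4 \<noteq> 0" using that by auto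
      show "1 / a - 2 / (a + 2) + 1 / (a + 4) = 8 / (a * (a + 2) * (a + 4))"
        using nz by (simp add: divide_simps) (simp add: algebra_simps)
      show "4 * (1 / (a + 2) - 1 / (a + 4)) = a * (8 / (a * (a + 2) * (a + 4)))"
        using nz by (simp add: divide_simps)
    qed
    have Nj: "N + j > 0" using N by simp
    have "(8 / ((N + j) * (N + j + 2) * (N + j + 4))) *\<^sub>R I =
        (8 / ((N + j) * (N + j + 2) * (N + j + 4))) *\<^sub>R ((N + j) *\<^sub>R J)"
      using E unfolding *[OF Nj] by (simp only: scaleR_scaleR mult.commute[of "N + j"])
    moreover have "8 / ((N + j) * (N + j + 2) * (N + j + 4)) > 0" using N by simp
    ultimately have "I = (N + j) *\<^sub>R J" by (metis (no_types) less_irrefl scaleR_left_imp_eq)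
    then show ?thesis using Suc by (simp add: I_def J_def N_def scaleR_conv_of_real add_ac)
  qed
qed

section \<open>The Funk--Hecke formula\<close>

lemma borel_measurable_surface_continuous:
  fixes f :: "'a::euclidean_space \<Rightarrow> 'b::real_normed_vector"
  assumes "continuous_on (sphere 0 1) f"
  shows "f \<in> borel_measurable surface_measure"
  unfolding measurable_cong_sets[OF sets_surface_measure refl]
  by (rule borel_measurable_continuous_on_restrict[OF assms])

lemma integrable_surface_mult:
  fixes f g :: "'a::euclidean_space \<Rightarrow> complex"
  assumes f: "integrable surface_measure f" and g: "continuous_on (sphere 0 1) g"
  shows "integrable surface_measure (\<lambda>y. g y * f y)"
proof -
  have "compact (g ` sphere 0 1)" using g by (intro compact_continuous_image) auto
  from compact_imp_bounded[OF this]
  obtain C where C: "\<And>y. y \<in> sphere 0 1 \<Longrightarrow> norm (g y) \<le> C"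
    unfolding bounded_iff by (simp only: ball_simps) blast
  show ?thesis
  proof (rule Bochner_Integration.integrable_bound)
    show "integrable surface_measure (\<lambda>y. complex_of_real C * f y)"
      using f by simp
    show "(\<lambda>y. g y * f y) \<in> borel_measurable surface_measure"
      using borel_measurable_integrable[OF f] borel_measurable_surface_continuous[OF g] by measurable
    show "AE y in surface_measure. norm (g y * f y) \<le> norm (complex_of_real C * f y)"
    proof (rule AE_I2)
      fix y :: 'a assume "y \<in> space surface_measure"
      then have "norm (g y) \<le> \<bar>C\<bar>" using C[of y] by simp
      then show "norm (g y * f y) \<le> norm (complex_of_real C * f y)"
        by (simp add: norm_mult mult_right_mono)
    qed
  qed
qed

lemma integrable_surface_continuous:
  fixes f :: "'a::euclidean_space \<Rightarrow> 'b::{banach, second_countable_topology}"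
  assumes f: "continuous_on (sphere 0 1) f"
  shows "integrable surface_measure f"
proof -
  interpret finite_measure "surface_measure :: 'a measure" by (rule finite_measure_surface_measure)
  have "compact (f ` sphere 0 1)" using f by (intro compact_continuous_image) auto
  from compact_imp_bounded[OF this]
  obtain C where C: "\<And>y. y \<in> sphere 0 1 \<Longrightarrow> norm (f y) \<le> C"
    unfolding bounded_iff by (simp only: ball_simps) blast
  show ?thesis
    by (rule integrable_const_bound[where B=C])
      (use C in \<open>auto intro: borel_measurable_surface_continuous[OF f]\<close>)
qed

lemma integrable_surface_polynomial:
  fixes f :: "'a::euclidean_space \<Rightarrow> complex"
  shows "polynomial_function f \<Longrightarrow> integrable surface_measure f"
  by (intro integrable_surface_continuous continuous_on_polymonial_function)

lemma harmonic_polynomialsD: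
  assumes "Y \<in> harmonic_polynomials n"
  shows "polynomial_function Y" "homogeneous n Y" "laplacian Y = (\<lambda>x. 0)"
  using assms by (auto simp: harmonic_polynomials_iff)

text \<open>By Euler's identity (j + 1) Y is the sum of the products of y \<bullet> b with the b-th
  partial derivative. The divergence theorem turns the integral of each product into that of a
  second derivative, and the sum of those is the Laplacian. The dimension condition keeps the factor
  N + j - 1 away from 0.\<close>

lemma integral_harmonic_eq_0:
  fixes Y :: "'a::euclidean_space \<Rightarrow> complex"
  assumes Y: "Y \<in> harmonic_polynomials (Suc j)" and N: "2 \<le> DIM('a)"
  shows "(\<integral>y. Y y \<partial>surface_measure) = 0"
proof -
  note YD = harmonic_polynomialsD[OF Y]
  have pd: "polynomial_function (partial_deriv b Y)" "homogeneous j (partial_deriv b Y)" for b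
    using YD by (auto intro: polynomial_function_partial_deriv homogeneous_partial_deriv)
  let ?c = "of_real (real DIM('a) + real j - 1) :: complex"
  have "of_nat (Suc j) * (\<integral>y. Y y \<partial>surface_measure) = (\<integral>y. of_nat (Suc j) * Y y \<partial>surface_measure)"
    by simp
  also have "\<dots> = (\<integral>y. (\<Sum>b\<in>Basis. of_real (y \<bullet> b) * partial_deriv b Y y) \<partial>surface_measure)"
    by (simp only: partial_deriv_self[OF YD(1,2), symmetric] partial_deriv_euclidean[OF YD(1), of y y for y])
  also have "\<dots> = (\<Sum>b\<in>Basis. (\<integral>y. of_real (y \<bullet> b) * partial_deriv b Y y \<partial>surface_measure))"
    by (intro Bochner_Integration.integral_sum integrable_surface_polynomial polynomial_function_inner_mult pd)
  finally have "?c * (of_nat (Suc j) * (\<integral>y. Y y \<partial>surface_measure)) =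
      (\<Sum>b\<in>Basis. ?c * (\<integral>y. of_real (y \<bullet> b) * partial_deriv b Y y \<partial>surface_measure))"
    by (simp add: sum_distrib_left)
  also have "\<dots> = (\<Sum>b\<in>Basis. (\<integral>y. partial_deriv b (partial_deriv b Y) y \<partial>surface_measure))"
    by (simp only: surface_integral_partial_deriv[OF pd])
  also have "\<dots> = (\<integral>y. laplacian Y y \<partial>surface_measure)"
    unfolding laplacian_eq_sum
    by (intro Bochner_Integration.integral_sum[symmetric] integrable_surface_polynomial
        polynomial_function_partial_deriv pd)
  also have "\<dots> = 0" by (simp add: YD)
  finally show ?thesis using N
    by (simp only: mult_eq_0_iff of_nat_eq_0_iff of_real_eq_0_iff) auto
qed

text \<open>The divergence theorem in direction x for the homogeneous polynomial (y \<bullet> x) ^ m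
  Y; the product rule gives the two terms on the right since x \<bullet> x = 1. For m = 0 the
  truncated exponent m - 1 is multiplied by 0.\<close>

lemma funk_hecke_recursion:
  fixes Y :: "'a::euclidean_space \<Rightarrow> complex"
  assumes Y: "polynomial_function Y" "homogeneous j Y" and x: "norm x = 1"
  shows "of_real (real DIM('a) + real (m + j) - 1) * (\<integral>y. of_real ((y \<bullet> x) ^ Suc m) * Y y \<partial>surface_measure) =
    of_nat m * (\<integral>y. of_real ((y \<bullet> x) ^ (m - 1)) * Y y \<partial>surface_measure) +
    (\<integral>y. of_real ((y \<bullet> x) ^ m) * partial_deriv x Y y \<partial>surface_measure)"
proof -
  let ?f = "\<lambda>y::'a. complex_of_real (y \<bullet> x)"
  have f: "polynomial_function ?f" by (intro poly_intros)
  let ?F = "\<lambda>y. of_real ((y \<bullet> x) ^ m) * Y y"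
  have fm: "polynomial_function (\<lambda>y. ?f y ^ m)" for m by (intro poly_intros)
  have F: "polynomial_function ?F" "homogeneous (m + j) ?F"
    using polynomial_function_complex_mult[OF fm Y(1)] homogeneous_mult[OF homogeneous_inner_power Y(2)]
    by simp_all
  have pd: "partial_deriv x ?F = (\<lambda>y. of_nat m * (of_real ((y \<bullet> x) ^ (m - 1)) * Y y) + of_real ((y \<bullet> x) ^ m) * partial_deriv x Y y)"
  proof -
    have "partial_deriv x ?F = (\<lambda>y. ?f y ^ m * partial_deriv x Y y + partial_deriv x (\<lambda>y. ?f y ^ m) y * Y y)"
      using partial_deriv_mult[OF fm Y(1), of x m] by simp
    then show ?thesis
      using x by (simp add: partial_deriv_power[OF f] partial_deriv_inner norm_eq_1 fun_eq_iff mult_ac add_ac)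
  qed
  have i: "integrable surface_measure (\<lambda>y. of_real ((y \<bullet> x) ^ k) * g y)" if "polynomial_function g" for g :: "'a \<Rightarrow> complex" and k
    using integrable_surface_polynomial[OF polynomial_function_complex_mult[OF fm that]] by simp
  have "of_real (real DIM('a) + real (m + j) - 1) * (\<integral>y. of_real ((y \<bullet> x) ^ Suc m) * Y y \<partial>surface_measure) =
      (\<integral>y. partial_deriv x ?F y \<partial>surface_measure)"
    unfolding surface_integral_partial_deriv[OF F] by (simp add: mult_ac)
  also have "\<dots> = (\<integral>y. of_nat m * (of_real ((y \<bullet> x) ^ (m - 1)) * Y y) \<partial>surface_measure) +
     (\<integral>y. of_real ((y \<bullet> x) ^ m) * partial_deriv x Y y \<partial>surface_measure)"
    unfolding pd
    by (intro Bochner_Integration.integral_add integrable_mult_right i Y polynomial_function_partial_deriv)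
  finally show ?thesis by (simp only: integral_mult_right_zero)
qed

text \<open>The recursion reduces power m and degree j to power m - 2 with the same Y and to power m
  - 1 with the derivative of Y in direction x. The latter is harmonic of degree j - 1, and at x its
  value is j Y (x) by Euler's identity, so the multiplier depends neither on Y nor on x. The
  induction hypothesis must range over all degrees.\<close>

lemma funk_hecke_monomial:
  assumes N: "2 \<le> DIM('a::euclidean_space)"
  shows "\<exists>\<kappa>. \<forall>Y\<in>harmonic_polynomials j. \<forall>x::'a. norm x = 1 \<longrightarrow>
    (\<integral>y. of_real ((y \<bullet> x) ^ m) * Y y \<partial>surface_measure) = \<kappa> * Y x"
proof (induction m arbitrary: j rule: less_induct)
  case (less m)
  consider "m = 0" "j = 0" | j' where "m = 0" "j = Suc j'" | m' where "m = Suc m'"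
    by (meson not0_implies_Suc)
  then show ?case
  proof cases
    case 1
    have "(\<integral>y. Y y \<partial>surface_measure) = of_real (measure surface_measure (sphere 0 1 :: 'a set)) * Y x"
      if "Y \<in> harmonic_polynomials 0" for Y and x :: 'a
    proof -
      have "Y y = Y x" for y
        using homogeneousD[OF harmonic_polynomialsD(2)[OF that], of 0 y]
          homogeneousD[OF harmonic_polynomialsD(2)[OF that], of 0 x] by simp
      then have "(\<integral>y. Y y \<partial>surface_measure) = (\<integral>y. Y x \<partial>(surface_measure :: 'a measure))"
        by (intro Bochner_Integration.integral_cong) auto
      then show ?thesis by (simp add: scaleR_conv_of_real)
    qed
    with 1 show ?thesis by auto
  next
    case 2
    then show ?thesis using integral_harmonic_eq_0[OF _ N] by (intro exI[of _ 0]) auto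
  next
    case 3
    have lt: "m' - 1 < m" "m' < m" using 3 by auto
    from less.IH[OF lt(1), of j] obtain \<kappa>1 where \<kappa>1: "\<And>Y x. Y \<in> harmonic_polynomials j \<Longrightarrow> norm (x :: 'a) = 1 \<Longrightarrow>
        (\<integral>y. of_real ((y \<bullet> x) ^ (m' - 1)) * Y y \<partial>surface_measure) = \<kappa>1 * Y x"
      by blast
    from less.IH[OF lt(2), of "j - 1"] obtain \<kappa>2 where \<kappa>2: "\<And>Y x. Y \<in> harmonic_polynomials (j - 1) \<Longrightarrow> norm (x :: 'a) = 1 \<Longrightarrow>
        (\<integral>y. of_real ((y \<bullet> x) ^ m') * Y y \<partial>surface_measure) = \<kappa>2 * Y x"
      by blast
    let ?c = "complex_of_real (real DIM('a) + real (m' + j) - 1)"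
    have c: "?c \<noteq> 0" using N by (simp only: of_real_eq_0_iff)
    have "(\<integral>y. of_real ((y \<bullet> x) ^ m) * Y y \<partial>surface_measure) = ((of_nat m' * \<kappa>1 + \<kappa>2 * of_nat j) / ?c) * Y x"
      if Y: "Y \<in> harmonic_polynomials j" and x: "norm x = 1" for Y and x :: 'a
    proof -
      note YD = harmonic_polynomialsD[OF Y]
      have "(\<integral>y. of_real ((y \<bullet> x) ^ m') * partial_deriv x Y y \<partial>surface_measure) = \<kappa>2 * of_nat j * Y x"
      proof (cases j)
        case 0
        have "partial_deriv x Y = (\<lambda>_. 0)"
          using partial_deriv_homogeneous_0[of Y x] YD(2) 0 by simp
        then show ?thesis by (simp add: 0)
      next
        case (Suc j')
        then show ?thesis using \<kappa>2[OF _ x, of "partial_deriv x Y"] partial_deriv_harmonic[of Y j' x] Y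
          partial_deriv_self[OF YD(1,2)] by (simp add: mult.assoc)
      qed
      then have "?c * (\<integral>y. of_real ((y \<bullet> x) ^ m) * Y y \<partial>surface_measure) = of_nat m' * (\<kappa>1 * Y x) + \<kappa>2 * of_nat j * Y x"
        unfolding 3 funk_hecke_recursion[OF YD(1,2) x] \<kappa>1[OF Y x] by (simp only:)
      then show ?thesis using c by (simp only: times_divide_eq_left eq_divide_eq if_False, simp add: algebra_simps)
    qed
    then show ?thesis by blast
  qed
qed

section \<open>From polynomial to continuous profiles\<close>

lemma inner_sphere_bounds:
  fixes x y :: "'a::real_inner"
  assumes "norm x = 1" "norm y = 1"
  shows "x \<bullet> y \<in> {-1..1}"
  using Cauchy_Schwarz_ineq2[of x y] assms by auto

lemma continuous_on_inner_compose:
  fixes \<phi> :: "real \<Rightarrow> 'b::topological_space"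
  assumes "continuous_on {-1..1} \<phi>" "norm x = 1"
  shows "continuous_on (sphere 0 1) (\<lambda>y. \<phi> (y \<bullet> x))"
  by (rule continuous_on_compose2[OF assms(1)])
    (use inner_sphere_bounds[OF _ assms(2)] in \<open>auto intro!: continuous_intros\<close>)

lemma weierstrass_sequence:
  fixes \<phi> :: "real \<Rightarrow> real"
  assumes "continuous_on {-1..1} \<phi>"
  obtains g where "\<And>k. real_polynomial_function (g k)"
    "\<And>k t. t \<in> {-1..1} \<Longrightarrow> \<bar>g k t - \<phi> t\<bar> \<le> 1 / real (Suc k)"
proof -
  have "\<exists>g. real_polynomial_function g \<and> (\<forall>t\<in>{-1..1}. \<bar>\<phi> t - g t\<bar> < 1 / real (Suc k))" for k
  proof -
    have "0 < 1 / real (Suc k)" by simp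
    from Stone_Weierstrass_real_polynomial_function[OF compact_Icc assms this]
    show ?thesis by metis
  qed
  then obtain g where g: "\<And>k. real_polynomial_function (g k) \<and> (\<forall>t\<in>{-1..1}. \<bar>\<phi> t - g k t\<bar> < 1 / real (Suc k))"
    by metis
  show ?thesis
  proof
    show "real_polynomial_function (g k)" for k using g by blast
    show "\<bar>g k t - \<phi> t\<bar> \<le> 1 / real (Suc k)" if "t \<in> {-1..1}" for k t
      using g[of k] that by (metis abs_minus_commute less_imp_le)
  qed
qed

lemma weierstrass_integral:
  fixes g :: "nat \<Rightarrow> real \<Rightarrow> real" and Y :: "'a::euclidean_space \<Rightarrow> complex"
  assumes \<phi>: "continuous_on {-1..1} \<phi>" and g: "\<And>k. real_polynomial_function (g k)"
    and approx: "\<And>k t. t \<in> {-1..1} \<Longrightarrow> \<bar>g k t - \<phi> t\<bar> \<le> 1 / real (Suc k)"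
    and Y: "integrable surface_measure Y" and x: "norm x = 1"
  shows "(\<lambda>k. \<integral>y. of_real (g k (y \<bullet> x)) * Y y \<partial>surface_measure) \<longlonglongrightarrow> (\<integral>y. of_real (\<phi> (y \<bullet> x)) * Y y \<partial>surface_measure)"
proof (rule integral_dominated_convergence[where w="\<lambda>y. norm (of_real (\<bar>\<phi> (y \<bullet> x)\<bar> + 1) * Y y)"])
  have cg: "continuous_on {-1..1} (g k)" for k
    using g[of k] by (intro continuous_on_polymonial_function) (simp add: real_polynomial_function_eq)
  have i: "integrable surface_measure (\<lambda>y. of_real (h (y \<bullet> x)) * Y y)" if h: "continuous_on {-1..1} h" for h
    by (intro integrable_surface_mult Y continuous_intros continuous_on_inner_compose[OF h x])
  show "(\<lambda>y. of_real (\<phi> (y \<bullet> x)) * Y y) \<in> borel_measurable surface_measure"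
    "(\<lambda>y. of_real (g k (y \<bullet> x)) * Y y) \<in> borel_measurable surface_measure" for k
    using i[OF \<phi>] i[OF cg] by auto
  show "integrable surface_measure (\<lambda>y. norm (of_real (\<bar>\<phi> (y \<bullet> x)\<bar> + 1) * Y y))"
    by (intro integrable_norm i[of "\<lambda>t. \<bar>\<phi> t\<bar> + 1"] continuous_intros \<phi>)
  have b: "y \<bullet> x \<in> {-1..1}" if "y \<in> space surface_measure" for y
    using inner_sphere_bounds[OF _ x, of y] that by simp
  show "AE y in surface_measure. (\<lambda>k. of_real (g k (y \<bullet> x)) * Y y) \<longlonglongrightarrow> of_real (\<phi> (y \<bullet> x)) * Y y"
  proof (rule AE_I2)
    fix y :: 'a assume y: "y \<in> space surface_measure"
    have "(\<lambda>k. g k (y \<bullet> x)) \<longlonglongrightarrow> \<phi> (y \<bullet> x)"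
    proof (rule LIM_zero_cancel, rule Lim_null_comparison)
      show "\<forall>\<^sub>F k in sequentially. norm (g k (y \<bullet> x) - \<phi> (y \<bullet> x)) \<le> 1 / real (Suc k)"
        using approx[OF b[OF y]] by (simp del: of_nat_Suc)
      show "(\<lambda>k. 1 / real (Suc k)) \<longlonglongrightarrow> 0"
        using LIMSEQ_inverse_real_of_nat by (simp add: inverse_eq_divide)
    qed
    then show "(\<lambda>k. of_real (g k (y \<bullet> x)) * Y y) \<longlonglongrightarrow> of_real (\<phi> (y \<bullet> x)) * Y y"
      by (intro tendsto_intros)
  qed
  show "AE y in surface_measure. norm (of_real (g k (y \<bullet> x)) * Y y) \<le> norm (of_real (\<bar>\<phi> (y \<bullet> x)\<bar> + 1) * Y y)" for k
  proof (rule AE_I2)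
    fix y :: 'a assume y: "y \<in> space surface_measure"
    have "1 / real (Suc k) \<le> 1" by simp
    then have "\<bar>g k (y \<bullet> x)\<bar> \<le> \<bar>\<phi> (y \<bullet> x)\<bar> + 1"
      using approx[OF b[OF y], of k] by linarith
    then show "norm (of_real (g k (y \<bullet> x)) * Y y) \<le> norm (of_real (\<bar>\<phi> (y \<bullet> x)\<bar> + 1) * Y y)"
      unfolding norm_mult norm_of_real by (intro mult_right_mono) auto
  qed
qed

text \<open>Stated as a cross-multiplied identity so that it is stable under uniform limits of \<open>\<phi>\<close>.\<close>

theorem funk_hecke:
  fixes Y Y' :: "'a::euclidean_space \<Rightarrow> complex"
  assumes N: "2 \<le> DIM('a)" and \<phi>: "continuous_on {-1..1} \<phi>"
    and Y: "Y \<in> harmonic_polynomials n" "Y' \<in> harmonic_polynomials n"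
    and x: "norm x = 1" "norm x' = 1"
  shows "(\<integral>y. of_real (\<phi> (y \<bullet> x)) * Y y \<partial>surface_measure) * Y' x' =
    (\<integral>y. of_real (\<phi> (y \<bullet> x')) * Y' y \<partial>surface_measure) * Y x"
proof -
  have iY: "integrable surface_measure Z" if "Z \<in> harmonic_polynomials n" for Z :: "'a \<Rightarrow> complex"
    using that by (intro integrable_surface_polynomial harmonic_polynomialsD)
  have poly: "(\<integral>y. of_real (g (y \<bullet> x)) * Y y \<partial>surface_measure) * Y' x' =
    (\<integral>y. of_real (g (y \<bullet> x')) * Y' y \<partial>surface_measure) * Y x" if pg: "real_polynomial_function g" for g
  proof -
    obtain a K where g: "g = (\<lambda>t. \<Sum>i\<le>K. a i * t ^ i)"
      using real_polynomial_function_imp_sum[OF pg] by blast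
    have "\<exists>\<kappa>. \<forall>i. \<forall>Y\<in>harmonic_polynomials n. \<forall>x::'a. norm x = 1 \<longrightarrow>
        (\<integral>y. of_real ((y \<bullet> x) ^ i) * Y y \<partial>surface_measure) = \<kappa> i * Y x"
      using funk_hecke_monomial[OF N, of n] by metis
    then obtain \<kappa> where \<kappa>: "\<And>i Y x. Y \<in> harmonic_polynomials n \<Longrightarrow> norm (x :: 'a) = 1 \<Longrightarrow>
        (\<integral>y. of_real ((y \<bullet> x) ^ i) * Y y \<partial>surface_measure) = \<kappa> i * Y x" by blast
    have "(\<integral>y. of_real (g (y \<bullet> x)) * Y y \<partial>surface_measure) = (\<Sum>i\<le>K. of_real (a i) * \<kappa> i) * Y x"
      if Y: "Y \<in> harmonic_polynomials n" and x: "norm x = 1" for Y and x :: 'a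
    proof -
      have "(\<integral>y. of_real (g (y \<bullet> x)) * Y y \<partial>surface_measure) =
          (\<integral>y. (\<Sum>i\<le>K. of_real (a i) * (of_real ((y \<bullet> x) ^ i) * Y y)) \<partial>surface_measure)"
        by (simp add: g sum_distrib_right mult.assoc)
      also have "\<dots> = (\<Sum>i\<le>K. (\<integral>y. of_real (a i) * (of_real ((y \<bullet> x) ^ i) * Y y) \<partial>surface_measure))"
        by (intro Bochner_Integration.integral_sum integrable_mult_right integrable_surface_mult iY Y continuous_intros)
      also have "\<dots> = (\<Sum>i\<le>K. of_real (a i) * (\<kappa> i * Y x))"
        by (simp only: integral_mult_right_zero \<kappa>[OF Y x])
      finally show ?thesis by (simp add: sum_distrib_right mult.assoc)
    qed
    then show ?thesis using Y x by (simp add: mult_ac)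
  qed
  obtain g where g: "\<And>k. real_polynomial_function (g k)"
    "\<And>k t. t \<in> {-1..1} \<Longrightarrow> \<bar>g k t - \<phi> t\<bar> \<le> 1 / real (Suc k)"
    using weierstrass_sequence[OF \<phi>] by blast
  have "(\<lambda>k. (\<integral>y. of_real (g k (y \<bullet> x)) * Y y \<partial>surface_measure) * Y' x') \<longlonglongrightarrow>
      (\<integral>y. of_real (\<phi> (y \<bullet> x)) * Y y \<partial>surface_measure) * Y' x'"
    by (intro tendsto_intros weierstrass_integral[OF \<phi> g] iY Y x)
  moreover have "(\<lambda>k. (\<integral>y. of_real (g k (y \<bullet> x)) * Y y \<partial>surface_measure) * Y' x') \<longlonglongrightarrow>
      (\<integral>y. of_real (\<phi> (y \<bullet> x')) * Y' y \<partial>surface_measure) * Y x"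
    unfolding poly[OF g(1)]
    by (intro tendsto_intros weierstrass_integral[OF \<phi> g] iY Y x)
  ultimately show ?thesis by (rule LIMSEQ_unique)
qed

section \<open>Zonal harmonics\<close>

lemma laplacian_mult:
  fixes f g :: "'a::euclidean_space \<Rightarrow> complex"
  assumes "polynomial_function f" "polynomial_function g"
  shows "laplacian (\<lambda>x. f x * g x) x = f x * laplacian g x + laplacian f x * g x +
    2 * (\<Sum>b\<in>Basis. partial_deriv b f x * partial_deriv b g x)"
  using assms
  by (simp add: laplacian_def partial_deriv_mult partial_deriv_add polynomial_function_partial_deriv
      polynomial_function_complex_mult sum.distrib sum_distrib_left algebra_simps)

lemma partial_deriv_inner_self_power:
  "partial_deriv b (\<lambda>x::'a::euclidean_space. complex_of_real ((x \<bullet> x) ^ k)) =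
     (\<lambda>x. complex_of_real (2 * real k) * (of_real (x \<bullet> b) * of_real ((x \<bullet> x) ^ (k - 1))))"
proof -
  have p: "polynomial_function (\<lambda>x::'a. complex_of_real (x \<bullet> x))" by (intro poly_intros)
  have "partial_deriv b (\<lambda>x::'a. complex_of_real (x \<bullet> x)) = (\<lambda>x. 2 * of_real (x \<bullet> b))"
  proof (rule partial_deriv_eqI)
    fix x :: 'a
    have "((\<lambda>t. (x + t *\<^sub>R b) \<bullet> (x + t *\<^sub>R b)) has_real_derivative 2 * (x \<bullet> b)) (at 0)"
      unfolding inner_add_left inner_add_right inner_scaleR_left inner_scaleR_right
      by (auto intro!: derivative_eq_intros simp: inner_commute)
    then have "((\<lambda>t. complex_of_real ((x + t *\<^sub>R b) \<bullet> (x + t *\<^sub>R b))) has_vector_derivative of_real (2 * (x \<bullet> b))) (at 0)"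
      by (rule has_vector_derivative_of_real)
    then show "((\<lambda>t. complex_of_real ((x + t *\<^sub>R b) \<bullet> (x + t *\<^sub>R b))) has_vector_derivative 2 * of_real (x \<bullet> b)) (at 0)"
      by simp
  qed
  with partial_deriv_power[OF p, of b k] show ?thesis by (simp add: fun_eq_iff)
qed

text \<open>The gradient of (x \<bullet> x) ^ k is radial, so the mixed term of the product rule is
  a multiple of the radial derivative of f, which Euler's identity replaces by m f. The truncated k
  - 1 is harmless because of the factor k.\<close>

lemma laplacian_mult_inner_self_power:
  fixes f :: "'a::euclidean_space \<Rightarrow> complex"
  assumes f: "polynomial_function f" "homogeneous m f"
  shows "laplacian (\<lambda>x. f x * of_real ((x \<bullet> x) ^ k)) x = laplacian f x * of_real ((x \<bullet> x) ^ k) +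
    of_real (2 * real k * (2 * real k + real DIM('a) - 2 + 2 * real m)) * (f x * of_real ((x \<bullet> x) ^ (k - 1)))"
proof -
  let ?g = "\<lambda>k x. complex_of_real ((x \<bullet> x) ^ k) :: complex"
  have g: "polynomial_function (?g k :: 'a \<Rightarrow> complex)" for k by (intro poly_intros)
  have xb: "polynomial_function (\<lambda>x::'a. complex_of_real (x \<bullet> b))" for b by (intro poly_intros)
  have grad: "(\<Sum>b\<in>Basis. partial_deriv b f x * partial_deriv b (?g k) x) = of_real (2 * real k * real m) * (f x * ?g (k - 1) x)"
  proof -
    have "(\<Sum>b\<in>Basis. partial_deriv b f x * partial_deriv b (?g k) x) =
        of_real (2 * real k) * ?g (k - 1) x * (\<Sum>b\<in>Basis. of_real (x \<bullet> b) * partial_deriv b f x)"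
      unfolding partial_deriv_inner_self_power sum_distrib_left
      by (intro sum.cong refl) (simp add: mult_ac)
    also have "\<dots> = of_real (2 * real k) * ?g (k - 1) x * (of_nat m * f x)"
      by (simp only: partial_deriv_euclidean[OF f(1), symmetric] partial_deriv_self[OF f])
    finally show ?thesis by simp
  qed
  have lap: "laplacian (?g k) x = of_real (2 * real k * (2 * real k + real DIM('a) - 2)) * ?g (k - 1) x"
  proof -
    have "partial_deriv b (partial_deriv b (?g k)) x =
        of_real (2 * real k) * (of_real (x \<bullet> b) * (of_real (2 * real (k - 1)) * (of_real (x \<bullet> b) * ?g (k - 2) x)) + of_real (b \<bullet> b) * ?g (k - 1) x)"
      for b
      unfolding partial_deriv_inner_self_power
      by (simp only: partial_deriv_cmult[OF polynomial_function_complex_mult[OF xb g]]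
          partial_deriv_mult[OF xb g] partial_deriv_inner partial_deriv_inner_self_power) (simp, simp add: numeral_2_eq_2)
    then have "laplacian (?g k) x = (\<Sum>b\<in>Basis. of_real (2 * real k) * of_real (2 * real (k - 1)) * ?g (k - 2) x * of_real ((x \<bullet> b) * (x \<bullet> b))
        + of_real (2 * real k) * ?g (k - 1) x)"
      unfolding laplacian_def by (intro sum.cong) (auto simp: algebra_simps)
    also have "\<dots> = of_real (2 * real k) * of_real (2 * real (k - 1)) * ?g (k - 2) x * of_real (\<Sum>b\<in>Basis. (x \<bullet> b) * (x \<bullet> b))
        + of_real (real DIM('a)) * (of_real (2 * real k) * ?g (k - 1) x)"
      by (simp only: sum.distrib sum_distrib_left[symmetric] of_real_sum sum_constant of_real_of_nat_eq
          mult.left_commute[of "of_nat DIM('a)"])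
    also have "(\<Sum>b\<in>Basis. (x \<bullet> b) * (x \<bullet> b)) = x \<bullet> x"
      by (rule euclidean_inner[symmetric])
    also have "of_real (2 * real k) * of_real (2 * real (k - 1)) * ?g (k - 2) x * of_real (x \<bullet> x) =
        of_real (2 * real k) * of_real (2 * (real k - 1)) * ?g (k - 1) x"
    proof (cases "k \<le> 1")
      case True then show ?thesis by (cases k) auto
    next
      case False
      then obtain j where "k = Suc (Suc j)" by (metis One_nat_def Suc_le_eq not_less_eq_eq old.nat.exhaust le0 not_less0 less_Suc0)
      then show ?thesis by simp
    qed
    finally show ?thesis by (simp add: algebra_simps)
  qed
  show ?thesis
    unfolding laplacian_mult[OF f(1) g] grad lap by (simp add: algebra_simps)
qed

text \<open>The coefficients of the zonal harmonic \<open>\<Sum>\<^sub>k c\<^sub>k (x \<bullet> e)\<^sup>n\<^sup>-\<^sup>2\<^sup>k |x|\<^sup>2\<^sup>k\<close> in dimension \<open>N\<close>: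
  the recursion is exactly the vanishing of the Laplacian.\<close>

primrec zonal_coeff :: "nat \<Rightarrow> nat \<Rightarrow> nat \<Rightarrow> real" where
  "zonal_coeff N n 0 = 1"
| "zonal_coeff N n (Suc k) = - zonal_coeff N n k * ((real n - 2 * real k) * (real n - 2 * real k - 1)) /
     (2 * real (Suc k) * (2 * real n - 2 * real (Suc k) + real N - 2))"

lemma zonal_coeff_Suc:
  assumes "k < n div 2" "N > 0"
  shows "zonal_coeff N n k * ((real n - 2 * real k) * (real n - 2 * real k - 1)) =
    - zonal_coeff N n (Suc k) * (2 * real (Suc k) * (2 * real n - 2 * real (Suc k) + real N - 2))"
proof -
  have "2 * Suc k \<le> n" using assms(1) by presburger
  then have "2 * real (Suc k) \<le> real n" by linarith
  then have "2 * real (Suc k) * (2 * real n - 2 * real (Suc k) + real N - 2) \<noteq> 0"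
    using assms by auto
  then show ?thesis by (simp only: zonal_coeff.simps) (simp del: of_nat_Suc)
qed

text \<open>Term k of one sum cancels term k + 1 of the other by the recursion of the coefficients.
  At the ends, the factor k kills the term k = 0, and (n - 2 k) (n - 2 k - 1) vanishes for k = n div
  2. The sequence X is left arbitrary so that the same cancellation serves the Laplace equation and
  the ordinary differential equation.\<close>

lemma zonal_telescope:
  fixes X :: "nat \<Rightarrow> 'b::real_algebra_1"
  assumes "N > 0"
  shows "(\<Sum>k\<le>n div 2. of_real (zonal_coeff N n k * ((real n - 2 * real k) * (real n - 2 * real k - 1))) * X (Suc k)) +
    (\<Sum>k\<le>n div 2. of_real (zonal_coeff N n k * (2 * real k * (2 * real n - 2 * real k + real N - 2))) * X k) = 0"
    (is "(\<Sum>k\<le>?K. ?f k) + (\<Sum>k\<le>?K. ?g k) = 0")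
proof -
  have "(real n - 2 * real ?K) * (real n - 2 * real ?K - 1) = 0"
  proof (cases "even n")
    case True
    then have "real n = 2 * real ?K" by (metis even_two_times_div_two of_nat_mult of_nat_numeral)
    then show ?thesis by simp
  next
    case False
    then have "n = 2 * ?K + 1" by presburger
    then have "real n = 2 * real ?K + 1" by linarith
    then show ?thesis by simp
  qed
  then have K: "?f ?K = 0" by (simp only: mult_zero_right of_real_0 mult_zero_left)
  have g0: "?g 0 = 0" by simp
  have "?f k = - ?g (Suc k)" if "k < ?K" for k
    using zonal_coeff_Suc[OF that assms] by (simp only:) (simp only: of_real_minus minus_mult_left[symmetric] mult_minus_left)
  then have "(\<Sum>k<?K. ?f k) = - (\<Sum>k<?K. ?g (Suc k))"
    by (simp add: sum_negf)
  moreover have "(\<Sum>k\<le>?K. ?f k) = (\<Sum>k<?K. ?f k)"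
    by (simp only: lessThan_Suc_atMost[symmetric] sum.lessThan_Suc K add_0_right)
  moreover have "(\<Sum>k\<le>?K. ?g k) = (\<Sum>k<?K. ?g (Suc k))"
    by (simp only: sum.atMost_shift g0 add_0_left)
  ultimately show ?thesis by simp
qed

text \<open>Only the rule for the Laplacian of B m enters. Two families satisfy it: the powers (x
  \<bullet> e) ^ m, which lead to zonal harmonics, and their superpositions
  \<open>moment f m\<close>, which show that convolution with the zonal kernel produces harmonic
  polynomials.\<close>

lemma zonal_combination_harmonic:
  fixes B :: "nat \<Rightarrow> 'a::euclidean_space \<Rightarrow> complex"
  assumes B: "\<And>m. polynomial_function (B m)" "\<And>m. homogeneous m (B m)"
    and lap: "\<And>m x. laplacian (B m) x = of_real (real m * (real m - 1)) * B (m - 2) x"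
  shows "(\<lambda>x. \<Sum>k\<le>n div 2. of_real (zonal_coeff DIM('a) n k) * (B (n - 2 * k) x * of_real ((x \<bullet> x) ^ k)))
    \<in> harmonic_polynomials n"
proof -
  let ?a = "zonal_coeff DIM('a) n"
  let ?F = "\<lambda>k x. of_real (?a k) * (B (n - 2 * k) x * of_real ((x \<bullet> x) ^ k))"
  have g: "polynomial_function (\<lambda>x::'a. complex_of_real ((x \<bullet> x) ^ k))" for k by (intro poly_intros)
  have G: "polynomial_function (\<lambda>x. B m x * of_real ((x \<bullet> x) ^ k))" for m k
    by (intro polynomial_function_complex_mult B g)
  have F: "polynomial_function (?F k)" for k
    by (intro polynomial_function_complex_mult polynomial_function_const B g)
  have hom: "homogeneous n (?F k)" if "k \<le> n div 2" for k
  proof -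
    have "homogeneous (2 * k) (\<lambda>x::'a. of_real ((x \<bullet> x) ^ k))"
      by (simp add: homogeneous_def power_mult power_mult_distrib power2_eq_square mult_ac)
    from homogeneous_cmult[OF homogeneous_mult[OF B(2)[of "n - 2 * k"] this]] that
    show ?thesis by simp
  qed
  have "laplacian (\<lambda>x. \<Sum>k\<le>n div 2. ?F k x) x = 0" for x
  proof -
    have "laplacian (\<lambda>x. \<Sum>k\<le>n div 2. ?F k x) x = (\<Sum>k\<le>n div 2. laplacian (?F k) x)"
      unfolding laplacian_def
      by (subst sum.swap, subst partial_deriv_sum, rule F, subst partial_deriv_sum)
        (intro polynomial_function_partial_deriv F, simp)
    also have "\<dots> = (\<Sum>k\<le>n div 2. of_real (?a k * ((real n - 2 * real k) * (real n - 2 * real k - 1))) * (B (n - 2 * Suc k) x * of_real ((x \<bullet> x) ^ k))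
       + of_real (?a k * (2 * real k * (2 * real n - 2 * real k + real DIM('a) - 2))) * (B (n - 2 * k) x * of_real ((x \<bullet> x) ^ (k - 1))))"
    proof (intro sum.cong refl)
      fix k assume "k \<in> {..n div 2}"
      then have m: "real (n - 2 * k) = real n - 2 * real k" by (auto simp: of_nat_diff)
      have "laplacian (?F k) x = of_real (?a k) * laplacian (\<lambda>x. B (n - 2 * k) x * of_real ((x \<bullet> x) ^ k)) x"
        unfolding laplacian_def
        by (simp only: partial_deriv_cmult[OF G] partial_deriv_cmult[OF polynomial_function_partial_deriv[OF G]] sum_distrib_left)
      then show "laplacian (?F k) x = of_real (?a k * ((real n - 2 * real k) * (real n - 2 * real k - 1))) * (B (n - 2 * Suc k) x * of_real ((x \<bullet> x) ^ k))
       + of_real (?a k * (2 * real k * (2 * real n - 2 * real k + real DIM('a) - 2))) * (B (n - 2 * k) x * of_real ((x \<bullet> x) ^ (k - 1)))"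
        unfolding laplacian_mult_inner_self_power[OF B] lap m by (simp add: algebra_simps)
    qed
    also have "\<dots> = 0"
      using zonal_telescope[of "DIM('a)" n "\<lambda>k. B (n - 2 * k) x * of_real ((x \<bullet> x) ^ (k - 1))"]
      by (simp add: sum.distrib)
    finally show ?thesis .
  qed
  then show ?thesis
    unfolding harmonic_polynomials_iff
    by (intro conjI polynomial_function_sum F homogeneous_sum hom ext) auto
qed

section \<open>The zonal harmonic as a polynomial in one variable\<close>

definition zonal_poly :: "nat \<Rightarrow> nat \<Rightarrow> real poly" where
  "zonal_poly N n = (\<Sum>k\<le>n div 2. monom (zonal_coeff N n k) (n - 2 * k))"

lemma poly_zonal_poly: "poly (zonal_poly N n) t = (\<Sum>k\<le>n div 2. zonal_coeff N n k * t ^ (n - 2 * k))"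
  by (simp add: zonal_poly_def poly_sum poly_monom)

text \<open>The polynomial is monic of degree n. This is what later permits division by its value at
  1.\<close>

lemma zonal_poly_nonzero: "zonal_poly N n \<noteq> 0"
proof -
  have "coeff (zonal_poly N n) n = (\<Sum>k\<le>n div 2. if k = 0 then zonal_coeff N n 0 else 0)"
    unfolding zonal_poly_def coeff_sum by (intro sum.cong) auto
  also have "\<dots> = 1" by simp
  finally show ?thesis by auto
qed

lemma zonal_poly_minus: "poly (zonal_poly N n) (- t) = (- 1) ^ n * poly (zonal_poly N n) t"
  unfolding poly_zonal_poly sum_distrib_left
proof (intro sum.cong refl)
  fix k assume "k \<in> {..n div 2}"
  then have "even n = even (n - 2 * k)" by auto
  then have "(- 1) ^ n = ((- 1) ^ (n - 2 * k) :: real)" by (simp add: minus_one_power_iff)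
  then show "zonal_coeff N n k * (- t) ^ (n - 2 * k) = (- 1) ^ n * (zonal_coeff N n k * t ^ (n - 2 * k))"
    by (simp add: power_minus[of t])
qed

lemma pderiv_sum: "pderiv (sum f A) = (\<Sum>i\<in>A. pderiv (f i))"
  by (induction A rule: infinite_finite_induct) (auto simp: pderiv_add)

text \<open>Gegenbauer's equation, checked coefficientwise: multiplying t into the first derivative
  and t^2 into the second leaves exactly the two sums of the telescoping identity.\<close>

lemma zonal_poly_ode:
  assumes "N > 0"
  shows "(1 - t\<^sup>2) * poly (pderiv (pderiv (zonal_poly N n))) t - (real N - 1) * t * poly (pderiv (zonal_poly N n)) t
    + real n * (real n + real N - 2) * poly (zonal_poly N n) t = 0"
proof -
  let ?a = "zonal_coeff N n"
  define m where "m k = n - 2 * k" for k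
  have d1: "poly (pderiv (zonal_poly N n)) t = (\<Sum>k\<le>n div 2. ?a k * (real (m k) * t ^ (m k - 1)))"
    by (simp add: zonal_poly_def pderiv_sum pderiv_monom poly_sum poly_monom m_def mult_ac)
  have d2: "poly (pderiv (pderiv (zonal_poly N n))) t = (\<Sum>k\<le>n div 2. ?a k * (real (m k) * (real (m k) - 1) * t ^ (m k - 2)))"
  proof -
    have "poly (pderiv (pderiv (zonal_poly N n))) t = (\<Sum>k\<le>n div 2. of_nat (m k - 1) * (of_nat (m k) * ?a k) * t ^ (m k - 1 - 1))"
      by (simp only: zonal_poly_def pderiv_sum pderiv_monom poly_sum poly_monom m_def[symmetric])
    also have "\<dots> = (\<Sum>k\<le>n div 2. ?a k * (real (m k) * (real (m k) - 1) * t ^ (m k - 2)))"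
    proof (intro sum.cong refl)
      fix k
      show "of_nat (m k - 1) * (of_nat (m k) * ?a k) * t ^ (m k - 1 - 1) = ?a k * (real (m k) * (real (m k) - 1) * t ^ (m k - 2))"
        by (cases "m k") (auto simp: numeral_2_eq_2)
    qed
    finally show ?thesis .
  qed
  have d0: "poly (zonal_poly N n) t = (\<Sum>k\<le>n div 2. ?a k * t ^ m k)"
    by (simp add: poly_zonal_poly m_def)
  have "(1 - t\<^sup>2) * poly (pderiv (pderiv (zonal_poly N n))) t - (real N - 1) * t * poly (pderiv (zonal_poly N n)) t
      + real n * (real n + real N - 2) * poly (zonal_poly N n) t =
    (\<Sum>k\<le>n div 2. of_real (?a k * ((real n - 2 * real k) * (real n - 2 * real k - 1))) * t ^ m (Suc k)) +
    (\<Sum>k\<le>n div 2. of_real (?a k * (2 * real k * (2 * real n - 2 * real k + real N - 2))) * t ^ m k)"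
    unfolding d0 d1 d2 sum_distrib_left sum_subtractf[symmetric] sum.distrib[symmetric]
  proof (intro sum.cong refl)
    fix k assume "k \<in> {..n div 2}"
    then have mr: "real n = real (m k) + 2 * real k" by (auto simp: of_nat_diff m_def)
    have t1: "t * (real (m k) * t ^ (m k - 1)) = real (m k) * t ^ m k"
      by (cases "m k") auto
    have t2: "t\<^sup>2 * (real (m k) * (real (m k) - 1) * t ^ (m k - 2)) = real (m k) * (real (m k) - 1) * t ^ m k"
    proof (cases "m k \<le> 1")
      case True then show ?thesis by (cases "m k") auto
    next
      case False
      then obtain j where "m k = 2 + j" using le_Suc_ex[of 2 "m k"] by auto
      then show ?thesis by (simp add: power2_eq_square)
    qed
    have ms: "m (Suc k) = m k - 2" by (simp add: m_def)
    have "(1 - t\<^sup>2) * (?a k * (real (m k) * (real (m k) - 1) * t ^ (m k - 2))) - (real N - 1) * t * (?a k * (real (m k) * t ^ (m k - 1)))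
        + real n * (real n + real N - 2) * (?a k * t ^ m k) =
      ?a k * (real (m k) * (real (m k) - 1) * t ^ (m k - 2) - t\<^sup>2 * (real (m k) * (real (m k) - 1) * t ^ (m k - 2))
        - (real N - 1) * (t * (real (m k) * t ^ (m k - 1))) + real n * (real n + real N - 2) * t ^ m k)"
      by (simp add: algebra_simps)
    also have "\<dots> = of_real (?a k * ((real n - 2 * real k) * (real n - 2 * real k - 1))) * t ^ m (Suc k)
         + of_real (?a k * (2 * real k * (2 * real n - 2 * real k + real N - 2))) * t ^ m k"
      unfolding t1 t2 ms mr by (simp add: algebra_simps)
    finally show "(1 - t\<^sup>2) * (?a k * (real (m k) * (real (m k) - 1) * t ^ (m k - 2))) - (real N - 1) * t * (?a k * (real (m k) * t ^ (m k - 1)))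
        + real n * (real n + real N - 2) * (?a k * t ^ m k) =
        of_real (?a k * ((real n - 2 * real k) * (real n - 2 * real k - 1))) * t ^ m (Suc k)
         + of_real (?a k * (2 * real k * (2 * real n - 2 * real k + real N - 2))) * t ^ m k" .
  qed
  also have "\<dots> = 0"
    by (rule zonal_telescope[OF assms])
  finally show ?thesis .
qed

section \<open>Energy estimates for the zonal differential equation\<close>

text \<open>A crude form of Jordan's inequality from x - x^3 / 6 \<le> sin x and x \<le> 2. It is
  the source of the factors 3, 6 and 12 in the constants below.\<close>

lemma sin_ge_third:
  fixes x :: real
  assumes "0 \<le> x" "x \<le> pi / 2"
  shows "x / 3 \<le> sin x"
proof -
  have "\<bar>sin x - (\<Sum>m<3. sin_coeff m * x ^ m)\<bar> \<le> inverse (fact 3) * \<bar>x\<bar> ^ 3"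
    by (rule Maclaurin_sin_bound)
  moreover have S: "(\<Sum>m<3. sin_coeff m * x ^ m) = x"
    by (simp add: numeral_3_eq_3 sin_coeff_def)
  ultimately have "\<bar>sin x - x\<bar> \<le> x ^ 3 / 6"
    using assms by (simp only: S) (simp add: fact_numeral)
  then have "x - x ^ 3 / 6 \<le> sin x"
    using abs_ge_minus_self[of "sin x - x"] by linarith
  moreover have "x ^ 3 \<le> 4 * x"
  proof -
    have "x \<le> 2" using assms pi_half_less_two by linarith
    then have "x * x \<le> 2 * 2" using assms by (intro mult_mono) auto
    then have "x * (x * x) \<le> x * 4" using assms by (intro mult_left_mono) auto
    then show ?thesis by (simp add: power3_eq_cube mult_ac)
  qed
  ultimately show ?thesis by simp
qed

text \<open>D is the dimension of the ambient space minus 2, the exponent of the sine weight, and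
  \<omega>^2 is the eigenvalue n (n + D). After t = cos \<theta> the equation reads u'' + D cot
  \<theta> u' + \<omega>^2 u = 0.\<close>

locale zonal_ode =
  fixes D :: nat and \<omega> :: real and p :: "real poly"
  assumes D: "1 \<le> D" and \<omega>: "1 \<le> \<omega>"
    and ode: "\<And>t. (1 - t\<^sup>2) * poly (pderiv (pderiv p)) t - (real D + 1) * t * poly (pderiv p) t + \<omega>\<^sup>2 * poly p t = 0"
begin

definition u :: "real \<Rightarrow> real" where "u \<theta> = poly p (cos \<theta>)"
definition u' :: "real \<Rightarrow> real" where "u' \<theta> = - sin \<theta> * poly (pderiv p) (cos \<theta>)"
definition u'' :: "real \<Rightarrow> real" where
  "u'' \<theta> = (sin \<theta>)\<^sup>2 * poly (pderiv (pderiv p)) (cos \<theta>) - cos \<theta> * poly (pderiv p) (cos \<theta>)"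
definition energy :: "real \<Rightarrow> real" where "energy \<theta> = (u' \<theta>)\<^sup>2 + \<omega>\<^sup>2 * (u \<theta>)\<^sup>2"

lemma DERIV_u [derivative_intros]: "(u has_real_derivative u' \<theta>) (at \<theta>)"
proof -
  have "(u has_real_derivative poly (pderiv p) (cos \<theta>) * (- sin \<theta>)) (at \<theta>)"
    unfolding u_def[abs_def] by (rule DERIV_chain2[OF poly_DERIV DERIV_cos])
  then show ?thesis by (simp add: u'_def mult.commute)
qed

lemma DERIV_u' [derivative_intros]: "(u' has_real_derivative u'' \<theta>) (at \<theta>)"
proof -
  have "((\<lambda>x. poly (pderiv p) (cos x)) has_real_derivative poly (pderiv (pderiv p)) (cos \<theta>) * (- sin \<theta>)) (at \<theta>)"
    by (rule DERIV_chain2[OF poly_DERIV DERIV_cos])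
  from DERIV_mult[OF DERIV_minus[OF DERIV_sin] this] show ?thesis
    unfolding u'_def[abs_def] u''_def by (rule DERIV_cong) (simp add: power2_eq_square)
qed

text \<open>Multiplied by sin \<theta>, so that the identity holds at the poles as well.\<close>

lemma ode_angle: "sin \<theta> * u'' \<theta> = - real D * cos \<theta> * u' \<theta> - \<omega>\<^sup>2 * sin \<theta> * u \<theta>"
proof -
  have "(sin \<theta>)\<^sup>2 * poly (pderiv (pderiv p)) (cos \<theta>) =
      (real D + 1) * cos \<theta> * poly (pderiv p) (cos \<theta>) - \<omega>\<^sup>2 * poly p (cos \<theta>)"
    using ode[of "cos \<theta>"] by (simp add: sin_squared_eq algebra_simps)
  then have eq: "u'' \<theta> = real D * cos \<theta> * poly (pderiv p) (cos \<theta>) - \<omega>\<^sup>2 * u \<theta>"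
    unfolding u''_def u_def by (simp add: algebra_simps)
  show ?thesis unfolding eq u'_def by (simp add: algebra_simps)
qed

lemma energy_nonneg: "0 \<le> energy \<theta>" by (simp add: energy_def)

text \<open>The loss by friction, -2 D cot \<theta> times the square of u', written with the
  derivative of p so that no singularity appears at \<theta> = 0.\<close>

lemma DERIV_energy:
  "(energy has_real_derivative - 2 * real D * cos \<theta> * sin \<theta> * (poly (pderiv p) (cos \<theta>))\<^sup>2) (at \<theta>)"
proof -
  have "(energy has_real_derivative 2 * u' \<theta> * u'' \<theta> + \<omega>\<^sup>2 * (2 * u \<theta> * u' \<theta>)) (at \<theta>)"
    unfolding energy_def[abs_def] by (auto intro!: derivative_eq_intros)
  then show ?thesis
  proof (rule DERIV_cong)
    have "2 * u' \<theta> * u'' \<theta> + \<omega>\<^sup>2 * (2 * u \<theta> * u' \<theta>) =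
      - 2 * poly (pderiv p) (cos \<theta>) * (sin \<theta> * u'' \<theta> + \<omega>\<^sup>2 * sin \<theta> * u \<theta>)"
    by (simp add: u'_def algebra_simps)
  also have "\<dots> = - 2 * real D * cos \<theta> * sin \<theta> * (poly (pderiv p) (cos \<theta>))\<^sup>2"
      by (simp add: ode_angle u'_def power2_eq_square)
    finally show "2 * u' \<theta> * u'' \<theta> + \<omega>\<^sup>2 * (2 * u \<theta> * u' \<theta>) =
      - 2 * real D * cos \<theta> * sin \<theta> * (poly (pderiv p) (cos \<theta>))\<^sup>2" .
  qed
qed

lemma sin_cos_nonneg:
  assumes "0 \<le> \<theta>" "\<theta> \<le> pi / 2"
  shows "0 \<le> sin \<theta>" "0 \<le> cos \<theta>" "sin \<theta> \<le> 1"
  using assms by (auto intro: sin_ge_zero cos_ge_zero)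

lemma energy_antimono:
  assumes "0 \<le> a" "a \<le> b" "b \<le> pi / 2"
  shows "energy b \<le> energy a"
proof (rule DERIV_nonpos_imp_nonincreasing[OF assms(2)])
  fix x assume "a \<le> x" "x \<le> b"
  then have "0 \<le> sin x" "0 \<le> cos x" using assms sin_cos_nonneg[of x] by auto
  then have "- 2 * real D * cos x * sin x * (poly (pderiv p) (cos x))\<^sup>2 \<le> 0" by simp
  with DERIV_energy show "\<exists>y. (energy has_real_derivative y) (at x) \<and> y \<le> 0" by blast
qed

lemma energy_0: "energy 0 = \<omega>\<^sup>2 * (poly p 1)\<^sup>2"
  by (simp add: energy_def u_def u'_def)

text \<open>At \<theta> = 0 the derivative u' vanishes, so p 1 = 0 would make the energy 0 there
  and, as it decreases, on all of [0, pi/2]. Then p would have infinitely many roots.\<close>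

lemma poly_1_nonzero:
  assumes "p \<noteq> 0"
  shows "poly p 1 \<noteq> 0"
proof
  assume p1: "poly p 1 = 0"
  have "poly p t = 0" if "t \<in> {0..1}" for t
  proof -
    have b: "0 \<le> arccos t" "arccos t \<le> pi / 2" using that arccos_lbound[of t] arccos_le_pi2[of t] by auto
    then have "energy (arccos t) \<le> energy 0" by (intro energy_antimono) auto
    also have "\<dots> = 0" by (simp add: energy_0 p1)
    finally have "energy (arccos t) = 0" using energy_nonneg[of "arccos t"] by simp
    then have "\<omega>\<^sup>2 * (u (arccos t))\<^sup>2 \<le> 0"
      unfolding energy_def by (smt (verit) zero_le_power2)
    then have "u (arccos t) = 0"
      using \<omega> by (simp add: mult_le_0_iff not_le[symmetric])
    then show ?thesis using that by (simp add: u_def)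
  qed
  then have "{0..1} \<subseteq> {t. poly p t = 0}" by auto
  then have "finite {0..1::real}" using poly_roots_finite[OF assms] finite_subset by blast
  then show False using infinite_Icc[of 0 "1::real"] by simp
qed

end

locale normalized_zonal_ode = zonal_ode +
  assumes p1: "poly p 1 = 1"
begin

lemma u_0: "u 0 = 1" by (simp add: u_def p1)

lemma energy_le:
  assumes "0 \<le> \<theta>" "\<theta> \<le> pi / 2"
  shows "energy \<theta> \<le> \<omega>\<^sup>2"
  using energy_antimono[of 0 \<theta>] assms by (simp add: energy_0 p1)

lemma abs_u_le_1:
  assumes "0 \<le> \<theta>" "\<theta> \<le> pi / 2"
  shows "\<bar>u \<theta>\<bar> \<le> 1"
proof -
  have "\<omega>\<^sup>2 * (u \<theta>)\<^sup>2 \<le> \<omega>\<^sup>2 * 1"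
    using energy_le[OF assms] unfolding energy_def by (smt (verit) zero_le_power2)
  then have "(u \<theta>)\<^sup>2 \<le> 1" using \<omega> by (subst (asm) mult_le_cancel_left_pos) auto
  then show ?thesis by (simp add: abs_square_le_1)
qed

lemma abs_u'_le:
  assumes "0 \<le> \<theta>" "\<theta> \<le> pi / 2"
  shows "\<bar>u' \<theta>\<bar> \<le> \<omega>"
proof -
  have "(u' \<theta>)\<^sup>2 \<le> \<omega>\<^sup>2"
    using energy_le[OF assms] unfolding energy_def by (smt (verit) mult_nonneg_nonneg zero_le_power2)
  then show ?thesis using \<omega> by (metis abs_le_square_iff abs_of_nonneg order_trans zero_le_one)
qed

text \<open>The energy bound gives \<bar>u'\<bar> \<le> \<omega>. In particular u \<ge> 1/2 up to
  the angle 1 / (2 \<omega>), which fixes the size of the caps.\<close>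

lemma u_ge:
  assumes "0 \<le> \<theta>" "\<theta> \<le> pi / 2"
  shows "1 - \<omega> * \<theta> \<le> u \<theta>"
proof -
  have "u 0 + \<omega> * 0 \<le> u \<theta> + \<omega> * \<theta>"
  proof (rule DERIV_nonneg_imp_nondecreasing[where f="\<lambda>x. u x + \<omega> * x"])
    fix x assume "0 \<le> x" "x \<le> \<theta>"
    then have "0 \<le> u' x + \<omega>" using abs_u'_le[of x] assms by (simp add: abs_le_iff)
    moreover have "((\<lambda>x. u x + \<omega> * x) has_real_derivative u' x + \<omega>) (at x)"
      by (auto intro!: derivative_eq_intros)
    ultimately show "\<exists>y. ((\<lambda>x. u x + \<omega> * x) has_real_derivative y) (at x) \<and> 0 \<le> y" by blast
  qed (use assms in auto)
  then show ?thesis by (simp add: u_0)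
qed

text \<open>Friction cannot destroy more than the full kinetic term: the derivative of this product
  retains just the potential part, which is nonnegative. The bound is lossy by powers of sin b / sin
  a and is used only between angles comparable to 1 / \<omega>.\<close>

lemma sin_power_energy_mono:
  assumes "0 \<le> a" "a \<le> b" "b \<le> pi / 2"
  shows "sin a ^ (2 * D) * energy a \<le> sin b ^ (2 * D) * energy b"
proof (rule DERIV_nonneg_imp_nondecreasing[OF assms(2)])
  fix x assume "a \<le> x" "x \<le> b"
  then have sc: "0 \<le> sin x" "0 \<le> cos x" using assms sin_cos_nonneg[of x] by auto
  have "((\<lambda>x. sin x ^ (2 * D) * energy x) has_real_derivative
      real (2 * D) * sin x ^ (2 * D - 1) * cos x * energy x + sin x ^ (2 * D) * (- 2 * real D * cos x * sin x * (poly (pderiv p) (cos x))\<^sup>2)) (at x)"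
    by (auto intro!: derivative_eq_intros DERIV_energy)
  moreover have "real (2 * D) * sin x ^ (2 * D - 1) * cos x * energy x + sin x ^ (2 * D) * (- 2 * real D * cos x * sin x * (poly (pderiv p) (cos x))\<^sup>2)
      = 2 * real D * sin x ^ (2 * D - 1) * cos x * (\<omega>\<^sup>2 * (u x)\<^sup>2)"
  proof -
    have "sin x ^ (2 * D) = sin x ^ (2 * D - 1) * sin x" using D by (simp add: power_eq_if)
    then show ?thesis
      by (simp add: energy_def u'_def power2_eq_square algebra_simps)
  qed
  moreover have "0 \<le> 2 * real D * sin x ^ (2 * D - 1) * cos x * (\<omega>\<^sup>2 * (u x)\<^sup>2)" using sc by simp
  ultimately show "\<exists>y. ((\<lambda>x. sin x ^ (2 * D) * energy x) has_real_derivative y) (at x) \<and> 0 \<le> y"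
    by metis
qed

lemma abs_u_u'_le: "\<bar>u \<theta> * u' \<theta>\<bar> \<le> energy \<theta> / (2 * \<omega>)"
proof -
  have "0 \<le> (\<omega> * \<bar>u \<theta>\<bar> - \<bar>u' \<theta>\<bar>)\<^sup>2" by simp
  then have "2 * \<omega> * \<bar>u \<theta> * u' \<theta>\<bar> \<le> energy \<theta>"
    by (simp add: power2_eq_square algebra_simps energy_def abs_mult)
  then show ?thesis using \<omega> by (simp add: field_simps)
qed

text \<open>The correction term makes the derivative of \<open>H\<close> smaller than \<open>H\<close> by a factor
  \<open>1 / (\<omega> \<theta>\<^sup>2)\<close>, which is integrable on \<open>\<theta> \<ge> const / \<omega>\<close>: \<open>H\<close> is an adiabatic invariant.\<close>

definition H :: "real \<Rightarrow> real" where
  "H \<theta> = sin \<theta> ^ D * energy \<theta> + real D * (sin \<theta> ^ (D - 1) * cos \<theta>) * (u \<theta> * u' \<theta>)"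

text \<open>The derivative of sin^D times the energy contains \<omega>^2 u^2 - u'^2, which has no
  sign but, up to friction, is minus the derivative of u u'. The correction term in H cancels it,
  and the remaining multiples of u u' combine through cos^2 + sin^2 = 1.\<close>

lemma DERIV_H:
  assumes s: "sin \<theta> \<noteq> 0"
  shows "(H has_real_derivative - real D * (sin \<theta> ^ D / (sin \<theta>)\<^sup>2) * (u \<theta> * u' \<theta>)) (at \<theta>)"
proof -
  \<comment> \<open>This is sin \<theta> to the power D - 2, written as a quotient because D may be
    1.\<close>
  define S where "S = sin \<theta> ^ D / (sin \<theta>)\<^sup>2"
  have SD: "sin \<theta> ^ D = S * (sin \<theta>)\<^sup>2" using s by (simp add: S_def)
  have SD1: "sin \<theta> ^ (D - 1) = S * sin \<theta>" using s D by (simp add: S_def power2_eq_square power_diff)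
  have SD2: "real (D - 1) * sin \<theta> ^ (D - 1 - 1) = (real D - 1) * S"
  proof (cases "D = 1")
    case False
    then have "D \<ge> 2" using D by simp
    then have "S = sin \<theta> ^ (D - 2)" using s by (simp add: S_def power_diff)
    then show ?thesis using \<open>D \<ge> 2\<close> by (simp add: of_nat_diff numeral_2_eq_2)
  qed simp
  let ?c = "cos \<theta>" and ?s = "sin \<theta>"
  have e: "(energy has_real_derivative - 2 * real D * ?c * (u' \<theta>)\<^sup>2 / ?s) (at \<theta>)"
    by (rule DERIV_cong[OF DERIV_energy]) (use s in \<open>simp add: u'_def power2_eq_square\<close>)
  have "(H has_real_derivative
      (real D * sin \<theta> ^ (D - 1) * ?c * energy \<theta> + sin \<theta> ^ D * (- 2 * real D * ?c * (u' \<theta>)\<^sup>2 / ?s))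
      + (real D * ((real (D - 1) * sin \<theta> ^ (D - 1 - 1)) * ?c * ?c + sin \<theta> ^ (D - 1) * (- ?s)) * (u \<theta> * u' \<theta>)
        + real D * (sin \<theta> ^ (D - 1) * ?c) * (u' \<theta> * u' \<theta> + u \<theta> * u'' \<theta>))) (at \<theta>)"
    unfolding H_def[abs_def]
    by (rule derivative_eq_intros e refl | simp)+ (simp add: algebra_simps)
  also have "(real D * sin \<theta> ^ (D - 1) * ?c * energy \<theta> + sin \<theta> ^ D * (- 2 * real D * ?c * (u' \<theta>)\<^sup>2 / ?s))
      + (real D * ((real (D - 1) * sin \<theta> ^ (D - 1 - 1)) * ?c * ?c + sin \<theta> ^ (D - 1) * (- ?s)) * (u \<theta> * u' \<theta>)
        + real D * (sin \<theta> ^ (D - 1) * ?c) * (u' \<theta> * u' \<theta> + u \<theta> * u'' \<theta>)) =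
      real D * S * (?s * ?c * energy \<theta> - 2 * ?s * ?c * (u' \<theta>)\<^sup>2 + ((real D - 1) * (?c * ?c) - ?s\<^sup>2) * (u \<theta> * u' \<theta>)
        + ?c * (?s * (u' \<theta>)\<^sup>2 + u \<theta> * (?s * u'' \<theta>)))"
    unfolding SD2 SD1 SD using s by (simp add: power2_eq_square algebra_simps del: sin_cos_squared_add3)
  also have "\<dots> = real D * S * ((- (?c * ?c) - ?s\<^sup>2) * (u \<theta> * u' \<theta>))"
    unfolding ode_angle energy_def by algebra
  also have "- (?c * ?c) - ?s\<^sup>2 = - 1"
    using sin_cos_squared_add[of \<theta>] by (simp add: power2_eq_square)
  finally show ?thesis by (simp add: S_def)
qed

text \<open>Chosen so that \<omega> sin \<theta> \<ge> A / 3 = D for \<theta> \<ge> A / \<omega>;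
  the correction term in H is then at most half of the main term. Angles below A / \<omega> are
  handled by the elementary bounds near the pole.\<close>

definition A :: real where "A = 3 * real D"

lemma A_ge: "3 \<le> A" using D by (simp add: A_def)

lemma H_bounds:
  assumes \<theta>: "A / \<omega> \<le> \<theta>" "\<theta> \<le> pi / 2"
  shows "sin \<theta> ^ D * energy \<theta> / 2 \<le> H \<theta>" "H \<theta> \<le> 3 / 2 * (sin \<theta> ^ D * energy \<theta>)"
    "\<bar>real D * (sin \<theta> ^ D / (sin \<theta>)\<^sup>2) * (u \<theta> * u' \<theta>)\<bar> \<le> 9 * real D / (\<omega> * \<theta>\<^sup>2) * H \<theta>"
proof -
  have \<theta>0: "\<theta> > 0" using \<theta>(1) A_ge \<omega> by (smt (verit) divide_pos_pos)
  have \<omega>\<theta>: "A \<le> \<omega> * \<theta>" using \<theta>(1) \<omega> by (simp add: field_simps)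
  have s3: "\<theta> / 3 \<le> sin \<theta>" using \<theta>0 \<theta> by (intro sin_ge_third) auto
  then have s: "sin \<theta> > 0" using \<theta>0 by simp
  have c: "0 \<le> cos \<theta>" "cos \<theta> \<le> 1" using \<theta>0 \<theta> sin_cos_nonneg[of \<theta>] by auto
  let ?G = "sin \<theta> ^ D * energy \<theta>"
  have G0: "0 \<le> ?G" using s energy_nonneg by simp
  have "\<bar>real D * (sin \<theta> ^ (D - 1) * cos \<theta>) * (u \<theta> * u' \<theta>)\<bar> = real D * (sin \<theta> ^ (D - 1) * cos \<theta>) * \<bar>u \<theta> * u' \<theta>\<bar>"
    using s c by (simp add: abs_mult)
  also have "\<dots> \<le> real D * (sin \<theta> ^ (D - 1) * 1) * (energy \<theta> / (2 * \<omega>))"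
    using s c by (intro mult_mono abs_u_u'_le) auto
  also have "\<dots> = real D / (2 * \<omega> * sin \<theta>) * ?G"
    using D s by (simp add: power_eq_if)
  also have "\<dots> \<le> 1 / 2 * ?G"
  proof (rule mult_right_mono[OF _ G0])
    have "A / 3 \<le> \<omega> * sin \<theta>"
    proof -
      have "\<omega> * (\<theta> / 3) \<le> \<omega> * sin \<theta>" using s3 \<omega> by (intro mult_left_mono) auto
      moreover have "\<omega> * (\<theta> / 3) = \<omega> * \<theta> / 3" by simp
      ultimately show ?thesis using \<omega>\<theta> by linarith
    qed
    then show "real D / (2 * \<omega> * sin \<theta>) \<le> 1 / 2"
      using s \<omega> by (simp add: A_def field_simps)
  qed
  finally have "\<bar>real D * (sin \<theta> ^ (D - 1) * cos \<theta>) * (u \<theta> * u' \<theta>)\<bar> \<le> 1 / 2 * ?G" .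
  then show HG: "?G / 2 \<le> H \<theta>" and "H \<theta> \<le> 3 / 2 * ?G"
    using abs_ge_self[of "real D * (sin \<theta> ^ (D - 1) * cos \<theta>) * (u \<theta> * u' \<theta>)"]
      abs_ge_minus_self[of "real D * (sin \<theta> ^ (D - 1) * cos \<theta>) * (u \<theta> * u' \<theta>)"]
    unfolding H_def by linarith+
  have "\<bar>real D * (sin \<theta> ^ D / (sin \<theta>)\<^sup>2) * (u \<theta> * u' \<theta>)\<bar> = real D * (sin \<theta> ^ D / (sin \<theta>)\<^sup>2) * \<bar>u \<theta> * u' \<theta>\<bar>"
    using s by (simp add: abs_mult)
  also have "\<dots> \<le> real D * (sin \<theta> ^ D / (\<theta> / 3)\<^sup>2) * (energy \<theta> / (2 * \<omega>))"
    using s s3 \<theta>0 by (intro mult_mono abs_u_u'_le divide_left_mono power_mono) auto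
  also have "\<dots> = 9 * real D / (\<omega> * \<theta>\<^sup>2) * (?G / 2)"
    by (simp add: power_divide mult_ac)
  also have "\<dots> \<le> 9 * real D / (\<omega> * \<theta>\<^sup>2) * H \<theta>"
    using HG \<omega> by (intro mult_left_mono) auto
  finally show "\<bar>real D * (sin \<theta> ^ D / (sin \<theta>)\<^sup>2) * (u \<theta> * u' \<theta>)\<bar> \<le> 9 * real D / (\<omega> * \<theta>\<^sup>2) * H \<theta>" .
qed

text \<open>Gronwall's argument: \<bar>H'\<bar> \<le> (B / \<theta>^2) H with B = 9 D / \<omega>, so
  H exp (- B / \<theta>) increases and H exp (B / \<theta>) decreases. At the left end B / \<theta>
  is exactly 3, hence H changes at most by the factor exp 3, whatever \<omega> is.\<close>

lemma H_comparison:
  assumes \<theta>: "A / \<omega> \<le> \<theta>" "\<theta> \<le> pi / 2"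
  shows "exp (- 3) * H (A / \<omega>) \<le> H \<theta>" "H \<theta> \<le> exp 3 * H (A / \<omega>)"
proof -
  define B where "B = 9 * real D / \<omega>"
  have B0: "0 \<le> B" using \<omega> by (simp add: B_def)
  have A0: "0 < A / \<omega>" using A_ge \<omega> by simp
  have sinpos: "0 < sin x" if "A / \<omega> \<le> x" "x \<le> \<theta>" for x
    using that A0 \<theta> by (intro sin_gt_zero) (use pi_gt_zero in linarith)+
  have BA: "B / (A / \<omega>) = 3" using D \<omega> by (simp add: B_def A_def)
  have H0: "0 \<le> H x" if "A / \<omega> \<le> x" "x \<le> \<theta>" for x
    using H_bounds(1)[of x] that \<theta> sinpos[OF that] energy_nonneg[of x]
    by (smt (verit) divide_nonneg_nonneg mult_nonneg_nonneg zero_le_power)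
  have dexp: "((\<lambda>x. exp (k / x)) has_real_derivative exp (k / x) * (- k / x\<^sup>2)) (at x)" if "x > 0" for k x :: real
    using that by (auto intro!: derivative_eq_intros simp: power2_eq_square)
  have pm: "0 \<le> a + b" "0 \<le> - a + b" if "\<bar>a\<bar> \<le> b" for a b :: real
    using that by auto
  have hB: "\<bar>- real D * (sin x ^ D / (sin x)\<^sup>2) * (u x * u' x)\<bar> \<le> B / x\<^sup>2 * H x" if "A / \<omega> \<le> x" "x \<le> \<theta>" for x
  proof -
    have "9 * real D / (\<omega> * x\<^sup>2) = B / x\<^sup>2" by (simp add: B_def)
    then show ?thesis using H_bounds(3)[of x] that \<theta>
      by (simp only: minus_mult_left[symmetric] abs_minus_cancel)
  qed
  have "H (A / \<omega>) * exp (- B / (A / \<omega>)) \<le> H \<theta> * exp (- B / \<theta>)"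
  proof (rule DERIV_nonneg_imp_nondecreasing[OF \<theta>(1)])
    fix x assume x: "A / \<omega> \<le> x" "x \<le> \<theta>"
    let ?h = "- real D * (sin x ^ D / (sin x)\<^sup>2) * (u x * u' x)"
    have "((\<lambda>x. H x * exp (- B / x)) has_real_derivative ?h * exp (- B / x) + exp (- B / x) * (- (- B) / x\<^sup>2) * H x) (at x)"
      using sinpos[OF x] x A0 by (intro DERIV_mult DERIV_H dexp) auto
    moreover have "0 \<le> ?h + B / x\<^sup>2 * H x"
      by (rule pm[OF hB[OF x]])
    then have "0 \<le> exp (- B / x) * (?h + B / x\<^sup>2 * H x)" by simp
    then have "0 \<le> ?h * exp (- B / x) + exp (- B / x) * (- (- B) / x\<^sup>2) * H x" by (simp add: algebra_simps)
    ultimately show "\<exists>y. ((\<lambda>x. H x * exp (- B / x)) has_real_derivative y) (at x) \<and> 0 \<le> y" by blast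
  qed
  also have "\<dots> \<le> H \<theta> * 1"
    using H0[OF \<theta>(1) order_refl] B0 A0 \<theta> by (intro mult_left_mono) auto
  finally show "exp (- 3) * H (A / \<omega>) \<le> H \<theta>" using BA by (simp add: mult.commute)
  have "H \<theta> * 1 \<le> H \<theta> * exp (B / \<theta>)"
    using H0[OF \<theta>(1) order_refl] B0 A0 \<theta> by (intro mult_left_mono) auto
  also have "\<dots> \<le> H (A / \<omega>) * exp (B / (A / \<omega>))"
  proof (rule DERIV_nonpos_imp_nonincreasing[OF \<theta>(1)])
    fix x assume x: "A / \<omega> \<le> x" "x \<le> \<theta>"
    let ?h = "- real D * (sin x ^ D / (sin x)\<^sup>2) * (u x * u' x)"
    have "((\<lambda>x. H x * exp (B / x)) has_real_derivative ?h * exp (B / x) + exp (B / x) * (- B / x\<^sup>2) * H x) (at x)"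
      using sinpos[OF x] x A0 by (intro DERIV_mult DERIV_H dexp) auto
    moreover have "0 \<le> - ?h + B / x\<^sup>2 * H x"
      by (rule pm[OF hB[OF x]])
    then have "0 \<le> exp (B / x) * (- ?h + B / x\<^sup>2 * H x)" by simp
    then have "?h * exp (B / x) + exp (B / x) * (- B / x\<^sup>2) * H x \<le> 0" by (simp add: algebra_simps)
    ultimately show "\<exists>y. ((\<lambda>x. H x * exp (B / x)) has_real_derivative y) (at x) \<and> y \<le> 0" by blast
  qed
  finally show "H \<theta> \<le> exp 3 * H (A / \<omega>)" using BA by (simp add: mult.commute)
qed

section \<open>Two-sided bounds for the scaled energy\<close>

definition c1 :: real where "c1 = exp (- 3) / (12 * 36 ^ D * A ^ D)"
definition c2 :: real where "c2 = 3 * exp 3 * A ^ D"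

lemma c1_pos: "0 < c1" using A_ge by (simp add: c1_def)
lemma c2_pos: "0 < c2" using A_ge by (simp add: c2_def)

text \<open>Up to A / \<omega> the bounds \<omega> sin \<theta> \<le> A and energy \<le> \<omega>^2
  suffice. Beyond, the bound at A / \<omega> is transported by H; passing from the energy to H and
  back costs the factor 2 * (3/2) = 3 in \<open>c2\<close>.\<close>

lemma scaled_energy_upper:
  assumes \<theta>: "0 \<le> \<theta>" "\<theta> \<le> pi / 2"
  shows "(\<omega> * sin \<theta>) ^ D * energy \<theta> \<le> c2 * \<omega>\<^sup>2"
proof -
  have small: "(\<omega> * sin x) ^ D * energy x \<le> A ^ D * \<omega>\<^sup>2" if "0 \<le> x" "x \<le> A / \<omega>" "x \<le> pi / 2" for x
  proof -
    have "\<omega> * sin x \<le> A"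
      using order_trans[OF sin_x_le_x[of x] that(2)] that \<omega> by (simp add: field_simps)
    then show ?thesis
      using that \<omega> energy_le[of x] energy_nonneg sin_cos_nonneg[of x] A_ge
      by (intro mult_mono power_mono) auto
  qed
  have e3: "(1::real) \<le> exp 3" by simp
  show ?thesis
  proof (cases "\<theta> \<le> A / \<omega>")
    case True
    have "A ^ D * \<omega>\<^sup>2 \<le> c2 * \<omega>\<^sup>2"
    proof (rule mult_right_mono)
      have "1 * A ^ D \<le> (3 * exp 3) * A ^ D"
        using e3 A_ge by (intro mult_right_mono) (linarith, simp)
      then show "A ^ D \<le> c2" by (simp add: c2_def)
    qed simp
    then show ?thesis using small[OF \<theta>(1) True \<theta>(2)] by linarith
  next
    case False
    then have F: "A / \<omega> \<le> \<theta>" by simp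
    have A0: "0 \<le> A / \<omega>" using A_ge \<omega> by simp
    have "sin \<theta> ^ D * energy \<theta> \<le> 2 * H \<theta>" using H_bounds(1)[OF F \<theta>(2)] by simp
    also have "\<dots> \<le> 2 * (exp 3 * H (A / \<omega>))" using H_comparison(2)[OF F \<theta>(2)] by simp
    also have "\<dots> \<le> 2 * (exp 3 * (3 / 2 * (sin (A / \<omega>) ^ D * energy (A / \<omega>))))"
      using H_bounds(2)[OF order_refl order_trans[OF F \<theta>(2)]] by (intro mult_left_mono) auto
    finally have "\<omega> ^ D * (sin \<theta> ^ D * energy \<theta>) \<le> \<omega> ^ D * (2 * (exp 3 * (3 / 2 * (sin (A / \<omega>) ^ D * energy (A / \<omega>)))))"
      using \<omega> by (intro mult_left_mono) auto
    also have "\<dots> = 3 * exp 3 * ((\<omega> * sin (A / \<omega>)) ^ D * energy (A / \<omega>))"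
      by (simp add: power_mult_distrib)
    also have "\<dots> \<le> 3 * exp 3 * (A ^ D * \<omega>\<^sup>2)"
      using small[OF A0 order_refl order_trans[OF F \<theta>(2)]] by (intro mult_left_mono) auto
    finally show ?thesis by (simp add: c2_def power_mult_distrib mult_ac)
  qed
qed

text \<open>The energy is large near the pole because u is near 1 there.
  \<open>sin_power_energy_mono\<close> carries this to A / \<omega> at the cost of powers of 36 and
  A, and H carries it on to \<theta> with the factor exp (-3) / 3.\<close>

lemma scaled_energy_lower:
  assumes \<theta>: "A / \<omega> \<le> \<theta>" "\<theta> \<le> pi / 2"
  shows "c1 * \<omega>\<^sup>2 \<le> (\<omega> * sin \<theta>) ^ D * energy \<theta>"
proof -
  define a where "a = A / \<omega>"
  \<comment> \<open>At this angle u is still at least 1/2, so the potential energy alone is at least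
    \<omega>^2 / 4.\<close>
  define b where "b = 1 / (2 * \<omega>)"
  have a0: "0 < a" using A_ge \<omega> by (simp add: a_def)
  have b0: "0 < b" "b \<le> a" using A_ge \<omega> by (auto simp: a_def b_def field_simps)
  have a2: "a \<le> pi / 2" using order_trans[OF \<theta>] by (simp add: a_def)
  have sa: "0 < sin a" using a0 a2 pi_gt_zero by (intro sin_gt_zero) linarith+
  have ub: "1 / 2 \<le> u b"
    using u_ge[of b] b0 a2 \<omega> by (simp add: b_def)
  have "\<omega>\<^sup>2 * (1 / 4) \<le> \<omega>\<^sup>2 * (u b)\<^sup>2"
    using power_mono[OF ub, of 2] by (intro mult_left_mono) (auto simp: power2_eq_square)
  then have Eb: "\<omega>\<^sup>2 / 4 \<le> energy b"
    using zero_le_power2[of "u' b"] unfolding energy_def by linarith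
  have sb: "1 / (6 * \<omega>) \<le> sin b" using sin_ge_third[of b] b0 a2 by (simp add: b_def)
  have "(1 / (6 * \<omega>)) ^ (2 * D) * (\<omega>\<^sup>2 / 4) \<le> sin b ^ (2 * D) * energy b"
    using \<omega> sb Eb by (intro mult_mono power_mono) auto
  also have "\<dots> \<le> sin a ^ (2 * D) * energy a"
    using b0 a2 by (intro sin_power_energy_mono) auto
  also have "\<dots> = sin a ^ D * (sin a ^ D * energy a)"
    by (simp add: mult_2 power_add)
  also have "\<dots> \<le> (A / \<omega>) ^ D * (sin a ^ D * energy a)"
    using sa sin_x_le_x[of a] a0 energy_nonneg by (intro mult_right_mono power_mono) (auto simp: a_def)
  finally have "(1 / (6 * \<omega>)) ^ (2 * D) * (\<omega>\<^sup>2 / 4) \<le> (A / \<omega>) ^ D * (sin a ^ D * energy a)" .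
  then have "\<omega> ^ D * (\<omega> ^ D / A ^ D * ((1 / (6 * \<omega>)) ^ (2 * D) * (\<omega>\<^sup>2 / 4))) \<le>
      \<omega> ^ D * (\<omega> ^ D / A ^ D * ((A / \<omega>) ^ D * (sin a ^ D * energy a)))"
    using \<omega> A_ge by (intro mult_left_mono) auto
  moreover have "\<omega> ^ D * (\<omega> ^ D / A ^ D * ((1 / (6 * \<omega>)) ^ (2 * D) * (\<omega>\<^sup>2 / 4))) = \<omega>\<^sup>2 / (4 * 36 ^ D * A ^ D)"
  proof -
    have "(1 / (6 * \<omega>)) ^ (2 * D) = 1 / (36 ^ D * \<omega> ^ D * \<omega> ^ D)"
      by (simp add: power_mult power_mult_distrib power_divide power2_eq_square)
    then show ?thesis using \<omega> by simp
  qed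
  moreover have "\<omega> ^ D * (\<omega> ^ D / A ^ D * ((A / \<omega>) ^ D * (sin a ^ D * energy a))) = \<omega> ^ D * (sin a ^ D * energy a)"
    using \<omega> A_ge by (simp add: power_divide)
  ultimately have base: "\<omega>\<^sup>2 / (4 * 36 ^ D * A ^ D) \<le> \<omega> ^ D * (sin a ^ D * energy a)" by simp
  have s\<theta>: "0 \<le> sin \<theta>" using a0 \<theta> sin_cos_nonneg[of \<theta>] by (simp add: a_def)
  have "exp (- 3) * (sin a ^ D * energy a / 2) \<le> exp (- 3) * H a"
    using H_bounds(1)[of a] a2 by (simp add: a_def)
  also have "\<dots> \<le> H \<theta>" using H_comparison(1)[OF \<theta>] by (simp add: a_def)
  also have "\<dots> \<le> 3 / 2 * (sin \<theta> ^ D * energy \<theta>)" by (rule H_bounds(2)[OF \<theta>])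
  finally have "exp (- 3) / 3 * (sin a ^ D * energy a) \<le> sin \<theta> ^ D * energy \<theta>" by simp
  then have "\<omega> ^ D * (exp (- 3) / 3 * (sin a ^ D * energy a)) \<le> \<omega> ^ D * (sin \<theta> ^ D * energy \<theta>)"
    using \<omega> by (intro mult_left_mono) auto
  moreover have "exp (- 3) / 3 * (\<omega>\<^sup>2 / (4 * 36 ^ D * A ^ D)) \<le> exp (- 3) / 3 * (\<omega> ^ D * (sin a ^ D * energy a))"
    using base by (intro mult_left_mono) auto
  ultimately show ?thesis by (simp add: c1_def power_mult_distrib mult_ac)
qed

end

section \<open>From the energy to mean squares\<close>

context normalized_zonal_ode
begin

lemma continuous_u [continuous_intros]: "continuous_on S u"
  by (rule DERIV_continuous_on[OF has_field_derivative_at_within[OF DERIV_u]])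

text \<open>Pointwise u may vanish, but on average kinetic and potential energy agree: twice
  \<omega>^2 u^2 is the energy minus u'^2 - \<omega>^2 u^2, and with the weight (\<omega> sin
  \<theta>) ^ D the latter is an exact derivative. Integration by parts against a decreasing v
  leaves boundary terms controlled by v a alone.\<close>

lemma weighted_integral_lower:
  fixes v v' :: "real \<Rightarrow> real"
  assumes a: "A / \<omega> \<le> a" and ab: "a \<le> b" and b: "b \<le> pi / 2"
    and dv: "\<And>\<theta>. \<theta> \<in> {a..b} \<Longrightarrow> (v has_real_derivative v' \<theta>) (at \<theta>)"
    and v: "\<And>\<theta>. \<theta> \<in> {a..b} \<Longrightarrow> 0 \<le> v \<theta>" and v': "\<And>\<theta>. \<theta> \<in> {a..b} \<Longrightarrow> v' \<theta> \<le> 0"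
  shows "c1 * integral {a..b} v - c2 * v a / \<omega> \<le>
    2 * integral {a..b} (\<lambda>\<theta>. v \<theta> * ((\<omega> * sin \<theta>) ^ D * (u \<theta>)\<^sup>2))"
proof -
  \<comment> \<open>The equation in self-adjoint form makes the derivative of W equal to (\<omega>
    sin \<theta>) ^ D (u'^2 - \<omega>^2 u^2), without a friction term.\<close>
  define W where "W \<theta> = (\<omega> * sin \<theta>) ^ D * (u \<theta> * u' \<theta>)" for \<theta>
  have a0: "0 < a" using a A_ge \<omega> by (smt (verit) divide_pos_pos)
  have spos: "0 < sin \<theta>" if "\<theta> \<in> {a..b}" for \<theta>
    using that a0 b by (intro sin_gt_zero) (use pi_gt_zero in \<open>auto\<close>)
  have Wb: "\<bar>W \<theta>\<bar> \<le> c2 * \<omega> / 2" if t: "\<theta> \<in> {a..b}" for \<theta>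
  proof -
    have "\<bar>W \<theta>\<bar> = (\<omega> * sin \<theta>) ^ D * \<bar>u \<theta> * u' \<theta>\<bar>"
      using spos[OF t] \<omega> by (simp add: W_def abs_mult)
    also have "\<dots> \<le> (\<omega> * sin \<theta>) ^ D * (energy \<theta> / (2 * \<omega>))"
      using spos[OF t] \<omega> by (intro mult_left_mono abs_u_u'_le) auto
    also have "\<dots> = (\<omega> * sin \<theta>) ^ D * energy \<theta> / (2 * \<omega>)" by simp
    also have "\<dots> \<le> c2 * \<omega>\<^sup>2 / (2 * \<omega>)"
      using scaled_energy_upper[of \<theta>] t a0 b \<omega> by (intro divide_right_mono) auto
    also have "\<dots> = c2 * \<omega> / 2" using \<omega> by (simp add: power2_eq_square)
    finally show ?thesis .
  qed
  have dW: "(W has_real_derivative (\<omega> * sin \<theta>) ^ D * ((u' \<theta>)\<^sup>2 - \<omega>\<^sup>2 * (u \<theta>)\<^sup>2)) (at \<theta>)" if t: "\<theta> \<in> {a..b}" for \<theta>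
  proof -
    have "(W has_real_derivative real D * (\<omega> * sin \<theta>) ^ (D - 1) * (\<omega> * cos \<theta>) * (u \<theta> * u' \<theta>)
        + (\<omega> * sin \<theta>) ^ D * (u' \<theta> * u' \<theta> + u \<theta> * u'' \<theta>)) (at \<theta>)"
      unfolding W_def[abs_def]
      by (rule derivative_eq_intros refl | simp)+
    moreover have eq: "(\<omega> * sin \<theta>) ^ D = (\<omega> * sin \<theta>) ^ (D - 1) * (\<omega> * sin \<theta>)"
      using D by (simp add: power_eq_if)
    have "real D * (\<omega> * sin \<theta>) ^ (D - 1) * (\<omega> * cos \<theta>) * (u \<theta> * u' \<theta>)
        + (\<omega> * sin \<theta>) ^ D * (u' \<theta> * u' \<theta> + u \<theta> * u'' \<theta>) =
        (\<omega> * sin \<theta>) ^ (D - 1) * \<omega> * (real D * cos \<theta> * (u \<theta> * u' \<theta>) + sin \<theta> * (u' \<theta> * u' \<theta>) + u \<theta> * (sin \<theta> * u'' \<theta>))"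
      unfolding eq by (simp only: algebra_simps)
    also have "\<dots> = (\<omega> * sin \<theta>) ^ D * ((u' \<theta>)\<^sup>2 - \<omega>\<^sup>2 * (u \<theta>)\<^sup>2)"
      unfolding eq ode_angle by (simp add: power2_eq_square algebra_simps)
    ultimately show ?thesis by (rule DERIV_cong)
  qed
  let ?f = "\<lambda>\<theta>. v \<theta> * ((\<omega> * sin \<theta>) ^ D * (u \<theta>)\<^sup>2)"
  have cv: "continuous_on {a..b} v"
    by (rule DERIV_continuous_on[OF has_field_derivative_at_within[OF dv]])
  have fi: "?f integrable_on {a..b}"
    by (intro integrable_continuous_interval continuous_intros cv)
  have vi: "v integrable_on {a..b}" by (intro integrable_continuous_interval cv)
  have i1: "((\<lambda>\<theta>. v' \<theta>) has_integral v b - v a) {a..b}"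
    using dv by (intro fundamental_theorem_of_calculus ab)
      (auto simp: has_real_derivative_iff_has_vector_derivative intro: has_vector_derivative_at_within)
  have i2: "((\<lambda>\<theta>. v' \<theta> * W \<theta> + (\<omega> * sin \<theta>) ^ D * ((u' \<theta>)\<^sup>2 - \<omega>\<^sup>2 * (u \<theta>)\<^sup>2) * v \<theta>) has_integral v b * W b - v a * W a) {a..b}"
    using DERIV_mult[OF dv dW] by (intro fundamental_theorem_of_calculus ab)
      (auto simp: has_real_derivative_iff_has_vector_derivative intro: has_vector_derivative_at_within)
  \<comment> \<open>The term with v' on the left stands for the integral of v' W: as v' \<le> 0 and
    W is at most c2 \<omega> / 2, it can be replaced by a multiple of v b - v a.\<close>
  have "c1 * \<omega>\<^sup>2 * integral {a..b} v + (c2 * \<omega> / 2) * (v b - v a) - (v b * W b - v a * W a) \<le> (2 * \<omega>\<^sup>2) * integral {a..b} ?f"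
  proof (rule has_integral_le)
    show "((\<lambda>\<theta>. c1 * \<omega>\<^sup>2 * v \<theta> + (c2 * \<omega> / 2) * v' \<theta> - (v' \<theta> * W \<theta> + (\<omega> * sin \<theta>) ^ D * ((u' \<theta>)\<^sup>2 - \<omega>\<^sup>2 * (u \<theta>)\<^sup>2) * v \<theta>)) has_integral
        c1 * \<omega>\<^sup>2 * integral {a..b} v + (c2 * \<omega> / 2) * (v b - v a) - (v b * W b - v a * W a)) {a..b}"
      by (intro has_integral_diff has_integral_add has_integral_mult_right integrable_integral vi i1 i2)
    show "((\<lambda>\<theta>. 2 * \<omega>\<^sup>2 * ?f \<theta>) has_integral 2 * \<omega>\<^sup>2 * integral {a..b} ?f) {a..b}"
      by (intro has_integral_mult_right integrable_integral fi)
    fix \<theta> assume t: "\<theta> \<in> {a..b}"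
    have "v \<theta> * (c1 * \<omega>\<^sup>2) \<le> v \<theta> * ((\<omega> * sin \<theta>) ^ D * energy \<theta>)"
      using t a b v[OF t] by (intro mult_left_mono scaled_energy_lower) auto
    moreover have "(c2 * \<omega> / 2) * v' \<theta> \<le> v' \<theta> * W \<theta>"
      using mult_left_mono_neg[OF _ v'[OF t], of "W \<theta>" "c2 * \<omega> / 2"] Wb[OF t] by (simp add: abs_le_iff mult.commute)
    ultimately have "c1 * \<omega>\<^sup>2 * v \<theta> + (c2 * \<omega> / 2) * v' \<theta> - v' \<theta> * W \<theta> \<le> v \<theta> * ((\<omega> * sin \<theta>) ^ D * energy \<theta>)"
      by (simp add: mult_ac)
    then show "c1 * \<omega>\<^sup>2 * v \<theta> + (c2 * \<omega> / 2) * v' \<theta> - (v' \<theta> * W \<theta> + (\<omega> * sin \<theta>) ^ D * ((u' \<theta>)\<^sup>2 - \<omega>\<^sup>2 * (u \<theta>)\<^sup>2) * v \<theta>)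
        \<le> 2 * \<omega>\<^sup>2 * ?f \<theta>"
      by (simp add: energy_def algebra_simps)
  qed
  moreover have "v b * W b - v a * W a \<le> (c2 * \<omega> / 2) * (v b + v a)"
  proof -
    have "v b * W b \<le> v b * (c2 * \<omega> / 2)" "v a * (- W a) \<le> v a * (c2 * \<omega> / 2)"
      using abs_le_D1[OF Wb[of b]] abs_le_D2[OF Wb[of a]] v[of a] v[of b] ab by (intro mult_left_mono; simp)+
    then show ?thesis by (simp add: algebra_simps)
  qed
  moreover have "p - 2 * e * x \<le> r" if "p + e * (y - x) - q \<le> r" "q \<le> e * (y + x)" for p q r e x y :: real
    using that unfolding distrib_left right_diff_distrib by simp
  ultimately have "c1 * \<omega>\<^sup>2 * integral {a..b} v - 2 * (c2 * \<omega> / 2) * v a \<le> (2 * \<omega>\<^sup>2) * integral {a..b} ?f"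
    by blast
  then have "\<omega>\<^sup>2 * (c1 * integral {a..b} v - c2 * v a / \<omega>) \<le> \<omega>\<^sup>2 * (2 * integral {a..b} ?f)"
    using \<omega> by (simp add: algebra_simps power2_eq_square)
  then show ?thesis using \<omega> by (subst (asm) mult_le_cancel_left_pos) auto
qed

end

text \<open>The energy estimates hold on [0, pi/2]; evenness of the absolute value of p carries what
  concerns \<bar>u\<bar> and sin over to [pi/2, pi].\<close>

locale zonal_profile = normalized_zonal_ode +
  assumes parity: "\<And>t. \<bar>poly p (- t)\<bar> = \<bar>poly p t\<bar>"
begin

lemma u_reflect: "\<bar>u (pi - \<theta>)\<bar> = \<bar>u \<theta>\<bar>"
  by (simp add: u_def parity)

lemma reflect_cases:
  assumes "\<And>\<theta>. 0 \<le> \<theta> \<Longrightarrow> \<theta> \<le> pi / 2 \<Longrightarrow> P (sin \<theta>) \<bar>u \<theta>\<bar>" "0 \<le> \<theta>" "\<theta> \<le> pi"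
  shows "P (sin \<theta>) \<bar>u \<theta>\<bar>"
  using assms(1)[of \<theta>] assms(1)[of "pi - \<theta>"] assms(2,3) by (cases "\<theta> \<le> pi / 2") (auto simp: u_reflect)

lemma abs_u_le_1_pi: "0 \<le> \<theta> \<Longrightarrow> \<theta> \<le> pi \<Longrightarrow> \<bar>u \<theta>\<bar> \<le> 1"
  by (rule reflect_cases[where P="\<lambda>_ x. x \<le> 1"]) (auto intro: abs_u_le_1)

lemma scaled_u_upper:
  assumes "0 \<le> \<theta>" "\<theta> \<le> pi"
  shows "(\<omega> * sin \<theta>) ^ D * (u \<theta>)\<^sup>2 \<le> c2"
proof -
  have "(\<omega> * sin \<theta>) ^ D * \<bar>u \<theta>\<bar>\<^sup>2 \<le> c2"
  proof (rule reflect_cases[where P="\<lambda>s x. (\<omega> * s) ^ D * x\<^sup>2 \<le> c2", OF _ assms])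
    fix \<theta> assume t: "0 \<le> \<theta>" "\<theta> \<le> pi / 2"
    have "(\<omega> * sin \<theta>) ^ D * (\<omega>\<^sup>2 * (u \<theta>)\<^sup>2) \<le> (\<omega> * sin \<theta>) ^ D * energy \<theta>"
      using sin_cos_nonneg[OF t] \<omega> by (intro mult_left_mono) (auto simp: energy_def)
    also have "\<dots> \<le> c2 * \<omega>\<^sup>2" by (rule scaled_energy_upper[OF t])
    finally have "\<omega>\<^sup>2 * ((\<omega> * sin \<theta>) ^ D * (u \<theta>)\<^sup>2) \<le> \<omega>\<^sup>2 * c2" by (simp add: mult_ac)
    then show "(\<omega> * sin \<theta>) ^ D * \<bar>u \<theta>\<bar>\<^sup>2 \<le> c2"
      using \<omega> by (subst (asm) mult_le_cancel_left_pos) auto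
  qed
  then show ?thesis by simp
qed

definition c3 :: real where "c3 = 2 ^ D * (1 + c2)"

text \<open>Combines \<bar>u\<bar> \<le> 1 near the poles with the decay away from them; the 1 added
  to \<omega> sin \<theta> makes a single bound valid on the closed interval.\<close>

lemma u_decay:
  assumes "0 \<le> \<theta>" "\<theta> \<le> pi"
  shows "(1 + \<omega> * sin \<theta>) ^ D * (u \<theta>)\<^sup>2 \<le> c3"
proof -
  have s: "0 \<le> \<omega> * sin \<theta>" using assms \<omega> by (simp add: sin_ge_zero)
  have u1: "(u \<theta>)\<^sup>2 \<le> 1" using abs_u_le_1_pi[OF assms] by (simp add: abs_square_le_1)
  have "(1 + \<omega> * sin \<theta>) ^ D \<le> 2 ^ D * (1 + (\<omega> * sin \<theta>) ^ D)"
  proof (cases "\<omega> * sin \<theta> \<le> 1")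
    case True
    then have "(1 + \<omega> * sin \<theta>) ^ D \<le> 2 ^ D" using s by (intro power_mono) auto
    also have "\<dots> \<le> 2 ^ D * (1 + (\<omega> * sin \<theta>) ^ D)" using s by simp
    finally show ?thesis .
  next
    case False
    then have "(1 + \<omega> * sin \<theta>) ^ D \<le> (2 * (\<omega> * sin \<theta>)) ^ D" using s by (intro power_mono) auto
    also have "\<dots> \<le> 2 ^ D * (1 + (\<omega> * sin \<theta>) ^ D)" by (simp add: power_mult_distrib)
    finally show ?thesis .
  qed
  then have "(1 + \<omega> * sin \<theta>) ^ D * (u \<theta>)\<^sup>2 \<le> 2 ^ D * (1 + (\<omega> * sin \<theta>) ^ D) * (u \<theta>)\<^sup>2"
    by (intro mult_right_mono) auto
  also have "\<dots> = 2 ^ D * ((u \<theta>)\<^sup>2 + (\<omega> * sin \<theta>) ^ D * (u \<theta>)\<^sup>2)" by (simp add: algebra_simps)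
  also have "\<dots> \<le> c3"
    unfolding c3_def using u1 scaled_u_upper[OF assms] by (intro mult_left_mono add_mono) auto
  finally show ?thesis .
qed

lemma integral_u_square_upper:
  "\<omega> ^ D * integral {0..pi} (\<lambda>\<theta>. (u \<theta>)\<^sup>2 * sin \<theta> ^ D) \<le> pi * c2"
proof -
  have "integral {0..pi} (\<lambda>\<theta>. \<omega> ^ D * ((u \<theta>)\<^sup>2 * sin \<theta> ^ D)) \<le> integral {0..pi} (\<lambda>_. c2)"
  proof (rule integral_le)
    show "(\<lambda>\<theta>. \<omega> ^ D * ((u \<theta>)\<^sup>2 * sin \<theta> ^ D)) integrable_on {0..pi}"
      by (intro integrable_continuous_interval continuous_intros)
    show "\<omega> ^ D * ((u \<theta>)\<^sup>2 * sin \<theta> ^ D) \<le> c2" if "\<theta> \<in> {0..pi}" for \<theta>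
      using scaled_u_upper[of \<theta>] that by (simp add: power_mult_distrib mult_ac)
  qed auto
  then show ?thesis by simp
qed

text \<open>From this frequency on, A / \<omega> \<le> pi / 4 and c2 / \<omega> \<le> c1 pi / 8, so
  that over [pi/4, pi/2] the boundary term eats up at most half of the main term.\<close>

definition \<omega>0 :: real where "\<omega>0 = max (4 * A / pi) (max 1 (8 * c2 / (pi * c1)))"
definition c4 :: real where
  "c4 = min (c1 * pi / (16 * 4 ^ D)) ((1 / (12 * \<omega>0)) ^ (2 * D) / (16 * \<omega>0))"

lemma c4_pos: "0 < c4"
proof -
  have "0 < \<omega>0" unfolding \<omega>0_def by linarith
  then show ?thesis using c1_pos by (simp add: c4_def)
qed

text \<open>For large \<omega> the mean square over [pi/4, pi/2], where the sine is at least 1/4, is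
  sufficient. For \<omega> below \<omega>0 a fixed neighbourhood of the pole does, because u \<ge>
  1/2 there. The two entries of \<open>c4\<close> are the outcomes.\<close>

lemma integral_u_square_sin_lower:
  "c4 \<le> \<omega> ^ D * integral {0..pi} (\<lambda>\<theta>. (u \<theta>)\<^sup>2 * sin \<theta> ^ D * sin \<theta> ^ D)"
proof -
  let ?f = "\<lambda>\<theta>. (u \<theta>)\<^sup>2 * sin \<theta> ^ D * sin \<theta> ^ D"
  have fi: "?f integrable_on {a..b}" for a b
    by (intro integrable_continuous_interval continuous_intros)
  have f0: "0 \<le> ?f \<theta>" if "\<theta> \<in> {0..pi}" for \<theta>
    using sin_ge_zero[of \<theta>] that by simp
  have sub: "integral {a..b} ?f \<le> integral {0..pi} ?f" if "0 \<le> a" "b \<le> pi" for a b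
    by (rule integral_subset_le[OF _ fi fi]) (use that f0 in auto)
  have \<omega>0: "1 \<le> \<omega>0" by (simp add: \<omega>0_def)
  show ?thesis
  proof (cases "\<omega>0 \<le> \<omega>")
    case True
    have w1: "4 * A / pi \<le> \<omega>" "8 * c2 / (pi * c1) \<le> \<omega>" using True by (auto simp: \<omega>0_def)
    have a: "A / \<omega> \<le> pi / 4" using w1(1) \<omega> by (simp add: field_simps)
    have "c1 * integral {pi/4..pi/2} (\<lambda>_. 1) - c2 * 1 / \<omega> \<le>
      2 * integral {pi/4..pi/2} (\<lambda>\<theta>. 1 * ((\<omega> * sin \<theta>) ^ D * (u \<theta>)\<^sup>2))"
      by (rule weighted_integral_lower[OF a, where v'="\<lambda>_. 0"]) (use pi_gt_zero in auto)
    moreover have "c2 / \<omega> \<le> c1 * pi / 8"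
      using w1(2) \<omega> c1_pos c2_pos by (simp add: field_simps)
    moreover have "integral {pi/4..pi/2} (\<lambda>_. 1) = pi / 4" using pi_gt_zero by (simp add: field_simps)
    ultimately have low: "c1 * pi / 16 \<le> integral {pi/4..pi/2} (\<lambda>\<theta>. (\<omega> * sin \<theta>) ^ D * (u \<theta>)\<^sup>2)"
      by (simp add: mult.commute)
    have "integral {pi/4..pi/2} (\<lambda>\<theta>. (\<omega> * sin \<theta>) ^ D * (u \<theta>)\<^sup>2 * (1 / 4 ^ D)) \<le> integral {pi/4..pi/2} (\<lambda>\<theta>. \<omega> ^ D * ?f \<theta>)"
    proof (rule integral_le)
      show "(\<lambda>\<theta>. (\<omega> * sin \<theta>) ^ D * (u \<theta>)\<^sup>2 * (1 / 4 ^ D)) integrable_on {pi/4..pi/2}"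
        by (intro integrable_continuous_interval continuous_intros)
      show "(\<lambda>\<theta>. \<omega> ^ D * ?f \<theta>) integrable_on {pi/4..pi/2}"
        by (intro integrable_continuous_interval continuous_intros)
      fix \<theta> assume t: "\<theta> \<in> {pi/4..pi/2}"
      have "pi / 12 \<le> sin \<theta>" using sin_ge_third[of \<theta>] t pi_gt_zero by auto
      then have "1 / 4 \<le> sin \<theta>" using pi_gt3 by simp
      then have "(1 / 4) ^ D \<le> sin \<theta> ^ D" by (intro power_mono) auto
      then have "(\<omega> * sin \<theta>) ^ D * (u \<theta>)\<^sup>2 * (1 / 4 ^ D) \<le> (\<omega> * sin \<theta>) ^ D * (u \<theta>)\<^sup>2 * sin \<theta> ^ D"
        using \<open>1 / 4 \<le> sin \<theta>\<close> \<omega> by (intro mult_left_mono) (auto simp: power_divide)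
      then show "(\<omega> * sin \<theta>) ^ D * (u \<theta>)\<^sup>2 * (1 / 4 ^ D) \<le> \<omega> ^ D * ?f \<theta>"
        by (simp add: power_mult_distrib mult_ac)
    qed
    also have "\<dots> = \<omega> ^ D * integral {pi/4..pi/2} ?f" by simp
    also have "\<dots> \<le> \<omega> ^ D * integral {0..pi} ?f"
      using \<omega> pi_gt_zero by (intro mult_left_mono sub) auto
    finally have "integral {pi/4..pi/2} (\<lambda>\<theta>. (\<omega> * sin \<theta>) ^ D * (u \<theta>)\<^sup>2) * (1 / 4 ^ D) \<le> \<omega> ^ D * integral {0..pi} ?f"
      by (simp only: integral_mult_left)
    moreover have "c1 * pi / 16 * (1 / 4 ^ D) \<le> integral {pi/4..pi/2} (\<lambda>\<theta>. (\<omega> * sin \<theta>) ^ D * (u \<theta>)\<^sup>2) * (1 / 4 ^ D)"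
      using low by (intro mult_right_mono) auto
    moreover have "c4 \<le> c1 * pi / 16 * (1 / 4 ^ D)" by (simp add: c4_def)
    ultimately show ?thesis by linarith
  next
    case False
    \<comment> \<open>Since \<omega> < \<omega>0, every angle up to b satisfies \<omega> \<theta>
      \<le> 1/2.\<close>
    define b where "b = 1 / (2 * \<omega>0)"
    have b: "0 < b" "b \<le> 1" "\<omega> * b \<le> 1 / 2"
      using \<omega>0 False \<omega> by (auto simp: b_def field_simps)
    have b2: "b \<le> pi / 2" using b(2) pi_gt3 by simp
    note b = b b2
    have "integral {b/2..b} (\<lambda>\<theta>. 1 / 4 * (b / 6) ^ D * (b / 6) ^ D) \<le> integral {b/2..b} ?f"
    proof (rule integral_le[OF _ fi])
      fix \<theta> assume t: "\<theta> \<in> {b/2..b}"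
      have "\<omega> * \<theta> \<le> \<omega> * b" using t \<omega> by (intro mult_left_mono) auto
      then have "1 / 2 \<le> u \<theta>" using u_ge[of \<theta>] t b by auto
      then have "(1 / 2)\<^sup>2 \<le> (u \<theta>)\<^sup>2" by (intro power_mono) auto
      moreover have "b / 6 \<le> sin \<theta>" using sin_ge_third[of \<theta>] t b by auto
      ultimately show "1 / 4 * (b / 6) ^ D * (b / 6) ^ D \<le> ?f \<theta>"
        using b by (intro mult_mono power_mono) (auto simp: power2_eq_square)
    qed auto
    also have "\<dots> \<le> integral {0..pi} ?f" using b by (intro sub) auto
    also have "\<dots> \<le> \<omega> ^ D * integral {0..pi} ?f"
    proof -
      have "0 \<le> integral {0..pi} ?f"
        by (rule integral_nonneg[OF fi f0])
      then show ?thesis using \<omega> mult_right_mono[of 1 "\<omega> ^ D"] by (simp add: one_le_power)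
    qed
    also have "integral {b/2..b} (\<lambda>\<theta>. 1 / 4 * (b / 6) ^ D * (b / 6) ^ D) = (1 / (12 * \<omega>0)) ^ (2 * D) / (16 * \<omega>0)"
    proof -
      have b6: "b / 6 = 1 / (12 * \<omega>0)" by (simp add: b_def)
      have int: "integral {b/2..b} (\<lambda>\<theta>. 1 / 4 * (b / 6) ^ D * (b / 6) ^ D) = (b - b / 2) * (1 / 4 * (b / 6) ^ D * (b / 6) ^ D)"
        using b(1) by simp
      have b2: "b - b / 2 = 1 / (4 * \<omega>0)" by (simp add: b_def)
      have "(b - b / 2) * (1 / 4 * (b / 6) ^ D * (b / 6) ^ D) = (1 / (12 * \<omega>0)) ^ (2 * D) / (16 * \<omega>0)"
        unfolding b6 b2 mult_2 power_add by simp
      then show ?thesis by (simp only: int)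
    qed
    finally show ?thesis by (simp add: c4_def)
  qed
qed

text \<open>The weight v = 1 / \<theta> is decreasing, its integral from A / \<omega> on produces ln
  \<omega> - ln A, and its boundary term is the constant c2 / A because v (A / \<omega>) / \<omega>
  = 1 / A.\<close>

lemma integral_u_square_log_lower:
  assumes "A / \<omega> \<le> pi / 2"
  shows "(c1 * (ln \<omega> - ln A) - c2 / A) / 4 \<le>
    \<omega> ^ (D + 1) * integral {0..pi} (\<lambda>\<theta>. (u \<theta>)\<^sup>2 / (1 + \<omega> * sin \<theta>) * sin \<theta> ^ D)"
proof -
  define a where "a = A / \<omega>"
  have a: "0 < a" "a \<le> pi / 2" using A_ge \<omega> assms by (auto simp: a_def)
  let ?f = "\<lambda>\<theta>. (u \<theta>)\<^sup>2 / (1 + \<omega> * sin \<theta>) * sin \<theta> ^ D"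
  have nz: "0 < 1 + \<omega> * sin \<theta>" if "0 \<le> \<theta>" "\<theta> \<le> pi" for \<theta>
    using that \<omega> sin_ge_zero[of \<theta>] by (simp add: add_pos_nonneg)
  have fi: "?f integrable_on {x..y}" if "0 \<le> x" "y \<le> pi" for x y
  proof (intro integrable_continuous_interval continuous_intros ballI)
    fix \<theta> assume "\<theta> \<in> {x..y}"
    then show "1 + \<omega> * sin \<theta> \<noteq> 0" using nz[of \<theta>] that by auto
  qed
  have cinv: "continuous_on {a..pi/2} (\<lambda>\<theta>. 1 / \<theta>)" using a by (intro continuous_intros) auto
  have inv: "integral {a..pi/2} (\<lambda>\<theta>. 1 / \<theta>) = ln (pi / 2) - ln a"
  proof (rule integral_unique, rule fundamental_theorem_of_calculus[OF a(2)])
    fix x assume "x \<in> {a..pi/2}"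
    then show "(ln has_vector_derivative 1 / x) (at x within {a..pi/2})"
      using a unfolding has_real_derivative_iff_has_vector_derivative[symmetric]
      by (auto intro!: derivative_eq_intros)
  qed
  have lin: "(z - r) / 4 \<le> i / 2" if "x - q \<le> 2 * i" "q = r" "z \<le> x" for x q i r z :: real
  proof -
    have "z - r \<le> 2 * i" using that by simp
    then show ?thesis by simp
  qed
  define I where "I = integral {a..pi/2} (\<lambda>\<theta>. 1 / \<theta> * ((\<omega> * sin \<theta>) ^ D * (u \<theta>)\<^sup>2))"
  have "c1 * integral {a..pi/2} (\<lambda>\<theta>. 1 / \<theta>) - c2 * (1 / a) / \<omega> \<le>
      2 * integral {a..pi/2} (\<lambda>\<theta>. 1 / \<theta> * ((\<omega> * sin \<theta>) ^ D * (u \<theta>)\<^sup>2))"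
  proof (rule weighted_integral_lower[where v'="\<lambda>\<theta>. - (1 / \<theta>\<^sup>2)"])
    fix \<theta> assume "\<theta> \<in> {a..pi/2}"
    then show "((\<lambda>\<theta>. 1 / \<theta>) has_real_derivative - (1 / \<theta>\<^sup>2)) (at \<theta>)"
      using a by (auto intro!: derivative_eq_intros simp: power2_eq_square)
  qed (use a in \<open>auto simp: a_def\<close>)
  moreover have "c2 * (1 / a) / \<omega> = c2 / A" using \<omega> by (simp add: a_def)
  moreover have "c1 * (ln \<omega> - ln A) \<le> c1 * (ln (pi / 2) - ln a)"
  proof (rule mult_left_mono)
    have "0 \<le> ln (pi / 2)" using pi_gt3 by simp
    moreover have "ln a = ln A - ln \<omega>" using A_ge \<omega> by (simp add: a_def ln_div)
    ultimately show "ln \<omega> - ln A \<le> ln (pi / 2) - ln a" by linarith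
  qed (use c1_pos in simp)
  ultimately have low: "(c1 * (ln \<omega> - ln A) - c2 / A) / 4 \<le> integral {a..pi/2} (\<lambda>\<theta>. 1 / \<theta> * ((\<omega> * sin \<theta>) ^ D * (u \<theta>)\<^sup>2)) / 2"
    unfolding inv I_def[symmetric] by (rule lin)
  have "integral {a..pi/2} (\<lambda>\<theta>. (1 / \<theta> * ((\<omega> * sin \<theta>) ^ D * (u \<theta>)\<^sup>2)) / 2) \<le> integral {a..pi/2} (\<lambda>\<theta>. \<omega> ^ (D + 1) * ?f \<theta>)"
  proof (rule integral_le)
    show "(\<lambda>\<theta>. (1 / \<theta> * ((\<omega> * sin \<theta>) ^ D * (u \<theta>)\<^sup>2)) / 2) integrable_on {a..pi/2}"
      using a by (intro integrable_continuous_interval continuous_intros) auto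
    show "(\<lambda>\<theta>. \<omega> ^ (D + 1) * ?f \<theta>) integrable_on {a..pi/2}"
      using a pi_gt_zero by (intro integrable_on_mult_right fi) auto
    fix \<theta> assume t: "\<theta> \<in> {a..pi/2}"
    then have t0: "0 < \<theta>" "\<theta> \<le> pi" using a pi_gt_zero by auto
    \<comment> \<open>Away from the pole 1 + \<omega> sin \<theta> is at most 2 \<omega> \<theta>,
      so the weight 1 / \<theta> may be exchanged for \<omega> / (1 + \<omega> sin
      \<theta>).\<close>
    have "1 \<le> \<omega> * \<theta>"
      using t A_ge \<omega> by (simp add: a_def field_simps)
    moreover have "\<omega> * sin \<theta> \<le> \<omega> * \<theta>" using sin_x_le_x[of \<theta>] t0 \<omega> by simp
    ultimately have "1 + \<omega> * sin \<theta> \<le> 2 * (\<omega> * \<theta>)" by linarith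
    then have "1 / (2 * (\<omega> * \<theta>)) \<le> 1 / (1 + \<omega> * sin \<theta>)"
      using nz[of \<theta>] t0 by (intro divide_left_mono) (use \<omega> in auto)
    then have "(\<omega> * ((\<omega> * sin \<theta>) ^ D * (u \<theta>)\<^sup>2)) * (1 / (2 * (\<omega> * \<theta>))) \<le> (\<omega> * ((\<omega> * sin \<theta>) ^ D * (u \<theta>)\<^sup>2)) * (1 / (1 + \<omega> * sin \<theta>))"
      using \<omega> t0 sin_ge_zero[of \<theta>] by (intro mult_left_mono) auto
    then show "(1 / \<theta> * ((\<omega> * sin \<theta>) ^ D * (u \<theta>)\<^sup>2)) / 2 \<le> \<omega> ^ (D + 1) * ?f \<theta>"
      using \<omega> by (simp add: power_mult_distrib mult_ac)
  qed
  also have "\<dots> = \<omega> ^ (D + 1) * integral {a..pi/2} ?f" by (rule integral_mult_right)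
  also have "\<dots> \<le> \<omega> ^ (D + 1) * integral {0..pi} ?f"
  proof (rule mult_left_mono)
    show "integral {a..pi/2} ?f \<le> integral {0..pi} ?f"
    proof (rule integral_subset_le)
      have "0 \<le> ?f \<theta>" if "\<theta> \<in> {0..pi}" for \<theta>
        using nz[of \<theta>] sin_ge_zero[of \<theta>] that by simp
      then show "\<forall>\<theta>\<in>{0..pi}. 0 \<le> ?f \<theta>" by blast
      show "?f integrable_on {a..pi/2}" "?f integrable_on {0..pi}"
        using a pi_gt_zero by (auto intro!: fi simp del: times_divide_eq_left)
      show "{a..pi/2} \<subseteq> {0..pi}" using a pi_gt_zero by auto
    qed
  qed (use \<omega> in auto)
  finally have "integral {a..pi/2} (\<lambda>\<theta>. 1 / \<theta> * ((\<omega> * sin \<theta>) ^ D * (u \<theta>)\<^sup>2)) / 2 \<le> \<omega> ^ (D + 1) * integral {0..pi} ?f"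
    by (simp only: integral_divide)
  with low show ?thesis by (rule order_trans)
qed

end

text \<open>Replacing sin \<theta> by \<theta> / 3 on the left half and by (pi - \<theta>) / 3 on
  the right half leaves elementary integrals with logarithms as antiderivatives.\<close>

lemma integral_inverse_sin_upper:
  fixes \<omega> :: real
  assumes \<omega>: "1 \<le> \<omega>"
  shows "\<omega> * integral {0..pi} (\<lambda>\<theta>. 1 / (1 + \<omega> * sin \<theta>)) \<le> 6 * ln (1 + \<omega>)"
proof -
  let ?f = "\<lambda>\<theta>. 1 / (1 + \<omega> * sin \<theta>)"
  have nz: "0 < 1 + \<omega> * sin \<theta>" if "0 \<le> \<theta>" "\<theta> \<le> pi" for \<theta>
    using that \<omega> sin_ge_zero[of \<theta>] by (simp add: add_pos_nonneg)
  have fi: "?f integrable_on {x..y}" if "0 \<le> x" "y \<le> pi" for x y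
  proof (intro integrable_continuous_interval continuous_intros ballI)
    fix \<theta> assume "\<theta> \<in> {x..y}"
    then show "1 + \<omega> * sin \<theta> \<noteq> 0" using nz[of \<theta>] that by auto
  qed
  define L where "L = ln (1 + \<omega> * (pi / 2) / 3)"
  have w: "0 < 1 + \<omega> * x / 3" if "0 \<le> x" for x using that \<omega> by (simp add: add_pos_nonneg)
  have dln: "((\<lambda>\<theta>. 3 / \<omega> * ln (1 + \<omega> * \<theta> / 3)) has_real_derivative 1 / (1 + \<omega> * x / 3)) (at x)"
    if "0 \<le> x" for x
  proof -
    have "((\<lambda>\<theta>. ln (1 + \<omega> * \<theta> / 3)) has_real_derivative 1 / (1 + \<omega> * x / 3) * (\<omega> / 3)) (at x)"
      by (rule DERIV_chain2[where f=ln and g="\<lambda>\<theta>. 1 + \<omega> * \<theta> / 3" and x=x, OF DERIV_ln_divide[OF w[OF that]]]) (auto intro!: derivative_eq_intros)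
    from DERIV_cmult[OF this, of "3 / \<omega>"] show ?thesis
      by (rule DERIV_cong) (use \<omega> w[OF that] in \<open>simp add: field_simps\<close>)
  qed
  have dln': "((\<lambda>\<theta>. - (3 / \<omega> * ln (1 + \<omega> * (pi - \<theta>) / 3))) has_real_derivative 1 / (1 + \<omega> * (pi - x) / 3)) (at x)"
    if "x \<le> pi" for x
  proof -
    have "((\<lambda>x. pi - x) has_real_derivative - 1) (at x)"
      by (auto intro!: derivative_eq_intros)
    with dln[of "pi - x"] that have "((\<lambda>\<theta>. 3 / \<omega> * ln (1 + \<omega> * (pi - \<theta>) / 3)) has_real_derivative 1 / (1 + \<omega> * (pi - x) / 3) * - 1) (at x)"
      by (intro DERIV_chain2[where f="\<lambda>\<theta>. 3 / \<omega> * ln (1 + \<omega> * \<theta> / 3)" and g="\<lambda>x. pi - x"]) auto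
    from DERIV_minus[OF this] show ?thesis by simp
  qed
  have i1: "((\<lambda>\<theta>. 1 / (1 + \<omega> * \<theta> / 3)) has_integral 3 / \<omega> * L - 3 / \<omega> * ln (1 + \<omega> * 0 / 3)) {0..pi/2}"
    unfolding L_def
  proof (rule fundamental_theorem_of_calculus)
    fix x assume "x \<in> {0..pi/2}"
    then show "((\<lambda>\<theta>. 3 / \<omega> * ln (1 + \<omega> * \<theta> / 3)) has_vector_derivative 1 / (1 + \<omega> * x / 3)) (at x within {0..pi/2})"
      using dln[of x] unfolding has_real_derivative_iff_has_vector_derivative[symmetric]
      by (auto intro: has_field_derivative_at_within)
  qed simp
  have i2: "((\<lambda>\<theta>. 1 / (1 + \<omega> * (pi - \<theta>) / 3)) has_integral (- (3 / \<omega> * ln (1 + \<omega> * (pi - pi) / 3))) - (- (3 / \<omega> * ln (1 + \<omega> * (pi - pi/2) / 3)))) {pi/2..pi}"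
  proof (rule fundamental_theorem_of_calculus)
    fix x assume "x \<in> {pi/2..pi}"
    then show "((\<lambda>\<theta>. - (3 / \<omega> * ln (1 + \<omega> * (pi - \<theta>) / 3))) has_vector_derivative 1 / (1 + \<omega> * (pi - x) / 3)) (at x within {pi/2..pi})"
      unfolding has_real_derivative_iff_has_vector_derivative[symmetric]
      by (intro has_field_derivative_at_within[OF dln']) simp
  qed simp
  have "integral {0..pi} ?f = integral {0..pi/2} ?f + integral {pi/2..pi} ?f"
    by (rule Henstock_Kurzweil_Integration.integral_combine[symmetric]) (auto intro!: fi)
  also have "\<dots> \<le> 3 / \<omega> * L + 3 / \<omega> * L"
  proof (rule add_mono)
    show "integral {0..pi/2} ?f \<le> 3 / \<omega> * L"
    proof (rule has_integral_le)
      show "(?f has_integral integral {0..pi/2} ?f) {0..pi/2}" by (intro integrable_integral fi) auto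
      show "((\<lambda>\<theta>. 1 / (1 + \<omega> * \<theta> / 3)) has_integral 3 / \<omega> * L) {0..pi/2}" using i1 by simp
      fix \<theta> assume t: "\<theta> \<in> {0..pi/2}"
      have "\<omega> * (\<theta> / 3) \<le> \<omega> * sin \<theta>" using sin_ge_third[of \<theta>] t \<omega> by (intro mult_left_mono) auto
      then show "?f \<theta> \<le> 1 / (1 + \<omega> * \<theta> / 3)"
        using w[of \<theta>] t by (intro divide_left_mono mult_pos_pos nz) auto
    qed
    show "integral {pi/2..pi} ?f \<le> 3 / \<omega> * L"
    proof (rule has_integral_le)
      show "(?f has_integral integral {pi/2..pi} ?f) {pi/2..pi}" by (intro integrable_integral fi) auto
      show "((\<lambda>\<theta>. 1 / (1 + \<omega> * (pi - \<theta>) / 3)) has_integral 3 / \<omega> * L) {pi/2..pi}" using i2 by (simp add: L_def)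
      fix \<theta> assume t: "\<theta> \<in> {pi/2..pi}"
      have "\<omega> * ((pi - \<theta>) / 3) \<le> \<omega> * sin \<theta>" using sin_ge_third[of "pi - \<theta>"] t \<omega> by (intro mult_left_mono) auto
      then show "?f \<theta> \<le> 1 / (1 + \<omega> * (pi - \<theta>) / 3)"
        using w[of "pi - \<theta>"] t by (intro divide_left_mono mult_pos_pos nz) auto
    qed
  qed
  finally have "\<omega> * integral {0..pi} ?f \<le> 6 * L" using \<omega> by (simp add: field_simps)
  also have "L \<le> ln (1 + \<omega>)"
  proof -
    have "pi / 2 / 3 \<le> 1" using pi_less_4 by simp
    then have "\<omega> * (pi / 2 / 3) \<le> \<omega> * 1" using \<omega> by (intro mult_left_mono) auto
    then show ?thesis unfolding L_def using w[of "pi/2"] \<omega> by (subst ln_le_cancel_iff) auto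
  qed
  finally show ?thesis by simp
qed

section \<open>Integrals of zonal functions\<close>

lemma surface_measure_sphere_pos:
  "0 < measure (surface_measure :: 'a::euclidean_space measure) (sphere 0 1)"
proof -
  have "(\<integral>x. (1::real) \<partial>(surface_measure :: 'a measure)) = real DIM('a) * measure lborel (ball 0 1 :: 'a set)"
    by (subst integral_surface_measure) auto
  also have "\<dots> > 0" using content_ball_pos[of 1 "0::'a"] by simp
  finally show ?thesis by simp
qed

text \<open>The Funk--Hecke recursion for the constant harmonic Y = 1.\<close>

lemma sphere_moment_recursion:
  fixes e :: "'a::euclidean_space"
  assumes e: "norm e = 1"
  shows "(real DIM('a) + real k) * (\<integral>y. (y \<bullet> e) ^ (k + 2) \<partial>surface_measure) =
      (real k + 1) * (\<integral>y. (y \<bullet> e) ^ k \<partial>surface_measure)"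
    and "2 \<le> DIM('a) \<Longrightarrow> (\<integral>y. y \<bullet> e \<partial>surface_measure) = 0"
proof -
  let ?A = "\<lambda>k. (\<integral>y. (y \<bullet> e) ^ k \<partial>surface_measure)"
  have 1: "polynomial_function (\<lambda>_::'a. 1::complex)" "homogeneous 0 (\<lambda>_::'a. 1::complex)"
    by (auto simp: homogeneous_def)
  have c: "(\<integral>y. of_real ((y \<bullet> e) ^ k) * (1::complex) \<partial>surface_measure) = of_real (?A k)" for k
    by (simp only: mult_1_right integral_complex_of_real)
  have rec: "complex_of_real ((real DIM('a) + real m - 1) * ?A (Suc m)) = of_real (real m * ?A (m - 1))" for m
    using funk_hecke_recursion[OF 1 e, of m] unfolding c by (simp add: partial_deriv_const)
  then have rec': "(real DIM('a) + real m - 1) * ?A (Suc m) = real m * ?A (m - 1)" for m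
    by (simp only: of_real_eq_iff)
  show "(real DIM('a) + real k) * ?A (k + 2) = (real k + 1) * ?A k"
    using rec'[of "Suc k"] by (simp add: add_ac)
  show "2 \<le> DIM('a) \<Longrightarrow> (\<integral>y. y \<bullet> e \<partial>surface_measure) = 0"
    using rec'[of 0] by simp
qed

text \<open>The derivative of cos^(k + 1) sin^(D + 1) integrates to 0. With D + 2 equal to the
  dimension this is the recursion satisfied by the moments on the sphere.\<close>

lemma angular_moment_recursion:
  fixes D :: nat
  shows "(real D + 2 + real k) * integral {0..pi} (\<lambda>\<theta>. cos \<theta> ^ (k + 2) * sin \<theta> ^ D) =
      (real k + 1) * integral {0..pi} (\<lambda>\<theta>. cos \<theta> ^ k * sin \<theta> ^ D)"
    and "integral {0..pi} (\<lambda>\<theta>. cos \<theta> * sin \<theta> ^ D) = 0"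
proof -
  have ci: "(\<lambda>\<theta>. cos \<theta> ^ k * sin \<theta> ^ D) integrable_on {0..pi}" for k
    by (intro integrable_continuous_interval continuous_intros)
  have R1: "((\<lambda>\<theta>. (real D + 2 + real k) * (cos \<theta> ^ (k + 2) * sin \<theta> ^ D) - (real k + 1) * (cos \<theta> ^ k * sin \<theta> ^ D)) has_integral
      cos pi ^ (k + 1) * sin pi ^ (D + 1) - cos 0 ^ (k + 1) * sin 0 ^ (D + 1)) {0..pi}"
  proof (rule fundamental_theorem_of_calculus)
    fix x :: real
    have "((\<lambda>\<theta>. cos \<theta> ^ (k + 1) * sin \<theta> ^ (D + 1)) has_real_derivative
        real (k + 1) * cos x ^ k * (- sin x) * sin x ^ (D + 1) + real (D + 1) * sin x ^ D * cos x * cos x ^ (k + 1)) (at x)"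
      by (rule DERIV_cong[OF DERIV_mult[OF DERIV_power[OF DERIV_cos] DERIV_power[OF DERIV_sin]]]) simp
    moreover have "real (k + 1) * cos x ^ k * (- sin x) * sin x ^ (D + 1) + real (D + 1) * sin x ^ D * cos x * cos x ^ (k + 1) =
        (real D + 2 + real k) * (cos x ^ (k + 2) * sin x ^ D) - (real k + 1) * (cos x ^ k * sin x ^ D)"
    proof -
      have s: "sin x * sin x = 1 - cos x * cos x" using sin_squared_eq[of x] by (simp add: power2_eq_square)
      have "real (k + 1) * cos x ^ k * (- sin x) * sin x ^ (D + 1) = - (real k + 1) * cos x ^ k * sin x ^ D * (sin x * sin x)"
        by (simp add: algebra_simps)
      then show ?thesis unfolding s by (simp add: algebra_simps)
    qed
    ultimately show "((\<lambda>\<theta>. cos \<theta> ^ (k + 1) * sin \<theta> ^ (D + 1)) has_vector_derivative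
        (real D + 2 + real k) * (cos x ^ (k + 2) * sin x ^ D) - (real k + 1) * (cos x ^ k * sin x ^ D)) (at x within {0..pi})"
      unfolding has_real_derivative_iff_has_vector_derivative[symmetric] by (simp add: has_field_derivative_at_within)
  qed simp
  have R2: "((\<lambda>\<theta>. (real D + 2 + real k) * (cos \<theta> ^ (k + 2) * sin \<theta> ^ D) - (real k + 1) * (cos \<theta> ^ k * sin \<theta> ^ D)) has_integral
      (real D + 2 + real k) * integral {0..pi} (\<lambda>\<theta>. cos \<theta> ^ (k + 2) * sin \<theta> ^ D) - (real k + 1) * integral {0..pi} (\<lambda>\<theta>. cos \<theta> ^ k * sin \<theta> ^ D)) {0..pi}"
    by (intro has_integral_diff has_integral_mult_right integrable_integral ci)
  have "cos pi ^ (k + 1) * sin pi ^ (D + 1) - cos 0 ^ (k + 1) * sin 0 ^ (D + 1) = (0::real)"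
    by (simp only: sin_pi sin_zero power_Suc add_0_left mult_zero_left mult_zero_right diff_self Suc_eq_plus1[symmetric])
  with has_integral_unique[OF R2 R1] show "(real D + 2 + real k) * integral {0..pi} (\<lambda>\<theta>. cos \<theta> ^ (k + 2) * sin \<theta> ^ D) =
      (real k + 1) * integral {0..pi} (\<lambda>\<theta>. cos \<theta> ^ k * sin \<theta> ^ D)"
    by (metis (no_types) right_minus_eq)
  have "((\<lambda>\<theta>. (real D + 1) * (cos \<theta> * sin \<theta> ^ D)) has_integral sin pi ^ (D + 1) - sin 0 ^ (D + 1)) {0..pi}"
  proof (rule fundamental_theorem_of_calculus)
    fix x :: real
    have "((\<lambda>\<theta>. sin \<theta> ^ (D + 1)) has_real_derivative (real D + 1) * (cos x * sin x ^ D)) (at x)"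
      by (rule DERIV_cong[OF DERIV_power[OF DERIV_sin]]) simp
    then show "((\<lambda>\<theta>. sin \<theta> ^ (D + 1)) has_vector_derivative (real D + 1) * (cos x * sin x ^ D)) (at x within {0..pi})"
      unfolding has_real_derivative_iff_has_vector_derivative[symmetric] by (rule has_field_derivative_at_within)
  qed simp
  then have "integral {0..pi} (\<lambda>\<theta>. (real D + 1) * (cos \<theta> * sin \<theta> ^ D)) = sin pi ^ (D + 1) - sin 0 ^ (D + 1)"
    by (rule integral_unique)
  also have "\<dots> = 0" by simp
  finally show "integral {0..pi} (\<lambda>\<theta>. cos \<theta> * sin \<theta> ^ D) = 0"
    by (simp only: integral_mult_right mult_eq_0_iff) auto
qed

definition angular_mass :: "nat \<Rightarrow> real" where
  "angular_mass D = integral {0..pi} (\<lambda>\<theta>. sin \<theta> ^ D)"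

lemma angular_mass_pos: "0 < angular_mass D"
proof -
  have fi: "(\<lambda>\<theta>. sin \<theta> ^ D) integrable_on {a..b}" for a b :: real
    by (intro integrable_continuous_interval continuous_intros)
  have "integral {pi/4..pi/2} (\<lambda>\<theta>. (1/4::real) ^ D) \<le> integral {pi/4..pi/2} (\<lambda>\<theta>. sin \<theta> ^ D)"
  proof (rule integral_le[OF _ fi])
    fix \<theta> assume t: "\<theta> \<in> {pi/4..pi/2}"
    have "pi / 12 \<le> sin \<theta>" using sin_ge_third[of \<theta>] t pi_gt_zero by auto
    then have "1 / 4 \<le> sin \<theta>" using pi_gt3 by simp
    then show "(1/4) ^ D \<le> sin \<theta> ^ D" by (intro power_mono) auto
  qed auto
  also have "\<dots> \<le> angular_mass D"
    unfolding angular_mass_def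
    by (rule integral_subset_le[OF _ fi fi]) (use pi_gt_zero in \<open>auto intro!: zero_le_power sin_ge_zero\<close>)
  finally have "(pi / 2 - pi / 4) * (1/4) ^ D \<le> angular_mass D" using pi_gt_zero by simp
  moreover have "0 < (pi / 2 - pi / 4) * (1/4::real) ^ D" using pi_gt_zero by (intro mult_pos_pos) auto
  ultimately show ?thesis by linarith
qed

text \<open>The area of the equatorial sphere of dimension DIM - 2. Taking it as this quotient makes
  the zonal integral formula hold for the constant function by definition.\<close>

definition zonal_const :: "'a::euclidean_space itself \<Rightarrow> real" where
  "zonal_const _ = measure (surface_measure :: 'a measure) (sphere 0 1) / angular_mass (DIM('a) - 2)"

lemma zonal_const_pos: "0 < zonal_const TYPE('a::euclidean_space)"
  using surface_measure_sphere_pos[where 'a='a] angular_mass_pos by (simp add: zonal_const_def)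

text \<open>Both sides have the same moments: they obey the same two-step recursion and agree for k
  = 0 and k = 1. Linearity extends the equality to polynomials and uniform approximation to
  continuous \<phi>.\<close>

theorem surface_integral_zonal:
  fixes e :: "'a::euclidean_space" and \<phi> :: "real \<Rightarrow> real"
  assumes N: "2 \<le> DIM('a)" and e: "norm e = 1" and \<phi>: "continuous_on {-1..1} \<phi>"
  shows "(\<integral>y. \<phi> (y \<bullet> e) \<partial>surface_measure) =
    zonal_const TYPE('a) * integral {0..pi} (\<lambda>\<theta>. \<phi> (cos \<theta>) * sin \<theta> ^ (DIM('a) - 2))"
proof -
  define D where "D = DIM('a) - 2"
  have ND: "real DIM('a) = real D + 2" using N by (simp add: D_def)
  let ?C = "zonal_const TYPE('a)"
  let ?I = "\<lambda>\<phi>. integral {0..pi} (\<lambda>\<theta>. \<phi> (cos \<theta>) * sin \<theta> ^ D)"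
  let ?J = "\<lambda>\<phi>. (\<integral>y. \<phi> (y \<bullet> e) \<partial>surface_measure)"
  have mon: "?J (\<lambda>t. t ^ k) = ?C * ?I (\<lambda>t. t ^ k)" for k
  proof (induction k rule: nat_less_induct)
    case (1 k)
    consider "k = 0" | "k = 1" | j where "k = j + 2"
      by (metis One_nat_def add.commute add_2_eq_Suc not0_implies_Suc)
    then show ?case
    proof cases
      case 1
      then show ?thesis using angular_mass_pos[of D]
        by (simp add: zonal_const_def angular_mass_def D_def)
    next
      case 2
      then show ?thesis using sphere_moment_recursion(2)[OF e N] angular_moment_recursion(2)[of D] by simp
    next
      case (3 j)
      then have "?J (\<lambda>t. t ^ j) = ?C * ?I (\<lambda>t. t ^ j)" using 1 by simp
      then have "(real D + 2 + real j) * ?J (\<lambda>t. t ^ (j + 2)) = (real D + 2 + real j) * (?C * ?I (\<lambda>t. t ^ (j + 2)))"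
        using sphere_moment_recursion(1)[OF e, of j] angular_moment_recursion(1)[of D j] unfolding ND
        by (simp only: mult.left_commute[of _ ?C])
      then show ?thesis using 3 by (simp only: mult_cancel_left) linarith
    qed
  qed
  have int: "integrable surface_measure (\<lambda>y::'a. f (y \<bullet> e))" if "continuous_on {-1..1} f" for f :: "real \<Rightarrow> real"
    by (intro integrable_surface_continuous continuous_on_inner_compose[OF that e])
  have cI: "(\<lambda>\<theta>. f (cos \<theta>) * sin \<theta> ^ D) integrable_on {0..pi}" if "continuous_on {-1..1} f" for f :: "real \<Rightarrow> real"
    by (intro integrable_continuous_interval continuous_intros continuous_on_compose2[OF that]) auto
  have cp: "continuous_on {-1..1} (\<lambda>t::real. t ^ i)" for i by (intro continuous_intros)
  have poly: "?J g = ?C * ?I g" if g: "real_polynomial_function g" for g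
  proof -
    obtain a K where g: "g = (\<lambda>t. \<Sum>i\<le>K. a i * t ^ i)"
      using real_polynomial_function_imp_sum[OF g] by blast
    have "?J g = (\<Sum>i\<le>K. (\<integral>y. a i * (y \<bullet> e) ^ i \<partial>surface_measure))"
      unfolding g by (intro Bochner_Integration.integral_sum integrable_mult_right int cp)
    also have "\<dots> = (\<Sum>i\<le>K. a i * (?C * ?I (\<lambda>t. t ^ i)))"
      by (simp only: integral_mult_right_zero mon)
    also have "\<dots> = ?C * (\<Sum>i\<le>K. integral {0..pi} (\<lambda>\<theta>. a i * (cos \<theta> ^ i * sin \<theta> ^ D)))"
      by (simp add: sum_distrib_left mult_ac)
    also have "(\<Sum>i\<le>K. integral {0..pi} (\<lambda>\<theta>. a i * (cos \<theta> ^ i * sin \<theta> ^ D))) = integral {0..pi} (\<lambda>\<theta>. \<Sum>i\<le>K. a i * (cos \<theta> ^ i * sin \<theta> ^ D))"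
      by (rule integral_sum[symmetric]) (auto intro!: integrable_on_mult_right cI[OF cp])
    also have "\<dots> = ?I g" by (simp add: g sum_distrib_right mult.assoc)
    finally show ?thesis .
  qed
  obtain g where g: "\<And>k. real_polynomial_function (g k)"
    "\<And>k t. t \<in> {-1..1} \<Longrightarrow> \<bar>g k t - \<phi> t\<bar> \<le> 1 / real (Suc k)"
    using weierstrass_sequence[OF \<phi>] by blast
  have cg: "continuous_on {-1..1} (g k)" for k
    using g(1)[of k] by (intro continuous_on_polymonial_function) (simp add: real_polynomial_function_eq)
  have one: "integrable surface_measure (\<lambda>_::'a. 1::complex)"
    by (intro integrable_surface_continuous continuous_intros)
  have "(\<lambda>k. complex_of_real (?J (g k))) \<longlonglongrightarrow> complex_of_real (?J \<phi>)"
    using weierstrass_integral[OF \<phi> g one e] by (simp only: mult_1_right integral_complex_of_real)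
  then have L: "(\<lambda>k. ?J (g k)) \<longlonglongrightarrow> ?J \<phi>" by (simp only: tendsto_of_real_iff)
  have "(\<lambda>k. ?I (g k)) \<longlonglongrightarrow> ?I \<phi>"
  proof (rule LIM_zero_cancel, rule Lim_null_comparison)
    show "(\<lambda>k. pi * inverse (real (Suc k))) \<longlonglongrightarrow> 0"
      using tendsto_mult_right_zero[OF LIMSEQ_inverse_real_of_nat] by simp
    show "\<forall>\<^sub>F k in sequentially. norm (?I (g k) - ?I \<phi>) \<le> pi * inverse (real (Suc k))"
    proof (rule always_eventually, rule allI)
      fix k
      have "norm (?I (g k) - ?I \<phi>) = norm (integral {0..pi} (\<lambda>\<theta>. g k (cos \<theta>) * sin \<theta> ^ D - \<phi> (cos \<theta>) * sin \<theta> ^ D))"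
        by (simp only: Henstock_Kurzweil_Integration.integral_diff[OF cI[OF cg] cI[OF \<phi>]])
      also have "\<dots> \<le> integral {0..pi} (\<lambda>_. 1 / real (Suc k))"
      proof (rule Henstock_Kurzweil_Integration.integral_norm_bound_integral)
        show "(\<lambda>\<theta>. g k (cos \<theta>) * sin \<theta> ^ D - \<phi> (cos \<theta>) * sin \<theta> ^ D) integrable_on {0..pi}"
          by (intro Henstock_Kurzweil_Integration.integrable_diff cI cg \<phi>)
        fix \<theta> assume "\<theta> \<in> {0..pi}"
        then have s: "0 \<le> sin \<theta>" by (auto intro: sin_ge_zero)
        have "norm (g k (cos \<theta>) * sin \<theta> ^ D - \<phi> (cos \<theta>) * sin \<theta> ^ D) = \<bar>g k (cos \<theta>) - \<phi> (cos \<theta>)\<bar> * sin \<theta> ^ D"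
          using s by (simp add: abs_mult flip: left_diff_distrib)
        also have "\<dots> \<le> 1 / real (Suc k) * 1"
          using s by (intro mult_mono g(2) power_le_one) auto
        finally show "norm (g k (cos \<theta>) * sin \<theta> ^ D - \<phi> (cos \<theta>) * sin \<theta> ^ D) \<le> 1 / real (Suc k)" by simp
      qed auto
      also have "\<dots> = pi * inverse (real (Suc k))" by (simp add: divide_inverse)
      finally show "norm (?I (g k) - ?I \<phi>) \<le> pi * inverse (real (Suc k))" .
    qed
  qed
  then have "(\<lambda>k. ?J (g k)) \<longlonglongrightarrow> ?C * ?I \<phi>"
    unfolding poly[OF g(1)] by (intro tendsto_intros)
  with L show ?thesis unfolding D_def by (rule LIMSEQ_unique)
qed

section \<open>Legendre polynomials and the reproducing kernel\<close>

text \<open>A superposition of the powers of y \<bullet> x: as a function of x it is a homogeneous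
  polynomial of degree m, even if f is merely integrable.\<close>

definition moment :: "('a::euclidean_space \<Rightarrow> complex) \<Rightarrow> nat \<Rightarrow> 'a \<Rightarrow> complex" where
  "moment f m x = (\<integral>y. of_real ((y \<bullet> x) ^ m) * f y \<partial>surface_measure)"

lemma integrable_surface_inner_mult:
  fixes f :: "'a::euclidean_space \<Rightarrow> complex"
  assumes "integrable surface_measure f"
  shows "integrable surface_measure (\<lambda>y. of_real ((y \<bullet> x) ^ m) * f y)"
    "integrable surface_measure (\<lambda>y. of_real (y \<bullet> x) * f y)"
  by (intro integrable_surface_mult assms continuous_intros)+

lemma moment_Suc:
  assumes "integrable surface_measure f"
  shows "moment f (Suc m) x = (\<Sum>b\<in>Basis. of_real (x \<bullet> b) * moment (\<lambda>y. of_real (y \<bullet> b) * f y) m x)"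
proof -
  have "moment f (Suc m) x = (\<integral>y. (\<Sum>b\<in>Basis. of_real (x \<bullet> b) * (of_real ((y \<bullet> x) ^ m) * (of_real (y \<bullet> b) * f y))) \<partial>surface_measure)"
    unfolding moment_def
  proof (rule Bochner_Integration.integral_cong[OF refl])
    fix y
    have "of_real ((y \<bullet> x) ^ Suc m) * f y = of_real (\<Sum>b\<in>Basis. (y \<bullet> b) * (x \<bullet> b)) * (of_real ((y \<bullet> x) ^ m) * f y)"
      by (simp add: euclidean_inner[of y x] flip: of_real_sum)
    then show "of_real ((y \<bullet> x) ^ Suc m) * f y = (\<Sum>b\<in>Basis. of_real (x \<bullet> b) * (of_real ((y \<bullet> x) ^ m) * (of_real (y \<bullet> b) * f y)))"
      by (simp add: sum_distrib_right sum_distrib_left mult_ac)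
  qed
  also have "\<dots> = (\<Sum>b\<in>Basis. (\<integral>y. of_real (x \<bullet> b) * (of_real ((y \<bullet> x) ^ m) * (of_real (y \<bullet> b) * f y)) \<partial>surface_measure))"
    by (intro Bochner_Integration.integral_sum integrable_mult_right integrable_surface_inner_mult assms)
  finally show ?thesis by (simp add: moment_def)
qed

lemma moment_direction:
  assumes "integrable surface_measure f"
  shows "(\<Sum>b\<in>Basis. of_real (v \<bullet> b) * moment (\<lambda>y. of_real (y \<bullet> b) * f y) m x) = moment (\<lambda>y. of_real (y \<bullet> v) * f y) m x"
proof -
  have "moment (\<lambda>y. of_real (y \<bullet> v) * f y) m x = (\<integral>y. (\<Sum>b\<in>Basis. of_real (v \<bullet> b) * (of_real ((y \<bullet> x) ^ m) * (of_real (y \<bullet> b) * f y))) \<partial>surface_measure)"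
    unfolding moment_def
  proof (rule Bochner_Integration.integral_cong[OF refl])
    fix y
    have "complex_of_real (y \<bullet> v) = of_real (\<Sum>b\<in>Basis. (y \<bullet> b) * (v \<bullet> b))"
      by (simp only: euclidean_inner[of y v])
    then show "of_real ((y \<bullet> x) ^ m) * (of_real (y \<bullet> v) * f y) = (\<Sum>b\<in>Basis. of_real (v \<bullet> b) * (of_real ((y \<bullet> x) ^ m) * (of_real (y \<bullet> b) * f y)))"
      by (simp add: sum_distrib_right sum_distrib_left mult_ac)
  qed
  also have "\<dots> = (\<Sum>b\<in>Basis. (\<integral>y. of_real (v \<bullet> b) * (of_real ((y \<bullet> x) ^ m) * (of_real (y \<bullet> b) * f y)) \<partial>surface_measure))"
    by (intro Bochner_Integration.integral_sum integrable_mult_right integrable_surface_inner_mult assms)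
  finally show ?thesis by (simp add: moment_def)
qed

text \<open>One factor y \<bullet> x is expanded in the basis. The coefficients are moments of (y
  \<bullet> b) f, so the induction must range over all integrable f, and the derivative is carried
  along because the product rule calls for it.\<close>

lemma moment_polynomial:
  fixes f :: "'a::euclidean_space \<Rightarrow> complex"
  assumes "integrable surface_measure f"
  shows "polynomial_function (moment f m) \<and>
    (\<forall>v. partial_deriv v (moment f m) = (\<lambda>x. of_nat m * moment (\<lambda>y. of_real (y \<bullet> v) * f y) (m - 1) x))"
  using assms
proof (induction m arbitrary: f)
  case 0
  have "moment f 0 = (\<lambda>_. \<integral>y. f y \<partial>surface_measure)" by (simp add: moment_def fun_eq_iff)
  then show ?case by (simp add: partial_deriv_const)
next
  case (Suc m)
  have i: "integrable surface_measure (\<lambda>y. of_real (y \<bullet> b) * f y)" for b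
    by (intro integrable_surface_inner_mult Suc.prems)
  have p: "polynomial_function (moment (\<lambda>y. of_real (y \<bullet> b) * f y) m)" for b using Suc.IH[OF i] by blast
  have xb: "polynomial_function (\<lambda>x::'a. complex_of_real (x \<bullet> b))" for b by (intro poly_intros)
  have eq: "moment f (Suc m) = (\<lambda>x. \<Sum>b\<in>Basis. of_real (x \<bullet> b) * moment (\<lambda>y. of_real (y \<bullet> b) * f y) m x)"
    using moment_Suc[OF Suc.prems] by blast
  have "partial_deriv v (moment f (Suc m)) x = of_nat (Suc m) * moment (\<lambda>y. of_real (y \<bullet> v) * f y) m x" for v x
  proof -
    have "partial_deriv v (moment f (Suc m)) x =
      (\<Sum>b\<in>Basis. of_real (x \<bullet> b) * (of_nat m * moment (\<lambda>y. of_real (y \<bullet> b) * (of_real (y \<bullet> v) * f y)) (m - 1) x)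
        + of_real (v \<bullet> b) * moment (\<lambda>y. of_real (y \<bullet> b) * f y) m x)"
      unfolding eq
      by (subst partial_deriv_sum[OF polynomial_function_complex_mult[OF xb p]])
        (simp add: partial_deriv_mult[OF xb p] partial_deriv_inner Suc.IH[OF i] mult.left_commute)
    also have "\<dots> = of_nat m * (\<Sum>b\<in>Basis. of_real (x \<bullet> b) * moment (\<lambda>y. of_real (y \<bullet> b) * (of_real (y \<bullet> v) * f y)) (m - 1) x)
        + moment (\<lambda>y. of_real (y \<bullet> v) * f y) m x"
      unfolding sum.distrib moment_direction[OF Suc.prems] by (simp add: sum_distrib_left mult_ac)
    also have "of_nat m * (\<Sum>b\<in>Basis. of_real (x \<bullet> b) * moment (\<lambda>y. of_real (y \<bullet> b) * (of_real (y \<bullet> v) * f y)) (m - 1) x) =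
        of_nat m * moment (\<lambda>y. of_real (y \<bullet> v) * f y) m x"
      by (cases m) (simp_all add: moment_Suc[OF i])
    finally show ?thesis by (simp add: algebra_simps)
  qed
  moreover have "polynomial_function (moment f (Suc m))"
    unfolding eq by (intro polynomial_function_sum polynomial_function_complex_mult xb p finite_Basis)
  ultimately show ?case by (simp add: fun_eq_iff)
qed

lemma homogeneous_moment: "homogeneous m (moment f m)"
  by (simp add: homogeneous_def moment_def power_mult_distrib mult.assoc)

text \<open>The two derivatives bring out the square of y \<bullet> b, and summed over the basis
  these squares give y \<bullet> y = 1 on the sphere.\<close>

lemma laplacian_moment:
  fixes f :: "'a::euclidean_space \<Rightarrow> complex"
  assumes f: "integrable surface_measure f"
  shows "laplacian (moment f m) x = of_real (real m * (real m - 1)) * moment f (m - 2) x"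
proof -
  have i: "integrable surface_measure (\<lambda>y. of_real (y \<bullet> b) * f y)" for b
    by (intro integrable_surface_inner_mult f)
  have "partial_deriv b (partial_deriv b (moment f m)) x =
      of_nat m * (of_nat (m - 1) * moment (\<lambda>y. of_real (y \<bullet> b) * (of_real (y \<bullet> b) * f y)) (m - 1 - 1) x)" for b
    using moment_polynomial[OF f, of m] moment_polynomial[OF i, of b "m - 1"]
    by (simp add: partial_deriv_cmult)
  then have "laplacian (moment f m) x = of_nat m * of_nat (m - 1) * (\<Sum>b\<in>Basis. moment (\<lambda>y. of_real (y \<bullet> b) * (of_real (y \<bullet> b) * f y)) (m - 2) x)"
    by (simp add: laplacian_def sum_distrib_left mult.assoc numeral_2_eq_2)
  also have "(\<Sum>b\<in>Basis. moment (\<lambda>y. of_real (y \<bullet> b) * (of_real (y \<bullet> b) * f y)) (m - 2) x) =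
      (\<integral>y. (\<Sum>b\<in>Basis. of_real ((y \<bullet> x) ^ (m - 2)) * (of_real (y \<bullet> b) * (of_real (y \<bullet> b) * f y))) \<partial>surface_measure)"
    unfolding moment_def
    by (intro Bochner_Integration.integral_sum[symmetric] integrable_surface_inner_mult f)
  also have "\<dots> = moment f (m - 2) x"
    unfolding moment_def
  proof (rule Bochner_Integration.integral_cong[OF refl])
    fix y :: 'a assume "y \<in> space surface_measure"
    then have "(\<Sum>b\<in>Basis. (y \<bullet> b) * (y \<bullet> b)) = 1"
      by (simp add: euclidean_inner[symmetric] norm_eq_1)
    then have S: "(\<Sum>b\<in>Basis. complex_of_real ((y \<bullet> b) * (y \<bullet> b))) = 1" by (simp flip: of_real_sum of_real_mult)
    have "(\<Sum>b\<in>Basis. of_real ((y \<bullet> x) ^ (m - 2)) * (of_real (y \<bullet> b) * (of_real (y \<bullet> b) * f y))) =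
        of_real ((y \<bullet> x) ^ (m - 2)) * ((\<Sum>b\<in>Basis. complex_of_real ((y \<bullet> b) * (y \<bullet> b))) * f y)"
      by (simp add: sum_distrib_left sum_distrib_right mult_ac)
    then show "(\<Sum>b\<in>Basis. of_real ((y \<bullet> x) ^ (m - 2)) * (of_real (y \<bullet> b) * (of_real (y \<bullet> b) * f y))) = of_real ((y \<bullet> x) ^ (m - 2)) * f y"
      by (simp only: S mult_1_left)
  qed
  finally show ?thesis by (cases m) auto
qed

section \<open>The normalised zonal polynomials and their reproducing property\<close>

definition legendre :: "nat \<Rightarrow> nat \<Rightarrow> real poly" where
  "legendre N n = smult (inverse (poly (zonal_poly N n) 1)) (zonal_poly N n)"

definition frequency :: "nat \<Rightarrow> nat \<Rightarrow> real" where
  "frequency N n = sqrt (real n * (real n + real N - 2))"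

lemma frequency_bounds:
  assumes "2 \<le> N" "1 \<le> n"
  shows "real n \<le> frequency N n" "frequency N n \<le> sqrt (real N) * real n"
proof -
  have "real n * real n \<le> real n * (real n + real N - 2)" using assms by (intro mult_left_mono) auto
  then show "real n \<le> frequency N n"
    unfolding frequency_def by (intro real_le_rsqrt) (simp add: power2_eq_square)
  have "real n + real N - 2 \<le> real N * real n"
  proof -
    have "0 \<le> (real N - 1) * (real n - 1)" using assms by (intro mult_nonneg_nonneg) auto
    then show ?thesis by (simp add: algebra_simps)
  qed
  then have "real n * (real n + real N - 2) \<le> real n * (real N * real n)" by (intro mult_left_mono) auto
  then have "frequency N n \<le> sqrt (real n * (real N * real n))" unfolding frequency_def by simp
  also have "\<dots> = sqrt (real N) * real n" by (simp add: real_sqrt_mult)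
  finally show "frequency N n \<le> sqrt (real N) * real n" .
qed

lemma zonal_ode_zonal_poly:
  assumes "3 \<le> N" "1 \<le> n"
  shows "zonal_ode (N - 2) (frequency N n) (zonal_poly N n)"
proof
  show "1 \<le> N - 2" using assms by simp
  show "1 \<le> frequency N n" using frequency_bounds(1)[of N n] assms by linarith
  fix t
  have "(frequency N n)\<^sup>2 = real n * (real n + real N - 2)" using assms by (simp add: frequency_def)
  moreover have "real (N - 2) + 1 = real N - 1" using assms by simp
  ultimately show "(1 - t\<^sup>2) * poly (pderiv (pderiv (zonal_poly N n))) t - (real (N - 2) + 1) * t * poly (pderiv (zonal_poly N n)) t
      + (frequency N n)\<^sup>2 * poly (zonal_poly N n) t = 0"
    using zonal_poly_ode[of N t n] assms by simp
qed

lemma zonal_poly_1_nonzero: "3 \<le> N \<Longrightarrow> 1 \<le> n \<Longrightarrow> poly (zonal_poly N n) 1 \<noteq> 0"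
  using zonal_ode.poly_1_nonzero[OF zonal_ode_zonal_poly zonal_poly_nonzero] by blast

lemma legendre_1: "3 \<le> N \<Longrightarrow> 1 \<le> n \<Longrightarrow> poly (legendre N n) 1 = 1"
  by (simp add: legendre_def zonal_poly_1_nonzero)

lemma zonal_profile_legendre:
  assumes "3 \<le> N" "1 \<le> n"
  shows "zonal_profile (N - 2) (frequency N n) (legendre N n)"
proof -
  interpret Z: zonal_ode "N - 2" "frequency N n" "zonal_poly N n"
    using assms by (rule zonal_ode_zonal_poly)
  show ?thesis
  proof
    show "1 \<le> N - 2" by (rule Z.D)
    show "1 \<le> frequency N n" by (rule Z.\<omega>)
    fix t
    let ?c = "inverse (poly (zonal_poly N n) 1)"
    show "(1 - t\<^sup>2) * poly (pderiv (pderiv (legendre N n))) t - (real (N - 2) + 1) * t * poly (pderiv (legendre N n)) t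
      + (frequency N n)\<^sup>2 * poly (legendre N n) t = 0"
    proof -
      have "(1 - t\<^sup>2) * poly (pderiv (pderiv (legendre N n))) t - (real (N - 2) + 1) * t * poly (pderiv (legendre N n)) t
        + (frequency N n)\<^sup>2 * poly (legendre N n) t = ?c * ((1 - t\<^sup>2) * poly (pderiv (pderiv (zonal_poly N n))) t - (real (N - 2) + 1) * t * poly (pderiv (zonal_poly N n)) t
        + (frequency N n)\<^sup>2 * poly (zonal_poly N n) t)"
        unfolding legendre_def pderiv_smult poly_smult by (simp only: algebra_simps)
      then show ?thesis by (simp only: Z.ode mult_zero_right)
    qed
    show "poly (legendre N n) 1 = 1" using assms by (rule legendre_1)
    show "\<bar>poly (legendre N n) (- t)\<bar> = \<bar>poly (legendre N n) t\<bar>"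
      by (simp add: legendre_def zonal_poly_minus abs_mult)
  qed
qed

lemma laplacian_cmult:
  fixes f :: "'a::euclidean_space \<Rightarrow> complex"
  assumes "polynomial_function f"
  shows "laplacian (\<lambda>x. c * f x) = (\<lambda>x. c * laplacian f x)"
  unfolding laplacian_def
  by (simp only: partial_deriv_cmult[OF assms] partial_deriv_cmult[OF polynomial_function_partial_deriv[OF assms]] sum_distrib_left)

lemma legendre_combination_harmonic:
  fixes B :: "nat \<Rightarrow> 'a::euclidean_space \<Rightarrow> complex"
  assumes B: "\<And>m. polynomial_function (B m)" "\<And>m. homogeneous m (B m)"
    and lap: "\<And>m x. laplacian (B m) x = of_real (real m * (real m - 1)) * B (m - 2) x"
  obtains Y where "Y \<in> harmonic_polynomials n"
    "\<And>x. norm x = 1 \<Longrightarrow> Y x = of_real (inverse (poly (zonal_poly DIM('a) n) 1)) *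
      (\<Sum>k\<le>n div 2. of_real (zonal_coeff DIM('a) n k) * B (n - 2 * k) x)"
proof
  let ?c = "of_real (inverse (poly (zonal_poly DIM('a) n) 1)) :: complex"
  let ?Y = "\<lambda>x. \<Sum>k\<le>n div 2. of_real (zonal_coeff DIM('a) n k) * (B (n - 2 * k) x * of_real ((x \<bullet> x) ^ k))"
  have Y: "?Y \<in> harmonic_polynomials n" by (rule zonal_combination_harmonic[OF B lap])
  note YD = harmonic_polynomialsD[OF Y]
  have "laplacian (\<lambda>x. ?c * ?Y x) = (\<lambda>x. ?c * laplacian ?Y x)"
    by (rule laplacian_cmult[OF YD(1)])
  then show "(\<lambda>x. ?c * ?Y x) \<in> harmonic_polynomials n"
    using YD unfolding harmonic_polynomials_iff
    by (intro conjI polynomial_function_complex_mult polynomial_function_const homogeneous_cmult) auto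
  fix x :: 'a assume "norm x = 1"
  then have "x \<bullet> x = 1" by (simp add: norm_eq_1)
  then show "?c * ?Y x = ?c * (\<Sum>k\<le>n div 2. of_real (zonal_coeff DIM('a) n k) * B (n - 2 * k) x)" by simp
qed

lemma poly_legendre: "poly (legendre N n) t = inverse (poly (zonal_poly N n) 1) * (\<Sum>k\<le>n div 2. zonal_coeff N n k * t ^ (n - 2 * k))"
  by (simp add: legendre_def poly_zonal_poly)

lemma legendre_harmonic:
  fixes e :: "'a::euclidean_space"
  assumes e: "norm e = 1"
  obtains Y where "Y \<in> harmonic_polynomials n"
    "\<And>y. norm y = 1 \<Longrightarrow> Y y = of_real (poly (legendre DIM('a) n) (y \<bullet> e))"
proof -
  let ?B = "\<lambda>m y. complex_of_real ((y \<bullet> e) ^ m)"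
  have f: "polynomial_function (\<lambda>y::'a. complex_of_real (y \<bullet> e))" by (intro poly_intros)
  have p: "polynomial_function (\<lambda>y::'a. complex_of_real (y \<bullet> e) ^ m)" for m by (intro poly_intros)
  have lap: "laplacian (?B m) y = of_real (real m * (real m - 1)) * ?B (m - 2) y" for m and y :: 'a
  proof -
    have "partial_deriv b (partial_deriv b (\<lambda>y. complex_of_real (y \<bullet> e) ^ m)) y =
      of_nat m * (of_nat (m - 1) * of_real (y \<bullet> e) ^ (m - 1 - 1) * of_real (b \<bullet> e)) * of_real (b \<bullet> e)" for b
    proof -
      have q: "polynomial_function (\<lambda>y::'a. of_nat m * complex_of_real (y \<bullet> e) ^ (m - 1))" by (intro poly_intros)
      have "partial_deriv b (\<lambda>y. complex_of_real (y \<bullet> e) ^ m) = (\<lambda>y. of_real (b \<bullet> e) * (of_nat m * complex_of_real (y \<bullet> e) ^ (m - 1)))"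
        unfolding partial_deriv_power[OF f] partial_deriv_inner by (simp add: mult_ac)
      then show ?thesis
        by (simp only: partial_deriv_cmult[OF q] partial_deriv_cmult[OF p] partial_deriv_power[OF f] partial_deriv_inner) (simp add: mult_ac)
    qed
    then have "laplacian (?B m) y = of_nat m * of_nat (m - 1) * of_real (y \<bullet> e) ^ (m - 1 - 1) * of_real (\<Sum>b\<in>Basis. (e \<bullet> b) * (e \<bullet> b))"
      by (simp add: laplacian_def sum_distrib_left mult_ac inner_commute[of e])
    also have "(\<Sum>b\<in>Basis. (e \<bullet> b) * (e \<bullet> b)) = 1"
      using e by (simp add: euclidean_inner[symmetric] norm_eq_1)
    finally show ?thesis by (cases m) (auto simp: numeral_2_eq_2)
  qed
  have hom: "homogeneous m (?B m)" for m by (rule homogeneous_inner_power)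
  have pB: "polynomial_function (?B m :: 'a \<Rightarrow> complex)" for m using p[of m] by simp
  show ?thesis
    using legendre_combination_harmonic[of ?B n, OF pB hom lap] that
    by (auto simp: poly_legendre)
qed

text \<open>Integrating the zonal harmonic over its pole stays within the harmonic polynomials. This
  provides the projection of f without an orthonormal basis of the space of harmonics.\<close>

lemma legendre_integral_harmonic:
  fixes f :: "'a::euclidean_space \<Rightarrow> complex"
  assumes f: "integrable surface_measure f"
  obtains Y where "Y \<in> harmonic_polynomials n"
    "\<And>x. norm x = 1 \<Longrightarrow> Y x = (\<integral>y. of_real (poly (legendre DIM('a) n) (y \<bullet> x)) * f y \<partial>surface_measure)"
proof -
  have p: "polynomial_function (moment f m)" for m using moment_polynomial[OF f] by blast
  obtain Y where Y: "Y \<in> harmonic_polynomials n"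
    "\<And>x. norm x = 1 \<Longrightarrow> Y x = of_real (inverse (poly (zonal_poly DIM('a) n) 1)) *
      (\<Sum>k\<le>n div 2. of_real (zonal_coeff DIM('a) n k) * moment f (n - 2 * k) x)"
    using legendre_combination_harmonic[OF p homogeneous_moment laplacian_moment[OF f], of n] by blast
  have "(\<integral>y. of_real (poly (legendre DIM('a) n) (y \<bullet> x)) * f y \<partial>surface_measure) =
     of_real (inverse (poly (zonal_poly DIM('a) n) 1)) *
      (\<Sum>k\<le>n div 2. of_real (zonal_coeff DIM('a) n k) * moment f (n - 2 * k) x)" for x
  proof -
    have "(\<integral>y. of_real (poly (legendre DIM('a) n) (y \<bullet> x)) * f y \<partial>surface_measure) =
      (\<integral>y. of_real (inverse (poly (zonal_poly DIM('a) n) 1)) * (\<Sum>k\<le>n div 2. of_real (zonal_coeff DIM('a) n k) * (of_real ((y \<bullet> x) ^ (n - 2 * k)) * f y)) \<partial>surface_measure)"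
      by (simp add: poly_legendre sum_distrib_right mult.assoc)
    also have "\<dots> = of_real (inverse (poly (zonal_poly DIM('a) n) 1)) * (\<integral>y. (\<Sum>k\<le>n div 2. of_real (zonal_coeff DIM('a) n k) * (of_real ((y \<bullet> x) ^ (n - 2 * k)) * f y)) \<partial>surface_measure)"
      by (rule integral_mult_right_zero)
    also have "(\<integral>y. (\<Sum>k\<le>n div 2. of_real (zonal_coeff DIM('a) n k) * (of_real ((y \<bullet> x) ^ (n - 2 * k)) * f y)) \<partial>surface_measure) =
      (\<Sum>k\<le>n div 2. (\<integral>y. of_real (zonal_coeff DIM('a) n k) * (of_real ((y \<bullet> x) ^ (n - 2 * k)) * f y) \<partial>surface_measure))"
      by (intro Bochner_Integration.integral_sum integrable_mult_right integrable_surface_inner_mult f)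
    finally show ?thesis by (simp add: moment_def)
  qed
  with Y show ?thesis using that by simp
qed

lemma continuous_on_legendre: "continuous_on S (poly (legendre N n))"
  by (intro continuous_intros)

definition legendre_mass :: "'a::euclidean_space itself \<Rightarrow> nat \<Rightarrow> real" where
  "legendre_mass _ n = zonal_const TYPE('a) *
     integral {0..pi} (\<lambda>\<theta>. (poly (legendre DIM('a) n) (cos \<theta>))\<^sup>2 * sin \<theta> ^ (DIM('a) - 2))"

lemma legendre_mass_eq:
  fixes e :: "'a::euclidean_space"
  assumes "2 \<le> DIM('a)" "norm e = 1"
  shows "(\<integral>y. (poly (legendre DIM('a) n) (y \<bullet> e))\<^sup>2 \<partial>surface_measure) = legendre_mass TYPE('a) n"
  unfolding legendre_mass_def
  by (rule surface_integral_zonal[OF assms, of "\<lambda>t. (poly (legendre DIM('a) n) t)\<^sup>2"]) (intro continuous_intros)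

text \<open>Funk--Hecke for the two harmonics P (y \<bullet> x) and P (y \<bullet> e), both at the
  point e: the second has value 1 there and the first P (e \<bullet> x).\<close>

lemma zonal_convolution:
  fixes x e :: "'a::euclidean_space"
  assumes N: "3 \<le> DIM('a)" and n: "1 \<le> n" and x: "norm x = 1" and e: "norm e = 1" and \<phi>: "continuous_on {-1..1} \<phi>"
  shows "(\<integral>y. \<phi> (y \<bullet> e) * poly (legendre DIM('a) n) (y \<bullet> x) \<partial>surface_measure) =
    poly (legendre DIM('a) n) (e \<bullet> x) * (\<integral>y. \<phi> (y \<bullet> e) * poly (legendre DIM('a) n) (y \<bullet> e) \<partial>surface_measure)"
proof -
  let ?P = "poly (legendre DIM('a) n)"
  obtain Y where Y: "Y \<in> harmonic_polynomials n" "\<And>y. norm y = 1 \<Longrightarrow> Y y = of_real (?P (y \<bullet> x))"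
    using legendre_harmonic[OF x] by blast
  obtain Z where Z: "Z \<in> harmonic_polynomials n" "\<And>y. norm y = 1 \<Longrightarrow> Z y = of_real (?P (y \<bullet> e))"
    using legendre_harmonic[OF e] by blast
  have "(\<integral>y. of_real (\<phi> (y \<bullet> e)) * Y y \<partial>surface_measure) * Z e = (\<integral>y. of_real (\<phi> (y \<bullet> e)) * Z y \<partial>surface_measure) * Y e"
    using N by (intro funk_hecke[OF _ \<phi> Y(1) Z(1) e e]) simp
  moreover have "(\<integral>y. of_real (\<phi> (y \<bullet> e)) * Y y \<partial>surface_measure) = of_real (\<integral>y. \<phi> (y \<bullet> e) * ?P (y \<bullet> x) \<partial>surface_measure)"
    unfolding integral_complex_of_real[symmetric] by (rule Bochner_Integration.integral_cong) (auto simp: Y)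
  moreover have "(\<integral>y. of_real (\<phi> (y \<bullet> e)) * Z y \<partial>surface_measure) = of_real (\<integral>y. \<phi> (y \<bullet> e) * ?P (y \<bullet> e) \<partial>surface_measure)"
    unfolding integral_complex_of_real[symmetric] by (rule Bochner_Integration.integral_cong) (auto simp: Z)
  moreover have "Z e = 1" using e legendre_1[OF N n] by (simp add: Z norm_eq_1)
  moreover have "Y e = of_real (?P (e \<bullet> x))" using Y(2)[OF e] .
  ultimately show ?thesis
    by (simp only: mult_1_right mult.commute[of "poly _ _"] of_real_mult[symmetric] of_real_eq_iff)
qed

text \<open>The Funk--Hecke multiplier of the profile P is found by testing it on P (y \<bullet> x)
  itself, whose value at x is 1.\<close>

lemma legendre_reproducing:
  fixes x :: "'a::euclidean_space"
  assumes N: "3 \<le> DIM('a)" and n: "1 \<le> n" and x: "norm x = 1" and Y: "Y \<in> harmonic_polynomials n"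
  shows "(\<integral>y. of_real (poly (legendre DIM('a) n) (y \<bullet> x)) * Y y \<partial>surface_measure) = of_real (legendre_mass TYPE('a) n) * Y x"
proof -
  let ?P = "poly (legendre DIM('a) n)"
  obtain Z where Z: "Z \<in> harmonic_polynomials n" "\<And>y. norm y = 1 \<Longrightarrow> Z y = of_real (?P (y \<bullet> x))"
    using legendre_harmonic[OF x] by blast
  have "(\<integral>y. of_real (?P (y \<bullet> x)) * Y y \<partial>surface_measure) * Z x = (\<integral>y. of_real (?P (y \<bullet> x)) * Z y \<partial>surface_measure) * Y x"
    using N by (intro funk_hecke[OF _ continuous_on_legendre Y Z(1) x x]) simp
  moreover have "(\<integral>y. of_real (?P (y \<bullet> x)) * Z y \<partial>surface_measure) = of_real (\<integral>y. (?P (y \<bullet> x))\<^sup>2 \<partial>surface_measure)"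
    unfolding integral_complex_of_real[symmetric] by (rule Bochner_Integration.integral_cong) (auto simp: Z power2_eq_square)
  moreover have "Z x = 1" using x legendre_1[OF N n] by (simp add: Z norm_eq_1)
  ultimately show ?thesis using legendre_mass_eq[OF _ x, of n] N by simp
qed

section \<open>The projection as convolution with the zonal kernel\<close>

lemma Lp_norm_2_finite_iff:
  "Lp_norm M 2 f < \<infinity> \<longleftrightarrow> (\<integral>\<^sup>+ x. ennreal ((norm (f x))\<^sup>2) \<partial>M) < \<infinity>"
proof -
  have "norm (f x) powr enn2real 2 = (norm (f x))\<^sup>2" for x
    by (cases "norm (f x) = 0") (auto simp: powr_numeral)
  then show ?thesis by (auto simp: Lp_norm_def Let_def top.not_eq_extremum)
qed

lemma emeasure_sphere_finite: "emeasure surface_measure (sphere 0 1 :: 'a::euclidean_space set) < top"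
  using finite_measure.emeasure_finite[OF finite_measure_surface_measure, of "sphere 0 1 :: 'a set"]
  by (metis infinity_ennreal_def less_top)

lemma integrable_of_L2:
  fixes f :: "'a::euclidean_space \<Rightarrow> complex"
  assumes "f \<in> Lp_space surface_measure 2"
  shows "integrable surface_measure f"
proof (rule integrableI_bounded)
  interpret finite_measure "surface_measure :: 'a measure" by (rule finite_measure_surface_measure)
  show m: "f \<in> borel_measurable surface_measure" using assms by (simp add: Lp_space_def)
  have fin: "(\<integral>\<^sup>+ x. ennreal ((norm (f x))\<^sup>2) \<partial>surface_measure) < \<infinity>"
    using assms unfolding Lp_norm_2_finite_iff[symmetric] by (simp add: Lp_space_def)
  have "(\<integral>\<^sup>+ x. ennreal (norm (f x)) \<partial>surface_measure) \<le> (\<integral>\<^sup>+ x. 1 + ennreal ((norm (f x))\<^sup>2) \<partial>surface_measure)"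
  proof (rule nn_integral_mono)
    fix x
    have "norm (f x) \<le> 1 + (norm (f x))\<^sup>2"
      using sum_squares_ge_zero[of "norm (f x) - 1/2" 0] by (simp add: power2_eq_square algebra_simps)
    then have "ennreal (norm (f x)) \<le> ennreal (1 + (norm (f x))\<^sup>2)" by (rule ennreal_leI)
    then show "ennreal (norm (f x)) \<le> 1 + ennreal ((norm (f x))\<^sup>2)" by (simp add: ennreal_plus)
  qed
  also have "\<dots> = emeasure surface_measure (space surface_measure :: 'a set) + (\<integral>\<^sup>+ x. ennreal ((norm (f x))\<^sup>2) \<partial>surface_measure)"
    using m by (subst nn_integral_add) auto
  also have "\<dots> < \<infinity>" using fin emeasure_sphere_finite[where 'a='a] by simp
  finally show "(\<integral>\<^sup>+ x. ennreal (norm (f x)) \<partial>surface_measure) < \<infinity>" .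
qed

lemma bounded_in_L2:
  fixes f :: "'a::euclidean_space \<Rightarrow> complex"
  assumes m: "f \<in> borel_measurable surface_measure" and C: "\<And>x. norm x = 1 \<Longrightarrow> norm (f x) \<le> C"
  shows "f \<in> Lp_space surface_measure 2"
proof -
  interpret finite_measure "surface_measure :: 'a measure" by (rule finite_measure_surface_measure)
  have "(\<integral>\<^sup>+ x. ennreal ((norm (f x))\<^sup>2) \<partial>surface_measure) \<le> (\<integral>\<^sup>+ x. ennreal (C\<^sup>2) \<partial>(surface_measure :: 'a measure))"
    using C by (intro nn_integral_mono ennreal_leI power_mono) auto
  also have "\<dots> < \<infinity>" using emeasure_sphere_finite[where 'a='a] by (simp add: ennreal_mult_less_top)
  finally show ?thesis using m unfolding Lp_norm_2_finite_iff[symmetric] by (simp add: Lp_space_def)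
qed

lemma sphere_bounded:
  fixes g :: "'a::euclidean_space \<Rightarrow> 'b::real_normed_vector"
  assumes "continuous_on (sphere 0 1) g"
  shows "\<exists>B. \<forall>y. norm y = 1 \<longrightarrow> norm (g y) \<le> B"
proof -
  have "compact (g ` sphere 0 1)" by (intro compact_continuous_image assms) auto
  from compact_imp_bounded[OF this] obtain B where "\<forall>x\<in>g ` sphere 0 1. norm x \<le> B"
    unfolding bounded_iff by blast
  then show ?thesis by (intro exI[of _ B]) auto
qed

text \<open>The kernel depends on y \<bullet> x only and is therefore symmetric, so exchanging the
  integrals moves the convolution from f to g. This gives orthogonality of the projection and, later
  on, the duality estimates.\<close>

lemma kernel_fubini:
  fixes f g :: "'a::euclidean_space \<Rightarrow> complex" and k :: "real \<Rightarrow> real"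
  assumes f: "integrable surface_measure f" and g: "continuous_on (sphere 0 1) g" and k: "continuous_on UNIV k"
  shows "(\<integral>x. (\<integral>y. of_real (k (y \<bullet> x)) * f y \<partial>surface_measure) * g x \<partial>surface_measure) =
    (\<integral>y. f y * (\<integral>x. of_real (k (x \<bullet> y)) * g x \<partial>surface_measure) \<partial>surface_measure)"
proof -
  let ?M = "surface_measure :: 'a measure"
  interpret finite_measure ?M by (rule finite_measure_surface_measure)
  interpret P: pair_sigma_finite ?M ?M ..
  obtain B where B: "\<And>y. norm y = 1 \<Longrightarrow> norm (g y) \<le> B"
    using sphere_bounded[OF g] by metis
  have "compact (k ` {-1..1})" by (intro compact_continuous_image continuous_on_subset[OF k]) auto
  from compact_imp_bounded[OF this]
  obtain C where C: "\<And>t. t \<in> {-1..1} \<Longrightarrow> \<bar>k t\<bar> \<le> C"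
    unfolding bounded_iff by (simp only: ball_simps real_norm_def) blast
  have kb: "\<bar>k (y \<bullet> x)\<bar> \<le> C" if "norm x = 1" "norm y = 1" for x y :: 'a
    using C inner_sphere_bounds[OF that(2,1)] by blast
  have C0: "0 \<le> C" using C[of 0] by simp
  have B0: "0 \<le> B"
  proof -
    have "norm (SOME b::'a. b \<in> Basis) = 1" by (rule norm_Basis[OF SOME_Basis])
    from B[OF this] show ?thesis by (rule order_trans[OF norm_ge_zero])
  qed
  have fm[measurable]: "f \<in> borel_measurable ?M" using f by auto
  have gm[measurable]: "g \<in> borel_measurable ?M" by (rule borel_measurable_surface_continuous[OF g])
  have km[measurable]: "k \<in> borel_measurable borel" by (rule borel_measurable_continuous_onI[OF k])
  have im: "(\<lambda>p. fst p \<bullet> snd p) \<in> borel_measurable (?M \<Otimes>\<^sub>M ?M)"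
    by (intro borel_measurable_inner measurable_compose[OF measurable_fst measurable_surface_measure_imp_id]
        measurable_compose[OF measurable_snd measurable_surface_measure_imp_id])
  have km2: "(\<lambda>p. k (snd p \<bullet> fst p)) \<in> borel_measurable (?M \<Otimes>\<^sub>M ?M)"
    using measurable_compose[OF im km] by (simp add: inner_commute)
  let ?F = "\<lambda>p. complex_of_real (k (snd p \<bullet> fst p)) * f (snd p) * g (fst p)"
  have Fm: "?F \<in> borel_measurable (?M \<Otimes>\<^sub>M ?M)"
    using km2 by measurable
  have row: "integrable ?M (\<lambda>y. of_real (k (y \<bullet> x)) * f y)" for x
    by (intro integrable_surface_mult f continuous_intros continuous_on_compose2[OF k]) auto
  have Fi: "integrable (?M \<Otimes>\<^sub>M ?M) ?F"
  proof (rule P.Fubini_integrable[OF Fm])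
    show "AE x in ?M. integrable ?M (\<lambda>y. ?F (x, y))"
      using integrable_mult_left[OF row] by simp
    show "integrable ?M (\<lambda>x. \<integral>y. norm (?F (x, y)) \<partial>?M)"
    proof (rule integrable_const_bound[where B="C * B * (\<integral>y. norm (f y) \<partial>?M)"])
      show "(\<lambda>x. \<integral>y. norm (?F (x, y)) \<partial>?M) \<in> borel_measurable ?M"
        using Fm by (intro borel_measurable_lebesgue_integral) (simp add: case_prod_beta')
      show "AE x in ?M. norm (\<integral>y. norm (?F (x, y)) \<partial>?M) \<le> C * B * (\<integral>y. norm (f y) \<partial>?M)"
      proof (rule AE_I2)
        fix x :: 'a assume "x \<in> space ?M"
        then have x: "norm x = 1" by simp
        have "(\<integral>y. norm (?F (x, y)) \<partial>?M) \<le> (\<integral>y. C * B * norm (f y) \<partial>?M)"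
        proof (rule integral_mono)
          show "integrable ?M (\<lambda>y. norm (?F (x, y)))" using integrable_norm[OF integrable_mult_left[OF row]] by simp
          show "integrable ?M (\<lambda>y. C * B * norm (f y))" using f by simp
          fix y :: 'a assume "y \<in> space ?M"
          then have y: "norm y = 1" by simp
          have "norm (?F (x, y)) = \<bar>k (y \<bullet> x)\<bar> * norm (g x) * norm (f y)" by (simp add: norm_mult)
          also have "\<dots> \<le> C * B * norm (f y)"
            using kb[OF x y] B[OF x] C0 B0 by (intro mult_mono) auto
          finally show "norm (?F (x, y)) \<le> C * B * norm (f y)" .
        qed
        moreover have "0 \<le> (\<integral>y. norm (?F (x, y)) \<partial>?M)" by (rule integral_nonneg_AE) simp
        ultimately show "norm (\<integral>y. norm (?F (x, y)) \<partial>?M) \<le> C * B * (\<integral>y. norm (f y) \<partial>?M)" by simp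
      qed
    qed
  qed
  have "(\<integral>x. (\<integral>y. of_real (k (y \<bullet> x)) * f y \<partial>?M) * g x \<partial>?M) = (\<integral>x. (\<integral>y. ?F (x, y) \<partial>?M) \<partial>?M)"
    by (simp only: fst_conv snd_conv integral_mult_left_zero)
  also have "\<dots> = (\<integral>y. (\<integral>x. ?F (x, y) \<partial>?M) \<partial>?M)"
    using P.Fubini_integral[of "\<lambda>x y. ?F (x, y)"] Fi by (simp add: case_prod_beta')
  also have "\<dots> = (\<integral>y. (\<integral>x. f y * (of_real (k (x \<bullet> y)) * g x) \<partial>?M) \<partial>?M)"
    by (simp add: inner_commute mult_ac)
  finally show ?thesis by (simp only: integral_mult_right_zero)
qed

text \<open>The lower bound with the additional factor sin^D is enough, since that factor is at most
  1.\<close>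

lemma legendre_mass_pos:
  assumes "3 \<le> DIM('a::euclidean_space)" "1 \<le> n"
  shows "0 < legendre_mass TYPE('a) n"
proof -
  interpret zonal_profile "DIM('a) - 2" "frequency DIM('a) n" "legendre DIM('a) n"
    using assms by (rule zonal_profile_legendre)
  let ?D = "DIM('a) - 2"
  have "0 < integral {0..pi} (\<lambda>\<theta>. (u \<theta>)\<^sup>2 * sin \<theta> ^ ?D * sin \<theta> ^ ?D)"
    using integral_u_square_sin_lower c4_pos \<omega> by (smt (verit) mult_nonneg_nonpos zero_le_power)
  also have "\<dots> \<le> integral {0..pi} (\<lambda>\<theta>. (u \<theta>)\<^sup>2 * sin \<theta> ^ ?D)"
  proof (rule integral_le)
    fix \<theta> assume "\<theta> \<in> {0..pi}"
    then have "0 \<le> sin \<theta>" by (auto intro: sin_ge_zero)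
    then have "(u \<theta>)\<^sup>2 * sin \<theta> ^ ?D * sin \<theta> ^ ?D \<le> (u \<theta>)\<^sup>2 * sin \<theta> ^ ?D * 1"
      by (intro mult_left_mono power_le_one) auto
    then show "(u \<theta>)\<^sup>2 * sin \<theta> ^ ?D * sin \<theta> ^ ?D \<le> (u \<theta>)\<^sup>2 * sin \<theta> ^ ?D" by simp
  qed (intro integrable_continuous_interval continuous_intros)+
  finally show ?thesis
    using zonal_const_pos[where 'a='a] by (simp add: legendre_mass_def u_def)
qed

definition zonal_kernel :: "'a::euclidean_space itself \<Rightarrow> nat \<Rightarrow> real \<Rightarrow> real" where
  "zonal_kernel _ n t = poly (legendre DIM('a) n) t / legendre_mass TYPE('a) n"

lemma continuous_on_zonal_kernel [continuous_intros]:
  "continuous_on S (zonal_kernel TYPE('a::euclidean_space) n)"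
  unfolding zonal_kernel_def[abs_def] divide_inverse by (intro continuous_intros)

lemma zonal_kernel_reproducing:
  fixes x :: "'a::euclidean_space"
  assumes N: "3 \<le> DIM('a)" and n: "1 \<le> n" and x: "norm x = 1" and Y: "Y \<in> harmonic_polynomials n"
  shows "(\<integral>y. of_real (zonal_kernel TYPE('a) n (y \<bullet> x)) * Y y \<partial>surface_measure) = Y x"
proof -
  have "(\<integral>y. of_real (zonal_kernel TYPE('a) n (y \<bullet> x)) * Y y \<partial>surface_measure) =
      (\<integral>y. of_real (poly (legendre DIM('a) n) (y \<bullet> x)) * Y y / of_real (legendre_mass TYPE('a) n) \<partial>surface_measure)"
    by (simp add: zonal_kernel_def)
  also have "\<dots> = (\<integral>y. of_real (poly (legendre DIM('a) n) (y \<bullet> x)) * Y y \<partial>surface_measure) / of_real (legendre_mass TYPE('a) n)"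
    by (rule integral_divide_zero)
  also have "\<dots> = Y x"
    unfolding legendre_reproducing[OF N n x Y] using legendre_mass_pos[OF N n] by simp
  finally show ?thesis .
qed

lemma harmonic_polynomials_diff:
  assumes "Y \<in> harmonic_polynomials n" "Z \<in> harmonic_polynomials n"
  shows "(\<lambda>x. Y x - Z x) \<in> harmonic_polynomials n"
proof -
  note D = harmonic_polynomialsD[OF assms(1)] harmonic_polynomialsD[OF assms(2)]
  have mZ: "polynomial_function (\<lambda>x. (- 1) * Z x)"
    by (intro polynomial_function_complex_mult polynomial_function_const D)
  have "laplacian (\<lambda>x. Y x + (- 1) * Z x) = (\<lambda>x. laplacian Y x + laplacian (\<lambda>x. (- 1) * Z x) x)"
    unfolding laplacian_def
    by (simp only: partial_deriv_add[OF D(1) mZ]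
        partial_deriv_add[OF polynomial_function_partial_deriv[OF D(1)] polynomial_function_partial_deriv[OF mZ]] sum.distrib)
  then have "laplacian (\<lambda>x. Y x + (- 1) * Z x) = (\<lambda>x. 0)"
    unfolding laplacian_cmult[OF D(4)] D(3,6) by simp
  moreover have "polynomial_function (\<lambda>x. Y x + (- 1) * Z x)"
    by (intro polynomial_function_add D mZ)
  moreover have "homogeneous n (\<lambda>x. Y x + (- 1) * Z x)"
    by (intro homogeneous_add homogeneous_cmult D)
  ultimately show ?thesis unfolding harmonic_polynomials_iff by simp
qed

text \<open>The projection is a definite description, so existence and uniqueness are both at stake.
  The convolution is a spherical harmonic; against any harmonic Q the kernel moves over to Q by
  Fubini and reproduces it, which is orthogonality.\<close>

lemma L2_projection_eq:
  fixes f :: "'a::euclidean_space \<Rightarrow> complex"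
  assumes N: "3 \<le> DIM('a)" and n: "1 \<le> n" and f: "f \<in> Lp_space surface_measure 2"
  shows "L2_projection n f = restrict (\<lambda>x. \<integral>y. of_real (zonal_kernel TYPE('a) n (y \<bullet> x)) * f y \<partial>surface_measure) (sphere 0 1)"
proof -
  let ?m = "complex_of_real (legendre_mass TYPE('a) n)"
  let ?K = "\<lambda>x. \<integral>y. of_real (zonal_kernel TYPE('a) n (y \<bullet> x)) * f y \<partial>surface_measure"
  have fi: "integrable surface_measure f" by (rule integrable_of_L2[OF f])
  have fm: "integrable surface_measure (\<lambda>y. f y / ?m)" using fi by simp
  obtain Y where Y: "Y \<in> harmonic_polynomials n"
    "\<And>x. norm x = 1 \<Longrightarrow> Y x = (\<integral>y. of_real (poly (legendre DIM('a) n) (y \<bullet> x)) * (f y / ?m) \<partial>surface_measure)"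
    by (rule legendre_integral_harmonic[OF fm, of n]) blast
  have YK: "Y x = ?K x" if "norm x = 1" for x using Y(2)[OF that] by (simp add: zonal_kernel_def)
  have R: "restrict ?K (sphere 0 1) = restrict Y (sphere 0 1)" using YK by (auto simp: restrict_def fun_eq_iff)
  have cont: "continuous_on (sphere 0 1) Q" "integrable surface_measure Q" if "Q \<in> harmonic_polynomials n" for Q :: "'a \<Rightarrow> complex"
    using harmonic_polynomialsD(1)[OF that] by (auto intro: continuous_on_polymonial_function integrable_surface_polynomial)
  have ifQ: "integrable surface_measure (\<lambda>x. h x * cnj (Q x))" if "Q \<in> harmonic_polynomials n" "integrable surface_measure h" for Q h :: "'a \<Rightarrow> complex"
    using integrable_surface_mult[OF that(2) continuous_on_cnj[OF cont(1)[OF that(1)]]] by (simp add: mult.commute)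
  have orth: "(\<integral>x. (f x - Y x) * cnj (Q x) \<partial>surface_measure) = 0" if Q: "Q \<in> harmonic_polynomials n" for Q
  proof -
    have "(\<integral>x. Y x * cnj (Q x) \<partial>surface_measure) = (\<integral>x. ?K x * cnj (Q x) \<partial>surface_measure)"
      by (rule Bochner_Integration.integral_cong) (auto simp: YK)
    also have "\<dots> = (\<integral>y. f y * (\<integral>x. of_real (zonal_kernel TYPE('a) n (x \<bullet> y)) * cnj (Q x) \<partial>surface_measure) \<partial>surface_measure)"
      by (intro kernel_fubini fi continuous_on_cnj cont Q continuous_intros)
    also have "\<dots> = (\<integral>y. f y * cnj (Q y) \<partial>surface_measure)"
    proof (rule Bochner_Integration.integral_cong[OF refl])
      fix y :: 'a assume "y \<in> space surface_measure"
      then have y: "norm y = 1" by simp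
      have "(\<integral>x. of_real (zonal_kernel TYPE('a) n (x \<bullet> y)) * cnj (Q x) \<partial>surface_measure) =
          (\<integral>x. cnj (of_real (zonal_kernel TYPE('a) n (x \<bullet> y)) * Q x) \<partial>surface_measure)"
        by simp
      also have "\<dots> = cnj (Q y)"
        using Bochner_Integration.integral_cnj[of surface_measure "\<lambda>x. of_real (zonal_kernel TYPE('a) n (x \<bullet> y)) * Q x"]
        unfolding zonal_kernel_reproducing[OF N n y Q] .
      finally show "f y * (\<integral>x. of_real (zonal_kernel TYPE('a) n (x \<bullet> y)) * cnj (Q x) \<partial>surface_measure) = f y * cnj (Q y)" by simp
    qed
    finally have "(\<integral>x. f x * cnj (Q x) \<partial>surface_measure) - (\<integral>x. Y x * cnj (Q x) \<partial>surface_measure) = 0" by simp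
    then show ?thesis
      by (simp only: left_diff_distrib Bochner_Integration.integral_diff[OF ifQ[OF Q fi] ifQ[OF Q cont(2)[OF Y(1)]]])
  qed
  have sph: "(\<integral>x. (f x - restrict W (sphere 0 1) x) * cnj (restrict Q (sphere 0 1) x) \<partial>surface_measure) =
      (\<integral>x. (f x - W x) * cnj (Q x) \<partial>surface_measure)" for W Q :: "'a \<Rightarrow> complex"
    by (rule Bochner_Integration.integral_cong) auto
  show ?thesis
    unfolding L2_projection_def R
  proof (rule the_equality)
    show "restrict Y (sphere 0 1) \<in> spherical_harmonics n \<and>
      (\<forall>Z\<in>spherical_harmonics n. (\<integral>x. (f x - restrict Y (sphere 0 1) x) * cnj (Z x) \<partial>surface_measure) = 0)"
    proof (intro conjI ballI)
      show "restrict Y (sphere 0 1) \<in> spherical_harmonics n"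
        using Y(1) unfolding spherical_harmonics_def by blast
      fix Z :: "'a \<Rightarrow> complex" assume "Z \<in> spherical_harmonics n"
      then obtain Q where Q: "Q \<in> harmonic_polynomials n" "Z = restrict Q (sphere 0 1)"
        unfolding spherical_harmonics_def by blast
      show "(\<integral>x. (f x - restrict Y (sphere 0 1) x) * cnj (Z x) \<partial>surface_measure) = 0"
        unfolding Q(2) sph by (rule orth[OF Q(1)])
    qed
    fix V assume V: "V \<in> spherical_harmonics n \<and>
      (\<forall>Z\<in>spherical_harmonics n. (\<integral>x. (f x - V x) * cnj (Z x) \<partial>surface_measure) = 0)"
    then obtain W where W: "W \<in> harmonic_polynomials n" "V = restrict W (sphere 0 1)"
      unfolding spherical_harmonics_def by blast
    \<comment> \<open>Uniqueness: the zonal harmonic with pole x is an admissible test function, and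
      testing W - Y against it returns the value at x times the mass.\<close>
    have "W x = Y x" if x: "norm x = 1" for x
    proof -
      obtain Q where Q: "Q \<in> harmonic_polynomials n" "\<And>y. norm y = 1 \<Longrightarrow> Q y = of_real (poly (legendre DIM('a) n) (y \<bullet> x))"
        using legendre_harmonic[OF x] by blast
      have oW: "(\<integral>x. (f x - W x) * cnj (Q x) \<partial>surface_measure) = 0"
      proof -
        have "restrict Q (sphere 0 1) \<in> spherical_harmonics n"
          using Q(1) unfolding spherical_harmonics_def by blast
        with V have "(\<integral>x. (f x - V x) * cnj (restrict Q (sphere 0 1) x) \<partial>surface_measure) = 0"
          by blast
        then show ?thesis unfolding W(2) sph .
      qed
      have "?m * (W x - Y x) = (\<integral>y. of_real (poly (legendre DIM('a) n) (y \<bullet> x)) * (W y - Y y) \<partial>surface_measure)"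
        by (rule legendre_reproducing[OF N n x harmonic_polynomials_diff[OF W(1) Y(1)], symmetric])
      also have "\<dots> = (\<integral>y. (f y - Y y) * cnj (Q y) - (f y - W y) * cnj (Q y) \<partial>surface_measure)"
        by (rule Bochner_Integration.integral_cong) (auto simp: Q algebra_simps)
      also have "\<dots> = (\<integral>y. (f y - Y y) * cnj (Q y) \<partial>surface_measure) - (\<integral>y. (f y - W y) * cnj (Q y) \<partial>surface_measure)"
        by (intro Bochner_Integration.integral_diff ifQ Q Bochner_Integration.integrable_diff fi cont Y W)
      also have "\<dots> = 0" by (simp only: oW orth[OF Q(1)] diff_self)
      finally show ?thesis using legendre_mass_pos[OF N n] by simp
    qed
    then show "V = restrict Y (sphere 0 1)" unfolding W(2) by (auto simp: restrict_def fun_eq_iff)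
  qed
qed

section \<open>Identifying the integral kernel\<close>

lemma continuous_section:
  assumes "continuous_on (S \<times> T) (\<lambda>(x, y). K x y)" "x \<in> S"
  shows "continuous_on T (K x)"
proof -
  have "continuous_on T ((\<lambda>(x, y). K x y) \<circ> (\<lambda>y. (x, y)))"
    by (rule continuous_on_compose) (auto intro!: continuous_intros continuous_on_subset[OF assms(1)] simp: assms(2))
  then show ?thesis by (simp add: o_def)
qed

text \<open>The kernel is chosen by \<open>SOME\<close> and specified only through its action on
  square integrable functions. The zonal kernel shows that a choice exists; for each fixed x any
  other choice agrees with it almost everywhere in y, which suffices for every measurable f.\<close>

theorem harmonic_projection_eq:
  fixes f :: "'a::euclidean_space \<Rightarrow> complex"
  assumes N: "3 \<le> DIM('a)" and n: "1 \<le> n" and f: "f \<in> borel_measurable surface_measure" and x: "norm x = 1"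
  shows "harmonic_projection n f x = (\<integral>y. of_real (zonal_kernel TYPE('a) n (y \<bullet> x)) * f y \<partial>surface_measure)"
proof -
  let ?S = "sphere 0 1 :: 'a set"
  let ?K0 = "\<lambda>x y. complex_of_real (zonal_kernel TYPE('a) n (y \<bullet> x))"
  let ?spec = "\<lambda>K. continuous_on (?S \<times> ?S) (\<lambda>(x, y). K x y) \<and>
        (\<forall>f\<in>Lp_space surface_measure 2. \<forall>x\<in>?S. L2_projection n f x = (\<integral>y. K x y * f y \<partial>surface_measure))"
  have "continuous_on (?S \<times> ?S) (\<lambda>p. complex_of_real (zonal_kernel TYPE('a) n (snd p \<bullet> fst p)))"
    by (intro continuous_intros continuous_on_compose2[OF continuous_on_zonal_kernel[of UNIV]]) auto
  then have K0: "?spec ?K0"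
    using L2_projection_eq[OF N n] by (simp add: case_prod_beta')
  define K where "K = (projection_kernel n :: 'a \<Rightarrow> 'a \<Rightarrow> complex)"
  have K: "?spec K" unfolding K_def projection_kernel_def by (rule someI[of ?spec, OF K0])
  have xS: "x \<in> ?S" using x by simp
  have cK: "continuous_on ?S (K x)" using K xS by (intro continuous_section[of ?S ?S]) auto
  have cK0: "continuous_on ?S (?K0 x)" using K0 xS by (intro continuous_section[of ?S ?S ?K0]) auto
  \<comment> \<open>The conjugate of the difference of the kernels is continuous, hence bounded and
    an admissible test function; both kernels represent the same projection, so the integral of
    |h|^2 is 0.\<close>
  define h where "h y = cnj (K x y - ?K0 x y)" for y
  have ch: "continuous_on ?S h" unfolding h_def[abs_def] by (intro continuous_on_cnj continuous_intros cK cK0)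
  have hm: "h \<in> borel_measurable surface_measure" by (rule borel_measurable_surface_continuous[OF ch])
  obtain B where B: "\<And>y. norm y = 1 \<Longrightarrow> norm (h y) \<le> B"
    using sphere_bounded[OF ch] by metis
  have hL: "h \<in> Lp_space surface_measure 2" by (rule bounded_in_L2[OF hm B])
  have hi: "integrable surface_measure h" by (rule integrable_of_L2[OF hL])
  have "(\<integral>y. K x y * h y \<partial>surface_measure) = (\<integral>y. ?K0 x y * h y \<partial>surface_measure)"
    using K K0 hL xS by metis
  then have "0 = (\<integral>y. K x y * h y \<partial>surface_measure) - (\<integral>y. ?K0 x y * h y \<partial>surface_measure)"
    by simp
  also have "\<dots> = (\<integral>y. K x y * h y - ?K0 x y * h y \<partial>surface_measure)"
    by (intro Bochner_Integration.integral_diff[symmetric] integrable_surface_mult hi cK cK0)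
  also have "\<dots> = (\<integral>y. of_real ((norm (h y))\<^sup>2) \<partial>surface_measure)"
    by (intro Bochner_Integration.integral_cong refl)
      (simp only: left_diff_distrib[symmetric] h_def complex_norm_square complex_mod_cnj)
  finally have Z: "0 = (\<integral>y. complex_of_real ((norm (h y))\<^sup>2) \<partial>surface_measure)" .
  from Z[symmetric] have I0: "(\<integral>y. (norm (h y))\<^sup>2 \<partial>surface_measure) = 0"
    by (simp only: integral_complex_of_real of_real_eq_0_iff)
  have ii: "integrable surface_measure (\<lambda>y. (norm (h y))\<^sup>2)"
    by (intro integrable_surface_continuous continuous_intros ch)
  have "AE y in surface_measure. 0 \<le> (norm (h y))\<^sup>2" by simp
  from integral_nonneg_eq_0_iff_AE[OF ii this] have AE: "AE y in surface_measure. (norm (h y))\<^sup>2 = 0"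
    using I0 by blast
  have "(\<integral>y. K x y * f y \<partial>surface_measure) = (\<integral>y. ?K0 x y * f y \<partial>surface_measure)"
  proof (rule integral_cong_AE)
    show "(\<lambda>y. K x y * f y) \<in> borel_measurable surface_measure" "(\<lambda>y. ?K0 x y * f y) \<in> borel_measurable surface_measure"
      using f borel_measurable_surface_continuous[OF cK] borel_measurable_surface_continuous[OF cK0] by measurable
    show "AE y in surface_measure. K x y * f y = ?K0 x y * f y"
      using AE by eventually_elim (simp add: h_def del: complex_cnj_diff)
  qed
  then show ?thesis by (simp add: harmonic_projection_def K_def)
qed

section \<open>Lebesgue norms\<close>

lemma recip_infinity [simp]: "recip \<infinity> = 0" "recip top = 0"
  by (simp_all add: recip_def)

lemma recip_finite:
  assumes "1 \<le> p" "p \<noteq> \<infinity>"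
  shows "1 \<le> enn2real p" "recip p = 1 / enn2real p" "p = ennreal (enn2real p)"
proof -
  obtain P where P: "p = ennreal P" "0 \<le> P" using assms(2) by (cases p) auto
  have "ennreal 1 \<le> ennreal P" using assms(1) P by simp
  then have P1: "1 \<le> P" using P by (subst (asm) ennreal_le_iff) auto
  then have "1 / p = ennreal (1 / P)" using P by (simp add: divide_ennreal flip: ennreal_1)
  with P P1 show "1 \<le> enn2real p" "recip p = 1 / enn2real p" "p = ennreal (enn2real p)"
    by (auto simp: recip_def)
qed

lemma recip_bounds: "1 \<le> p \<Longrightarrow> 0 \<le> recip p" "1 \<le> p \<Longrightarrow> recip p \<le> 1"
  using recip_finite[of p] by (cases "p = \<infinity>"; simp)+

lemma Lp_norm_cong:
  assumes "\<And>x. x \<in> space M \<Longrightarrow> f x = g x"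
  shows "Lp_norm M p f = Lp_norm M p g"
proof -
  have "(\<integral>\<^sup>+ x. ennreal (norm (f x) powr enn2real p) \<partial>M) = (\<integral>\<^sup>+ x. ennreal (norm (g x) powr enn2real p) \<partial>M)"
    by (intro nn_integral_cong) (simp add: assms)
  moreover have "esssup M (\<lambda>x. ennreal (norm (f x))) = esssup M (\<lambda>x. ennreal (norm (g x)))"
  proof -
    have "(\<lambda>x. ennreal (norm (f x))) \<in> borel_measurable M \<longleftrightarrow> (\<lambda>x. ennreal (norm (g x))) \<in> borel_measurable M"
      by (intro measurable_cong) (simp add: assms)
    moreover have "Limsup (ae_filter M) (\<lambda>x. ennreal (norm (f x))) = Limsup (ae_filter M) (\<lambda>x. ennreal (norm (g x)))"
      by (intro Limsup_eq AE_I2) (simp add: assms)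
    ultimately show ?thesis by (simp add: esssup_def)
  qed
  ultimately show ?thesis by (simp add: Lp_norm_def)
qed

lemma Lp_norm_ge_on:
  assumes q: "1 \<le> q" and B: "B \<in> sets M" "emeasure M B < \<infinity>" "0 < measure M B"
    and a: "0 \<le> a" "\<And>x. x \<in> B \<Longrightarrow> a \<le> norm (f x)"
  shows "ennreal (a * measure M B powr recip q) \<le> Lp_norm M q f"
proof (cases "q = \<infinity>")
  case True
  have "ennreal a \<le> esssup M (\<lambda>x. ennreal (norm (f x)))"
  proof (rule ccontr)
    assume "\<not> ?thesis"
    then have lt: "esssup M (\<lambda>x. ennreal (norm (f x))) < ennreal a" by simp
    have "AE x in M. x \<notin> B"
      using esssup_AE[of "\<lambda>x. ennreal (norm (f x))" M]
    proof eventually_elim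
      case (elim x)
      then have "ennreal (norm (f x)) < ennreal a" using lt by (rule le_less_trans)
      then have "norm (f x) < a" by (subst (asm) ennreal_less_iff) auto
      then show ?case using a(2)[of x] by auto
    qed
    then have "emeasure M B = 0" 
      using AE_iff_measurable[OF B(1), of "\<lambda>x. x \<notin> B"] sets.sets_into_space[OF B(1)] by auto
    then show False using B(3) by (simp add: measure_def)
  qed
  then show ?thesis using True B(3) by (simp add: Lp_norm_def)
next
  case False
  let ?Q = "enn2real q"
  note Q = recip_finite[OF q False]
  let ?I = "\<integral>\<^sup>+ x. ennreal (norm (f x) powr ?Q) \<partial>M"
  have "ennreal (a powr ?Q * measure M B) = (\<integral>\<^sup>+ x. ennreal (a powr ?Q) * indicator B x \<partial>M)"
    using B by (simp add: nn_integral_cmult_indicator emeasure_eq_ennreal_measure less_top ennreal_mult)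
  also have "\<dots> \<le> ?I"
  proof (rule nn_integral_mono)
    fix x
    have "x \<in> B \<Longrightarrow> a powr ?Q \<le> norm (f x) powr ?Q"
      using a Q by (intro powr_mono2) auto
    then show "ennreal (a powr ?Q) * indicator B x \<le> ennreal (norm (f x) powr ?Q)"
      by (auto simp: indicator_def intro: ennreal_leI)
  qed
  finally have I: "ennreal (a powr ?Q * measure M B) \<le> ?I" .
  show ?thesis
  proof (cases "?I = \<infinity>")
    case True
    then show ?thesis using False by (simp add: Lp_norm_def)
  next
    case I2: False
    then have "a powr ?Q * measure M B \<le> enn2real ?I"
      using enn2real_mono[OF I] by (simp add: less_top)
    then have "(a powr ?Q * measure M B) powr (1 / ?Q) \<le> enn2real ?I powr (1 / ?Q)"
      using Q by (intro powr_mono2) auto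
    moreover have "(a powr ?Q * measure M B) powr (1 / ?Q) = a * measure M B powr recip q"
      using a Q by (simp add: powr_mult powr_powr)
    ultimately show ?thesis using False I2 by (auto simp: Lp_norm_def Let_def intro: ennreal_leI)
  qed
qed

lemma Lp_norm_le_on:
  fixes f :: "'a \<Rightarrow> 'b::{real_normed_vector, second_countable_topology}"
  assumes p: "1 \<le> p" and f: "f \<in> borel_measurable M" and B: "B \<in> sets M" "emeasure M B < \<infinity>" "0 < measure M B"
    and b: "0 \<le> b" "\<And>x. x \<in> space M \<Longrightarrow> norm (f x) \<le> b * indicator B x"
  shows "Lp_norm M p f \<le> ennreal (b * measure M B powr recip p)"
proof (cases "p = \<infinity>")
  case True
  have "esssup M (\<lambda>x. ennreal (norm (f x))) \<le> ennreal b"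
  proof (rule esssup_I)
    show "(\<lambda>x. ennreal (norm (f x))) \<in> borel_measurable M" using f by measurable
    show "AE x in M. ennreal (norm (f x)) \<le> ennreal b"
    proof (rule AE_I2)
      fix x assume "x \<in> space M"
      from b(2)[OF this] show "ennreal (norm (f x)) \<le> ennreal b"
        using b(1) by (intro ennreal_leI) (cases "x \<in> B"; simp)
    qed
  qed
  then show ?thesis using True B(3) by (simp add: Lp_norm_def)
next
  case False
  let ?P = "enn2real p"
  note P = recip_finite[OF p False]
  let ?I = "\<integral>\<^sup>+ x. ennreal (norm (f x) powr ?P) \<partial>M"
  have "?I \<le> (\<integral>\<^sup>+ x. ennreal (b powr ?P) * indicator B x \<partial>M)"
  proof (rule nn_integral_mono)
    fix x assume x: "x \<in> space M"
    have "norm (f x) powr ?P \<le> (b * indicator B x) powr ?P"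
      using b(2)[OF x] P by (intro powr_mono2) auto
    then show "ennreal (norm (f x) powr ?P) \<le> ennreal (b powr ?P) * indicator B x"
      using P by (auto simp: indicator_def intro: ennreal_leI split: if_splits)
  qed
  also have "\<dots> = ennreal (b powr ?P * measure M B)"
    using B by (simp add: nn_integral_cmult_indicator emeasure_eq_ennreal_measure less_top ennreal_mult)
  finally have I: "?I \<le> ennreal (b powr ?P * measure M B)" .
  then have I2: "?I < \<infinity>" by (rule le_less_trans) simp
  have "enn2real ?I \<le> b powr ?P * measure M B"
    using enn2real_mono[OF I] B by simp
  then have "enn2real ?I powr (1 / ?P) \<le> (b powr ?P * measure M B) powr (1 / ?P)"
    using P by (intro powr_mono2) auto
  also have "\<dots> = b * measure M B powr recip p"
    using b P by (simp add: powr_mult powr_powr)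
  finally show ?thesis using False I2 by (auto simp: Lp_norm_def Let_def intro: ennreal_leI)
qed

lemma Lp_norm_eq_integral:
  assumes p: "1 \<le> p" "p \<noteq> \<infinity>" and i: "integrable M (\<lambda>x. norm (f x) powr enn2real p)"
  shows "Lp_norm M p f = ennreal ((\<integral>x. norm (f x) powr enn2real p \<partial>M) powr recip p)"
proof -
  have "(\<integral>\<^sup>+ x. ennreal (norm (f x) powr enn2real p) \<partial>M) = ennreal (\<integral>x. norm (f x) powr enn2real p \<partial>M)"
    by (rule nn_integral_eq_integral[OF i]) simp
  then show ?thesis using p recip_finite(2)[OF p] by (simp add: Lp_norm_def)
qed

text \<open>Hoelder's inequality solved for the norm of f, obtained by integrating Young's
  inequality for s f and g / s with an optimised s.\<close>

lemma hoelder_lower: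
  fixes f g :: "'a \<Rightarrow> real"
  assumes qr: "1 < q" "1 < r" "1 / q + 1 / r = 1"
    and f: "integrable M (\<lambda>x. \<bar>f x\<bar> powr q)" and g: "integrable M (\<lambda>x. \<bar>g x\<bar> powr r)" "(\<integral>x. \<bar>g x\<bar> powr r \<partial>M) \<le> G"
    and fg: "integrable M (\<lambda>x. f x * g x)" and X: "0 < X" "X \<le> (\<integral>x. f x * g x \<partial>M)" and G: "0 < G"
  shows "X * G powr (- (1 / r)) \<le> (\<integral>x. \<bar>f x\<bar> powr q \<partial>M) powr (1 / q)"
proof -
  \<comment> \<open>With this s the second term of Young's inequality becomes X / r, which leaves X
    / q for the first.\<close>
  define s where "s = (G / X) powr (1 / r)"
  have s: "0 < s" using X G by (simp add: s_def)
  have sr: "s powr r = G / X" using qr X G by (simp add: s_def powr_powr)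
  let ?F = "\<integral>x. \<bar>f x\<bar> powr q \<partial>M"
  have "X \<le> (\<integral>x. f x * g x \<partial>M)" by (rule X)
  also have "\<dots> \<le> (\<integral>x. s powr q / q * \<bar>f x\<bar> powr q + (1 / s powr r) / r * \<bar>g x\<bar> powr r \<partial>M)"
  proof (rule integral_mono[OF fg])
    show "integrable M (\<lambda>x. s powr q / q * \<bar>f x\<bar> powr q + (1 / s powr r) / r * \<bar>g x\<bar> powr r)"
      using f g by (intro Bochner_Integration.integrable_add integrable_mult_right)
    fix x
    have "f x * g x \<le> (s * \<bar>f x\<bar>) * (\<bar>g x\<bar> / s)"
      using s by (simp flip: abs_mult)
    also have "\<dots> \<le> (s * \<bar>f x\<bar>) powr q / q + (\<bar>g x\<bar> / s) powr r / r"
      using qr s by (intro Youngs_inequality) auto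
    also have "\<dots> = s powr q / q * \<bar>f x\<bar> powr q + (1 / s powr r) / r * \<bar>g x\<bar> powr r"
      using s by (simp add: powr_mult powr_divide)
    finally show "f x * g x \<le> s powr q / q * \<bar>f x\<bar> powr q + (1 / s powr r) / r * \<bar>g x\<bar> powr r" .
  qed
  also have "\<dots> = s powr q / q * ?F + (1 / s powr r) / r * (\<integral>x. \<bar>g x\<bar> powr r \<partial>M)"
    using f g by simp
  also have "\<dots> \<le> s powr q / q * ?F + (1 / s powr r) / r * G"
    using g(2) s qr by (intro add_left_mono mult_left_mono) auto
  also have "(1 / s powr r) / r * G = X / r" using G X sr by simp
  finally have "X - X / r \<le> s powr q / q * ?F" by simp
  moreover have "X - X / r = X / q"
  proof -
    have "X * (1 / q + 1 / r) = X" using qr by simp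
    then show ?thesis by (simp add: algebra_simps)
  qed
  ultimately have "X / q \<le> s powr q * ?F / q" by simp
  then have "X \<le> s powr q * ?F" using qr by (simp add: divide_le_cancel)
  then have F: "X * s powr (- q) \<le> ?F"
    using s by (simp add: powr_minus field_simps)
  have "X * G powr (- (1 / r)) = (X * s powr (- q)) powr (1 / q)"
  proof -
    have "(X * s powr (- q)) powr (1 / q) = X powr (1 / q) * s powr (- 1)"
      using X s qr by (simp add: powr_mult powr_powr)
    also have "s powr (- 1) = G powr (- (1 / r)) * X powr (1 / r)"
      using X G by (simp add: s_def powr_powr powr_divide powr_minus_divide)
    also have "X powr (1 / q) * (G powr (- (1 / r)) * X powr (1 / r)) = X powr (1 / q + 1 / r) * G powr (- (1 / r))"
      by (simp add: powr_add mult_ac)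
    finally show ?thesis using qr X by simp
  qed
  also have "\<dots> \<le> ?F powr (1 / q)"
    using F X s qr by (intro powr_mono2) auto
  finally show ?thesis .
qed

text \<open>Hoelder with g dominated by the constant 1; the exponent \<open>recip q - 1\<close> is
  minus the reciprocal of the conjugate of q. The ends q = 1 and q = \<infinity> are treated apart
  because there Young's inequality has no finite conjugate pair above 1.\<close>

lemma Lp_norm_ge_of_bounded_pairing:
  fixes f :: "'a \<Rightarrow> real" and h :: "'a \<Rightarrow> complex"
  assumes M: "finite_measure M" and q: "1 \<le> q"
    and h: "\<And>x. x \<in> space M \<Longrightarrow> h x = of_real (f x)"
    and f: "f \<in> borel_measurable M" "\<And>x. x \<in> space M \<Longrightarrow> \<bar>f x\<bar> \<le> C"
    and g: "g \<in> borel_measurable M" "\<And>x. x \<in> space M \<Longrightarrow> \<bar>g x\<bar> \<le> 1"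
    and X: "0 < X" "X \<le> (\<integral>x. f x * g x \<partial>M)" and S: "0 < measure M (space M)"
  shows "ennreal (X * measure M (space M) powr (recip q - 1)) \<le> Lp_norm M q h"
proof -
  interpret finite_measure M by (rule M)
  let ?S = "measure M (space M)"
  have fi: "integrable M f" by (rule integrable_const_bound[where B=C]) (use f in auto)
  have nh: "x \<in> space M \<Longrightarrow> norm (h x) = \<bar>f x\<bar>" for x by (simp add: h)
  have fg: "integrable M (\<lambda>x. f x * g x)"
  proof (rule Bochner_Integration.integrable_bound[OF fi])
    show "AE x in M. norm (f x * g x) \<le> norm (f x)"
      using g(2) by (auto simp: abs_mult intro!: AE_I2 mult_left_le)
  qed (use f g in measurable)
  have XF: "X \<le> (\<integral>x. \<bar>f x\<bar> \<partial>M)"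
  proof -
    have "(\<integral>x. f x * g x \<partial>M) \<le> (\<integral>x. \<bar>f x\<bar> \<partial>M)"
    proof (rule integral_mono[OF fg])
      show "integrable M (\<lambda>x. \<bar>f x\<bar>)" using fi by simp
      fix x assume "x \<in> space M"
      from g(2)[OF this] have "\<bar>f x\<bar> * \<bar>g x\<bar> \<le> \<bar>f x\<bar>" by (simp add: mult_left_le)
      then show "f x * g x \<le> \<bar>f x\<bar>" using abs_ge_self[of "f x * g x"] unfolding abs_mult by linarith
    qed
    with X show ?thesis by linarith
  qed
  have fp: "integrable M (\<lambda>x. \<bar>f x\<bar> powr Q)" if "0 \<le> Q" for Q
  proof (rule integrable_const_bound[where B="C powr Q"])
    show "AE x in M. norm (\<bar>f x\<bar> powr Q) \<le> C powr Q"
      using f(2) that by (auto intro!: AE_I2 powr_mono2)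
  qed (use f in measurable)
  consider "q = \<infinity>" | "q \<noteq> \<infinity>" "enn2real q = 1" | "q \<noteq> \<infinity>" "1 < enn2real q"
    using recip_finite(1)[OF q] by fastforce
  then show ?thesis
  proof cases
    case 1
    show ?thesis
    proof (rule ccontr)
      assume "\<not> ?thesis"
      then have lt: "esssup M (\<lambda>x. ennreal (norm (h x))) < ennreal (X * ?S powr (- 1))"
        using 1 by (simp add: Lp_norm_def)
      then obtain b where b: "esssup M (\<lambda>x. ennreal (norm (h x))) = ennreal b" "0 \<le> b"
        by (cases "esssup M (\<lambda>x. ennreal (norm (h x)))") auto
      have bX: "b < X * ?S powr (- 1)" using lt unfolding b(1) using b(2) by (simp add: ennreal_less_iff)
      have "AE x in M. \<bar>f x\<bar> \<le> b"
        using esssup_AE[of "\<lambda>x. ennreal (norm (h x))" M] AE_space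
        by eventually_elim (use b nh in auto)
      then have "(\<integral>x. \<bar>f x\<bar> \<partial>M) \<le> (\<integral>x. b \<partial>M)"
        using fi by (intro integral_mono_AE) auto
      also have "\<dots> = b * ?S" by simp
      also have "\<dots> < X * ?S powr (- 1) * ?S" using bX S by (rule mult_strict_right_mono)
      also have "\<dots> = X" using S by (simp add: powr_minus)
      finally show False using XF by simp
    qed
  next
    case 2
    then have "recip q = 1" using recip_finite(2)[OF q] by simp
    moreover have "Lp_norm M q h = ennreal (\<integral>x. \<bar>f x\<bar> \<partial>M)"
    proof -
      have i: "integrable M (\<lambda>x. norm (h x) powr enn2real q)"
        using fi 2 by (subst Bochner_Integration.integrable_cong[OF refl, where g="\<lambda>x. \<bar>f x\<bar>"]) (auto simp: nh)
      have "(\<integral>x. norm (h x) powr enn2real q \<partial>M) = (\<integral>x. \<bar>f x\<bar> \<partial>M)"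
        by (intro Bochner_Integration.integral_cong refl) (simp add: nh 2)
      then show ?thesis using Lp_norm_eq_integral[OF q 2(1) i] \<open>recip q = 1\<close> by simp
    qed
    ultimately show ?thesis using XF S by (auto intro: ennreal_leI)
  next
    case 3
    let ?Q = "enn2real q"
    define r where "r = ?Q / (?Q - 1)"
    have r: "1 < r" "1 / ?Q + 1 / r = 1" using 3 by (auto simp: r_def field_simps)
    have rq: "recip q = 1 / ?Q" using recip_finite(2)[OF q 3(1)] .
    have "X * ?S powr (- (1 / r)) \<le> (\<integral>x. \<bar>f x\<bar> powr ?Q \<partial>M) powr (1 / ?Q)"
    proof (rule hoelder_lower[OF 3(2) r fp _ _ fg X S])
      show "integrable M (\<lambda>x. \<bar>g x\<bar> powr r)"
        by (rule integrable_const_bound[where B=1]) (use g r in \<open>auto intro!: AE_I2 powr_le1\<close>)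
      then have "(\<integral>x. \<bar>g x\<bar> powr r \<partial>M) \<le> (\<integral>x. 1 \<partial>M)"
        using g r by (intro integral_mono) (auto intro!: powr_le1)
      then show "(\<integral>x. \<bar>g x\<bar> powr r \<partial>M) \<le> ?S" by simp
    qed (use 3 in simp)
    moreover have "- (1 / r) = recip q - 1" using r rq by simp
    moreover have "Lp_norm M q h = ennreal ((\<integral>x. \<bar>f x\<bar> powr ?Q \<partial>M) powr (1 / ?Q))"
    proof -
      have i: "integrable M (\<lambda>x. norm (h x) powr ?Q)"
        using fp[of ?Q] 3 by (subst Bochner_Integration.integrable_cong[OF refl, where g="\<lambda>x. \<bar>f x\<bar> powr ?Q"]) (auto simp: nh)
      have "(\<integral>x. norm (h x) powr ?Q \<partial>M) = (\<integral>x. \<bar>f x\<bar> powr ?Q \<partial>M)"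
        by (intro Bochner_Integration.integral_cong refl) (simp add: nh)
      then show ?thesis using Lp_norm_eq_integral[OF q 3(1) i] rq by simp
    qed
    ultimately show ?thesis by (auto intro: ennreal_leI)
  qed
qed

section \<open>Caps and zonal test functions\<close>

text \<open>Chordal distance makes the triangle inequality available. The factor 12 ensures that any
  two points of the cap enclose an angle of at most 1 / (2 \<omega>), the range on which P is at
  least 1/2.\<close>

definition cap :: "'a::euclidean_space \<Rightarrow> nat \<Rightarrow> 'a set" where
  "cap e n = {y. norm y = 1 \<and> norm (y - e) \<le> 1 / (12 * frequency DIM('a) n)}"

lemma cap_sets: "cap e n \<in> sets (surface_measure :: 'a::euclidean_space measure)"
proof -
  have "cap e n = sphere 0 1 \<inter> cball e (1 / (12 * frequency DIM('a) n))"
    by (auto simp: cap_def dist_norm norm_minus_commute)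
  then show ?thesis by (auto simp: sets_restrict_space_iff)
qed

lemma emeasure_cap_finite: "emeasure surface_measure (cap e n :: 'a::euclidean_space set) < \<infinity>"
  using finite_measure.emeasure_finite[OF finite_measure_surface_measure, of "cap e n"]
  by (metis infinity_ennreal_def less_top)

lemma inner_eq_norm_diff:
  fixes x y :: "'a::real_inner"
  assumes "norm x = 1" "norm y = 1"
  shows "x \<bullet> y = 1 - (norm (x - y))\<^sup>2 / 2"
  using assms by (simp add: power2_norm_eq_inner inner_diff_left inner_diff_right inner_commute norm_eq_1 field_simps)

text \<open>Both points range over the cap, so that the kernel is bounded below on the whole product
  of the cap with itself. The passage from the chord to the angle uses 1 - cos \<theta> = 2 sin^2
  (\<theta> / 2) and the lower bound for the sine.\<close>

lemma legendre_cap_ge: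
  fixes x y :: "'a::euclidean_space"
  assumes N: "3 \<le> DIM('a)" and n: "1 \<le> n" and xy: "x \<in> cap e n" "y \<in> cap e n"
  shows "1 / 2 \<le> poly (legendre DIM('a) n) (x \<bullet> y)"
proof -
  interpret zonal_profile "DIM('a) - 2" "frequency DIM('a) n" "legendre DIM('a) n"
    using N n by (rule zonal_profile_legendre)
  let ?\<omega> = "frequency DIM('a) n"
  define \<delta> where "\<delta> = 1 / (12 * ?\<omega>)"
  have \<delta>: "0 < \<delta>" "\<delta> \<le> 1 / 12" using \<omega> by (auto simp: \<delta>_def field_simps)
  have nx: "norm x = 1" "norm y = 1" "norm (x - e) \<le> \<delta>" "norm (y - e) \<le> \<delta>"
    using xy by (auto simp: cap_def \<delta>_def)
  have "norm (x - y) \<le> 2 * \<delta>"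
    using norm_triangle_ineq4[of "x - e" "y - e"] nx by simp
  then have "(norm (x - y))\<^sup>2 \<le> (2 * \<delta>)\<^sup>2" by (intro power_mono) auto
  then have t1: "1 - 2 * \<delta>\<^sup>2 \<le> x \<bullet> y"
    unfolding inner_eq_norm_diff[OF nx(1,2)] by (simp add: power2_eq_square)
  have t2: "x \<bullet> y \<in> {-1..1}" by (rule inner_sphere_bounds[OF nx(1,2)])
  define \<theta> where "\<theta> = arccos (x \<bullet> y)"
  have "\<delta> * \<delta> \<le> 1 / 12 * (1 / 12)" using \<delta> by (intro mult_mono) auto
  then have t0: "0 \<le> x \<bullet> y" using t1 by (simp add: power2_eq_square)
  have \<theta>: "0 \<le> \<theta>" "\<theta> \<le> pi / 2" "cos \<theta> = x \<bullet> y"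
    using t2 t0 arccos_le_pi2[of "x \<bullet> y"] by (auto simp: \<theta>_def arccos_lbound)
  have "\<theta> / 2 / 3 \<le> sin (\<theta> / 2)" using \<theta> by (intro sin_ge_third) auto
  then have "(\<theta> / 6)\<^sup>2 \<le> (sin (\<theta> / 2))\<^sup>2" using \<theta> by (intro power_mono) auto
  moreover have "cos \<theta> = 1 - 2 * (sin (\<theta> / 2))\<^sup>2" using cos_double_sin[of "\<theta> / 2"] by simp
  ultimately have "2 * (\<theta> / 6)\<^sup>2 \<le> 2 * \<delta>\<^sup>2" using t1 \<theta>(3) by linarith
  then have "\<theta> / 6 \<le> \<delta>" using \<delta> by (intro power2_le_imp_le[of "\<theta> / 6" \<delta>]) auto
  then have "?\<omega> * \<theta> \<le> ?\<omega> * (6 * \<delta>)" using \<omega> by (intro mult_left_mono) auto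
  also have "\<dots> = 1 / 2" using \<omega> by (simp add: \<delta>_def)
  finally show ?thesis using u_ge[OF \<theta>(1,2)] by (simp add: u_def \<theta>(3))
qed

lemma centre_in_cap:
  assumes "3 \<le> DIM('a::euclidean_space)" "1 \<le> n" "norm (e :: 'a) = 1"
  shows "e \<in> cap e n"
  using assms frequency_bounds(1)[of "DIM('a)" n] by (simp add: cap_def)

text \<open>The zonal formula is available for continuous profiles, so the indicator of the cap is
  bounded below by a continuous \<phi>, whose integral is at least that of sin^D over
  [\<delta>/4, \<delta>/2]. The length of this interval supplies the last of the d = D + 1 factors 1
  / n.\<close>

lemma cap_measure_lower:
  assumes N: "3 \<le> DIM('a::euclidean_space)"
  shows "\<exists>c>0. \<forall>n\<ge>1. \<forall>e::'a. norm e = 1 \<longrightarrow> c * real n powr (- real (DIM('a) - 1)) \<le> measure surface_measure (cap e n)"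
proof -
  define D where "D = DIM('a) - 2"
  define K where "K = 12 * sqrt (real DIM('a))"
  have K: "12 \<le> K" using N by (simp add: K_def)
  define c where "c = zonal_const TYPE('a) * ((1 / (4 * K)) * (1 / (12 * K)) ^ D)"
  have c: "0 < c" using K zonal_const_pos[where 'a='a] unfolding c_def by (intro mult_pos_pos zero_less_power) auto
  show ?thesis
  proof (intro exI[of _ c] conjI c allI impI)
    fix n :: nat and e :: 'a assume n: "1 \<le> n" and e: "norm e = 1"
    define \<delta> where "\<delta> = 1 / (12 * frequency DIM('a) n)"
    have f: "real n \<le> frequency DIM('a) n" "frequency DIM('a) n \<le> sqrt (real DIM('a)) * real n"
      using frequency_bounds[of "DIM('a)" n] N n by auto
    have \<delta>: "0 < \<delta>" "\<delta> \<le> 1" using f n by (auto simp: \<delta>_def field_simps)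
    have \<delta>2: "1 / (K * real n) \<le> \<delta>"
      unfolding \<delta>_def K_def using f n by (intro divide_left_mono) auto
    have mono: "cos \<delta> < cos (\<delta> / 2)" using \<delta> pi_gt3 by (intro cos_monotone_0_pi) auto
    \<comment> \<open>In the angle: 1 up to \<delta> / 2, 0 from \<delta> on, continuous in
      between.\<close>
    define \<phi> where "\<phi> t = max 0 (min 1 ((t - cos \<delta>) / (cos (\<delta> / 2) - cos \<delta>)))" for t
    have c\<phi>: "continuous_on S \<phi>" for S unfolding \<phi>_def[abs_def] divide_inverse by (intro continuous_intros)
    have incap: "y \<in> cap e n" if "norm y = 1" "cos \<delta> < y \<bullet> e" for y
    proof -
      have "(norm (y - e))\<^sup>2 = 2 - 2 * (y \<bullet> e)" using inner_eq_norm_diff[OF that(1) e] by simp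
      also have "\<dots> \<le> 2 - 2 * cos \<delta>" using that by simp
      also have "\<dots> = 4 * (sin (\<delta> / 2))\<^sup>2" using cos_double_sin[of "\<delta> / 2"] by simp
      also have "\<dots> \<le> 4 * (\<delta> / 2)\<^sup>2"
      proof -
        have "0 \<le> sin (\<delta> / 2)" using \<delta> pi_gt3 by (intro sin_ge_zero) auto
        then show ?thesis using sin_x_le_x[of "\<delta> / 2"] \<delta> by (intro mult_left_mono power_mono) auto
      qed
      finally have "(norm (y - e))\<^sup>2 \<le> \<delta>\<^sup>2" by (simp add: power2_eq_square)
      then have "norm (y - e) \<le> \<delta>" by (rule power2_le_imp_le) (use \<delta> in simp)
      with that show ?thesis by (simp add: cap_def \<delta>_def)
    qed
    have "(\<integral>y. \<phi> (y \<bullet> e) \<partial>surface_measure) \<le> (\<integral>y. indicator (cap e n) y \<partial>surface_measure)"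
    proof (rule integral_mono)
      show "integrable surface_measure (\<lambda>y. \<phi> (y \<bullet> e))"
        by (intro integrable_surface_continuous continuous_on_inner_compose c\<phi> e)
      show "integrable surface_measure (indicator (cap e n) :: 'a \<Rightarrow> real)"
        using cap_sets emeasure_cap_finite by (intro integrable_real_indicator) auto
      fix y :: 'a assume "y \<in> space surface_measure"
      then have y: "norm y = 1" by simp
      show "\<phi> (y \<bullet> e) \<le> indicator (cap e n) y"
      proof (cases "cos \<delta> < y \<bullet> e")
        case True then show ?thesis using incap[OF y] by (simp add: \<phi>_def)
      next
        case False
        then have "(y \<bullet> e - cos \<delta>) / (cos (\<delta> / 2) - cos \<delta>) \<le> 0" using mono by (intro divide_nonpos_pos) auto
        then show ?thesis by (simp add: \<phi>_def)
      qed
    qed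
    also have "\<dots> = measure surface_measure (cap e n)"
      using cap_sets[of e n] emeasure_cap_finite[of e n] sets.sets_into_space[OF cap_sets[of e n]] by (simp add: Int_absorb2)
    finally have up: "zonal_const TYPE('a) * integral {0..pi} (\<lambda>\<theta>. \<phi> (cos \<theta>) * sin \<theta> ^ D) \<le> measure surface_measure (cap e n)"
      using surface_integral_zonal[OF _ e c\<phi>] N by (simp add: D_def)
    have i\<phi>: "(\<lambda>\<theta>. \<phi> (cos \<theta>) * sin \<theta> ^ D) integrable_on {a..b}" for a b
      by (intro integrable_continuous_interval continuous_intros continuous_on_compose2[OF c\<phi>[of UNIV]]) auto
    have "integral {\<delta>/4..\<delta>/2} (\<lambda>\<theta>. (\<delta> / 12) ^ D) \<le> integral {\<delta>/4..\<delta>/2} (\<lambda>\<theta>. \<phi> (cos \<theta>) * sin \<theta> ^ D)"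
    proof (rule integral_le[OF _ i\<phi>])
      fix \<theta> assume t: "\<theta> \<in> {\<delta>/4..\<delta>/2}"
      have "\<theta> / 3 \<le> sin \<theta>" using t \<delta> pi_gt3 by (intro sin_ge_third) auto
      then have "\<delta> / 12 \<le> sin \<theta>" using t by simp
      then have "(\<delta> / 12) ^ D \<le> sin \<theta> ^ D" using \<delta> by (intro power_mono) auto
      moreover have "cos (\<delta> / 2) \<le> cos \<theta>" using t \<delta> pi_gt3 by (intro cos_monotone_0_pi_le) auto
      then have "1 \<le> (cos \<theta> - cos \<delta>) / (cos (\<delta> / 2) - cos \<delta>)" using mono by simp
      then have "\<phi> (cos \<theta>) = 1" by (simp add: \<phi>_def)
      ultimately show "(\<delta> / 12) ^ D \<le> \<phi> (cos \<theta>) * sin \<theta> ^ D" by simp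
    qed auto
    also have "\<dots> \<le> integral {0..pi} (\<lambda>\<theta>. \<phi> (cos \<theta>) * sin \<theta> ^ D)"
      by (rule integral_subset_le[OF _ i\<phi> i\<phi>])
        (use \<delta> pi_gt3 in \<open>auto simp: \<phi>_def intro!: mult_nonneg_nonneg zero_le_power sin_ge_zero\<close>)
    also have "integral {\<delta>/4..\<delta>/2} (\<lambda>\<theta>. (\<delta> / 12) ^ D) = (\<delta> / 4) * (\<delta> / 12) ^ D"
      using \<delta> by simp
    finally have low: "(\<delta> / 4) * (\<delta> / 12) ^ D \<le> integral {0..pi} (\<lambda>\<theta>. \<phi> (cos \<theta>) * sin \<theta> ^ D)" .
    have "(1 / (K * real n) / 4) * (1 / (K * real n) / 12) ^ D \<le> (\<delta> / 4) * (\<delta> / 12) ^ D"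
      using \<delta>2 \<delta> K n by (intro mult_mono power_mono divide_right_mono) auto
    with low have "zonal_const TYPE('a) * ((1 / (K * real n) / 4) * (1 / (K * real n) / 12) ^ D) \<le>
        zonal_const TYPE('a) * integral {0..pi} (\<lambda>\<theta>. \<phi> (cos \<theta>) * sin \<theta> ^ D)"
      using zonal_const_pos[where 'a='a] by (intro mult_left_mono) linarith+
    moreover have "zonal_const TYPE('a) * ((1 / (K * real n) / 4) * (1 / (K * real n) / 12) ^ D) = c * real n powr (- real (DIM('a) - 1))"
    proof -
      have "DIM('a) - 1 = Suc D" using N by (simp add: D_def)
      moreover have "real n powr (- real (Suc D)) = 1 / (real n * real n ^ D)"
        using n by (simp add: powr_minus_divide powr_realpow del: of_nat_Suc)
      ultimately show ?thesis by (simp add: c_def power_divide power_mult_distrib del: of_nat_Suc)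
    qed
    ultimately show "c * real n powr (- real (DIM('a) - 1)) \<le> measure surface_measure (cap e n)"
      using up by linarith
  qed
qed

section \<open>Zonal test functions and their pairing with P\<close>

definition pairing :: "'a::euclidean_space itself \<Rightarrow> nat \<Rightarrow> (real \<Rightarrow> real) \<Rightarrow> real" where
  "pairing _ n \<phi> = zonal_const TYPE('a) *
     integral {0..pi} (\<lambda>\<theta>. \<phi> (cos \<theta>) * poly (legendre DIM('a) n) (cos \<theta>) * sin \<theta> ^ (DIM('a) - 2))"

lemma pairing_eq:
  fixes e :: "'a::euclidean_space"
  assumes "2 \<le> DIM('a)" "norm e = 1" "continuous_on {-1..1} \<phi>"
  shows "(\<integral>y. \<phi> (y \<bullet> e) * poly (legendre DIM('a) n) (y \<bullet> e) \<partial>surface_measure) = pairing TYPE('a) n \<phi>"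
  unfolding pairing_def
  by (rule surface_integral_zonal[OF assms(1,2), of "\<lambda>t. \<phi> t * poly (legendre DIM('a) n) t"])
    (intro continuous_intros assms)

lemma real_power_powr: "0 < x \<Longrightarrow> x powr (- real k) = 1 / x ^ k"
  by (simp add: powr_minus_divide powr_realpow)

lemma legendre_mass_upper:
  assumes N: "3 \<le> DIM('a::euclidean_space)"
  shows "\<exists>C>0. \<forall>n\<ge>1. legendre_mass TYPE('a) n \<le> C * real n powr (- real (DIM('a) - 2))"
proof -
  let ?D = "DIM('a) - 2"
  define C where "C = zonal_const TYPE('a) * (pi * normalized_zonal_ode.c2 ?D)"
  have C: "0 < C"
  proof -
    \<comment> \<open>The constants involve the dimension only; degree 1 merely serves to enter the
      locale and read off their positivity.\<close>
    interpret zonal_profile ?D "frequency DIM('a) 1" "legendre DIM('a) 1"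
      using N by (rule zonal_profile_legendre) simp
    show ?thesis using c2_pos zonal_const_pos[where 'a='a] by (simp add: C_def)
  qed
  show ?thesis
  proof (intro exI[of _ C] conjI C allI impI)
    fix n :: nat assume n: "1 \<le> n"
    interpret zonal_profile ?D "frequency DIM('a) n" "legendre DIM('a) n"
      using N n by (rule zonal_profile_legendre)
    let ?I = "integral {0..pi} (\<lambda>\<theta>. (u \<theta>)\<^sup>2 * sin \<theta> ^ ?D)"
    have I0: "0 \<le> ?I"
      by (rule integral_nonneg) (auto intro!: integrable_continuous_interval continuous_intros mult_nonneg_nonneg zero_le_power[of "sin _"] sin_ge_zero)
    have "real n ^ ?D * ?I \<le> frequency DIM('a) n ^ ?D * ?I"
      using frequency_bounds(1)[of "DIM('a)" n] N n I0 by (intro mult_right_mono power_mono) auto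
    also have "\<dots> \<le> pi * c2" by (rule integral_u_square_upper)
    finally have "?I \<le> pi * c2 * real n powr (- real ?D)"
      using n by (simp add: real_power_powr field_simps)
    then have "zonal_const TYPE('a) * ?I \<le> zonal_const TYPE('a) * (pi * c2 * real n powr (- real ?D))"
      using zonal_const_pos[where 'a='a] by (intro mult_left_mono) auto
    then show "legendre_mass TYPE('a) n \<le> C * real n powr (- real ?D)"
      by (simp add: legendre_mass_def C_def u_def mult.assoc)
  qed
qed

text \<open>One factor sin^D is spent on making \<phi> bounded after multiplication by the power D /
  2 of n. The pairing with P then becomes the integral bounded below by \<open>c4\<close>, of order
  n to the power - D, times the same normalisation.\<close>

lemma bounded_profile:
  assumes N: "3 \<le> DIM('a::euclidean_space)"
  shows "\<exists>c>0. \<forall>n\<ge>1. \<exists>\<phi>. continuous_on {-1..1} \<phi> \<and> (\<forall>t\<in>{-1..1}. \<bar>\<phi> t\<bar> \<le> 1) \<and>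
    c * real n powr (- (real (DIM('a) - 2) / 2)) \<le> pairing TYPE('a) n \<phi>"
proof -
  let ?D = "DIM('a) - 2"
  let ?c2 = "normalized_zonal_ode.c2 ?D" and ?c4 = "zonal_profile.c4 ?D"
  define c where "c = zonal_const TYPE('a) * (?c4 / (sqrt ?c2 * sqrt (real DIM('a)) ^ ?D))"
  have c: "0 < c"
  proof -
    interpret zonal_profile ?D "frequency DIM('a) 1" "legendre DIM('a) 1"
      using N by (rule zonal_profile_legendre) simp
    show ?thesis using c2_pos c4_pos N zonal_const_pos[where 'a='a] by (simp add: c_def)
  qed
  show ?thesis
  proof (intro exI[of _ c] conjI c allI impI)
    fix n :: nat assume n: "1 \<le> n"
    interpret zonal_profile ?D "frequency DIM('a) n" "legendre DIM('a) n"
      using N n by (rule zonal_profile_legendre)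
    let ?\<omega> = "frequency DIM('a) n"
    let ?P = "poly (legendre DIM('a) n)"
    have f: "real n \<le> ?\<omega>" "?\<omega> \<le> sqrt (real DIM('a)) * real n"
      using frequency_bounds[of "DIM('a)" n] N n by auto
    \<comment> \<open>The square of this factor is n^D / c2, the largest that (\<omega> sin
      \<theta>)^D u^2 \<le> c2 and \<omega> \<ge> n allow.\<close>
    define a where "a = sqrt (real n ^ ?D) / sqrt c2"
    have a0: "0 \<le> a" using c2_pos by (simp add: a_def)
    \<comment> \<open>In the variable \<open>\<theta> = arccos t\<close> the square root is \<open>sin \<theta>\<close>.\<close>
    define \<phi> where "\<phi> t = a * (sqrt (1 - t\<^sup>2) ^ ?D * ?P t)" for t
    have sc: "sqrt (1 - (cos \<theta>)\<^sup>2) = sin \<theta>" if "\<theta> \<in> {0..pi}" for \<theta>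
      using that by (simp add: sin_squared_eq[symmetric] sin_ge_zero)
    show "\<exists>\<phi>. continuous_on {-1..1} \<phi> \<and> (\<forall>t\<in>{-1..1}. \<bar>\<phi> t\<bar> \<le> 1) \<and>
      c * real n powr (- (real ?D / 2)) \<le> pairing TYPE('a) n \<phi>"
    proof (intro exI[of _ \<phi>] conjI ballI)
      show "continuous_on {-1..1} \<phi>" unfolding \<phi>_def[abs_def] by (intro continuous_intros)
      fix t :: real assume t: "t \<in> {-1..1}"
      define \<theta> where "\<theta> = arccos t"
      have \<theta>: "\<theta> \<in> {0..pi}" "cos \<theta> = t" using t by (auto simp: \<theta>_def arccos_lbound arccos_ubound)
      have s: "0 \<le> sin \<theta>" "sin \<theta> \<le> 1" using \<theta> by (auto intro: sin_ge_zero)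
      have "(\<phi> t)\<^sup>2 = a\<^sup>2 * (sin \<theta> ^ ?D * (sin \<theta> ^ ?D * (u \<theta>)\<^sup>2))"
        using sc[OF \<theta>(1)] by (simp add: \<phi>_def u_def \<theta>(2) power2_eq_square mult_ac)
      also have "\<dots> \<le> a\<^sup>2 * (1 * (sin \<theta> ^ ?D * (u \<theta>)\<^sup>2))"
        using s by (intro mult_left_mono mult_right_mono power_le_one) auto
      also have "\<dots> = (real n ^ ?D * (sin \<theta> ^ ?D * (u \<theta>)\<^sup>2)) / c2"
        using c2_pos by (simp add: a_def power_divide)
      also have "\<dots> \<le> (?\<omega> ^ ?D * (sin \<theta> ^ ?D * (u \<theta>)\<^sup>2)) / c2"
        using f(1) s c2_pos by (intro divide_right_mono mult_right_mono power_mono) auto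
      also have "\<dots> \<le> c2 / c2"
        using scaled_u_upper[of \<theta>] \<theta> c2_pos by (intro divide_right_mono) (auto simp: power_mult_distrib mult_ac)
      finally have "(\<phi> t)\<^sup>2 \<le> 1" using c2_pos by simp
      then show "\<bar>\<phi> t\<bar> \<le> 1" by (simp add: abs_square_le_1)
    next
      have "c4 \<le> (sqrt (real DIM('a)) * real n) ^ ?D * integral {0..pi} (\<lambda>\<theta>. (u \<theta>)\<^sup>2 * sin \<theta> ^ ?D * sin \<theta> ^ ?D)"
      proof (rule order_trans[OF integral_u_square_sin_lower], rule mult_right_mono)
        show "?\<omega> ^ ?D \<le> (sqrt (real DIM('a)) * real n) ^ ?D" using f n by (intro power_mono) auto
        show "0 \<le> integral {0..pi} (\<lambda>\<theta>. (u \<theta>)\<^sup>2 * sin \<theta> ^ ?D * sin \<theta> ^ ?D)"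
          by (rule integral_nonneg) (auto intro!: integrable_continuous_interval continuous_intros mult_nonneg_nonneg zero_le_power[of "sin _"] sin_ge_zero)
      qed
      then have I: "c4 / (sqrt (real DIM('a)) ^ ?D * real n ^ ?D) \<le> integral {0..pi} (\<lambda>\<theta>. (u \<theta>)\<^sup>2 * sin \<theta> ^ ?D * sin \<theta> ^ ?D)"
        using n N by (simp add: power_mult_distrib field_simps)
      have "integral {0..pi} (\<lambda>\<theta>. \<phi> (cos \<theta>) * ?P (cos \<theta>) * sin \<theta> ^ ?D) = integral {0..pi} (\<lambda>\<theta>. a * ((u \<theta>)\<^sup>2 * sin \<theta> ^ ?D * sin \<theta> ^ ?D))"
        by (rule integral_cong) (simp add: \<phi>_def sc u_def, simp add: power2_eq_square)
      also have "\<dots> = a * integral {0..pi} (\<lambda>\<theta>. (u \<theta>)\<^sup>2 * sin \<theta> ^ ?D * sin \<theta> ^ ?D)" by (rule integral_mult_right)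
      also have "\<dots> \<ge> a * (c4 / (sqrt (real DIM('a)) ^ ?D * real n ^ ?D))"
        using I a0 by (rule mult_left_mono)
      finally have "zonal_const TYPE('a) * (a * (c4 / (sqrt (real DIM('a)) ^ ?D * real n ^ ?D))) \<le> pairing TYPE('a) n \<phi>"
        using zonal_const_pos[where 'a='a] unfolding pairing_def by (intro mult_left_mono) auto
      moreover have "a * (c4 / (sqrt (real DIM('a)) ^ ?D * real n ^ ?D)) = c4 / (sqrt c2 * sqrt (real DIM('a)) ^ ?D) * real n powr (- (real ?D / 2))"
      proof -
        have "sqrt (real n ^ ?D) / real n ^ ?D = real n powr (- (real ?D / 2))"
        proof -
          have "sqrt (real n ^ ?D) = real n powr (real ?D / 2)"
            using n by (simp add: powr_realpow[symmetric] powr_half_sqrt[symmetric] powr_powr)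
          moreover have "real n ^ ?D = real n powr (real ?D)" using n by (simp add: powr_realpow)
          ultimately show ?thesis by (simp flip: powr_diff)
        qed
        note S = this
        have "a * (c4 / (sqrt (real DIM('a)) ^ ?D * real n ^ ?D)) =
            c4 / (sqrt c2 * sqrt (real DIM('a)) ^ ?D) * (sqrt (real n ^ ?D) / real n ^ ?D)"
          by (simp add: a_def mult_ac)
        then show ?thesis unfolding S .
      qed
      ultimately show "c * real n powr (- (real ?D / 2)) \<le> pairing TYPE('a) n \<phi>"
        unfolding c_def by (simp only: mult.assoc)
    qed
  qed
qed

text \<open>The relation r (D / 2 + 1) = d balances the two integrals: up to constants, both reduce
  to \<omega> to the power - D times the integral of 1 / (1 + \<omega> sin \<theta>). From below
  this uses the mean square estimate, from above the pointwise decay of u.\<close>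

lemma log_profile:
  assumes N: "3 \<le> DIM('a::euclidean_space)"
  defines "d \<equiv> DIM('a) - 1"
  defines "r \<equiv> 2 * real d / (real d + 1)"
  shows "\<exists>c>0. \<exists>C>0. \<exists>n0\<ge>2. \<forall>n\<ge>n0. \<exists>\<phi>. continuous_on {-1..1} \<phi> \<and>
    c * (real n powr (- real d) * ln (real n)) \<le> pairing TYPE('a) n \<phi> \<and>
    (\<forall>e::'a. norm e = 1 \<longrightarrow> (\<integral>y. \<bar>\<phi> (y \<bullet> e)\<bar> powr r \<partial>surface_measure) \<le> C * (real n powr (- real d) * ln (real n)))"
proof -
  let ?D = "DIM('a) - 2"
  let ?c1 = "normalized_zonal_ode.c1 ?D" and ?c2 = "normalized_zonal_ode.c2 ?D" and ?c3 = "zonal_profile.c3 ?D"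
    and ?A = "normalized_zonal_ode.A ?D"
  have d: "d = Suc ?D" "2 \<le> d" using N by (auto simp: d_def)
  have r: "1 \<le> r" "r * (real ?D / 2 + 1) = real d" using d by (auto simp: r_def field_simps)
  define Q where "Q = sqrt (real DIM('a))"
  have Q: "1 \<le> Q" using N by (simp add: Q_def)
  define c where "c = zonal_const TYPE('a) * (?c1 / 8 / Q ^ d)"
  define C where "C = zonal_const TYPE('a) * (?c3 powr (r / 2) * 12)"
  have pos: "0 < c" "0 < C" "3 \<le> ?A" "0 < ?c1" "0 < ?c2"
  proof -
    interpret zonal_profile ?D "frequency DIM('a) 1" "legendre DIM('a) 1"
      using N by (rule zonal_profile_legendre) simp
    show "0 < c" "0 < C" "3 \<le> ?A" "0 < ?c1" "0 < ?c2"
      using c1_pos c2_pos Q zonal_const_pos[where 'a='a] A_ge by (auto simp: c_def C_def c3_def)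
  qed
  \<comment> \<open>Once ln n \<ge> L, half of the logarithm absorbs the constants subtracted in the
    lower bound.\<close>
  define L where "L = 2 * (ln ?A + ?c2 / (?A * ?c1))"
  \<comment> \<open>The entries ensure, in this order: ln n > 0, A / \<omega> \<le> 1, 1 + \<omega>
    \<le> n^2, and ln n \<ge> L.\<close>
  obtain n0 :: nat where n0: "real n0 \<ge> max (max 2 ?A) (max (1 + Q) (exp L))"
    using real_arch_simple by blast
  show ?thesis
  proof (rule exI[of _ c], rule conjI[OF pos(1)], rule exI[of _ C], rule conjI[OF pos(2)],
      rule exI[of _ n0], intro conjI allI impI)
    show "2 \<le> n0" using n0 by simp
    fix n assume n: "n0 \<le> n"
    have nn: "2 \<le> real n" "?A \<le> real n" "1 + Q \<le> real n" "exp L \<le> real n"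
      using n0 n by linarith+
    have n1: "1 \<le> n" using nn by simp
    interpret zonal_profile ?D "frequency DIM('a) n" "legendre DIM('a) n"
      using N n1 by (rule zonal_profile_legendre)
    let ?\<omega> = "frequency DIM('a) n"
    let ?P = "poly (legendre DIM('a) n)"
    have f: "real n \<le> ?\<omega>" "?\<omega> \<le> Q * real n"
      using frequency_bounds[of "DIM('a)" n] N n1 by (auto simp: Q_def)
    have lnn: "0 < ln (real n)" using nn by simp
    define \<phi> where "\<phi> t = ?P t / (1 + ?\<omega> * sqrt (1 - t\<^sup>2))" for t
    have den: "0 < 1 + ?\<omega> * sqrt (1 - t\<^sup>2)" if "t \<in> {-1..1}" for t
    proof -
      have "t\<^sup>2 \<le> 1" using that by (simp add: abs_square_le_1 abs_le_iff)
      then show ?thesis using \<omega> by (simp add: add_pos_nonneg)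
    qed
    have sc: "sqrt (1 - (cos \<theta>)\<^sup>2) = sin \<theta>" if "\<theta> \<in> {0..pi}" for \<theta>
      using that by (simp add: sin_squared_eq[symmetric] sin_ge_zero)
    have c\<phi>: "continuous_on {-1..1} \<phi>"
      unfolding \<phi>_def[abs_def] by (intro continuous_intros) (use den in force)
    show "\<exists>\<phi>. continuous_on {-1..1} \<phi> \<and>
      c * (real n powr (- real d) * ln (real n)) \<le> pairing TYPE('a) n \<phi> \<and>
      (\<forall>e::'a. norm e = 1 \<longrightarrow> (\<integral>y. \<bar>\<phi> (y \<bullet> e)\<bar> powr r \<partial>surface_measure) \<le> C * (real n powr (- real d) * ln (real n)))"
    proof (intro exI[of _ \<phi>] conjI c\<phi> allI impI)
      let ?J = "integral {0..pi} (\<lambda>\<theta>. (u \<theta>)\<^sup>2 / (1 + ?\<omega> * sin \<theta>) * sin \<theta> ^ ?D)"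
      have J: "integral {0..pi} (\<lambda>\<theta>. \<phi> (cos \<theta>) * ?P (cos \<theta>) * sin \<theta> ^ ?D) = ?J"
        by (rule integral_cong) (simp add: \<phi>_def sc u_def, simp add: power2_eq_square)
      have "?A / ?\<omega> \<le> 1" using nn f \<omega> by simp
      then have "?A / ?\<omega> \<le> pi / 2" using pi_gt3 by linarith
      from integral_u_square_log_lower[OF this]
      have low: "(c1 * (ln ?\<omega> - ln A) - c2 / A) / 4 \<le> ?\<omega> ^ d * ?J" by (simp add: d)
      have "c1 * ln (real n) / 8 \<le> (c1 * (ln ?\<omega> - ln A) - c2 / A) / 4"
      proof -
        have "ln (real n) \<le> ln ?\<omega>" using f nn by simp
        moreover have "L \<le> ln (real n)" using nn by (simp add: ln_ge_iff)
        moreover have "a / 2 + b \<le> c" if "a \<le> c" "2 * b \<le> a" for a b c :: real using that by simp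
        ultimately have "ln (real n) / 2 + (ln A + c2 / (A * c1)) \<le> ln ?\<omega>" unfolding L_def by blast
        then have "c1 * (ln (real n) / 2 + (ln A + c2 / (A * c1))) \<le> c1 * ln ?\<omega>"
          using pos by (intro mult_left_mono) auto
        moreover have "c1 * (c2 / (A * c1)) = c2 / A" using pos by simp
        ultimately show ?thesis by (simp add: algebra_simps)
      qed
      with low have "c1 * ln (real n) / 8 \<le> ?\<omega> ^ d * ?J" by linarith
      also have "\<dots> \<le> (Q * real n) ^ d * ?J"
      proof (rule mult_right_mono)
        show "?\<omega> ^ d \<le> (Q * real n) ^ d" using f nn by (intro power_mono) auto
        have "0 < ?\<omega> ^ d * ?J"
          using \<open>c1 * ln (real n) / 8 \<le> ?\<omega> ^ d * ?J\<close> lnn pos by (smt (verit) divide_pos_pos mult_pos_pos)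
        then show "0 \<le> ?J" using \<omega> by (simp add: zero_less_mult_iff)
      qed
      finally have "c1 / 8 / Q ^ d * (real n powr (- real d) * ln (real n)) \<le> ?J"
        using nn Q by (simp add: real_power_powr power_mult_distrib field_simps)
      then have "zonal_const TYPE('a) * (c1 / 8 / Q ^ d * (real n powr (- real d) * ln (real n))) \<le> zonal_const TYPE('a) * ?J"
        using zonal_const_pos[where 'a='a] by (intro mult_left_mono) auto
      then show "c * (real n powr (- real d) * ln (real n)) \<le> pairing TYPE('a) n \<phi>"
        unfolding pairing_def J by (simp add: c_def mult.assoc)
    next
      fix e :: 'a assume e: "norm e = 1"
      have N2: "2 \<le> DIM('a)" using N by simp
      have cont: "continuous_on {-1..1} (\<lambda>t. \<bar>\<phi> t\<bar> powr r)"
        using r(1) by (intro continuous_on_powr' continuous_intros c\<phi>) auto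
      have s0: "0 < 1 + ?\<omega> * sin \<theta>" if "\<theta> \<in> {0..pi}" for \<theta>
        using that \<omega> sin_ge_zero[of \<theta>] by (simp add: add_pos_nonneg)
      let ?b = "\<lambda>\<theta>. c3 powr (r / 2) / ?\<omega> ^ ?D * (1 / (1 + ?\<omega> * sin \<theta>))"
      have bi: "?b integrable_on {0..pi}"
        by (intro integrable_continuous_interval continuous_intros) (use s0 in force)
      have "integral {0..pi} (\<lambda>\<theta>. \<bar>\<phi> (cos \<theta>)\<bar> powr r * sin \<theta> ^ ?D) \<le> integral {0..pi} ?b"
      proof (rule integral_le[OF _ bi])
        show "(\<lambda>\<theta>. \<bar>\<phi> (cos \<theta>)\<bar> powr r * sin \<theta> ^ ?D) integrable_on {0..pi}"
          by (intro integrable_continuous_interval continuous_intros continuous_on_compose2[OF cont]) auto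
        fix \<theta> assume t: "\<theta> \<in> {0..pi}"
        define z where "z = 1 + ?\<omega> * sin \<theta>"
        have z: "1 \<le> z" using t \<omega> sin_ge_zero[of \<theta>] by (simp add: z_def)
        have s: "0 \<le> sin \<theta>" using t by (auto intro: sin_ge_zero)
        have "\<bar>u \<theta>\<bar> powr 2 \<le> c3 * z powr (- real ?D)"
        proof -
          have "z ^ ?D * (u \<theta>)\<^sup>2 \<le> c3" using u_decay[of \<theta>] t unfolding z_def by simp
          then show ?thesis using z by (simp add: real_power_powr field_simps)
        qed
        then have "(\<bar>u \<theta>\<bar> powr 2) powr (r / 2) \<le> (c3 * z powr (- real ?D)) powr (r / 2)"
          using r by (intro powr_mono2) auto
        moreover have "\<bar>u \<theta>\<bar> powr r \<le> c3 powr (r / 2) * z powr (- (r * real ?D / 2))"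
          if "(\<bar>u \<theta>\<bar> powr 2) powr (r / 2) \<le> (c3 * z powr (- real ?D)) powr (r / 2)"
        proof -
          have "0 \<le> c3" using pos by (simp add: c3_def)
          then have e2: "(c3 * z powr (- real ?D)) powr (r / 2) = c3 powr (r / 2) * z powr (- (r * real ?D / 2))"
            using z by (simp add: powr_mult powr_powr mult.commute)
          have e1: "(\<bar>u \<theta>\<bar> powr 2) powr (r / 2) = \<bar>u \<theta>\<bar> powr r"
            unfolding powr_powr by simp
          show ?thesis using that unfolding e1 e2 .
        qed
        ultimately have "\<bar>u \<theta>\<bar> powr r * z powr (- r) \<le> c3 powr (r / 2) * z powr (- (r * real ?D / 2)) * z powr (- r)"
          by (intro mult_right_mono) simp_all
        also have "\<dots> = c3 powr (r / 2) * z powr (- (r * (real ?D / 2 + 1)))"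
          by (simp add: powr_add[symmetric] algebra_simps)
        finally have up: "\<bar>u \<theta>\<bar> powr r * z powr (- r) \<le> c3 powr (r / 2) * z powr (- real d)"
          unfolding r(2) .
        have "\<bar>\<phi> (cos \<theta>)\<bar> powr r = \<bar>u \<theta>\<bar> powr r * z powr (- r)"
          using z sc[OF t] by (simp add: \<phi>_def u_def z_def[symmetric] abs_divide powr_divide powr_minus_divide)
        then have "\<bar>\<phi> (cos \<theta>)\<bar> powr r * sin \<theta> ^ ?D \<le> c3 powr (r / 2) * z powr (- real d) * sin \<theta> ^ ?D"
          using up s by (simp add: mult_right_mono)
        also have "z powr (- real d) = 1 / z * (1 / z ^ ?D)"
          using z by (simp add: real_power_powr d del: of_nat_Suc)
        also have "c3 powr (r / 2) * (1 / z * (1 / z ^ ?D)) * sin \<theta> ^ ?D = c3 powr (r / 2) * (1 / z) * (sin \<theta> / z) ^ ?D"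
          by (simp add: power_divide)
        \<comment> \<open>Of the d powers of 1 / z, D are used up by the weight sin^D through sin
          \<theta> / z \<le> 1 / \<omega>; a single one remains.\<close>
        also have "\<dots> \<le> c3 powr (r / 2) * (1 / z) * (1 / ?\<omega>) ^ ?D"
        proof (intro mult_left_mono power_mono)
          show "sin \<theta> / z \<le> 1 / ?\<omega>" using z \<omega> by (simp add: z_def field_simps)
        qed (use s z in auto)
        finally show "\<bar>\<phi> (cos \<theta>)\<bar> powr r * sin \<theta> ^ ?D \<le> ?b \<theta>"
          by (simp add: z_def power_divide mult.commute)
      qed
      also have "\<dots> = c3 powr (r / 2) / ?\<omega> ^ ?D * integral {0..pi} (\<lambda>\<theta>. 1 / (1 + ?\<omega> * sin \<theta>))"
        by (rule integral_mult_right)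
      also have "\<dots> = c3 powr (r / 2) / ?\<omega> ^ d * (?\<omega> * integral {0..pi} (\<lambda>\<theta>. 1 / (1 + ?\<omega> * sin \<theta>)))"
        using \<omega> by (simp add: d)
      also have "\<dots> \<le> c3 powr (r / 2) / real n ^ d * (6 * (2 * ln (real n)))"
      proof (rule mult_mono)
        show "c3 powr (r / 2) / ?\<omega> ^ d \<le> c3 powr (r / 2) / real n ^ d"
          using nn \<omega> f by (intro divide_left_mono power_mono) auto
        have "?\<omega> * integral {0..pi} (\<lambda>\<theta>. 1 / (1 + ?\<omega> * sin \<theta>)) \<le> 6 * ln (1 + ?\<omega>)"
          by (rule integral_inverse_sin_upper[OF \<omega>])
        also have "ln (1 + ?\<omega>) \<le> 2 * ln (real n)"
        proof -
          have "1 + ?\<omega> \<le> (1 + Q) * real n" using f nn Q by (simp add: algebra_simps)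
          also have "\<dots> \<le> real n * real n" using nn by (intro mult_right_mono) auto
          finally have "ln (1 + ?\<omega>) \<le> ln (real n * real n)" using \<omega> nn by simp
          then show ?thesis using nn by (simp add: ln_mult)
        qed
        finally show "?\<omega> * integral {0..pi} (\<lambda>\<theta>. 1 / (1 + ?\<omega> * sin \<theta>)) \<le> 6 * (2 * ln (real n))" by simp
        show "0 \<le> ?\<omega> * integral {0..pi} (\<lambda>\<theta>. 1 / (1 + ?\<omega> * sin \<theta>))"
        proof (intro mult_nonneg_nonneg integral_nonneg)
          show "(\<lambda>\<theta>. 1 / (1 + ?\<omega> * sin \<theta>)) integrable_on {0..pi}"
            by (intro integrable_continuous_interval continuous_intros) (use s0 in force)
          show "0 \<le> 1 / (1 + ?\<omega> * sin \<theta>)" if "\<theta> \<in> {0..pi}" for \<theta> using s0[OF that] by simp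
        qed (use \<omega> in simp)
      qed (use nn \<omega> in auto)
      finally have up: "integral {0..pi} (\<lambda>\<theta>. \<bar>\<phi> (cos \<theta>)\<bar> powr r * sin \<theta> ^ ?D) \<le> c3 powr (r / 2) * 12 * (real n powr (- real d) * ln (real n))"
        using nn by (simp add: real_power_powr)
      have "(\<integral>y. \<bar>\<phi> (y \<bullet> e)\<bar> powr r \<partial>surface_measure) = zonal_const TYPE('a) * integral {0..pi} (\<lambda>\<theta>. \<bar>\<phi> (cos \<theta>)\<bar> powr r * sin \<theta> ^ ?D)"
        by (rule surface_integral_zonal[OF N2 e cont])
      also have "\<dots> \<le> zonal_const TYPE('a) * (c3 powr (r / 2) * 12 * (real n powr (- real d) * ln (real n)))"
        using zonal_const_pos[where 'a='a] by (intro mult_left_mono up) auto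
      finally show "(\<integral>y. \<bar>\<phi> (y \<bullet> e)\<bar> powr r \<partial>surface_measure) \<le> C * (real n powr (- real d) * ln (real n))"
        by (simp add: C_def mult.assoc)
    qed
  qed
qed

section \<open>Lower bounds from caps and zonal functions\<close>

lemma op_norm_ge:
  assumes "f \<in> borel_measurable M" "Lp_norm M p f \<le> 1"
  shows "Lp_norm M q (T f) \<le> op_norm M p q T"
proof -
  have "Lp_norm M p f < \<infinity>" using assms(2) by (rule le_less_trans) simp
  then show ?thesis
    unfolding op_norm_def using assms by (intro SUP_upper) (auto simp: Lp_space_def)
qed

lemma harmonic_projection_zonal:
  fixes x e :: "'a::euclidean_space"
  assumes N: "3 \<le> DIM('a)" and n: "1 \<le> n" and x: "norm x = 1" and e: "norm e = 1" and \<phi>: "continuous_on {-1..1} \<phi>"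
  shows "(\<integral>y. zonal_kernel TYPE('a) n (y \<bullet> x) * \<phi> (y \<bullet> e) \<partial>surface_measure) =
      poly (legendre DIM('a) n) (e \<bullet> x) * pairing TYPE('a) n \<phi> / legendre_mass TYPE('a) n"
    and "harmonic_projection n (\<lambda>y. complex_of_real (\<phi> (y \<bullet> e))) x =
      of_real (poly (legendre DIM('a) n) (e \<bullet> x) * pairing TYPE('a) n \<phi> / legendre_mass TYPE('a) n)"
proof -
  let ?P = "poly (legendre DIM('a) n)"
  have N2: "2 \<le> DIM('a)" using N by simp
  have "(\<integral>y. zonal_kernel TYPE('a) n (y \<bullet> x) * \<phi> (y \<bullet> e) \<partial>surface_measure) =
      (\<integral>y. (\<phi> (y \<bullet> e) * ?P (y \<bullet> x)) / legendre_mass TYPE('a) n \<partial>surface_measure)"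
    by (simp add: zonal_kernel_def mult.commute)
  also have "\<dots> = (\<integral>y. \<phi> (y \<bullet> e) * ?P (y \<bullet> x) \<partial>surface_measure) / legendre_mass TYPE('a) n"
    by (rule integral_divide_zero)
  finally show eq: "(\<integral>y. zonal_kernel TYPE('a) n (y \<bullet> x) * \<phi> (y \<bullet> e) \<partial>surface_measure) =
      ?P (e \<bullet> x) * pairing TYPE('a) n \<phi> / legendre_mass TYPE('a) n"
    unfolding zonal_convolution[OF N n x e \<phi>] pairing_eq[OF N2 e \<phi>] .
  have "continuous_on (sphere 0 1) (\<lambda>y. complex_of_real (\<phi> (y \<bullet> e)))"
    by (intro continuous_intros continuous_on_inner_compose \<phi> e)
  from harmonic_projection_eq[OF N n borel_measurable_surface_continuous[OF this] x]
  show "harmonic_projection n (\<lambda>y. complex_of_real (\<phi> (y \<bullet> e))) x =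
      of_real (?P (e \<bullet> x) * pairing TYPE('a) n \<phi> / legendre_mass TYPE('a) n)"
    unfolding eq[symmetric] integral_complex_of_real[symmetric] of_real_mult .
qed

locale cap_setting =
  fixes e :: "'a::euclidean_space" and n :: nat
  assumes N: "3 \<le> DIM('a)" and n: "1 \<le> n" and e: "norm e = 1"
begin

abbreviation \<sigma> :: "'a measure" where "\<sigma> \<equiv> surface_measure"
definition \<mu> :: real where "\<mu> = measure \<sigma> (cap e n)"

lemma \<mu>_pos: "0 < \<mu>"
proof -
  obtain c where c: "c > 0" "c * real n powr (- real (DIM('a) - 1)) \<le> \<mu>"
    using cap_measure_lower[OF N] n e unfolding \<mu>_def by metis
  have "0 < c * real n powr (- real (DIM('a) - 1))" using c n by simp
  with c show ?thesis by linarith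
qed

lemma m_pos: "0 < legendre_mass TYPE('a) n" by (rule legendre_mass_pos[OF N n])

text \<open>The projection of a zonal function is a multiple of P (e \<bullet> x), and P is at least
  1/2 on the cap around e. The norm of the image is estimated on that cap alone.\<close>

lemma focusing:
  assumes q: "1 \<le> q" and \<phi>: "continuous_on {-1..1} \<phi>" "0 \<le> pairing TYPE('a) n \<phi>"
    and norm: "Lp_norm \<sigma> p (\<lambda>y. complex_of_real (\<phi> (y \<bullet> e))) \<le> 1"
  shows "ennreal (pairing TYPE('a) n \<phi> / (2 * legendre_mass TYPE('a) n) * \<mu> powr recip q) \<le> op_norm \<sigma> p q (harmonic_projection n)"
proof -
  let ?f = "\<lambda>y. complex_of_real (\<phi> (y \<bullet> e))"
  have fm: "?f \<in> borel_measurable \<sigma>"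
    by (intro borel_measurable_surface_continuous continuous_intros continuous_on_inner_compose \<phi> e)
  have "ennreal (pairing TYPE('a) n \<phi> / (2 * legendre_mass TYPE('a) n) * \<mu> powr recip q) \<le> Lp_norm \<sigma> q (harmonic_projection n ?f)"
    unfolding \<mu>_def
  proof (rule Lp_norm_ge_on[OF q cap_sets emeasure_cap_finite])
    show "0 < measure \<sigma> (cap e n)" using \<mu>_pos by (simp add: \<mu>_def)
    show "0 \<le> pairing TYPE('a) n \<phi> / (2 * legendre_mass TYPE('a) n)" using \<phi> m_pos by simp
    fix x assume x: "x \<in> cap e n"
    then have "norm x = 1" by (simp add: cap_def)
    then have "norm (harmonic_projection n ?f x) = \<bar>poly (legendre DIM('a) n) (e \<bullet> x) * pairing TYPE('a) n \<phi> / legendre_mass TYPE('a) n\<bar>"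
      using harmonic_projection_zonal(2)[OF N n _ e \<phi>(1)] by (simp only: norm_of_real)
    also have "\<dots> \<ge> 1 / 2 * pairing TYPE('a) n \<phi> / legendre_mass TYPE('a) n"
    proof (rule order_trans[OF _ abs_ge_self])
      show "1 / 2 * pairing TYPE('a) n \<phi> / legendre_mass TYPE('a) n \<le> poly (legendre DIM('a) n) (e \<bullet> x) * pairing TYPE('a) n \<phi> / legendre_mass TYPE('a) n"
        using legendre_cap_ge[OF N n centre_in_cap[OF N n e] x] \<phi> m_pos
        by (intro divide_right_mono mult_right_mono) auto
    qed
    finally show "pairing TYPE('a) n \<phi> / (2 * legendre_mass TYPE('a) n) \<le> norm (harmonic_projection n ?f x)" by simp
  qed
  also have "\<dots> \<le> op_norm \<sigma> p q (harmonic_projection n)" by (rule op_norm_ge[OF fm norm])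
  finally show ?thesis .
qed

section \<open>The normalised indicator of a cap and its projection\<close>

definition f :: "ennreal \<Rightarrow> 'a \<Rightarrow> real" where
  "f p y = \<mu> powr (- recip p) * indicator (cap e n) y"

definition F :: "ennreal \<Rightarrow> 'a \<Rightarrow> real" where
  "F p x = (\<integral>y. zonal_kernel TYPE('a) n (y \<bullet> x) * f p y \<partial>\<sigma>)"

lemma f_measurable: "f p \<in> borel_measurable \<sigma>" "(\<lambda>y. complex_of_real (f p y)) \<in> borel_measurable \<sigma>"
proof -
  have "indicator (cap e n) \<in> borel_measurable \<sigma>" using cap_sets by measurable
  then show "f p \<in> borel_measurable \<sigma>" unfolding f_def[abs_def] by measurable
  then show "(\<lambda>y. complex_of_real (f p y)) \<in> borel_measurable \<sigma>" by measurable
qed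

lemma f_integrable: "integrable \<sigma> (f p)" "integrable \<sigma> (\<lambda>y. complex_of_real (f p y))"
proof -
  have "integrable \<sigma> (indicator (cap e n) :: 'a \<Rightarrow> real)"
    using cap_sets emeasure_cap_finite by (intro integrable_real_indicator) auto
  then show "integrable \<sigma> (f p)" unfolding f_def[abs_def] by simp
  then show "integrable \<sigma> (\<lambda>y. complex_of_real (f p y))" by (rule integrable_of_real)
qed

lemma integral_f: "(\<integral>y. f p y \<partial>\<sigma>) = \<mu> powr (1 - recip p)"
proof -
  have "(\<integral>y. f p y \<partial>\<sigma>) = \<mu> powr (- recip p) * (\<integral>y. indicator (cap e n) y \<partial>\<sigma>)"
    unfolding f_def by (rule integral_mult_right_zero)
  also have "(\<integral>y. indicator (cap e n) y \<partial>\<sigma>) = \<mu>"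
    using sets.sets_into_space[OF cap_sets[of e n]] by (simp add: \<mu>_def Int_absorb2)
  finally show ?thesis using \<mu>_pos by (simp add: powr_diff powr_minus_divide)
qed

lemma f_norm:
  assumes p: "1 \<le> p"
  shows "Lp_norm \<sigma> p (\<lambda>y. complex_of_real (f p y)) \<le> 1"
proof -
  have "Lp_norm \<sigma> p (\<lambda>y. complex_of_real (f p y)) \<le> ennreal (\<mu> powr (- recip p) * measure \<sigma> (cap e n) powr recip p)"
    by (rule Lp_norm_le_on[OF p f_measurable(2) cap_sets emeasure_cap_finite])
      (use \<mu>_pos in \<open>auto simp: \<mu>_def f_def norm_mult\<close>)
  also have "\<dots> = 1" using \<mu>_pos by (simp add: \<mu>_def[symmetric] powr_minus)
  finally show ?thesis .
qed

lemma harmonic_projection_f: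
  "norm x = 1 \<Longrightarrow> harmonic_projection n (\<lambda>y. complex_of_real (f p y)) x = of_real (F p x)"
  unfolding harmonic_projection_eq[OF N n f_measurable(2)] F_def integral_complex_of_real[symmetric] by simp

text \<open>Although f jumps at the edge of the cap, its convolution with the kernel is the
  restriction of a harmonic polynomial.\<close>

lemma F_continuous: "continuous_on (sphere 0 1) (F p)"
proof -
  have i: "integrable \<sigma> (\<lambda>y. complex_of_real (f p y) / of_real (legendre_mass TYPE('a) n))" using f_integrable(2) by simp
  obtain Y where Y: "Y \<in> harmonic_polynomials n"
    "\<And>x. norm x = 1 \<Longrightarrow> Y x = (\<integral>y. of_real (poly (legendre DIM('a) n) (y \<bullet> x)) * (complex_of_real (f p y) / of_real (legendre_mass TYPE('a) n)) \<partial>\<sigma>)"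
    by (rule legendre_integral_harmonic[OF i, of n]) blast
  have "Re (Y x) = F p x" if x: "norm x = 1" for x
  proof -
    have "Y x = (\<integral>y. complex_of_real (zonal_kernel TYPE('a) n (y \<bullet> x) * f p y) \<partial>\<sigma>)"
      unfolding Y(2)[OF x] by (simp add: zonal_kernel_def)
    then have "Y x = of_real (F p x)" unfolding F_def integral_complex_of_real .
    then show ?thesis by simp
  qed
  moreover have "continuous_on (sphere 0 1) (\<lambda>x. Re (Y x))"
    by (intro continuous_intros continuous_on_polymonial_function harmonic_polynomialsD[OF Y(1)])
  ultimately show ?thesis by (subst continuous_on_cong[OF refl, of _ _ "\<lambda>x. Re (Y x)"]) auto
qed

lemma F_cap_ge:
  assumes x: "x \<in> cap e n"
  shows "\<mu> powr (1 - recip p) / (2 * legendre_mass TYPE('a) n) \<le> F p x"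
proof -
  have nx: "norm x = 1" using x by (simp add: cap_def)
  have "\<mu> powr (1 - recip p) / (2 * legendre_mass TYPE('a) n) = (\<integral>y. 1 / (2 * legendre_mass TYPE('a) n) * f p y \<partial>\<sigma>)"
    by (simp add: integral_f)
  also have "\<dots> \<le> F p x"
    unfolding F_def
  proof (rule integral_mono)
    show "integrable \<sigma> (\<lambda>y. 1 / (2 * legendre_mass TYPE('a) n) * f p y)" by (intro integrable_mult_right f_integrable)
    have "integrable \<sigma> (\<lambda>y. Re (of_real (zonal_kernel TYPE('a) n (y \<bullet> x)) * complex_of_real (f p y)))"
      by (intro integrable_Re integrable_surface_mult f_integrable continuous_intros
          continuous_on_compose2[OF continuous_on_zonal_kernel[of UNIV]]) auto
    then show "integrable \<sigma> (\<lambda>y. zonal_kernel TYPE('a) n (y \<bullet> x) * f p y)" by simp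
    fix y
    show "1 / (2 * legendre_mass TYPE('a) n) * f p y \<le> zonal_kernel TYPE('a) n (y \<bullet> x) * f p y"
    proof (cases "y \<in> cap e n")
      case True
      have "1 / 2 / legendre_mass TYPE('a) n \<le> poly (legendre DIM('a) n) (y \<bullet> x) / legendre_mass TYPE('a) n"
        using legendre_cap_ge[OF N n True x] m_pos by (intro divide_right_mono) auto
      then show ?thesis using \<mu>_pos by (intro mult_right_mono) (auto simp: zonal_kernel_def f_def)
    qed (simp add: f_def)
  qed
  finally show ?thesis .
qed

text \<open>On the product of the cap with itself the kernel is at least 1 / (2 m), where m is the
  mass of P; there is no cancellation for input and output both localised to the cap.\<close>

lemma concentration:
  assumes p: "1 \<le> p" and q: "1 \<le> q"
  shows "ennreal (\<mu> powr (1 - recip p) / (2 * legendre_mass TYPE('a) n) * \<mu> powr recip q) \<le> op_norm \<sigma> p q (harmonic_projection n)"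
proof -
  have "ennreal (\<mu> powr (1 - recip p) / (2 * legendre_mass TYPE('a) n) * \<mu> powr recip q) \<le>
      Lp_norm \<sigma> q (harmonic_projection n (\<lambda>y. complex_of_real (f p y)))"
    unfolding \<mu>_def
  proof (rule Lp_norm_ge_on[OF q cap_sets emeasure_cap_finite])
    show "0 < measure \<sigma> (cap e n)" using \<mu>_pos by (simp add: \<mu>_def)
    show "0 \<le> measure \<sigma> (cap e n) powr (1 - recip p) / (2 * legendre_mass TYPE('a) n)" using m_pos by simp
    fix x assume x: "x \<in> cap e n"
    then have nx: "norm x = 1" by (simp add: cap_def)
    show "measure \<sigma> (cap e n) powr (1 - recip p) / (2 * legendre_mass TYPE('a) n) \<le> norm (harmonic_projection n (\<lambda>y. complex_of_real (f p y)) x)"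
      using order_trans[OF F_cap_ge[OF x, of p] abs_ge_self]
      unfolding harmonic_projection_f[OF nx] \<mu>_def norm_of_real .
  qed
  also have "\<dots> \<le> op_norm \<sigma> p q (harmonic_projection n)" by (rule op_norm_ge[OF f_measurable(2) f_norm[OF p]])
  finally show ?thesis .
qed

text \<open>By symmetry of the kernel the projection can be moved from the cap indicator to the
  zonal function, where it acts as a multiple of P, and P is at least 1/2 on the support of the
  indicator.\<close>

lemma F_pairing:
  assumes \<phi>: "continuous_on {-1..1} \<phi>" "0 \<le> pairing TYPE('a) n \<phi>"
  shows "\<mu> powr (1 - recip p) * (pairing TYPE('a) n \<phi> / (2 * legendre_mass TYPE('a) n)) \<le> (\<integral>x. F p x * \<phi> (x \<bullet> e) \<partial>\<sigma>)"
proof -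
  let ?K = "zonal_kernel TYPE('a) n"
  have g: "continuous_on (sphere 0 1) (\<lambda>y. complex_of_real (\<phi> (y \<bullet> e)))"
    by (intro continuous_intros continuous_on_inner_compose \<phi> e)
  have "complex_of_real (\<integral>x. F p x * \<phi> (x \<bullet> e) \<partial>\<sigma>) =
      (\<integral>x. (\<integral>y. of_real (?K (y \<bullet> x)) * of_real (f p y) \<partial>\<sigma>) * of_real (\<phi> (x \<bullet> e)) \<partial>\<sigma>)"
    unfolding F_def by (simp only: integral_complex_of_real[symmetric] of_real_mult)
  also have "\<dots> = (\<integral>y. of_real (f p y) * (\<integral>x. of_real (?K (x \<bullet> y)) * of_real (\<phi> (x \<bullet> e)) \<partial>\<sigma>) \<partial>\<sigma>)"
    by (rule kernel_fubini[OF f_integrable(2) g continuous_on_zonal_kernel])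
  also have "\<dots> = of_real (\<integral>y. f p y * (\<integral>x. ?K (x \<bullet> y) * \<phi> (x \<bullet> e) \<partial>\<sigma>) \<partial>\<sigma>)"
    by (simp only: integral_complex_of_real[symmetric] of_real_mult)
  finally have eq: "(\<integral>x. F p x * \<phi> (x \<bullet> e) \<partial>\<sigma>) = (\<integral>y. f p y * (\<integral>x. ?K (x \<bullet> y) * \<phi> (x \<bullet> e) \<partial>\<sigma>) \<partial>\<sigma>)"
    by (simp only: of_real_eq_iff)
  also have "\<dots> = (\<integral>y. f p y * (poly (legendre DIM('a) n) (e \<bullet> y) * pairing TYPE('a) n \<phi> / legendre_mass TYPE('a) n) \<partial>\<sigma>)"
    by (rule Bochner_Integration.integral_cong[OF refl]) (simp add: harmonic_projection_zonal(1)[OF N n _ e \<phi>(1)])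
  also have "\<dots> \<ge> (\<integral>y. pairing TYPE('a) n \<phi> / (2 * legendre_mass TYPE('a) n) * f p y \<partial>\<sigma>)"
  proof (rule integral_mono)
    show "integrable \<sigma> (\<lambda>y. pairing TYPE('a) n \<phi> / (2 * legendre_mass TYPE('a) n) * f p y)" by (intro integrable_mult_right f_integrable)
    have "integrable \<sigma> (\<lambda>y. Re (of_real (poly (legendre DIM('a) n) (e \<bullet> y) * pairing TYPE('a) n \<phi> / legendre_mass TYPE('a) n) * complex_of_real (f p y)))"
      unfolding divide_inverse by (intro integrable_Re integrable_surface_mult f_integrable continuous_intros)
    then show "integrable \<sigma> (\<lambda>y. f p y * (poly (legendre DIM('a) n) (e \<bullet> y) * pairing TYPE('a) n \<phi> / legendre_mass TYPE('a) n))"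
      by (simp add: mult_ac flip: of_real_mult)
    fix y
    show "pairing TYPE('a) n \<phi> / (2 * legendre_mass TYPE('a) n) * f p y \<le> f p y * (poly (legendre DIM('a) n) (e \<bullet> y) * pairing TYPE('a) n \<phi> / legendre_mass TYPE('a) n)"
    proof (cases "y \<in> cap e n")
      case True
      have "1 / 2 * pairing TYPE('a) n \<phi> / legendre_mass TYPE('a) n \<le> poly (legendre DIM('a) n) (e \<bullet> y) * pairing TYPE('a) n \<phi> / legendre_mass TYPE('a) n"
        using legendre_cap_ge[OF N n centre_in_cap[OF N n e] True] \<phi> m_pos
        by (intro divide_right_mono mult_right_mono) auto
      then have "f p y * (1 / 2 * pairing TYPE('a) n \<phi> / legendre_mass TYPE('a) n) \<le> f p y * (poly (legendre DIM('a) n) (e \<bullet> y) * pairing TYPE('a) n \<phi> / legendre_mass TYPE('a) n)"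
        using \<mu>_pos by (intro mult_left_mono) (auto simp: f_def)
      then show ?thesis by (simp add: mult.commute)
    qed (simp add: f_def)
  qed
  finally show ?thesis by (simp add: integral_f mult.commute)
qed

lemma dual_bounded:
  assumes p: "1 \<le> p" and q: "1 \<le> q"
    and \<phi>: "continuous_on {-1..1} \<phi>" "0 < pairing TYPE('a) n \<phi>" "\<And>t. t \<in> {-1..1} \<Longrightarrow> \<bar>\<phi> t\<bar> \<le> 1"
  shows "ennreal (\<mu> powr (1 - recip p) * (pairing TYPE('a) n \<phi> / (2 * legendre_mass TYPE('a) n)) * measure \<sigma> (sphere 0 1) powr (recip q - 1))
    \<le> op_norm \<sigma> p q (harmonic_projection n)"
proof -
  obtain C where C: "\<And>x. norm x = 1 \<Longrightarrow> norm (F p x) \<le> C" using sphere_bounded[OF F_continuous] by metis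
  have "ennreal (\<mu> powr (1 - recip p) * (pairing TYPE('a) n \<phi> / (2 * legendre_mass TYPE('a) n)) * measure \<sigma> (space \<sigma>) powr (recip q - 1)) \<le>
      Lp_norm \<sigma> q (harmonic_projection n (\<lambda>y. complex_of_real (f p y)))"
  proof (rule Lp_norm_ge_of_bounded_pairing[OF finite_measure_surface_measure q, where f="F p" and C=C and g="\<lambda>x. \<phi> (x \<bullet> e)"])
    show "harmonic_projection n (\<lambda>y. complex_of_real (f p y)) x = of_real (F p x)" if "x \<in> space \<sigma>" for x
      using that by (intro harmonic_projection_f) simp
    show "F p \<in> borel_measurable \<sigma>" by (rule borel_measurable_surface_continuous[OF F_continuous])
    show "\<bar>F p x\<bar> \<le> C" if "x \<in> space \<sigma>" for x using C[of x] that by simp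
    show "(\<lambda>x. \<phi> (x \<bullet> e)) \<in> borel_measurable \<sigma>"
      by (intro borel_measurable_surface_continuous continuous_on_inner_compose \<phi> e)
    show "\<bar>\<phi> (x \<bullet> e)\<bar> \<le> 1" if "x \<in> space \<sigma>" for x
      using that by (intro \<phi>(3) inner_sphere_bounds e) simp
    show "0 < \<mu> powr (1 - recip p) * (pairing TYPE('a) n \<phi> / (2 * legendre_mass TYPE('a) n))" using \<phi>(2) m_pos \<mu>_pos by simp
    show "\<mu> powr (1 - recip p) * (pairing TYPE('a) n \<phi> / (2 * legendre_mass TYPE('a) n)) \<le> (\<integral>x. F p x * \<phi> (x \<bullet> e) \<partial>\<sigma>)"
      using \<phi> by (intro F_pairing) auto
    show "0 < measure \<sigma> (space \<sigma>)" using surface_measure_sphere_pos by simp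
  qed
  also have "\<dots> \<le> op_norm \<sigma> p q (harmonic_projection n)" by (rule op_norm_ge[OF f_measurable(2) f_norm[OF p]])
  finally show ?thesis by simp
qed

text \<open>As \<open>dual_bounded\<close>, with the test function measured in the conjugate
  exponent instead of the supremum norm: a lower bound for the pairing and an upper bound G for the
  r-th power integral together bound the image from below.\<close>

lemma dual_hoelder:
  assumes p: "1 \<le> p" and q: "1 \<le> q" "q \<noteq> \<infinity>" and r: "1 < enn2real q" "1 < r" "1 / enn2real q + 1 / r = 1"
    and \<phi>: "continuous_on {-1..1} \<phi>" "0 < pairing TYPE('a) n \<phi>" and G: "(\<integral>y. \<bar>\<phi> (y \<bullet> e)\<bar> powr r \<partial>\<sigma>) \<le> G" "0 < G"
  shows "ennreal (\<mu> powr (1 - recip p) * (pairing TYPE('a) n \<phi> / (2 * legendre_mass TYPE('a) n)) * G powr (- (1 / r)))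
    \<le> op_norm \<sigma> p q (harmonic_projection n)"
proof -
  let ?Q = "enn2real q"
  have rq: "recip q = 1 / ?Q" by (rule recip_finite(2)[OF q])
  have c\<phi>: "continuous_on (sphere 0 1) (\<lambda>x. \<phi> (x \<bullet> e))" by (intro continuous_on_inner_compose \<phi> e)
  have iF: "integrable \<sigma> (\<lambda>x. \<bar>F p x\<bar> powr ?Q)"
    using r by (intro integrable_surface_continuous continuous_on_powr' continuous_intros F_continuous) auto
  have "\<mu> powr (1 - recip p) * (pairing TYPE('a) n \<phi> / (2 * legendre_mass TYPE('a) n)) * G powr (- (1 / r)) \<le> (\<integral>x. \<bar>F p x\<bar> powr ?Q \<partial>\<sigma>) powr (1 / ?Q)"
  proof (rule hoelder_lower[OF r iF _ G(1) _ _ _ G(2)])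
    show "integrable \<sigma> (\<lambda>x. \<bar>\<phi> (x \<bullet> e)\<bar> powr r)"
      using r by (intro integrable_surface_continuous continuous_on_powr' continuous_intros c\<phi>) auto
    show "integrable \<sigma> (\<lambda>x. F p x * \<phi> (x \<bullet> e))"
      by (intro integrable_surface_continuous continuous_intros F_continuous c\<phi>)
    show "0 < \<mu> powr (1 - recip p) * (pairing TYPE('a) n \<phi> / (2 * legendre_mass TYPE('a) n))" using \<phi>(2) m_pos \<mu>_pos by simp
    show "\<mu> powr (1 - recip p) * (pairing TYPE('a) n \<phi> / (2 * legendre_mass TYPE('a) n)) \<le> (\<integral>x. F p x * \<phi> (x \<bullet> e) \<partial>\<sigma>)"
      using \<phi> by (intro F_pairing) auto
  qed
  then have "ennreal (\<mu> powr (1 - recip p) * (pairing TYPE('a) n \<phi> / (2 * legendre_mass TYPE('a) n)) * G powr (- (1 / r))) \<le>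
      ennreal ((\<integral>x. \<bar>F p x\<bar> powr ?Q \<partial>\<sigma>) powr (1 / ?Q))" by (rule ennreal_leI)
  also have "\<dots> = Lp_norm \<sigma> q (\<lambda>x. complex_of_real (F p x))"
    using Lp_norm_eq_integral[OF q, of \<sigma> "\<lambda>x. complex_of_real (F p x)"] iF rq by simp
  also have "\<dots> = Lp_norm \<sigma> q (harmonic_projection n (\<lambda>y. complex_of_real (f p y)))"
    by (rule Lp_norm_cong) (simp add: harmonic_projection_f)
  also have "\<dots> \<le> op_norm \<sigma> p q (harmonic_projection n)" by (rule op_norm_ge[OF f_measurable(2) f_norm[OF p]])
  finally show ?thesis .
qed

end

section \<open>The lower bound from highest weight harmonics\<close>

lemma positive_limit_bounds:
  fixes X :: "nat \<Rightarrow> real"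
  assumes lim: "X \<longlonglongrightarrow> L" and L: "0 < L" and pos: "\<And>k. 1 \<le> k \<Longrightarrow> 0 < X k"
  shows "\<exists>c>0. \<exists>C>0. \<forall>k\<ge>1. c \<le> X k \<and> X k \<le> C"
proof -
  have "Bseq X" using lim convergentI convergent_imp_Bseq by blast
  then obtain C where C: "C > 0" "\<And>k. norm (X k) \<le> C" unfolding Bseq_def by blast
  have "(\<lambda>k. inverse (X k)) \<longlonglongrightarrow> inverse L" using lim L by (intro tendsto_inverse) auto
  then have "Bseq (\<lambda>k. inverse (X k))" using convergentI convergent_imp_Bseq by blast
  then obtain B where B: "B > 0" "\<And>k. norm (inverse (X k)) \<le> B" unfolding Bseq_def by blast
  have "1 / B \<le> X k \<and> X k \<le> C" if "1 \<le> k" for k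
    using B(1) B(2)[of k] C(2)[of k] pos[OF that] by (simp add: field_simps)
  then show ?thesis using B(1) C(1) by (intro exI[of _ "1 / B"] conjI exI[of _ C]) auto
qed

lemma cap_measure_pos:
  fixes e :: "'a::euclidean_space"
  assumes "3 \<le> DIM('a)" "1 \<le> n" "norm e = 1"
  shows "0 < measure surface_measure (cap e n)"
proof -
  interpret cap_setting e n using assms by unfold_locales
  show ?thesis using \<mu>_pos by (simp add: \<mu>_def)
qed

locale knapp_setting =
  fixes e1 e2 :: "'a::euclidean_space"
  assumes N: "3 \<le> DIM('a)" and e12: "e1 \<in> Basis" "e2 \<in> Basis" "e1 \<noteq> e2"
begin

abbreviation \<sigma> :: "'a measure" where "\<sigma> \<equiv> surface_measure"
definition w :: "'a \<Rightarrow> complex" where "w y = of_real (y \<bullet> e1) + \<i> * of_real (y \<bullet> e2)"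
definition \<rho> :: "'a \<Rightarrow> real" where "\<rho> y = (y \<bullet> e1)\<^sup>2 + (y \<bullet> e2)\<^sup>2"

lemma norm_w: "norm (w y) = sqrt (\<rho> y)"
  by (simp add: w_def \<rho>_def cmod_def)

lemma e_products: "e1 \<bullet> e1 = 1" "e2 \<bullet> e2 = 1" "e1 \<bullet> e2 = 0" "e2 \<bullet> e1 = 0" "norm e1 = 1"
  using e12 by (auto simp: inner_not_same_Basis)

lemma \<rho>_bounds: "0 \<le> \<rho> y" "norm y = 1 \<Longrightarrow> \<rho> y \<le> 1"
proof -
  show "0 \<le> \<rho> y" by (simp add: \<rho>_def)
  assume y: "norm y = 1"
  have "(\<Sum>b\<in>{e1, e2}. (y \<bullet> b) * (y \<bullet> b)) \<le> (\<Sum>b\<in>Basis. (y \<bullet> b) * (y \<bullet> b))"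
    using e12 by (intro sum_mono2) auto
  also have "\<dots> = 1" using y by (simp add: euclidean_inner[symmetric] norm_eq_1)
  finally show "\<rho> y \<le> 1" using e12 by (simp add: \<rho>_def power2_eq_square)
qed

text \<open>The gradient of w is a constant isotropic vector: its entries are those of e1 + \<i> e2,
  whose squares add up to 1 - 1 = 0.\<close>

lemma w_power_harmonic: "(\<lambda>y. w y ^ n) \<in> harmonic_polynomials n"
proof -
  have wp: "polynomial_function w" unfolding w_def[abs_def] by (intro poly_intros)
  define c where "c b = complex_of_real (b \<bullet> e1) + \<i> * of_real (b \<bullet> e2)" for b
  have pw: "partial_deriv b w = (\<lambda>_. c b)" for b
  proof -
    have p: "polynomial_function (\<lambda>y::'a. complex_of_real (y \<bullet> e1))" "polynomial_function (\<lambda>y::'a. complex_of_real (y \<bullet> e2))"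
      "polynomial_function (\<lambda>y::'a. \<i> * complex_of_real (y \<bullet> e2))"
      by (intro poly_intros)+
    show ?thesis
      unfolding w_def[abs_def] by (simp add: partial_deriv_add[OF p(1,3)] partial_deriv_cmult[OF p(2)] partial_deriv_inner c_def)
  qed
  have pd: "partial_deriv b (partial_deriv b (\<lambda>y. w y ^ n)) y = of_nat n * (of_nat (n - 1) * w y ^ (n - 1 - 1)) * (c b * c b)" for b y
  proof -
    have q: "polynomial_function (\<lambda>y. w y ^ (n - 1))" using wp by (intro poly_intros)
    have "partial_deriv b (\<lambda>y. w y ^ n) = (\<lambda>y. (of_nat n * c b) * w y ^ (n - 1))"
      unfolding partial_deriv_power[OF wp] pw by (simp add: mult_ac)
    then show ?thesis
      by (simp only: partial_deriv_cmult[OF q] partial_deriv_power[OF wp] pw) (simp add: mult_ac)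
  qed
  have "(\<Sum>b\<in>Basis. c b * c b) = of_real (\<Sum>b\<in>Basis. (e1 \<bullet> b) * (e1 \<bullet> b)) - of_real (\<Sum>b\<in>Basis. (e2 \<bullet> b) * (e2 \<bullet> b))
      + 2 * \<i> * of_real (\<Sum>b\<in>Basis. (e1 \<bullet> b) * (e2 \<bullet> b))"
    by (simp add: c_def sum_distrib_left sum.distrib sum_subtractf inner_commute[of e1] inner_commute[of e2] algebra_simps)
  also have "\<dots> = 0" by (simp only: euclidean_inner[symmetric] e_products) simp
  finally have cc: "(\<Sum>b\<in>Basis. c b * c b) = 0" .
  have "laplacian (\<lambda>y. w y ^ n) = (\<lambda>y. 0)"
    unfolding laplacian_def pd sum_distrib_left[symmetric] cc by simp
  moreover have "homogeneous n (\<lambda>y. w y ^ n)"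
  proof -
    have "w (t *\<^sub>R y) = of_real t * w y" for t y by (simp add: w_def algebra_simps)
    then show ?thesis by (simp add: homogeneous_def power_mult_distrib)
  qed
  ultimately show ?thesis
    using wp unfolding harmonic_polynomials_iff by (auto intro: polynomial_function_complex_power)
qed

section \<open>Moments of the highest weight harmonics\<close>

definition M :: "nat \<Rightarrow> real" where "M k = (\<integral>y. \<rho> y ^ k \<partial>\<sigma>)"

lemma \<rho>_continuous [continuous_intros]: "continuous_on S \<rho>"
  unfolding \<rho>_def[abs_def] by (intro continuous_intros)

text \<open>The divergence theorem for (y \<bullet> e) \<rho> ^ k in direction e, added up for e =
  e1 and e = e2; the squares of the two coordinates recombine to \<rho>.\<close>

lemma moment_recursion: "(real DIM('a) + 2 * real k) * M (Suc k) = (2 + 2 * real k) * M k"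
proof -
  let ?r = "\<lambda>y. complex_of_real (\<rho> y)"
  have rp: "polynomial_function ?r"
  proof -
    have "polynomial_function (\<lambda>y. complex_of_real (y \<bullet> e1) ^ 2 + complex_of_real (y \<bullet> e2) ^ 2)" by (intro poly_intros)
    then show ?thesis by (simp only: \<rho>_def of_real_add of_real_power)
  qed
  have part: "complex_of_real (real DIM('a) + 2 * real k) * (\<integral>y. of_real ((y \<bullet> e) * (y \<bullet> e) * \<rho> y ^ k) \<partial>\<sigma>) =
      (\<integral>y. of_real (\<rho> y ^ k + 2 * real k * ((y \<bullet> e) * (y \<bullet> e) * \<rho> y ^ (k - 1))) \<partial>\<sigma>)" if e: "e = e1 \<or> e = e2" for e
  proof -
    let ?x = "\<lambda>y::'a. complex_of_real (y \<bullet> e)"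
    have xp: "polynomial_function ?x" by (intro poly_intros)
    have rkp: "polynomial_function (\<lambda>y. ?r y ^ k)" by (rule polynomial_function_complex_power[OF rp])
    let ?F = "\<lambda>y. ?x y * ?r y ^ k"
    have Fp: "polynomial_function ?F" using xp rkp by (rule polynomial_function_complex_mult)
    have Fh: "homogeneous (1 + 2 * k) ?F"
    proof -
      have r2: "homogeneous 2 ?r" by (simp add: homogeneous_def \<rho>_def power_mult_distrib algebra_simps)
      have "homogeneous 1 ?x" by (simp add: homogeneous_def)
      then show ?thesis by (rule homogeneous_mult[OF _ homogeneous_power[OF r2]])
    qed
    have pr: "partial_deriv e ?r = (\<lambda>y. 2 * ?x y)"
    proof -
      have p: "polynomial_function (\<lambda>y::'a. complex_of_real (y \<bullet> b))" "polynomial_function (\<lambda>y::'a. complex_of_real (y \<bullet> b) ^ 2)" for b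
        by (intro poly_intros)+
      have "?r = (\<lambda>y. complex_of_real (y \<bullet> e1) ^ 2 + complex_of_real (y \<bullet> e2) ^ 2)" by (simp add: \<rho>_def fun_eq_iff)
      then show ?thesis using e
        by (auto simp: partial_deriv_add[OF p(2) p(2)] partial_deriv_power[OF p(1)] partial_deriv_inner e_products)
    qed
    have "partial_deriv e ?F = (\<lambda>y. ?x y * (of_nat k * ?r y ^ (k - 1) * (2 * ?x y)) + of_real (e \<bullet> e) * ?r y ^ k)"
      unfolding partial_deriv_mult[OF xp rkp] partial_deriv_power[OF rp] pr partial_deriv_inner ..
    then have pF: "partial_deriv e ?F = (\<lambda>y. of_real (\<rho> y ^ k + 2 * real k * ((y \<bullet> e) * (y \<bullet> e) * \<rho> y ^ (k - 1))))"
      using e e_products by (auto simp: fun_eq_iff algebra_simps)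
    from surface_integral_partial_deriv[OF Fp Fh, of e, unfolded pF] show ?thesis
      by (simp add: mult_ac add_ac)
  qed
  have i: "integrable \<sigma> (\<lambda>y. (y \<bullet> e) * (y \<bullet> e) * \<rho> y ^ k)" "integrable \<sigma> (\<lambda>y. \<rho> y ^ k + 2 * real k * ((y \<bullet> e) * (y \<bullet> e) * \<rho> y ^ (k - 1)))" for e k
    by (intro integrable_surface_continuous continuous_intros)+
  have part': "(real DIM('a) + 2 * real k) * (\<integral>y. (y \<bullet> e) * (y \<bullet> e) * \<rho> y ^ k \<partial>\<sigma>) =
      (\<integral>y. \<rho> y ^ k + 2 * real k * ((y \<bullet> e) * (y \<bullet> e) * \<rho> y ^ (k - 1)) \<partial>\<sigma>)" if e: "e = e1 \<or> e = e2" for e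
    using part[OF e] unfolding integral_complex_of_real of_real_mult[symmetric] of_real_eq_iff .
  have "(real DIM('a) + 2 * real k) * M (Suc k) = (real DIM('a) + 2 * real k) * (\<integral>y. (y \<bullet> e1) * (y \<bullet> e1) * \<rho> y ^ k + (y \<bullet> e2) * (y \<bullet> e2) * \<rho> y ^ k \<partial>\<sigma>)"
    by (simp add: M_def \<rho>_def power2_eq_square algebra_simps)
  also have "\<dots> = (\<integral>y. \<rho> y ^ k + 2 * real k * ((y \<bullet> e1) * (y \<bullet> e1) * \<rho> y ^ (k - 1)) \<partial>\<sigma>) + (\<integral>y. \<rho> y ^ k + 2 * real k * ((y \<bullet> e2) * (y \<bullet> e2) * \<rho> y ^ (k - 1)) \<partial>\<sigma>)"
    by (simp only: Bochner_Integration.integral_add[OF i(1) i(1)] distrib_left part' simp_thms)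
  also have "\<dots> = (\<integral>y. (\<rho> y ^ k + 2 * real k * ((y \<bullet> e1) * (y \<bullet> e1) * \<rho> y ^ (k - 1))) + (\<rho> y ^ k + 2 * real k * ((y \<bullet> e2) * (y \<bullet> e2) * \<rho> y ^ (k - 1))) \<partial>\<sigma>)"
    by (rule Bochner_Integration.integral_add[symmetric]) (rule i)+
  also have "\<dots> = (\<integral>y. (2 + 2 * real k) * \<rho> y ^ k \<partial>\<sigma>)"
  proof (rule Bochner_Integration.integral_cong[OF refl])
    fix y
    have "real k * \<rho> y ^ k = real k * (((y \<bullet> e1) * (y \<bullet> e1) + (y \<bullet> e2) * (y \<bullet> e2)) * \<rho> y ^ (k - 1))"
      by (cases k) (auto simp: \<rho>_def power2_eq_square)
    then show "(\<rho> y ^ k + 2 * real k * ((y \<bullet> e1) * (y \<bullet> e1) * \<rho> y ^ (k - 1))) + (\<rho> y ^ k + 2 * real k * ((y \<bullet> e2) * (y \<bullet> e2) * \<rho> y ^ (k - 1))) = (2 + 2 * real k) * \<rho> y ^ k"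
      by (simp add: algebra_simps)
  qed
  also have "\<dots> = (2 + 2 * real k) * M k" unfolding M_def by (rule integral_mult_right_zero)
  finally show ?thesis .
qed

definition a :: real where "a = real (DIM('a) - 2) / 2"

lemma a_pos: "0 < a" using N by (simp add: a_def)

lemma M_0: "M 0 = measure \<sigma> (sphere 0 1)" by (simp add: M_def)

lemma M_closed_form: "M k = M 0 * fact k / pochhammer (a + 1) k"
proof (induction k)
  case (Suc k)
  have Na: "real DIM('a) + 2 * real k = 2 * (a + 1 + real k)" using N by (simp add: a_def of_nat_diff field_simps)
  have pos: "0 < a + 1 + real k" using a_pos by simp
  have "2 * ((a + 1 + real k) * M (Suc k)) = 2 * ((1 + real k) * M k)"
    using moment_recursion[of k] unfolding Na by (simp add: algebra_simps)
  then have "(a + 1 + real k) * M (Suc k) = (1 + real k) * M k" by simp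
  then have "M (Suc k) = (1 + real k) * M k / (a + 1 + real k)" using pos by (simp add: field_simps)
  then show ?case unfolding Suc.IH by (simp add: pochhammer_Suc mult_ac)
qed simp

text \<open>Up to the constant factor M 0 * a, the moments multiplied by the power a of k are Gauss'
  product for the Gamma function at a. Its limit is positive, so the sequence lies between two
  positive constants.\<close>

lemma M_asymptotics: "\<exists>c>0. \<exists>C>0. \<forall>k\<ge>1. c * real k powr (- a) \<le> M k \<and> M k \<le> C * real k powr (- a)"
proof -
  define X where "X k = M k * real k powr a" for k
  have M0: "0 < M 0" unfolding M_0 by (rule surface_measure_sphere_pos)
  have pp: "0 < pochhammer (a + 1) k" for k using a_pos by (intro pochhammer_pos) auto
  have X: "X k = M 0 * a * Gamma_series a k" if "1 \<le> k" for k
  proof -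
    have "pochhammer a (Suc k) = a * pochhammer (a + 1) k" by (simp add: pochhammer_rec)
    moreover have "exp (a * ln (real k)) = real k powr a" using that by (simp add: powr_def)
    ultimately have "M 0 * a * Gamma_series a k = M 0 * a * (fact k * real k powr a / (a * pochhammer (a + 1) k))"
      by (simp add: Gamma_series_def)
    also have "\<dots> = X k" unfolding X_def M_closed_form[of k] using a_pos by simp
    finally show ?thesis by simp
  qed
  have "(\<lambda>k. M 0 * a * Gamma_series a k) \<longlonglongrightarrow> M 0 * a * Gamma a"
    by (intro tendsto_intros Gamma_series_LIMSEQ)
  then have lim: "X \<longlonglongrightarrow> M 0 * a * Gamma a"
    by (rule Lim_transform_eventually) (use X in \<open>auto simp: eventually_at_top_linorder intro!: exI[of _ 1]\<close>)
  have L: "0 < M 0 * a * Gamma a" using M0 a_pos Gamma_real_pos[OF a_pos] by simp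
  have Xp: "0 < X k" if "1 \<le> k" for k
    using that M0 pp[of k] unfolding X_def M_closed_form[of k] by simp
  obtain c C where cC: "c > 0" "C > 0" "\<And>k. 1 \<le> k \<Longrightarrow> c \<le> X k \<and> X k \<le> C"
    using positive_limit_bounds[OF lim L Xp] by metis
  have "c * real k powr (- a) \<le> M k \<and> M k \<le> C * real k powr (- a)" if "1 \<le> k" for k
    using cC(3)[OF that] that by (simp add: X_def powr_minus field_simps)
  with cC show ?thesis by (intro exI[of _ c] conjI exI[of _ C]) auto
qed

lemma w_power_norm: "norm (w y ^ n) powr P = \<rho> y powr (real n * P / 2)" if "0 < \<rho> y"
  using that by (simp add: norm_power norm_w powr_half_sqrt[symmetric] powr_powr powr_realpow[symmetric])

lemma w_power_integrable: "0 < P \<Longrightarrow> integrable \<sigma> (\<lambda>y. norm (w y ^ n) powr P)"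
  unfolding w_def[abs_def] by (intro integrable_surface_continuous continuous_on_powr' continuous_intros) auto

text \<open>The recursion knows integer powers of \<rho> only. As \<rho> \<le> 1 on the sphere,
  rounding the exponent n P / 2 up or down gives bounds on either side.\<close>

lemma w_power_between:
  assumes y: "norm y = 1" and n: "1 \<le> n" and P: "1 \<le> P"
  shows "\<rho> y ^ nat \<lceil>real n * P / 2\<rceil> \<le> norm (w y ^ n) powr P"
    and "norm (w y ^ n) powr P \<le> \<rho> y ^ nat \<lfloor>real n * P / 2\<rfloor>"
proof -
  have nP: "0 < real n * P / 2" using n P by simp
  have r1: "\<rho> y \<le> 1" by (rule \<rho>_bounds(2)[OF y])
  show "\<rho> y ^ nat \<lceil>real n * P / 2\<rceil> \<le> norm (w y ^ n) powr P" "norm (w y ^ n) powr P \<le> \<rho> y ^ nat \<lfloor>real n * P / 2\<rfloor>"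
  proof -
    show "\<rho> y ^ nat \<lceil>real n * P / 2\<rceil> \<le> norm (w y ^ n) powr P"
    proof (cases "\<rho> y = 0")
      case True
      have "0 < nat \<lceil>real n * P / 2\<rceil>" using nP by simp
      then show ?thesis using True by (simp add: zero_power)
    next
      case False
      then have r: "0 < \<rho> y" using \<rho>_bounds(1)[of y] by simp
      have "\<rho> y powr real (nat \<lceil>real n * P / 2\<rceil>) \<le> \<rho> y powr (real n * P / 2)"
        using r r1 by (intro powr_mono') linarith+
      then show ?thesis using r by (simp add: w_power_norm powr_realpow)
    qed
    show "norm (w y ^ n) powr P \<le> \<rho> y ^ nat \<lfloor>real n * P / 2\<rfloor>"
    proof (cases "\<rho> y = 0")
      case True
      then have "w y = 0" using norm_w[of y] True by simp
      then have "w y ^ n = 0" using n by simp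
      then have eq: "norm (w y ^ n) powr P = 0" by simp
      show ?thesis unfolding eq using \<rho>_bounds(1)[of y] by simp
    next
      case False
      then have r: "0 < \<rho> y" using \<rho>_bounds(1)[of y] by simp
      have "\<rho> y powr (real n * P / 2) \<le> \<rho> y powr real (nat \<lfloor>real n * P / 2\<rfloor>)"
        using r r1 nP by (intro powr_mono') linarith+
      then show ?thesis using r by (simp add: w_power_norm powr_realpow)
    qed
  qed
qed

lemma w_power_integral_bounds:
  assumes P: "1 \<le> P"
  shows "\<exists>c>0. \<exists>C>0. \<forall>n\<ge>1. c * real n powr (- a) \<le> (\<integral>y. norm (w y ^ n) powr P \<partial>\<sigma>) \<and>
    (\<integral>y. norm (w y ^ n) powr P \<partial>\<sigma>) \<le> C * real n powr (- a)"
proof -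
  obtain c C where cC: "c > 0" "C > 0" "\<And>k. 1 \<le> k \<Longrightarrow> c * real k powr (- a) \<le> M k"
    "\<And>k. 1 \<le> k \<Longrightarrow> M k \<le> C * real k powr (- a)"
    using M_asymptotics by metis
  have iM: "integrable \<sigma> (\<lambda>y. \<rho> y ^ k)" for k by (intro integrable_surface_continuous continuous_intros)
  define c' where "c' = c * (P / 2 + 1) powr (- a)"
  define C' where "C' = max C (M 0) * 4 powr a"
  have c': "0 < c'" using cC P by (simp add: c'_def)
  have C': "0 < C'" using cC by (simp add: C'_def)
  have "c' * real n powr (- a) \<le> (\<integral>y. norm (w y ^ n) powr P \<partial>\<sigma>) \<and> (\<integral>y. norm (w y ^ n) powr P \<partial>\<sigma>) \<le> C' * real n powr (- a)"
    if n: "1 \<le> n" for n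
  proof
    let ?K = "nat \<lceil>real n * P / 2\<rceil>" and ?k = "nat \<lfloor>real n * P / 2\<rfloor>"
    have nP: "0 < real n * P / 2" using n P by simp
    have K: "1 \<le> ?K" "real ?K \<le> real n * (P / 2 + 1)"
    proof -
      show "1 \<le> ?K" using nP by linarith
      have "real ?K \<le> real n * P / 2 + 1" using nP by linarith
      also have "\<dots> \<le> real n * (P / 2 + 1)" using n by (simp add: algebra_simps)
      finally show "real ?K \<le> real n * (P / 2 + 1)" .
    qed
    have "c' * real n powr (- a) = c * (real n * (P / 2 + 1)) powr (- a)"
      using n P by (simp add: c'_def powr_mult)
    also have "\<dots> \<le> c * real ?K powr (- a)"
      using K a_pos cC n P by (intro mult_left_mono powr_mono2') auto
    also have "\<dots> \<le> M ?K" by (rule cC(3)[OF K(1)])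
    also have "\<dots> \<le> (\<integral>y. norm (w y ^ n) powr P \<partial>\<sigma>)"
      unfolding M_def using w_power_between(1)[OF _ n P] P
      by (intro integral_mono iM w_power_integrable) auto
    finally show "c' * real n powr (- a) \<le> (\<integral>y. norm (w y ^ n) powr P \<partial>\<sigma>)" .
    have "(\<integral>y. norm (w y ^ n) powr P \<partial>\<sigma>) \<le> M ?k"
      unfolding M_def using w_power_between(2)[OF _ n P] P
      by (intro integral_mono iM w_power_integrable) auto
    \<comment> \<open>Since n P / 2 \<ge> n / 2, the rounded exponent is at least n / 4 unless it is
      0. In that case n / 4 \<le> 1 and M 0 itself serves as the bound.\<close>
    also have "\<dots> \<le> max C (M 0) * (real n / 4) powr (- a)"
    proof (cases "1 \<le> ?k")
      case True
      have "real n / 2 \<le> real n * P / 2" using mult_left_mono[OF P, of "real n"] by simp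
      also have "\<dots> < real ?k + 1" using nP by linarith
      finally have "real n / 4 \<le> real ?k" using True by linarith
      then have "real ?k powr (- a) \<le> (real n / 4) powr (- a)"
        using n a_pos by (intro powr_mono2') auto
      then have "C * real ?k powr (- a) \<le> max C (M 0) * (real n / 4) powr (- a)"
        using cC by (intro mult_mono) auto
      with cC(4)[OF True] show ?thesis by linarith
    next
      case False
      then have k0: "?k = 0" by linarith
      have "real n / 2 \<le> real n * P / 2" using mult_left_mono[OF P, of "real n"] by simp
      moreover have "real n * P / 2 < 1"
      proof -
        have "\<lfloor>real n * P / 2\<rfloor> < 1" using False by linarith
        then show ?thesis unfolding floor_less_iff by simp
      qed
      ultimately have "real n / 4 \<le> 1" by linarith
      then have "1 powr (- a) \<le> (real n / 4) powr (- a)"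
        using n a_pos by (intro powr_mono2') auto
      then have "M 0 * 1 \<le> max C (M 0) * (real n / 4) powr (- a)"
        using cC by (intro mult_mono) auto
      then show ?thesis using k0 by simp
    qed
    also have "\<dots> = C' * real n powr (- a)" using n by (simp add: C'_def powr_divide powr_minus field_simps)
    finally show "(\<integral>y. norm (w y ^ n) powr P \<partial>\<sigma>) \<le> C' * real n powr (- a)" .
  qed
  with c' C' show ?thesis by (intro exI[of _ c'] conjI exI[of _ C']) auto
qed

lemma norm_w_power_le_1: "norm y = 1 \<Longrightarrow> norm (w y ^ n) \<le> 1"
  using \<rho>_bounds[of y] by (simp add: norm_power norm_w power_le_one)

lemma scaled_norm_integral:
  assumes "0 < s" "0 < P"
  shows "integrable \<sigma> (\<lambda>y. norm (of_real (1 / s) * w y ^ n) powr P)"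
    "(\<integral>y. norm (of_real (1 / s) * w y ^ n) powr P \<partial>\<sigma>) = (1 / s) powr P * (\<integral>y. norm (w y ^ n) powr P \<partial>\<sigma>)"
proof -
  have eq: "norm (of_real (1 / s) * w y ^ n) powr P = (1 / s) powr P * norm (w y ^ n) powr P" for y
    using assms by (simp only: norm_mult norm_of_real powr_mult) simp
  show "integrable \<sigma> (\<lambda>y. norm (of_real (1 / s) * w y ^ n) powr P)"
    unfolding eq by (intro integrable_mult_right w_power_integrable assms)
  show "(\<integral>y. norm (of_real (1 / s) * w y ^ n) powr P \<partial>\<sigma>) = (1 / s) powr P * (\<integral>y. norm (w y ^ n) powr P \<partial>\<sigma>)"
    unfolding eq by (rule integral_mult_right_zero)
qed

text \<open>At distance at most 1 / n from e1 the coordinate y \<bullet> e1 is at least 1 - 1 / (2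
  n), and Bernoulli's inequality keeps the n-th power above 1/2. This settles the supremum
  norm.\<close>

lemma norm_w_power_cap_ge:
  assumes n: "1 \<le> n" and y: "y \<in> cap e1 n"
  shows "1 / 2 \<le> norm (w y ^ n)"
proof -
  have y1: "norm y = 1" "norm (y - e1) \<le> 1 / (12 * frequency DIM('a) n)" using y by (auto simp: cap_def)
  have f: "real n \<le> frequency DIM('a) n" using frequency_bounds(1)[of "DIM('a)" n] N n by simp
  have "1 / (12 * frequency DIM('a) n) \<le> 1 / real n"
    using f n by (intro divide_left_mono) auto
  with y1 have d: "norm (y - e1) \<le> 1 / real n" by linarith
  then have d2: "(norm (y - e1))\<^sup>2 \<le> (1 / real n)\<^sup>2" by (intro power_mono) auto
  have "(1 / real n)\<^sup>2 \<le> 1 / real n" using n by (simp add: power2_eq_square field_simps)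
  with d2 have "(norm (y - e1))\<^sup>2 \<le> 1 / real n" by (rule order_trans)
  then have ip: "1 - 1 / (2 * real n) \<le> y \<bullet> e1"
    using n unfolding inner_eq_norm_diff[OF y1(1) e_products(5)] by simp
  have h: "1 / (2 * real n) \<le> 1 / 2" using n by (simp add: field_simps)
  have "1 / 2 = 1 + real n * (- (1 / (2 * real n)))" using n by simp
  also have "\<dots> \<le> (1 + (- (1 / (2 * real n)))) ^ n" using h by (intro Bernoulli_inequality) linarith
  also have "\<dots> \<le> norm (w y) ^ n"
  proof (rule power_mono)
    have "y \<bullet> e1 \<le> \<bar>Re (w y)\<bar>" by (simp add: w_def)
    also have "\<dots> \<le> norm (w y)" by (rule abs_Re_le_cmod)
    finally show "1 + - (1 / (2 * real n)) \<le> norm (w y)" using ip by linarith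
    show "0 \<le> 1 + - (1 / (2 * real n))" using h by linarith
  qed
  finally show ?thesis by (simp add: norm_power)
qed

text \<open>The projection fixes this harmonic, so the operator norm is at least the quotient of its
  two Lebesgue norms; these are known up to constants from the moments.\<close>

theorem knapp_lower_bound:
  assumes p: "1 \<le> p" and q: "1 \<le> q"
  shows "\<exists>c>0. \<forall>n\<ge>1. ennreal (c * real n powr (a * (recip p - recip q))) \<le> op_norm \<sigma> p q (harmonic_projection n)"
proof -
  \<comment> \<open>For p = \<infinity> the exponent \<open>recip p\<close> is 0, so the scale is 1
    for any choice of C, and the bound |w| \<le> 1 suffices.\<close>
  have upper: "\<exists>C>0. \<forall>n\<ge>1. Lp_norm \<sigma> p (\<lambda>y. of_real (1 / (C * real n powr (- a)) powr recip p) * w y ^ n) \<le> 1"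
  proof (cases "p = \<infinity>")
    case True
    have "Lp_norm \<sigma> p (\<lambda>y. w y ^ n) \<le> ennreal (1 * measure \<sigma> (sphere 0 1) powr recip p)" for n
    proof (rule Lp_norm_le_on[OF p])
      show "(\<lambda>y. w y ^ n) \<in> borel_measurable \<sigma>"
        unfolding w_def by (intro borel_measurable_surface_continuous continuous_intros)
      show "sphere 0 1 \<in> sets \<sigma>" using sets.top[of \<sigma>] by simp
      show "emeasure \<sigma> (sphere 0 1) < \<infinity>" using emeasure_sphere_finite by simp
      show "0 < measure \<sigma> (sphere 0 1)" by (rule surface_measure_sphere_pos)
      show "norm (w y ^ n) \<le> 1 * indicator (sphere 0 1) y" if "y \<in> space \<sigma>" for y
        using norm_w_power_le_1[of y n] that by simp
    qed simp
    then show ?thesis using True surface_measure_sphere_pos[where 'a='a] by (intro exI[of _ 1]) simp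
  next
    case False
    let ?P = "enn2real p"
    note P = recip_finite[OF p False]
    obtain C where C: "C > 0" "\<And>n. 1 \<le> n \<Longrightarrow> (\<integral>y. norm (w y ^ n) powr ?P \<partial>\<sigma>) \<le> C * real n powr (- a)"
      using w_power_integral_bounds[OF P(1)] by metis
    show ?thesis
    proof (intro exI[of _ C] conjI C(1) allI impI)
      fix n :: nat assume n: "1 \<le> n"
      define s where "s = (C * real n powr (- a)) powr recip p"
      have X: "0 < C * real n powr (- a)" using C n by simp
      have s: "0 < s" "(1 / s) powr ?P = 1 / (C * real n powr (- a))"
        using X P n by (auto simp: s_def powr_divide powr_powr)
      have P0: "0 < ?P" using P by simp
      note S = scaled_norm_integral[OF s(1) P0, of n]
      have le: "(\<integral>y. norm (of_real (1 / s) * w y ^ n) powr ?P \<partial>\<sigma>) \<le> 1"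
        unfolding S(2) s(2) using C(2)[OF n] X by simp
      have "Lp_norm \<sigma> p (\<lambda>y. of_real (1 / s) * w y ^ n) = ennreal ((\<integral>y. norm (of_real (1 / s) * w y ^ n) powr ?P \<partial>\<sigma>) powr recip p)"
        by (rule Lp_norm_eq_integral[OF p False S(1)])
      also have "\<dots> \<le> ennreal 1"
        using le recip_bounds[OF p] by (intro ennreal_leI powr_le1 integral_nonneg_AE) auto
      finally show "Lp_norm \<sigma> p (\<lambda>y. of_real (1 / (C * real n powr (- a)) powr recip p) * w y ^ n) \<le> 1"
        by (simp add: s_def powr_divide)
    qed
  qed
  then obtain C where C: "C > 0" "\<And>n. 1 \<le> n \<Longrightarrow> Lp_norm \<sigma> p (\<lambda>y. of_real (1 / (C * real n powr (- a)) powr recip p) * w y ^ n) \<le> 1"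
    by blast
  \<comment> \<open>The scale s stays free here, so that it can be set to the normalisation found
    for p.\<close>
  have lower: "\<exists>c>0. \<forall>n\<ge>1. \<forall>s>0. ennreal (c * real n powr (- a * recip q) / s) \<le> Lp_norm \<sigma> q (\<lambda>y. of_real (1 / s) * w y ^ n)"
  proof (cases "q = \<infinity>")
    case True
    have "ennreal ((1 / (2 * s)) * measure \<sigma> (cap e1 n) powr recip q) \<le> Lp_norm \<sigma> q (\<lambda>y. of_real (1 / s) * w y ^ n)"
      if n: "1 \<le> n" and s: "0 < s" for n s
    proof (rule Lp_norm_ge_on[OF q cap_sets emeasure_cap_finite])
      show "0 < measure \<sigma> (cap e1 n)" by (rule cap_measure_pos[OF N n e_products(5)])
      show "0 \<le> 1 / (2 * s)" using s by simp
      fix y assume "y \<in> cap e1 n"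
      then have "1 / 2 \<le> norm (w y ^ n)" by (rule norm_w_power_cap_ge[OF n])
      then have "1 / s * (1 / 2) \<le> 1 / s * norm (w y ^ n)" using s by (intro mult_left_mono) auto
      then show "1 / (2 * s) \<le> norm (of_real (1 / s) * w y ^ n)"
        using s by (simp add: norm_mult norm_divide)
    qed
    moreover have "measure \<sigma> (cap e1 n) powr recip q = 1" if n: "1 \<le> n" for n
      using True cap_measure_pos[OF N n e_products(5)] by simp
    ultimately show ?thesis using True by (intro exI[of _ "1/2"]) auto
  next
    case False
    let ?Q = "enn2real q"
    note Q = recip_finite[OF q False]
    obtain c where c: "c > 0" "\<And>n. 1 \<le> n \<Longrightarrow> c * real n powr (- a) \<le> (\<integral>y. norm (w y ^ n) powr ?Q \<partial>\<sigma>)"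
      using w_power_integral_bounds[OF Q(1)] by metis
    show ?thesis
    proof (intro exI[of _ "c powr recip q"] conjI allI impI)
      show "0 < c powr recip q" using c by simp
      fix n :: nat and s :: real assume n: "1 \<le> n" and s: "0 < s"
      have Q0: "0 < ?Q" using Q by simp
      note S = scaled_norm_integral[OF s Q0, of n]
      have "c powr recip q * real n powr (- a * recip q) / s = ((1 / s) powr ?Q * (c * real n powr (- a))) powr recip q"
        using c s Q by (simp add: powr_mult powr_powr)
      also have "\<dots> \<le> (\<integral>y. norm (of_real (1 / s) * w y ^ n) powr ?Q \<partial>\<sigma>) powr recip q"
        unfolding S(2) using c n s recip_bounds[OF q] by (intro powr_mono2 mult_left_mono) auto
      finally show "ennreal (c powr recip q * real n powr (- a * recip q) / s) \<le> Lp_norm \<sigma> q (\<lambda>y. of_real (1 / s) * w y ^ n)"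
        unfolding Lp_norm_eq_integral[OF q False S(1)] by (rule ennreal_leI)
    qed
  qed
  then obtain c where c: "c > 0" "\<And>n s. 1 \<le> n \<Longrightarrow> 0 < s \<Longrightarrow> ennreal (c * real n powr (- a * recip q) / s) \<le> Lp_norm \<sigma> q (\<lambda>y. of_real (1 / s) * w y ^ n)"
    by blast
  show ?thesis
  proof (intro exI[of _ "c / C powr recip p"] conjI allI impI)
    show "0 < c / C powr recip p" using c C by simp
    fix n :: nat assume n: "1 \<le> n"
    define s where "s = (C * real n powr (- a)) powr recip p"
    have X: "0 < C * real n powr (- a)" using C n by simp
    have s: "0 < s" using n C(1) by (simp add: s_def)
    have s': "1 / (C * real n powr (- a)) powr recip p = 1 / s" by (simp add: s_def)
    let ?f = "\<lambda>y. of_real (1 / s) * w y ^ n"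
    have fc: "continuous_on (sphere 0 1) ?f" unfolding w_def[abs_def] by (intro continuous_intros)
    have T: "harmonic_projection n ?f x = ?f x" if x: "norm x = 1" for x
    proof -
      have "harmonic_projection n ?f x = (\<integral>y. of_real (1 / s) * (of_real (zonal_kernel TYPE('a) n (y \<bullet> x)) * w y ^ n) \<partial>\<sigma>)"
        unfolding harmonic_projection_eq[OF N n borel_measurable_surface_continuous[OF fc] x]
        by (simp add: mult.left_commute)
      also have "\<dots> = of_real (1 / s) * (\<integral>y. of_real (zonal_kernel TYPE('a) n (y \<bullet> x)) * w y ^ n \<partial>\<sigma>)"
        by (rule integral_mult_right_zero)
      finally show ?thesis unfolding zonal_kernel_reproducing[OF N n x w_power_harmonic] .
    qed
    have "c / C powr recip p * real n powr (a * (recip p - recip q)) = c * real n powr (- a * recip q) / s"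
    proof -
      have "s = C powr recip p * real n powr (- a * recip p)"
        using C n by (simp add: s_def powr_mult powr_powr)
      moreover have "real n powr (a * (recip p - recip q)) = real n powr (- a * recip q) / real n powr (- a * recip p)"
        by (simp add: powr_diff[symmetric] algebra_simps)
      ultimately show ?thesis by simp
    qed
    then have "ennreal (c / C powr recip p * real n powr (a * (recip p - recip q))) \<le> Lp_norm \<sigma> q ?f"
      using c(2)[OF n s] by simp
    also have "\<dots> = Lp_norm \<sigma> q (harmonic_projection n ?f)"
      by (rule Lp_norm_cong, rule T[symmetric]) simp
    also have "\<dots> \<le> op_norm \<sigma> p q (harmonic_projection n)"
      using C(2)[OF n] unfolding s' by (intro op_norm_ge borel_measurable_surface_continuous[OF fc])
    finally show "ennreal (c / C powr recip p * real n powr (a * (recip p - recip q))) \<le> op_norm \<sigma> p q (harmonic_projection n)" .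
  qed
qed

end

section \<open>The exponents\<close>

lemma pairing_scale: "pairing TYPE('a::euclidean_space) n (\<lambda>t. \<phi> t * s) = pairing TYPE('a) n \<phi> * s"
proof -
  have "(\<lambda>\<theta>. \<phi> (cos \<theta>) * s * poly (legendre DIM('a) n) (cos \<theta>) * sin \<theta> ^ (DIM('a) - 2)) =
      (\<lambda>\<theta>. \<phi> (cos \<theta>) * poly (legendre DIM('a) n) (cos \<theta>) * sin \<theta> ^ (DIM('a) - 2) * s)"
    by (simp add: fun_eq_iff mult_ac)
  then show ?thesis by (simp add: pairing_def integral_mult_left)
qed

text \<open>A finite supremum b is beaten as soon as ln n exceeds t, where the \<kappa>-th power of
  t is b / c + 1.\<close>

lemma SUP_eq_infinity_of_log_growth:
  fixes h :: "nat \<Rightarrow> ennreal"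
  assumes c: "0 < c" and \<kappa>: "0 < \<kappa>"
    and h: "\<And>n. n0 \<le> n \<Longrightarrow> ennreal (c * (real n powr g * ln (real n) powr \<kappa>)) \<le> h n"
  shows "(SUP n\<in>{1..}. ennreal (real n powr (- g)) * h n) = \<infinity>"
proof (rule ccontr)
  assume "\<not> ?thesis"
  then obtain b where b: "0 \<le> b" "(SUP n\<in>{1..}. ennreal (real n powr (- g)) * h n) = ennreal b"
    by (cases "SUP n\<in>{1..}. ennreal (real n powr (- g)) * h n") auto
  define t where "t = (b / c + 1) powr (1 / \<kappa>)"
  have t: "0 < t" "t powr \<kappa> = b / c + 1"
  proof -
    have x: "0 < b / c + 1" using b c by (intro add_nonneg_pos) auto
    then show "0 < t" by (simp add: t_def)
    show "t powr \<kappa> = b / c + 1" using x \<kappa> by (simp add: t_def powr_powr)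
  qed
  define n where "n = max (max n0 1) (nat \<lceil>exp t\<rceil>)"
  have n: "n0 \<le> n" "1 \<le> n" by (auto simp: n_def)
  have "exp t \<le> real (nat \<lceil>exp t\<rceil>)" by (rule real_nat_ceiling_ge)
  also have "\<dots> \<le> real n" by (simp add: n_def)
  finally have "t \<le> ln (real n)" using n by (subst ln_ge_iff) auto
  then have "t powr \<kappa> \<le> ln (real n) powr \<kappa>" using t \<kappa> by (intro powr_mono2) auto
  then have big: "b < c * ln (real n) powr \<kappa>" using t(2) c by (simp add: field_simps)
  have "real n powr (- g) * (c * (real n powr g * ln (real n) powr \<kappa>)) = c * ln (real n) powr \<kappa>"
    using n by (simp add: powr_minus)
  then have "ennreal (c * ln (real n) powr \<kappa>) = ennreal (real n powr (- g)) * ennreal (c * (real n powr g * ln (real n) powr \<kappa>))"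
    using c by (simp add: ennreal_mult[symmetric])
  also have "\<dots> \<le> ennreal (real n powr (- g)) * h n" by (intro mult_left_mono h n) simp
  also have "\<dots> \<le> ennreal b" unfolding b(2)[symmetric] using n by (intro SUP_upper) auto
  finally show False using big b(1) by (simp add: ennreal_le_iff)
qed

section \<open>The lower bounds as powers of n\<close>

locale exponent_setting =
  fixes e :: "'a::euclidean_space" and p q :: ennreal
  assumes N: "3 \<le> DIM('a)" and e: "norm e = 1" and p: "1 \<le> p" and q: "1 \<le> q"
begin

definition d :: real where "d = real DIM('a) - 1"

lemma d: "2 \<le> d" "real (DIM('a) - 1) = d" "real (DIM('a) - 2) = d - 1"
  using N by (auto simp: d_def of_nat_diff)

lemma mass_bound: "\<exists>k>0. \<forall>n\<ge>1. k * real n powr (d - 1) \<le> 1 / (2 * legendre_mass TYPE('a) n)"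
proof -
  obtain C where C: "C > 0" "\<And>n. 1 \<le> n \<Longrightarrow> legendre_mass TYPE('a) n \<le> C * real n powr (- (d - 1))"
    using legendre_mass_upper[OF N] unfolding d by metis
  have "1 / (2 * C) * real n powr (d - 1) \<le> 1 / (2 * legendre_mass TYPE('a) n)" if n: "1 \<le> n" for n
  proof -
    have "1 / (2 * C) * real n powr (d - 1) = 1 / (2 * (C * real n powr (- (d - 1))))"
      unfolding powr_minus_divide by simp
    also have "\<dots> \<le> 1 / (2 * legendre_mass TYPE('a) n)"
      using C n C(2)[OF n] legendre_mass_pos[OF N n] by (intro divide_left_mono mult_left_mono mult_pos_pos) auto
    finally show ?thesis .
  qed
  with C(1) show ?thesis by (intro exI[of _ "1 / (2 * C)"]) auto
qed

text \<open>A single constant k serves all nonnegative exponents s, so that the same cap estimate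
  can be inserted for s = 1 - 1/p and for s = 1/q.\<close>

lemma cap_bound: "\<exists>k>0. \<forall>n\<ge>1. \<forall>s\<ge>0. k powr s * real n powr (- d * s) \<le> measure surface_measure (cap e n) powr s"
proof -
  obtain k where k: "k > 0" "\<And>n. 1 \<le> n \<Longrightarrow> k * real n powr (- d) \<le> measure surface_measure (cap e n)"
    using cap_measure_lower[OF N] e unfolding d by metis
  have "k powr s * real n powr (- d * s) \<le> measure surface_measure (cap e n) powr s" if n: "1 \<le> n" and s: "0 \<le> s" for n s
  proof -
    have "k powr s * real n powr (- d * s) = (k * real n powr (- d)) powr s"
      using k n by (simp add: powr_mult powr_powr)
    also have "\<dots> \<le> measure surface_measure (cap e n) powr s"
      using k n s by (intro powr_mono2) auto
    finally show ?thesis .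
  qed
  with k(1) show ?thesis by (intro exI[of _ k]) auto
qed

lemma concentration_bound: "\<exists>c>0. \<forall>n\<ge>1. ennreal (c * real n powr (d * (recip p - recip q) - 1)) \<le> op_norm (surface_measure :: 'a measure) p q (harmonic_projection n)"
proof -
  obtain k l where k: "k > 0" "\<And>n s. 1 \<le> n \<Longrightarrow> 0 \<le> s \<Longrightarrow> k powr s * real n powr (- d * s) \<le> measure surface_measure (cap e n) powr s"
    and l: "l > 0" "\<And>n. 1 \<le> n \<Longrightarrow> l * real n powr (d - 1) \<le> 1 / (2 * legendre_mass TYPE('a) n)"
    using mass_bound cap_bound by metis
  let ?s = "1 - recip p" and ?t = "recip q"
  have st: "0 \<le> ?s" "0 \<le> ?t" using recip_bounds p q by auto
  have "ennreal (k powr ?s * l * k powr ?t * real n powr (d * (recip p - recip q) - 1)) \<le> op_norm (surface_measure :: 'a measure) p q (harmonic_projection n)" if n: "1 \<le> n" for n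
  proof -
    interpret cap_setting e n using N n e by unfold_locales
    have "d * (recip p - recip q) - 1 = - d * ?s + (d - 1) + (- d * ?t)" by (simp add: algebra_simps)
    then have "real n powr (d * (recip p - recip q) - 1) = real n powr (- d * ?s) * real n powr (d - 1) * real n powr (- d * ?t)"
      by (simp only: powr_add)
    then have "k powr ?s * l * k powr ?t * real n powr (d * (recip p - recip q) - 1) =
        (k powr ?s * real n powr (- d * ?s)) * (l * real n powr (d - 1)) * (k powr ?t * real n powr (- d * ?t))"
      by (simp only: mult_ac)
    also have "\<dots> \<le> \<mu> powr ?s * (1 / (2 * legendre_mass TYPE('a) n)) * \<mu> powr ?t"
      unfolding \<mu>_def using k l n st less_imp_le[OF m_pos] by (intro mult_mono) auto
    finally show ?thesis
      using concentration[OF p q] by (simp add: order_trans[OF ennreal_leI])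
  qed
  then show ?thesis using k(1) l(1) by (intro exI[of _ "k powr ?s * l * k powr ?t"]) auto
qed

text \<open>P stands for any lower bound of the pairing; the bounded and the logarithmic profile are
  both inserted here.\<close>

lemma focusing_bound:
  "\<exists>k>0. \<forall>n\<ge>1. \<forall>\<phi> P. continuous_on {-1..1} \<phi> \<longrightarrow> 0 \<le> P \<longrightarrow> P \<le> pairing TYPE('a) n \<phi> \<longrightarrow>
     Lp_norm surface_measure p (\<lambda>y. complex_of_real (\<phi> (y \<bullet> e))) \<le> 1 \<longrightarrow>
     ennreal (k * (P * real n powr (d - 1 - d * recip q))) \<le> op_norm (surface_measure :: 'a measure) p q (harmonic_projection n)"
proof -
  obtain k l where k: "k > 0" "\<And>n s. 1 \<le> n \<Longrightarrow> 0 \<le> s \<Longrightarrow> k powr s * real n powr (- d * s) \<le> measure surface_measure (cap e n) powr s"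
    and l: "l > 0" "\<And>n. 1 \<le> n \<Longrightarrow> l * real n powr (d - 1) \<le> 1 / (2 * legendre_mass TYPE('a) n)"
    using mass_bound cap_bound by metis
  let ?t = "recip q"
  have t: "0 \<le> ?t" using recip_bounds q by auto
  have "ennreal (l * k powr ?t * (P * real n powr (d - 1 - d * recip q))) \<le> op_norm (surface_measure :: 'a measure) p q (harmonic_projection n)"
    if n: "1 \<le> n" and \<phi>: "continuous_on {-1..1} \<phi>" and P: "0 \<le> P" "P \<le> pairing TYPE('a) n \<phi>"
      and norm: "Lp_norm surface_measure p (\<lambda>y. complex_of_real (\<phi> (y \<bullet> e))) \<le> 1" for n \<phi> P
  proof -
    interpret cap_setting e n using N n e by unfold_locales
    have "d - 1 - d * recip q = d - 1 + (- d * ?t)" by simp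
    then have "real n powr (d - 1 - d * recip q) = real n powr (d - 1) * real n powr (- d * ?t)"
      by (simp only: powr_add)
    then have "l * k powr ?t * (P * real n powr (d - 1 - d * recip q)) =
        P * (l * real n powr (d - 1)) * (k powr ?t * real n powr (- d * ?t))"
      by (simp only: mult_ac)
    also have "\<dots> \<le> pairing TYPE('a) n \<phi> * (1 / (2 * legendre_mass TYPE('a) n)) * \<mu> powr ?t"
      unfolding \<mu>_def using k l n t P less_imp_le[OF m_pos] by (intro mult_mono) auto
    finally show ?thesis
      using focusing[OF q \<phi> order_trans[OF P] norm] by (simp add: order_trans[OF ennreal_leI])
  qed
  then show ?thesis using k(1) l(1) by (intro exI[of _ "l * k powr ?t"]) auto
qed

text \<open>The counterpart of \<open>focusing_bound\<close> for the dual estimates: the power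
  collects the cap measure raised to 1 - 1/p and the reciprocal of the mass of P, with exponents - d
  (1 - 1/p) and d - 1.\<close>

lemma duality_bound:
  "\<exists>k>0. \<forall>n\<ge>1. \<forall>\<phi> P. 0 \<le> P \<longrightarrow> P \<le> pairing TYPE('a) n \<phi> \<longrightarrow>
     k * (P * real n powr (d * recip p - 1)) \<le>
       measure surface_measure (cap e n) powr (1 - recip p) * (pairing TYPE('a) n \<phi> / (2 * legendre_mass TYPE('a) n))"
proof -
  obtain k l where k: "k > 0" "\<And>n s. 1 \<le> n \<Longrightarrow> 0 \<le> s \<Longrightarrow> k powr s * real n powr (- d * s) \<le> measure surface_measure (cap e n) powr s"
    and l: "l > 0" "\<And>n. 1 \<le> n \<Longrightarrow> l * real n powr (d - 1) \<le> 1 / (2 * legendre_mass TYPE('a) n)"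
    using mass_bound cap_bound by metis
  let ?s = "1 - recip p"
  have s: "0 \<le> ?s" using recip_bounds p by auto
  have "k powr ?s * l * (P * real n powr (d * recip p - 1)) \<le>
       measure surface_measure (cap e n) powr ?s * (pairing TYPE('a) n \<phi> / (2 * legendre_mass TYPE('a) n))"
    if n: "1 \<le> n" and P: "0 \<le> P" "P \<le> pairing TYPE('a) n \<phi>" for n \<phi> P
  proof -
    have "d * recip p - 1 = - d * ?s + (d - 1)" by (simp add: algebra_simps)
    then have "real n powr (d * recip p - 1) = real n powr (- d * ?s) * real n powr (d - 1)"
      by (simp only: powr_add)
    then have "k powr ?s * l * (P * real n powr (d * recip p - 1)) =
        (k powr ?s * real n powr (- d * ?s)) * (P * (l * real n powr (d - 1)))"
      by (simp only: mult_ac)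
    also have "\<dots> \<le> measure surface_measure (cap e n) powr ?s * (pairing TYPE('a) n \<phi> * (1 / (2 * legendre_mass TYPE('a) n)))"
      using k l n s P by (intro mult_mono) auto
    finally show ?thesis by simp
  qed
  then show ?thesis using k(1) l(1) by (intro exI[of _ "k powr ?s * l"]) auto
qed

text \<open>The pairing contributes the exponent - (d - 1) / 2 and the image on the cap d - 1 - d /
  q. Multiplying \<phi> by s, a power of the total mass, turns boundedness by 1 into norm at most 1
  for every p.\<close>

lemma bounded_focusing_bound: "\<exists>c>0. \<forall>n\<ge>1. ennreal (c * real n powr ((d - 1) / 2 - d * recip q)) \<le> op_norm (surface_measure :: 'a measure) p q (harmonic_projection n)"
proof -
  obtain c where c: "c > 0" "\<And>n. 1 \<le> n \<Longrightarrow> \<exists>\<phi>. continuous_on {-1..1} \<phi> \<and> (\<forall>t\<in>{-1..1}. \<bar>\<phi> t\<bar> \<le> 1) \<and>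
      c * real n powr (- ((d - 1) / 2)) \<le> pairing TYPE('a) n \<phi>"
    using bounded_profile[OF N] unfolding d by metis
  obtain k where k: "k > 0" "\<And>n \<phi> P. 1 \<le> n \<Longrightarrow> continuous_on {-1..1} \<phi> \<Longrightarrow> 0 \<le> P \<Longrightarrow> P \<le> pairing TYPE('a) n \<phi> \<Longrightarrow>
     Lp_norm surface_measure p (\<lambda>y. complex_of_real (\<phi> (y \<bullet> e))) \<le> 1 \<Longrightarrow>
     ennreal (k * (P * real n powr (d - 1 - d * recip q))) \<le> op_norm (surface_measure :: 'a measure) p q (harmonic_projection n)"
    using focusing_bound by metis
  define s where "s = measure surface_measure (sphere (0::'a) 1) powr (- recip p)"
  have S: "0 < measure surface_measure (sphere (0::'a) 1)" by (rule surface_measure_sphere_pos)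
  then have s: "0 < s" by (simp add: s_def)
  have "ennreal (k * c * s * real n powr ((d - 1) / 2 - d * recip q)) \<le> op_norm (surface_measure :: 'a measure) p q (harmonic_projection n)" if n: "1 \<le> n" for n
  proof -
    obtain \<phi> where \<phi>: "continuous_on {-1..1} \<phi>" "\<And>t. t \<in> {-1..1} \<Longrightarrow> \<bar>\<phi> t\<bar> \<le> 1"
        "c * real n powr (- ((d - 1) / 2)) \<le> pairing TYPE('a) n \<phi>"
      using c(2)[OF n] by blast
    let ?\<psi> = "\<lambda>t. \<phi> t * s"
    have \<psi>c: "continuous_on {-1..1} ?\<psi>" by (intro continuous_intros \<phi>)
    have "Lp_norm surface_measure p (\<lambda>y. complex_of_real (?\<psi> (y \<bullet> e))) \<le> ennreal (s * measure surface_measure (sphere (0::'a) 1) powr recip p)"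
    proof (rule Lp_norm_le_on[OF p])
      show "(\<lambda>y. complex_of_real (?\<psi> (y \<bullet> e))) \<in> borel_measurable surface_measure"
        by (intro borel_measurable_surface_continuous continuous_on_of_real continuous_on_inner_compose \<psi>c e)
      show "sphere 0 1 \<in> sets (surface_measure :: 'a measure)" using sets.top[of "surface_measure :: 'a measure"] by simp
      show "emeasure surface_measure (sphere (0::'a) 1) < \<infinity>" using emeasure_sphere_finite by simp
      fix y :: 'a assume "y \<in> space surface_measure"
      then have y: "norm y = 1" by simp
      have "\<bar>\<phi> (y \<bullet> e)\<bar> \<le> 1" using inner_sphere_bounds[OF y e] by (intro \<phi>) auto
      then show "norm (complex_of_real (?\<psi> (y \<bullet> e))) \<le> s * indicator (sphere 0 1) y"
        unfolding norm_of_real abs_mult using s y by (simp add: mult_left_le_one_le)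
    qed (use S s in auto)
    also have "\<dots> = 1" using S by (simp add: s_def powr_minus)
    finally have norm: "Lp_norm surface_measure p (\<lambda>y. complex_of_real (?\<psi> (y \<bullet> e))) \<le> 1" .
    have "(d - 1) / 2 - d * recip q = - ((d - 1) / 2) + (d - 1 - d * recip q)" by (simp add: field_simps)
    then have "real n powr ((d - 1) / 2 - d * recip q) = real n powr (- ((d - 1) / 2)) * real n powr (d - 1 - d * recip q)"
      by (simp only: powr_add)
    then have "k * c * s * real n powr ((d - 1) / 2 - d * recip q) =
        k * ((c * real n powr (- ((d - 1) / 2)) * s) * real n powr (d - 1 - d * recip q))"
      by (simp only: mult_ac)
    also have "ennreal \<dots> \<le> op_norm (surface_measure :: 'a measure) p q (harmonic_projection n)"
      by (rule k(2)[OF n \<psi>c _ _ norm]) (use \<phi>(3) s c in \<open>auto simp: pairing_scale\<close>)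
    finally show ?thesis .
  qed
  then show ?thesis using k(1) c(1) s by (intro exI[of _ "k * c * s"]) auto
qed

text \<open>The exponent is - (d - 1) / 2 from the pairing plus d / p - 1 from
  \<open>duality_bound\<close>.\<close>

lemma bounded_duality_bound: "\<exists>c>0. \<forall>n\<ge>1. ennreal (c * real n powr (- (d + 1) / 2 + d * recip p)) \<le> op_norm (surface_measure :: 'a measure) p q (harmonic_projection n)"
proof -
  obtain c where c: "c > 0" "\<And>n. 1 \<le> n \<Longrightarrow> \<exists>\<phi>. continuous_on {-1..1} \<phi> \<and> (\<forall>t\<in>{-1..1}. \<bar>\<phi> t\<bar> \<le> 1) \<and>
      c * real n powr (- ((d - 1) / 2)) \<le> pairing TYPE('a) n \<phi>"
    using bounded_profile[OF N] unfolding d by metis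
  obtain k where k: "k > 0" "\<And>n \<phi> P. 1 \<le> n \<Longrightarrow> 0 \<le> P \<Longrightarrow> P \<le> pairing TYPE('a) n \<phi> \<Longrightarrow>
     k * (P * real n powr (d * recip p - 1)) \<le>
       measure surface_measure (cap e n) powr (1 - recip p) * (pairing TYPE('a) n \<phi> / (2 * legendre_mass TYPE('a) n))"
    using duality_bound by metis
  define s where "s = measure surface_measure (sphere (0::'a) 1) powr (recip q - 1)"
  have s: "0 < s" using surface_measure_sphere_pos[where 'a='a] by (simp add: s_def)
  have "ennreal (k * c * s * real n powr (- (d + 1) / 2 + d * recip p)) \<le> op_norm (surface_measure :: 'a measure) p q (harmonic_projection n)" if n: "1 \<le> n" for n
  proof -
    interpret cap_setting e n using N n e by unfold_locales
    obtain \<phi> where \<phi>: "continuous_on {-1..1} \<phi>" "\<And>t. t \<in> {-1..1} \<Longrightarrow> \<bar>\<phi> t\<bar> \<le> 1"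
        "c * real n powr (- ((d - 1) / 2)) \<le> pairing TYPE('a) n \<phi>"
      using c(2)[OF n] by blast
    have P: "0 < c * real n powr (- ((d - 1) / 2))" using c n by simp
    have "- (d + 1) / 2 + d * recip p = - ((d - 1) / 2) + (d * recip p - 1)" by (simp add: field_simps)
    then have "real n powr (- (d + 1) / 2 + d * recip p) = real n powr (- ((d - 1) / 2)) * real n powr (d * recip p - 1)"
      by (simp only: powr_add)
    then have "k * c * s * real n powr (- (d + 1) / 2 + d * recip p) =
        k * ((c * real n powr (- ((d - 1) / 2))) * real n powr (d * recip p - 1)) * s"
      by (simp only: mult_ac)
    also have "\<dots> \<le> \<mu> powr (1 - recip p) * (pairing TYPE('a) n \<phi> / (2 * legendre_mass TYPE('a) n)) * s"
      unfolding \<mu>_def using k(2)[OF n less_imp_le[OF P] \<phi>(3)] s by (intro mult_right_mono) auto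
    finally have "ennreal (k * c * s * real n powr (- (d + 1) / 2 + d * recip p)) \<le>
        ennreal (\<mu> powr (1 - recip p) * (pairing TYPE('a) n \<phi> / (2 * legendre_mass TYPE('a) n)) * s)"
      by (rule ennreal_leI)
    also have "\<dots> \<le> op_norm (surface_measure :: 'a measure) p q (harmonic_projection n)" unfolding s_def by (rule dual_bounded[OF p q \<phi>(1) _ \<phi>(2)]) (use P \<phi>(3) in linarith)
    finally show ?thesis .
  qed
  then show ?thesis using k(1) c(1) s by (intro exI[of _ "k * c * s"]) auto
qed

lemma knapp_bound: "\<exists>c>0. \<forall>n\<ge>1. ennreal (c * real n powr ((d - 1) / 2 * (recip p - recip q))) \<le> op_norm (surface_measure :: 'a measure) p q (harmonic_projection n)"
proof -
  obtain e1 e2 :: 'a where e12: "e1 \<in> Basis" "e2 \<in> Basis" "e1 \<noteq> e2"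
  proof -
    have "\<not> (\<forall>x\<in>Basis. \<forall>y\<in>Basis. x = (y::'a))"
      using N card_le_Suc0_iff_eq[of "Basis :: 'a set"] by auto
    then show ?thesis using that by blast
  qed
  interpret knapp_setting e1 e2 using N e12 by unfold_locales
  show ?thesis using knapp_lower_bound[OF p q] unfolding a_def d .
qed

text \<open>The maximum is attained by one of its four terms, and each term has its own lower bound,
  so no comparison between regions of exponents is needed.\<close>

lemma lower_bound:
  assumes \<delta>: "real \<delta> = d"
  shows "\<exists>c>0. \<forall>n\<ge>1. ennreal (c * real n powr gamma_exponent \<delta> p q) \<le> op_norm (surface_measure :: 'a measure) p q (harmonic_projection n)"
proof -
  have "gamma_exponent \<delta> p q \<in> {(d - 1) / 2 * (recip p - recip q), d * (recip p - recip q) - 1,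
      (d - 1) / 2 - d * recip q, - (d + 1) / 2 + d * recip p}"
    unfolding gamma_exponent_def \<delta> by (rule Max_in) auto
  then show ?thesis
    using knapp_bound concentration_bound bounded_focusing_bound bounded_duality_bound
    by (elim insertE emptyE) (simp_all only:)
qed

section \<open>The logarithmic gain on the two segments\<close>

definition r :: real where "r = 2 * d / (d + 1)"

lemma r: "1 < r" "1 / r = (d + 1) / (2 * d)" "d / r = (d + 1) / 2" "1 - 1 / r = (d - 1) / (2 * d)"
  using d(1) by (simp_all add: r_def field_simps)

lemma log_profiles: "\<exists>c>0. \<exists>C>0. \<exists>n0\<ge>2. \<forall>n\<ge>n0. \<exists>\<phi>. continuous_on {-1..1} \<phi> \<and>
    c * (real n powr (- d) * ln (real n)) \<le> pairing TYPE('a) n \<phi> \<and>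
    (\<integral>y. \<bar>\<phi> (y \<bullet> e)\<bar> powr r \<partial>surface_measure) \<le> C * (real n powr (- d) * ln (real n))"
  using log_profile[OF N] e unfolding d r_def[symmetric] by meson

text \<open>The quotient of the pairing and the norm of the logarithmic profile. Both carry the same
  factor ln n, but the norm takes it to the power 1 / r only; what is left over is the gain, with
  exponent 1 - 1/r = (d - 1) / (2 d).\<close>

lemma log_power_ratio:
  assumes C: "0 < C" and n: "2 \<le> n"
  shows "real n powr (- d) * ln (real n) * (C * (real n powr (- d) * ln (real n))) powr (- (1 / r)) =
    C powr (- (1 / r)) * (real n powr (- (d - 1) / 2) * ln (real n) powr ((d - 1) / (2 * d)))"
proof -
  have L: "0 < ln (real n)" using n by simp
  have x: "- d * (- (1 / r)) = (d + 1) / 2" using r(3) by simp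
  have 1: "(C * (real n powr (- d) * ln (real n))) powr (- (1 / r)) =
      C powr (- (1 / r)) * (real n powr ((d + 1) / 2) * ln (real n) powr (- (1 / r)))"
    using C L n by (simp only: powr_mult powr_powr x)
  have 2: "real n powr (- d) * real n powr ((d + 1) / 2) = real n powr (- (d - 1) / 2)"
    by (simp add: powr_add[symmetric] field_simps)
  have 3: "ln (real n) * ln (real n) powr (- (1 / r)) = ln (real n) powr ((d - 1) / (2 * d))"
  proof -
    have "ln (real n) powr (1 + (- (1 / r))) = ln (real n) powr 1 * ln (real n) powr (- (1 / r))" by (rule powr_add)
    then show ?thesis using L r(4) by simp
  qed
  have "real n powr (- d) * ln (real n) * (C powr (- (1 / r)) * (real n powr ((d + 1) / 2) * ln (real n) powr (- (1 / r)))) =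
      C powr (- (1 / r)) * ((real n powr (- d) * real n powr ((d + 1) / 2)) * (ln (real n) * ln (real n) powr (- (1 / r))))"
    by (simp only: mult_ac)
  then show ?thesis unfolding 1 2 3 .
qed

text \<open>On the line of abscissa 1 / r the input norm is the one of exponent r, so the
  logarithmic profile can be normalised in it. The power of n is the same as for the bounded
  profile.\<close>

lemma log_focusing_bound:
  assumes rp: "recip p = (d + 1) / (2 * d)"
  shows "\<exists>c>0. \<exists>n0. \<forall>n\<ge>n0. ennreal (c * (real n powr ((d - 1) / 2 - d * recip q) * ln (real n) powr ((d - 1) / (2 * d)))) \<le> op_norm (surface_measure :: 'a measure) p q (harmonic_projection n)"
proof -
  have "recip p \<noteq> 0" using rp d(1) by simp
  then have pi: "p \<noteq> \<infinity>" using recip_infinity by auto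
  have pr: "enn2real p = r" "recip p = 1 / r"
  proof -
    show "recip p = 1 / r" using rp r(2) by simp
    then have "1 / enn2real p = 1 / r" using recip_finite(2)[OF p pi] by simp
    then show "enn2real p = r" by (metis div_by_1 divide_divide_eq_right mult_1)
  qed
  obtain c C n0 where c: "c > 0" and C: "C > 0" and n0: "2 \<le> n0" and prof: "\<And>n. n0 \<le> n \<Longrightarrow> \<exists>\<phi>. continuous_on {-1..1} \<phi> \<and>
    c * (real n powr (- d) * ln (real n)) \<le> pairing TYPE('a) n \<phi> \<and>
    (\<integral>y. \<bar>\<phi> (y \<bullet> e)\<bar> powr r \<partial>surface_measure) \<le> C * (real n powr (- d) * ln (real n))"
    using log_profiles by metis
  obtain k where k: "k > 0" "\<And>n \<phi> P. 1 \<le> n \<Longrightarrow> continuous_on {-1..1} \<phi> \<Longrightarrow> 0 \<le> P \<Longrightarrow> P \<le> pairing TYPE('a) n \<phi> \<Longrightarrow>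
     Lp_norm surface_measure p (\<lambda>y. complex_of_real (\<phi> (y \<bullet> e))) \<le> 1 \<Longrightarrow>
     ennreal (k * (P * real n powr (d - 1 - d * recip q))) \<le> op_norm (surface_measure :: 'a measure) p q (harmonic_projection n)"
    using focusing_bound by metis
  let ?k = "k * c * C powr (- (1 / r))"
  have "ennreal (?k * (real n powr ((d - 1) / 2 - d * recip q) * ln (real n) powr ((d - 1) / (2 * d)))) \<le> op_norm (surface_measure :: 'a measure) p q (harmonic_projection n)" if n: "n0 \<le> n" for n
  proof -
    have n2: "2 \<le> n" using n n0 by simp
    define G where "G = C * (real n powr (- d) * ln (real n))"
    have G: "0 < G" using C n2 by (simp add: G_def)
    define s where "s = G powr (- (1 / r))"
    have s: "0 < s" "s powr r = 1 / G"
    proof -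
      show "0 < s" using G by (simp add: s_def)
      have "s powr r = G powr (- (1 / r) * r)" unfolding s_def by (rule powr_powr)
      also have "- (1 / r) * r = - 1" using r(1) by simp
      finally show "s powr r = 1 / G" using G by (simp add: powr_minus_divide)
    qed
    obtain \<phi> where \<phi>: "continuous_on {-1..1} \<phi>" "c * (real n powr (- d) * ln (real n)) \<le> pairing TYPE('a) n \<phi>"
      "(\<integral>y. \<bar>\<phi> (y \<bullet> e)\<bar> powr r \<partial>surface_measure) \<le> G"
      using prof[OF n] unfolding G_def by blast
    let ?\<psi> = "\<lambda>t. \<phi> t * s"
    have \<psi>c: "continuous_on {-1..1} ?\<psi>" by (intro continuous_intros \<phi>)
    have eq: "norm (complex_of_real (?\<psi> (y \<bullet> e))) powr r = 1 / G * \<bar>\<phi> (y \<bullet> e)\<bar> powr r" for y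
    proof -
      have "norm (complex_of_real (?\<psi> (y \<bullet> e))) = s * \<bar>\<phi> (y \<bullet> e)\<bar>"
        unfolding norm_of_real abs_mult using s by simp
      then show ?thesis using s by (simp add: powr_mult)
    qed
    have int: "integrable surface_measure (\<lambda>y. \<bar>\<phi> (y \<bullet> e)\<bar> powr r)"
      using r(1) by (intro integrable_surface_continuous continuous_on_powr' continuous_intros continuous_on_inner_compose \<phi> e) auto
    have "Lp_norm surface_measure p (\<lambda>y. complex_of_real (?\<psi> (y \<bullet> e))) =
        ennreal ((\<integral>y. norm (complex_of_real (?\<psi> (y \<bullet> e))) powr r \<partial>surface_measure) powr recip p)"
      unfolding pr(1)[symmetric]
      by (rule Lp_norm_eq_integral[OF p pi], unfold pr(1) eq) (rule integrable_mult_right[OF int])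
    also have "\<dots> = ennreal ((1 / G * (\<integral>y. \<bar>\<phi> (y \<bullet> e)\<bar> powr r \<partial>surface_measure)) powr recip p)"
      unfolding eq integral_mult_right_zero ..
    also have "\<dots> \<le> ennreal 1"
      using \<phi>(3) G recip_bounds[OF p] by (intro ennreal_leI powr_le1 mult_nonneg_nonneg) auto
    finally have norm: "Lp_norm surface_measure p (\<lambda>y. complex_of_real (?\<psi> (y \<bullet> e))) \<le> 1" by simp
    have "(d - 1) / 2 - d * recip q = - (d - 1) / 2 + (d - 1 - d * recip q)" by (simp add: field_simps)
    then have pw: "real n powr ((d - 1) / 2 - d * recip q) = real n powr (- (d - 1) / 2) * real n powr (d - 1 - d * recip q)"
      by (simp only: powr_add)
    have "?k * (real n powr ((d - 1) / 2 - d * recip q) * ln (real n) powr ((d - 1) / (2 * d))) =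
        k * c * (C powr (- (1 / r)) * (real n powr (- (d - 1) / 2) * ln (real n) powr ((d - 1) / (2 * d)))) * real n powr (d - 1 - d * recip q)"
      unfolding pw by (simp only: mult_ac)
    also have "\<dots> = k * ((c * (real n powr (- d) * ln (real n)) * s) * real n powr (d - 1 - d * recip q))"
      unfolding log_power_ratio[OF C n2, symmetric] s_def G_def by (simp only: mult_ac)
    also have "ennreal \<dots> \<le> op_norm (surface_measure :: 'a measure) p q (harmonic_projection n)"
      by (rule k(2)[OF _ \<psi>c _ _ norm]) (use \<phi>(2) s c n2 in \<open>auto simp: pairing_scale\<close>)
    finally show ?thesis .
  qed
  then show ?thesis using k(1) c C by (intro exI[of _ ?k] conjI exI[of _ n0]) auto
qed

text \<open>Here 1 / q = 1 - 1 / r, so r is conjugate to q, and the logarithmic profile is the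
  function against which the projected cap indicator is tested.\<close>

lemma log_duality_bound:
  assumes rq: "recip q = (d - 1) / (2 * d)"
  shows "\<exists>c>0. \<exists>n0. \<forall>n\<ge>n0. ennreal (c * (real n powr (- (d + 1) / 2 + d * recip p) * ln (real n) powr ((d - 1) / (2 * d)))) \<le> op_norm (surface_measure :: 'a measure) p q (harmonic_projection n)"
proof -
  have "recip q \<noteq> 0" using rq d(1) by simp
  then have qi: "q \<noteq> \<infinity>" using recip_infinity by auto
  note Q = recip_finite[OF q qi]
  have qr: "1 < enn2real q" "1 / enn2real q + 1 / r = 1"
  proof -
    show "1 / enn2real q + 1 / r = 1" using Q(2) rq r(4) by simp
    have "recip q < 1" unfolding rq using d(1) by (simp add: divide_less_eq)
    then show "1 < enn2real q" using Q by (simp add: field_simps)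
  qed
  obtain c C n0 where c: "c > 0" and C: "C > 0" and n0: "2 \<le> n0" and prof: "\<And>n. n0 \<le> n \<Longrightarrow> \<exists>\<phi>. continuous_on {-1..1} \<phi> \<and>
    c * (real n powr (- d) * ln (real n)) \<le> pairing TYPE('a) n \<phi> \<and>
    (\<integral>y. \<bar>\<phi> (y \<bullet> e)\<bar> powr r \<partial>surface_measure) \<le> C * (real n powr (- d) * ln (real n))"
    using log_profiles by metis
  obtain k where k: "k > 0" "\<And>n \<phi> P. 1 \<le> n \<Longrightarrow> 0 \<le> P \<Longrightarrow> P \<le> pairing TYPE('a) n \<phi> \<Longrightarrow>
     k * (P * real n powr (d * recip p - 1)) \<le>
       measure surface_measure (cap e n) powr (1 - recip p) * (pairing TYPE('a) n \<phi> / (2 * legendre_mass TYPE('a) n))"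
    using duality_bound by metis
  let ?k = "k * c * C powr (- (1 / r))"
  have "ennreal (?k * (real n powr (- (d + 1) / 2 + d * recip p) * ln (real n) powr ((d - 1) / (2 * d)))) \<le> op_norm (surface_measure :: 'a measure) p q (harmonic_projection n)" if nn: "n0 \<le> n" for n
  proof -
    have n2: "2 \<le> n" "1 \<le> n" using nn n0 by auto
    interpret cap_setting e n using N n2(2) e by unfold_locales
    define G where "G = C * (real n powr (- d) * ln (real n))"
    have G: "0 < G" using C n2 by (simp add: G_def)
    define P where "P = c * (real n powr (- d) * ln (real n))"
    have P: "0 < P" using c n2 by (simp add: P_def)
    obtain \<phi> where \<phi>: "continuous_on {-1..1} \<phi>" "P \<le> pairing TYPE('a) n \<phi>"
      "(\<integral>y. \<bar>\<phi> (y \<bullet> e)\<bar> powr r \<partial>surface_measure) \<le> G"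
      using prof[OF nn] unfolding G_def P_def by blast
    have "- (d + 1) / 2 + d * recip p = - (d - 1) / 2 + (d * recip p - 1)" by (simp add: field_simps)
    then have pw: "real n powr (- (d + 1) / 2 + d * recip p) = real n powr (- (d - 1) / 2) * real n powr (d * recip p - 1)"
      by (simp only: powr_add)
    have "?k * (real n powr (- (d + 1) / 2 + d * recip p) * ln (real n) powr ((d - 1) / (2 * d))) =
        k * c * (C powr (- (1 / r)) * (real n powr (- (d - 1) / 2) * ln (real n) powr ((d - 1) / (2 * d)))) * real n powr (d * recip p - 1)"
      unfolding pw by (simp only: mult_ac)
    also have "\<dots> = k * (P * real n powr (d * recip p - 1)) * G powr (- (1 / r))"
      unfolding log_power_ratio[OF C n2(1), symmetric] P_def G_def by (simp only: mult_ac)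
    also have "\<dots> \<le> \<mu> powr (1 - recip p) * (pairing TYPE('a) n \<phi> / (2 * legendre_mass TYPE('a) n)) * G powr (- (1 / r))"
      unfolding \<mu>_def using k(2)[OF n2(2) less_imp_le[OF P] \<phi>(2)] by (intro mult_right_mono) auto
    finally have "ennreal (?k * (real n powr (- (d + 1) / 2 + d * recip p) * ln (real n) powr ((d - 1) / (2 * d)))) \<le>
        ennreal (\<mu> powr (1 - recip p) * (pairing TYPE('a) n \<phi> / (2 * legendre_mass TYPE('a) n)) * G powr (- (1 / r)))"
      by (rule ennreal_leI)
    also have "\<dots> \<le> op_norm (surface_measure :: 'a measure) p q (harmonic_projection n)"
      by (rule dual_hoelder[OF p q qi qr(1) r(1) qr(2) \<phi>(1) _ \<phi>(3) G]) (use P \<phi>(2) in linarith)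
    finally show ?thesis .
  qed
  then show ?thesis using k(1) c C by (intro exI[of _ ?k] conjI exI[of _ n0]) auto
qed

text \<open>On this vertical line the second and the third term of the exponent coincide. The first
  is at most the third exactly if 2 d (d + 1) y \<le> (d - 1)^2, that is up to the ordinate of S;
  the fourth is 0.\<close>

lemma exponent_comparison:
  assumes x: "x = (d + 1) / (2 * d)" and y: "0 \<le> y" "y \<le> (d - 1)\<^sup>2 / (2 * d * (d + 1))"
  shows "(d - 1) / 2 * (x - y) \<le> (d - 1) / 2 - d * y" "d * (x - y) - 1 = (d - 1) / 2 - d * y"
    "- (d + 1) / 2 + d * x \<le> (d - 1) / 2 - d * y"
proof -
  have dx: "d * x = (d + 1) / 2" using d(1) x by simp
  have dy: "2 * (d + 1) * (d * y) \<le> (d - 1)\<^sup>2"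
  proof -
    have "0 < 2 * d * (d + 1)" using d(1) by simp
    with y(2) have "y * (2 * d * (d + 1)) \<le> (d - 1)\<^sup>2" by (simp only: pos_le_divide_eq)
    then show ?thesis by (simp only: mult_ac)
  qed
  have "2 * d * ((d - 1) / 2 * (x - y)) \<le> 2 * d * ((d - 1) / 2 - d * y)"
  proof -
    have "2 * d * ((d - 1) / 2 * (x - y)) = (d - 1) * (d * x) - (d - 1) * (d * y)" by (simp add: field_simps)
    also have "\<dots> \<le> 2 * d * ((d - 1) / 2 - d * y)"
      using dy unfolding dx by (simp add: field_simps power2_eq_square)
    finally show ?thesis .
  qed
  moreover have "0 < 2 * d" using d(1) by simp
  ultimately show "(d - 1) / 2 * (x - y) \<le> (d - 1) / 2 - d * y" by (simp only: mult_le_cancel_left_pos)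
  show "d * (x - y) - 1 = (d - 1) / 2 - d * y" using dx by (simp add: field_simps)
  have "2 * (d + 1) * (d * y) \<le> 2 * (d + 1) * ((d - 1) / 2)"
  proof -
    have "(d - 1) * (d - 1) \<le> (d + 1) * (d - 1)" using d(1) by (intro mult_right_mono) auto
    also have "\<dots> = 2 * (d + 1) * ((d - 1) / 2)" by (simp add: field_simps)
    finally show ?thesis using dy by (simp add: power2_eq_square)
  qed
  then have "d * y \<le> (d - 1) / 2" using d(1) by simp
  then show "- (d + 1) / 2 + d * x \<le> (d - 1) / 2 - d * y" unfolding dx by (simp add: field_simps)
qed

text \<open>On [S, R] the term for focusing attains the maximum, and on the reflected segment the
  term for duality does. In either case the lower bound with the logarithm has exactly the power n
  to the exponent, times an unbounded factor.\<close>

lemma log_blow_up: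
  assumes \<delta>: "real \<delta> = d"
    and seg: "(recip p, recip q) \<in> closed_segment (point_S \<delta>) (point_R \<delta>)
       \<union> closed_segment (dual_point (point_S \<delta>)) (dual_point (point_R \<delta>))"
  shows "(SUP n\<in>{1..}. ennreal (real n powr (- gamma_exponent \<delta> p q)) * op_norm (surface_measure :: 'a measure) p q (harmonic_projection n)) = \<infinity>"
proof -
  let ?\<kappa> = "(d - 1) / (2 * d)" and ?Y = "(d - 1)\<^sup>2 / (2 * d * (d + 1))"
  have \<kappa>: "0 < ?\<kappa>" using d(1) by simp
  define X Y where "X = (d + 1) / (2 * d)" and "Y = ?Y"
  have Y: "0 \<le> Y" using d(1) by (simp add: Y_def)
  have SR: "point_S \<delta> = (X, Y)" "point_R \<delta> = (X, 0)" by (simp_all add: point_S_def point_R_def X_def Y_def \<delta>)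
  from seg have "(recip p = (d + 1) / (2 * d) \<and> 0 \<le> recip q \<and> recip q \<le> ?Y) \<or>
      (1 - recip q = (d + 1) / (2 * d) \<and> 0 \<le> 1 - recip p \<and> 1 - recip p \<le> ?Y)"
  proof
    assume "(recip p, recip q) \<in> closed_segment (point_S \<delta>) (point_R \<delta>)"
    then obtain u where u: "0 \<le> u" "u \<le> 1" "(recip p, recip q) = (1 - u) *\<^sub>R point_S \<delta> + u *\<^sub>R point_R \<delta>"
      unfolding closed_segment_def by blast
    have "recip p = X" "recip q = (1 - u) * Y" using u(3) by (simp_all add: SR algebra_simps)
    moreover have "0 \<le> (1 - u) * Y" "(1 - u) * Y \<le> Y" using u Y by (simp_all add: mult_left_le_one_le)
    ultimately show ?thesis unfolding X_def Y_def by simp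
  next
    assume "(recip p, recip q) \<in> closed_segment (dual_point (point_S \<delta>)) (dual_point (point_R \<delta>))"
    then obtain u where u: "0 \<le> u" "u \<le> 1" "(recip p, recip q) = (1 - u) *\<^sub>R dual_point (point_S \<delta>) + u *\<^sub>R dual_point (point_R \<delta>)"
      unfolding closed_segment_def by blast
    have "1 - recip q = X" "1 - recip p = (1 - u) * Y" using u(3) by (simp_all add: SR dual_point_def algebra_simps)
    moreover have "0 \<le> (1 - u) * Y" "(1 - u) * Y \<le> Y" using u Y by (simp_all add: mult_left_le_one_le)
    ultimately show ?thesis unfolding X_def Y_def by simp
  qed
  then show ?thesis
  proof (elim disjE conjE)
    assume h: "recip p = (d + 1) / (2 * d)" "0 \<le> recip q" "recip q \<le> ?Y"
    note E = exponent_comparison[OF h]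
    have g: "gamma_exponent \<delta> p q = (d - 1) / 2 - d * recip q"
      unfolding gamma_exponent_def \<delta> 
    proof (rule Max_eqI)
      show "y \<le> (d - 1) / 2 - d * recip q" if "y \<in> {(d - 1) / 2 * (recip p - recip q), d * (recip p - recip q) - 1,
          (d - 1) / 2 - d * recip q, - (d + 1) / 2 + d * recip p}" for y
        using that E by (elim insertE emptyE) (simp_all only: order_refl)
    qed auto
    show ?thesis unfolding g using log_focusing_bound[OF h(1)] by (elim exE conjE, intro SUP_eq_infinity_of_log_growth[OF _ \<kappa>]) auto
  next
    assume h: "1 - recip q = (d + 1) / (2 * d)" "0 \<le> 1 - recip p" "1 - recip p \<le> ?Y"
    note E = exponent_comparison[OF h]
    have rq: "recip q = (d - 1) / (2 * d)" using h(1) d(1) by (simp add: field_simps)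
    \<comment> \<open>The reflection (x, y) to (1 - y, 1 - x) preserves x - y and exchanges the
      third and the fourth term, so the comparison made on the first segment can be reused.\<close>
    have E4: "- (d + 1) / 2 + d * recip p = (d - 1) / 2 - d * (1 - recip p)" by (simp add: field_simps)
    have E3: "(d - 1) / 2 - d * recip q = - (d + 1) / 2 + d * (1 - recip q)" by (simp add: field_simps)
    have E12: "recip p - recip q = 1 - recip q - (1 - recip p)" by simp
    have g: "gamma_exponent \<delta> p q = - (d + 1) / 2 + d * recip p"
      unfolding gamma_exponent_def \<delta>
    proof (rule Max_eqI)
      show "y \<le> - (d + 1) / 2 + d * recip p" if "y \<in> {(d - 1) / 2 * (recip p - recip q), d * (recip p - recip q) - 1,
          (d - 1) / 2 - d * recip q, - (d + 1) / 2 + d * recip p}" for y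
        using that unfolding E4 E3 E12 using E by (elim insertE emptyE) (simp_all only: order_refl)
    qed auto
    show ?thesis unfolding g using log_duality_bound[OF rq] by (elim exE conjE, intro SUP_eq_infinity_of_log_growth[OF _ \<kappa>]) auto
  qed
qed

end

theorem theorem1p1:
  fixes d :: nat and p q :: ennreal
  assumes "CARD('n::finite) = d + 1" and "2 \<le> d" and "1 \<le> p" and "p \<le> q"
  shows "(\<exists>c::real. c > 0 \<and>
            (\<forall>n\<ge>1. op_norm (surface_measure :: (real ^ 'n) measure) p q (harmonic_projection n)
                     \<ge> ennreal (c * real n powr gamma_exponent d p q))) \<and>
         ((recip p, recip q) \<in> closed_segment (point_S d) (point_R d)
            \<union> closed_segment (dual_point (point_S d)) (dual_point (point_R d)) \<longrightarrow>
          (SUP n\<in>{1..}. ennreal (real n powr (- gamma_exponent d p q)) *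
             op_norm (surface_measure :: (real ^ 'n) measure) p q (harmonic_projection n)) = \<infinity>)"
proof -
  \<comment> \<open>The common pole of the caps and zonal functions; the bounds obtained do not
    depend on it.\<close>
  obtain e :: "real ^ 'n" where e: "norm e = 1" using vector_choose_size[of 1] by auto
  interpret exponent_setting e p q
    using assms e by unfold_locales auto
  have "real d = exponent_setting.d TYPE(real ^ 'n)" using assms by (simp add: d_def)
  from lower_bound[OF this] log_blow_up[OF this] show ?thesis by blast
qed

end
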